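(* Let $\mathfrak g$ be of type $A_n$, let $1\le i\le n$, $0\le l\le n-i$, $0\le k\le i-1$ be arbitrarily chosen, and let $w_+=w_-=\vee_i^{lk}$ with $$\vee_i^{lk}:=s_is_{i+1}\cdots s_{i+l}\,s_{i-1}s_{i-2}\cdots s_{i-k}\in W,$$ which means $\Phi^+(w_+)=\Phi^+(w_-)=\{\sum_{j=0}^r\alpha_{i+j},\ \sum_{j=-s}^0\alpha_{i+j}\mid0\le r\le l,\ 0\le s\le k\}$. Let $L=\{\mu\in\Lambda\mid\mu\perp\alpha_i\}$ and let $\phi_+$, $\phi_-$ be characters on $\psi U^+[\vee_i^{lk}]$, $U^-[\vee_i^{lk}]^{op}$ with $\mathrm{supp}(\phi_+)=\mathrm{supp}(\phi_-)=\{\alpha_i\}$ and $$\phi_+(E_{\alpha_i}K_{\alpha_i}^{-1})\,\phi_-(F_{\alpha_i})=\frac{q^2}{(q-q^{-1})(1-q^2)}.$$ Then $$C:=U^-[\vee_i^{lk}]^{op}_{\phi_-}\,\mathbb{C}[L]\,\psi U^+[\vee_i^{lk}]_{\phi_+}$$ is a basic right coideal subalgebra of $U_q(\mathfrak g)$. More precisely, $C$ has the following relations between two character-shifted root vectors for roots $\mu,\nu,\mu'\in\Phi^+(\vee_i^{lk})$: $$[\bar E_{\alpha_i},\bar F_{\alpha_i}]_{q^{(\alpha_i,\alpha_i)}}=\frac{q^2}{q-q^{-1}},$$ $$[\bar E_\mu,\bar E_\nu]_{q^{(\mu,\nu)}}=0,\qquad[\bar F_\mu,\bar F_\nu]_{q^{(\mu,\nu)}}=0,$$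 $$[\bar E_\mu,\bar F_\nu]_{q^{(\mu,\nu)}}=0\quad\text{if }\mu\ne\nu,$$ $$[\bar E_\mu,\bar F_\mu]_{q^{(\mu,\mu)}}=q^2[\bar E_{\mu'},\bar F_{\mu'}]_1\quad\text{if }\mu\neq\alpha_i,$$ where $\mu'=\mu-\alpha_{i+r}$ if $\mu=\sum_{j=0}^r\alpha_{i+j}$, and $\mu'=\mu-\alpha_{i-s}$ if $\mu=\sum_{j=-s}^0\alpha_{i+j}$.
   Context: Notation: $[a,b]_c=ab-c\,ba$. Simple roots $\alpha_1,\dots,\alpha_n$ of type $A_n$ in the usual order, form with $(\alpha_i,\alpha_i)=2$, root lattice $\Lambda$, Weyl group $W$ with simple reflections $s_i$, $\Phi^+(w)=\{\beta\in\Phi^+\mid w^{-1}\beta<0\}$. $q\in\mathbb{C}^\times$ is not a root of unity. $U=U_q(\mathfrak g)$ is generated by $E_\alpha,F_\alpha,K_\alpha^{\pm1}$ ($\alpha$ simple) with $K_\alpha E_\beta=q^{(\alpha,\beta)}E_\beta K_\alpha$, $K_\alpha F_\beta=q^{-(\alpha,\beta)}F_\beta K_\alpha$, $[E_\alpha,F_\beta]_1=\delta_{\alpha\beta}\frac{K_\alpha-K_\alpha^{-1}}{q-q^{-1}}$, quantum Serre relations, $\Delta(E_\alpha)=E_\alpha\otimes1+K_\alpha\otimes E_\alpha$, $\Delta(F_\alpha)=F_\alpha\otimes K_\alpha^{-1}+1\otimes F_\alpha$, $\Delta(K_\alpha)=K_\alpha\otimes K_\alpha$; $K_\mu=\prod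 K_{\alpha_i}^{a_i}$ for $\mu=\sum a_i\alpha_i$. $\mathbb{C}[L]$ is the span of the $K_\mu$, $\mu\in L$. Lusztig automorphisms $T_\alpha=T_{s_\alpha}$: $T_\alpha(K_\mu)=K_{s_\alpha\mu}$, $T_\alpha(E_\alpha)=-F_\alpha K_\alpha$, $T_\alpha(F_\alpha)=-K_\alpha^{-1}E_\alpha$; if $(\alpha,\beta)=0$ they fix $E_\beta,F_\beta$; if $(\alpha,\beta)=-1$, $T_\alpha(E_\beta)=E_\alpha E_\beta-q^{-1}E_\beta E_\alpha$, $T_\alpha(F_\beta)=F_\beta F_\alpha-qF_\alpha F_\beta$. For the given reduced expression $w=s_{i_1}\cdots s_{i_m}$ of $w=\vee_i^{lk}$ and $\beta_j=s_{i_1}\cdots s_{i_{j-1}}\alpha_{i_j}$ (so $\Phi^+(w)=\{\beta_1,\dots,\beta_m\}$): the root vectors $E_{\beta_j}=T_{s_{i_1}}\cdots T_{s_{i_{j-1}}}(E_{\alpha_{i_j}})$ generate $U^+[w]$, and the root vectors $F_{\beta_j}=T^{-1}_{s_{i_1}}\cdots T^{-1}_{s_{i_{j-1}}}(F_{\alpha_{i_j}})$ generate $U^-[w]^{op}$. $\psi$ is the algebra automorphism $\psi(x_\mu)=q^{-(\mu,\mu)/2}x_\mu K_\mu^{-1}$ for $x_\mu$ of degree $\mu$. $\psi U^+[w]$ and $U^-[w]^{op}$ are right coideal subalgebras; here a right coideal subalgebra is a subalgebra $C$ with $\Delta(C)\subset C\otimes U$. The characters with support $\{\alpha_i\}$ are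 those nonzero on the root vector of $\alpha_i$ and zero on the other root vectors. For a character $\phi$ on a right coideal subalgebra $A$, the character-shift is $A_\phi=\{\phi(a^{(1)})a^{(2)}\mid a\in A\}$. The character-shifted root vectors are $\bar E_\mu=(\phi_+\otimes\mathrm{id})\Delta(E_\mu K_\mu^{-1})$ and $\bar F_\mu=(\phi_-\otimes\mathrm{id})\Delta(F_\mu)$; in particular $\bar E_{\alpha_i}=E_{\alpha_i}K_{\alpha_i}^{-1}+\phi_+(E_{\alpha_i}K_{\alpha_i}^{-1})K_{\alpha_i}^{-1}$ and $\bar F_{\alpha_i}=F_{\alpha_i}+\phi_-(F_{\alpha_i})K_{\alpha_i}^{-1}$. An algebra is basic if all its finite-dimensional irreducible representations are one-dimensional.
   Formalization: The factor q² in the last relation is false for these root vectors; it is −q, and q² holds once F̄_μ is rescaled by (−q)^{ht(μ)−1}. The E–E relations are stated only for μ before ν in the convex order and the F–F relations only for μ after ν, as they fail for μ=ν or when reversed with (μ,ν)=1. *)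

theory Defs
  imports
    "HOL-Library.Poly_Mapping"
    "HOL-Library.Product_Plus"
    "HOL-Algebra.QuotRing"
    "HOL-Algebra.Subrings"
    "Jordan_Normal_Form.VS_Connect"
begin

section \<open>Root system of type A\<close>

text \<open>The root lattice is rendered as functions \<open>nat \<Rightarrow> int\<close> supported in \<open>{1..n}\<close>:
  the value at \<open>a\<close> is the coefficient of the simple root \<open>\<alpha>\<^sub>a\<close>.\<close>

definition simple_root :: "nat \<Rightarrow> nat \<Rightarrow> int" where
  "simple_root a = (\<lambda>b. if b = a then 1 else 0)"

definition root_lattice :: "nat \<Rightarrow> (nat \<Rightarrow> int) set" where
  "root_lattice n = {\<mu>. \<forall>a. a \<notin> {1..n} \<longrightarrow> \<mu> a = 0}"

definition cartan :: "nat \<Rightarrow> nat \<Rightarrow> int" where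
  "cartan a b = (if a = b then 2 else if a = Suc b \<or> b = Suc a then -1 else 0)"

definition root_form :: "nat \<Rightarrow> (nat \<Rightarrow> int) \<Rightarrow> (nat \<Rightarrow> int) \<Rightarrow> int" where
  "root_form n \<mu> \<nu> = (\<Sum>a\<in>{1..n}. \<Sum>b\<in>{1..n}. \<mu> a * \<nu> b * cartan a b)"

definition reflection :: "nat \<Rightarrow> nat \<Rightarrow> (nat \<Rightarrow> int) \<Rightarrow> nat \<Rightarrow> int" where
  "reflection n a \<mu> = (\<lambda>b. \<mu> b - root_form n \<mu> (simple_root a) * simple_root a b)"

definition root_sum :: "nat \<Rightarrow> nat \<Rightarrow> nat \<Rightarrow> int" where
  "root_sum a b = (\<lambda>c. \<Sum>j\<in>{a..b}. simple_root j c)"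

definition pos_roots :: "nat \<Rightarrow> (nat \<Rightarrow> int) set" where
  "pos_roots n = {root_sum a b | a b. 1 \<le> a \<and> a \<le> b \<and> b \<le> n}"

text \<open>A Weyl group element is given by a word \<open>ws = [i\<^sub>1, \<dots>, i\<^sub>m]\<close>, standing for
  \<open>s\<^bsub>i\<^sub>1\<^esub> \<cdots> s\<^bsub>i\<^sub>m\<^esub>\<close>; its inverse is given by the reversed word.\<close>

definition weyl_act :: "nat \<Rightarrow> nat list \<Rightarrow> (nat \<Rightarrow> int) \<Rightarrow> nat \<Rightarrow> int" where
  "weyl_act n ws \<mu> = foldr (reflection n) ws \<mu>"

definition inversions :: "nat \<Rightarrow> nat list \<Rightarrow> (nat \<Rightarrow> int) set" where
  "inversions n ws = {\<beta> \<in> pos_roots n. - weyl_act n (rev ws) \<beta> \<in> pos_roots n}"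

text \<open>\<open>beta n ws j\<close> is \<open>\<beta>\<^bsub>j+1\<^esub>\<close> in one-based numbering.\<close>

definition beta :: "nat \<Rightarrow> nat list \<Rightarrow> nat \<Rightarrow> nat \<Rightarrow> int" where
  "beta n ws j = weyl_act n (take j ws) (simple_root (ws ! j))"

text \<open>The position of a root in the convex order \<open>\<beta>\<^sub>1 < \<dots> < \<beta>\<^sub>m\<close>; the word is meant to be
  reduced, so that the roots \<open>\<beta>\<^sub>j\<close> are distinct.\<close>

definition root_index :: "nat \<Rightarrow> nat list \<Rightarrow> (nat \<Rightarrow> int) \<Rightarrow> nat" where
  "root_index n ws \<mu> = (THE j. j < length ws \<and> beta n ws j = \<mu>)"

definition vee :: "nat \<Rightarrow> nat \<Rightarrow> nat \<Rightarrow> nat list" where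
  "vee i l k = [i..<Suc (i + l)] @ rev [i - k..<i]"

section \<open>Complex algebras\<close>

text \<open>A complex algebra is a \<open>module\<close> record, whose ring part carries the multiplication.
  Words form a monoid under concatenation, so that finitely supported functions on words are
  the free algebra, and on pairs of words its tensor square.\<close>

instantiation list :: (type) monoid_add
begin

definition zero_list :: "'a list" where
  "zero_list = []"

definition plus_list :: "'a list \<Rightarrow> 'a list \<Rightarrow> 'a list" where
  "plus_list = (@)"

instance
  by standard (simp_all add: zero_list_def plus_list_def)

end

definition monoid_alg :: "'k::monoid_add set \<Rightarrow> (complex, 'k \<Rightarrow>\<^sub>0 complex) module" where
  "monoid_alg S = \<lparr>carrier = {p. Poly_Mapping.keys p \<subseteq> S}, mult = (*), one = 1, zero = 0,
     add = (+), smult = (\<lambda>c p. Poly_Mapping.single 0 c * p)\<rparr>"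

definition quot_alg :: "(complex, 'a) module \<Rightarrow> 'a set \<Rightarrow> (complex, 'a set) module" where
  "quot_alg A I = \<lparr>carrier = carrier (A Quot I), mult = mult (A Quot I), one = one (A Quot I),
     zero = zero (A Quot I), add = add (A Quot I),
     smult = (\<lambda>c X. \<Union>x\<in>X. I +>\<^bsub>A\<^esub> (c \<odot>\<^bsub>A\<^esub> x))\<rparr>"

text \<open>The map into \<open>quot_alg B J\<close> that a map \<open>f\<close>, compatible with the ideals, induces on
  cosets.\<close>

definition quot_map :: "(complex, 'b) module \<Rightarrow> 'b set \<Rightarrow> ('a \<Rightarrow> 'b) \<Rightarrow> 'a set \<Rightarrow> 'b set" where
  "quot_map B J f X = the_elem ((\<lambda>x. J +>\<^bsub>B\<^esub> f x) ` X)"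

definition subalg :: "(complex, 'a) module \<Rightarrow> 'a set \<Rightarrow> bool" where
  "subalg A B \<longleftrightarrow> subring B A \<and> (\<forall>c. \<forall>x\<in>B. c \<odot>\<^bsub>A\<^esub> x \<in> B)"

definition gen_subalg :: "(complex, 'a) module \<Rightarrow> 'a set \<Rightarrow> 'a set" where
  "gen_subalg A S = \<Inter>{B. subalg A B \<and> S \<subseteq> B}"

text \<open>The linear span of the products \<open>b c\<close>, for linear subspaces \<open>B\<close> and \<open>C\<close>.\<close>

definition prod_span :: "(complex, 'a) module \<Rightarrow> 'a set \<Rightarrow> 'a set \<Rightarrow> 'a set" where
  "prod_span A B C =
     {\<Oplus>\<^bsub>A\<^esub>p\<in>P. fst p \<otimes>\<^bsub>A\<^esub> snd p | P. finite P \<and> P \<subseteq> B \<times> C}"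

definition qcomm :: "(complex, 'a) module \<Rightarrow> 'a \<Rightarrow> 'a \<Rightarrow> complex \<Rightarrow> 'a" where
  "qcomm A a b c = a \<otimes>\<^bsub>A\<^esub> b \<ominus>\<^bsub>A\<^esub> c \<odot>\<^bsub>A\<^esub> (b \<otimes>\<^bsub>A\<^esub> a)"

definition character :: "(complex, 'a) module \<Rightarrow> 'a set \<Rightarrow> ('a \<Rightarrow> complex) \<Rightarrow> bool" where
  "character A B \<phi> \<longleftrightarrow> \<phi> \<in> Ring.ring_hom (A\<lparr>carrier := B\<rparr>) class_ring \<and>
     (\<forall>c. \<forall>x\<in>B. \<phi> (c \<odot>\<^bsub>A\<^esub> x) = c * \<phi> x)"

text \<open>Finite-dimensional representations of a subalgebra \<open>B\<close>, on the space of column vectors.\<close>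

definition representation ::
    "(complex, 'a) module \<Rightarrow> 'a set \<Rightarrow> nat \<Rightarrow> ('a \<Rightarrow> complex mat) \<Rightarrow> bool" where
  "representation A B d \<rho> \<longleftrightarrow>
     \<rho> \<in> Ring.ring_hom (A\<lparr>carrier := B\<rparr>) (ring_mat TYPE(complex) d ()) \<and>
     (\<forall>c. \<forall>x\<in>B. \<rho> (c \<odot>\<^bsub>A\<^esub> x) = c \<cdot>\<^sub>m \<rho> x)"

definition linear_subspace :: "nat \<Rightarrow> complex vec set \<Rightarrow> bool" where
  "linear_subspace d W \<longleftrightarrow> W \<subseteq> carrier_vec d \<and> 0\<^sub>v d \<in> W \<and>
     (\<forall>v\<in>W. \<forall>w\<in>W. v + w \<in> W) \<and> (\<forall>c. \<forall>v\<in>W. c \<cdot>\<^sub>v v \<in> W)"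

definition irreducible_rep ::
    "(complex, 'a) module \<Rightarrow> 'a set \<Rightarrow> nat \<Rightarrow> ('a \<Rightarrow> complex mat) \<Rightarrow> bool" where
  "irreducible_rep A B d \<rho> \<longleftrightarrow> representation A B d \<rho> \<and> d \<noteq> 0 \<and>
     (\<forall>W. linear_subspace d W \<and> (\<forall>x\<in>B. \<forall>v\<in>W. \<rho> x *\<^sub>v v \<in> W) \<longrightarrow>
        W = {0\<^sub>v d} \<or> W = carrier_vec d)"

definition basic_alg :: "(complex, 'a) module \<Rightarrow> 'a set \<Rightarrow> bool" where
  "basic_alg A B \<longleftrightarrow> (\<forall>d \<rho>. irreducible_rep A B d \<rho> \<longrightarrow> d = 1)"

section \<open>The quantum group\<close>

datatype letter = LE nat | LF nat | LK nat | LKinv nat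

type_synonym free = "letter list \<Rightarrow>\<^sub>0 complex"
type_synonym free2 = "(letter list \<times> letter list) \<Rightarrow>\<^sub>0 complex"

definition letters :: "nat \<Rightarrow> letter set" where
  "letters n = (\<Union>a\<in>{1..n}. {LE a, LF a, LK a, LKinv a})"

definition free_alg :: "nat \<Rightarrow> (complex, free) module" where
  "free_alg n = monoid_alg (lists (letters n))"

definition free_alg2 :: "nat \<Rightarrow> (complex, free2) module" where
  "free_alg2 n = monoid_alg (lists (letters n) \<times> lists (letters n))"

definition scalar :: "complex \<Rightarrow> 'k::monoid_add \<Rightarrow>\<^sub>0 complex" where
  "scalar c = Poly_Mapping.single 0 c"

definition word :: "letter list \<Rightarrow> free" where
  "word w = Poly_Mapping.single w 1"

definition Kword :: "nat \<Rightarrow> (nat \<Rightarrow> int) \<Rightarrow> letter list" where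
  "Kword n \<mu> = concat (map (\<lambda>a. replicate (nat (\<mu> a)) (LK a) @ replicate (nat (- \<mu> a)) (LKinv a))
     [1..<Suc n])"

text \<open>The algebra homomorphism with prescribed values on the letters.\<close>

definition free_ext :: "(letter \<Rightarrow> 'k::monoid_add \<Rightarrow>\<^sub>0 complex) \<Rightarrow> free \<Rightarrow> 'k \<Rightarrow>\<^sub>0 complex" where
  "free_ext f p =
     (\<Sum>w\<in>Poly_Mapping.keys p. scalar (Poly_Mapping.lookup p w) * prod_list (map f w))"

definition tens_free :: "free \<Rightarrow> free \<Rightarrow> free2" where
  "tens_free x y = (\<Sum>u\<in>Poly_Mapping.keys x. \<Sum>v\<in>Poly_Mapping.keys y.
     Poly_Mapping.single (u, v) (Poly_Mapping.lookup x u * Poly_Mapping.lookup y v))"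

definition torus_relations :: "nat \<Rightarrow> complex \<Rightarrow> free set" where
  "torus_relations n q = (\<Union>a\<in>{1..n}. \<Union>b\<in>{1..n}.
     {word [LK a, LKinv a] - 1, word [LKinv a, LK a] - 1, word [LK a, LK b] - word [LK b, LK a],
      word [LK a, LE b] - scalar (q powi cartan a b) * word [LE b, LK a],
      word [LK a, LF b] - scalar (q powi (- cartan a b)) * word [LF b, LK a]})"

definition commutator_relations :: "nat \<Rightarrow> complex \<Rightarrow> free set" where
  "commutator_relations n q = (\<Union>a\<in>{1..n}. \<Union>b\<in>{1..n}.
     {word [LE a, LF b] - word [LF b, LE a] -
        (if a = b then scalar (1 / (q - inverse q)) * (word [LK a] - word [LKinv a]) else 0)})"

definition serre_relations :: "nat \<Rightarrow> complex \<Rightarrow> (nat \<Rightarrow> letter) \<Rightarrow> free set" where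
  "serre_relations n q x =
     {word [x a, x b] - word [x b, x a] | a b. a \<in> {1..n} \<and> b \<in> {1..n} \<and> cartan a b = 0} \<union>
     {word [x a, x a, x b] - scalar (q + inverse q) * word [x a, x b, x a] + word [x b, x a, x a]
        | a b. a \<in> {1..n} \<and> b \<in> {1..n} \<and> cartan a b = -1}"

definition Uq_ideal :: "nat \<Rightarrow> complex \<Rightarrow> free set" where
  "Uq_ideal n q = Idl\<^bsub>free_alg n\<^esub> (torus_relations n q \<union> commutator_relations n q \<union>
     serre_relations n q LE \<union> serre_relations n q LF)"

definition Uq :: "nat \<Rightarrow> complex \<Rightarrow> (complex, free set) module" where
  "Uq n q = quot_alg (free_alg n) (Uq_ideal n q)"

definition UqE :: "nat \<Rightarrow> complex \<Rightarrow> nat \<Rightarrow> free set" where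
  "UqE n q a = Uq_ideal n q +>\<^bsub>free_alg n\<^esub> word [LE a]"

definition UqF :: "nat \<Rightarrow> complex \<Rightarrow> nat \<Rightarrow> free set" where
  "UqF n q a = Uq_ideal n q +>\<^bsub>free_alg n\<^esub> word [LF a]"

definition UqK :: "nat \<Rightarrow> complex \<Rightarrow> (nat \<Rightarrow> int) \<Rightarrow> free set" where
  "UqK n q \<mu> = Uq_ideal n q +>\<^bsub>free_alg n\<^esub> word (Kword n \<mu>)"

definition torus_alg :: "nat \<Rightarrow> complex \<Rightarrow> (nat \<Rightarrow> int) set \<Rightarrow> free set set" where
  "torus_alg n q L =
     {\<Oplus>\<^bsub>Uq n q\<^esub>\<mu>\<in>M. c \<mu> \<odot>\<^bsub>Uq n q\<^esub> UqK n q \<mu> | c M. finite M \<and> M \<subseteq> L}"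

subsection \<open>Coproduct\<close>

text \<open>\<open>U \<otimes> U\<close> is the quotient of the tensor square of the free algebra \<open>A\<close> by
  \<open>I \<otimes> A + A \<otimes> I\<close>, where \<open>U = A / I\<close>.\<close>

definition Uq2_ideal :: "nat \<Rightarrow> complex \<Rightarrow> free2 set" where
  "Uq2_ideal n q = Idl\<^bsub>free_alg2 n\<^esub>
     ((\<lambda>x. tens_free x 1) ` Uq_ideal n q \<union> (\<lambda>x. tens_free 1 x) ` Uq_ideal n q)"

definition Uq2 :: "nat \<Rightarrow> complex \<Rightarrow> (complex, free2 set) module" where
  "Uq2 n q = quot_alg (free_alg2 n) (Uq2_ideal n q)"

definition tens :: "nat \<Rightarrow> complex \<Rightarrow> free set \<Rightarrow> free set \<Rightarrow> free2 set" where
  "tens n q X Y = the_elem ((\<lambda>(x, y). Uq2_ideal n q +>\<^bsub>free_alg2 n\<^esub> tens_free x y) ` (X \<times> Y))"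

fun coproduct_letter :: "letter \<Rightarrow> free2" where
  "coproduct_letter (LE a) = tens_free (word [LE a]) 1 + tens_free (word [LK a]) (word [LE a])"
| "coproduct_letter (LF a) = tens_free (word [LF a]) (word [LKinv a]) + tens_free 1 (word [LF a])"
| "coproduct_letter (LK a) = tens_free (word [LK a]) (word [LK a])"
| "coproduct_letter (LKinv a) = tens_free (word [LKinv a]) (word [LKinv a])"

definition coproduct :: "nat \<Rightarrow> complex \<Rightarrow> free set \<Rightarrow> free2 set" where
  "coproduct n q = quot_map (free_alg2 n) (Uq2_ideal n q) (free_ext coproduct_letter)"

text \<open>\<open>B \<otimes> C\<close> inside \<open>U \<otimes> U\<close>, for linear subspaces \<open>B\<close> and \<open>C\<close> of \<open>U\<close>.\<close>

definition tens_span :: "nat \<Rightarrow> complex \<Rightarrow> free set set \<Rightarrow> free set set \<Rightarrow> free2 set set" where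
  "tens_span n q B C =
     {\<Oplus>\<^bsub>Uq2 n q\<^esub>p\<in>P. tens n q (fst p) (snd p) | P. finite P \<and> P \<subseteq> B \<times> C}"

definition right_coideal_subalg :: "nat \<Rightarrow> complex \<Rightarrow> free set set \<Rightarrow> bool" where
  "right_coideal_subalg n q C \<longleftrightarrow> subalg (Uq n q) C \<and>
     (\<forall>c\<in>C. coproduct n q c \<in> tens_span n q C (carrier (Uq n q)))"

text \<open>\<open>apply_left n q B \<phi>\<close> is \<open>\<phi> \<otimes> id\<close>, from \<open>B \<otimes> U\<close> to \<open>U\<close>.\<close>

definition apply_left ::
    "nat \<Rightarrow> complex \<Rightarrow> free set set \<Rightarrow> (free set \<Rightarrow> complex) \<Rightarrow> free2 set \<Rightarrow> free set" where
  "apply_left n q B \<phi> z = (THE y. \<exists>P. finite P \<and> P \<subseteq> B \<times> carrier (Uq n q) \<and>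
     z = (\<Oplus>\<^bsub>Uq2 n q\<^esub>p\<in>P. tens n q (fst p) (snd p)) \<and>
     y = (\<Oplus>\<^bsub>Uq n q\<^esub>p\<in>P. \<phi> (fst p) \<odot>\<^bsub>Uq n q\<^esub> snd p))"

definition char_shift ::
    "nat \<Rightarrow> complex \<Rightarrow> free set set \<Rightarrow> (free set \<Rightarrow> complex) \<Rightarrow> free set set" where
  "char_shift n q B \<phi> = (\<lambda>a. apply_left n q B \<phi> (coproduct n q a)) ` B"

subsection \<open>Lusztig automorphisms and root vectors\<close>

fun lusztig_letter :: "nat \<Rightarrow> complex \<Rightarrow> nat \<Rightarrow> letter \<Rightarrow> free" where
  "lusztig_letter n q a (LE b) =
     (if a = b then - word [LF a, LK a]
      else if cartan a b = -1 then word [LE a, LE b] - scalar (inverse q) * word [LE b, LE a]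
      else word [LE b])"
| "lusztig_letter n q a (LF b) =
     (if a = b then - word [LKinv a, LE a]
      else if cartan a b = -1 then word [LF b, LF a] - scalar q * word [LF a, LF b]
      else word [LF b])"
| "lusztig_letter n q a (LK b) = word (Kword n (reflection n a (simple_root b)))"
| "lusztig_letter n q a (LKinv b) = word (Kword n (- reflection n a (simple_root b)))"

definition lusztig :: "nat \<Rightarrow> complex \<Rightarrow> nat \<Rightarrow> free set \<Rightarrow> free set" where
  "lusztig n q a = quot_map (free_alg n) (Uq_ideal n q) (free_ext (lusztig_letter n q a))"

definition lusztig_inv :: "nat \<Rightarrow> complex \<Rightarrow> nat \<Rightarrow> free set \<Rightarrow> free set" where
  "lusztig_inv n q a = inv_into (carrier (Uq n q)) (lusztig n q a)"

definition rootE :: "nat \<Rightarrow> complex \<Rightarrow> nat list \<Rightarrow> (nat \<Rightarrow> int) \<Rightarrow> free set" where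
  "rootE n q ws \<mu> = (let j = root_index n ws \<mu> in
     foldr (lusztig n q) (take j ws) (UqE n q (ws ! j)))"

definition rootF :: "nat \<Rightarrow> complex \<Rightarrow> nat list \<Rightarrow> (nat \<Rightarrow> int) \<Rightarrow> free set" where
  "rootF n q ws \<mu> = (let j = root_index n ws \<mu> in
     foldr (lusztig_inv n q) (take j ws) (UqF n q (ws ! j)))"

fun letter_degree :: "letter \<Rightarrow> nat \<Rightarrow> int" where
  "letter_degree (LE a) = simple_root a"
| "letter_degree (LF a) = - simple_root a"
| "letter_degree (LK a) = (\<lambda>b. 0)"
| "letter_degree (LKinv a) = (\<lambda>b. 0)"

definition word_degree :: "letter list \<Rightarrow> nat \<Rightarrow> int" where
  "word_degree w = (\<lambda>b. \<Sum>x\<leftarrow>w. letter_degree x b)"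

text \<open>The form is even, so the integer division by \<open>2\<close> is exact.\<close>

definition psi_free :: "nat \<Rightarrow> complex \<Rightarrow> free \<Rightarrow> free" where
  "psi_free n q p = (\<Sum>w\<in>Poly_Mapping.keys p.
     scalar (Poly_Mapping.lookup p w * q powi (- (root_form n (word_degree w) (word_degree w) div 2))) *
     word w * word (Kword n (- word_degree w)))"

definition psi :: "nat \<Rightarrow> complex \<Rightarrow> free set \<Rightarrow> free set" where
  "psi n q = quot_map (free_alg n) (Uq_ideal n q) (psi_free n q)"

definition psi_Uplus :: "nat \<Rightarrow> complex \<Rightarrow> nat list \<Rightarrow> free set set" where
  "psi_Uplus n q ws = psi n q ` gen_subalg (Uq n q) (rootE n q ws ` inversions n ws)"

definition Uminus_op :: "nat \<Rightarrow> complex \<Rightarrow> nat list \<Rightarrow> free set set" where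
  "Uminus_op n q ws = gen_subalg (Uq n q) (rootF n q ws ` inversions n ws)"

definition supp_plus ::
    "nat \<Rightarrow> complex \<Rightarrow> nat list \<Rightarrow> (free set \<Rightarrow> complex) \<Rightarrow> (nat \<Rightarrow> int) set" where
  "supp_plus n q ws \<phi> = {\<beta> \<in> inversions n ws. \<phi> (psi n q (rootE n q ws \<beta>)) \<noteq> 0}"

definition supp_minus ::
    "nat \<Rightarrow> complex \<Rightarrow> nat list \<Rightarrow> (free set \<Rightarrow> complex) \<Rightarrow> (nat \<Rightarrow> int) set" where
  "supp_minus n q ws \<phi> = {\<beta> \<in> inversions n ws. \<phi> (rootF n q ws \<beta>) \<noteq> 0}"

definition barE ::
    "nat \<Rightarrow> complex \<Rightarrow> nat list \<Rightarrow> (free set \<Rightarrow> complex) \<Rightarrow> (nat \<Rightarrow> int) \<Rightarrow> free set" where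
  "barE n q ws \<phi> \<mu> = apply_left n q (psi_Uplus n q ws) \<phi>
     (coproduct n q (rootE n q ws \<mu> \<otimes>\<^bsub>Uq n q\<^esub> UqK n q (- \<mu>)))"

definition barF ::
    "nat \<Rightarrow> complex \<Rightarrow> nat list \<Rightarrow> (free set \<Rightarrow> complex) \<Rightarrow> (nat \<Rightarrow> int) \<Rightarrow> free set" where
  "barF n q ws \<phi> \<mu> = apply_left n q (Uminus_op n q ws) \<phi> (coproduct n q (rootF n q ws \<mu>))"

text \<open>The factor by which \<open>[Ebar\<^sub>\<mu>, Fbar\<^sub>\<mu>]\<close> and \<open>[Ebar\<^sub>\<mu>\<^sub>', Fbar\<^sub>\<mu>\<^sub>']\<close> differ depends on the
  normalization of the root vectors. For \<open>rootF\<close>, obtained from the inverse Lusztig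
  automorphisms, it is \<open>-q\<close>; it becomes \<open>q\<^sup>2\<close> after rescaling by powers of \<open>-q\<close> as follows, where
  the exponent is the height of \<open>\<mu>\<close> minus one. The root vectors of simple roots are unaffected.\<close>

definition barF_norm ::
    "nat \<Rightarrow> complex \<Rightarrow> nat list \<Rightarrow> (free set \<Rightarrow> complex) \<Rightarrow> (nat \<Rightarrow> int) \<Rightarrow> free set" where
  "barF_norm n q ws \<phi> \<mu> =
     (- q) ^ nat ((\<Sum>a\<in>{1..n}. \<mu> a) - 1) \<odot>\<^bsub>Uq n q\<^esub> barF n q ws \<phi> \<mu>"

end

theory Submission
  imports Defs "HOL-Library.Function_Algebras" "Jordan_Normal_Form.Spectral_Radius"
begin

hide_const (open) Multiset.mult Polynomial.smult Modules.module

text \<open>Why the theorem holds. Every root of the word \<open>vee i l k\<close> is the sum of the simple roots along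
a path in the Dynkin diagram that starts at \<open>i\<close> and runs upwards or downwards. Its root vector is an
iterated \<open>q\<close>-commutator of the generators along this path (\<open>reach_lusztig\<close>, \<open>reach_lusztig_inv\<close>).
Its coproduct is therefore a sum over the ways to cut the path in two (\<open>coprod_eroot\<close>, \<open>coprod_froot\<close>),
with the initial piece in the left factor. A character supported on the simple root at \<open>i\<close> sees only
the cut after the first vertex, so the shifted root vector is the root vector plus a multiple of the
root vector of the path without its first vertex, times a torus element (\<open>ebar\<close>, \<open>fbar\<close>).

Shifting is an algebra homomorphism (\<open>sh_mult\<close>), so that the relations among the shifted \<open>E\<close>, and
those among the shifted \<open>F\<close>, are the relations of the root vectors (\<open>eroot_prefix\<close>,
\<open>eroot_opposite\<close>). Mixed relations go by induction along the paths: prolonging a path by a vertex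
\<open>m\<close> is a \<open>q\<close>-commutator with \<open>E\<^sub>m K\<^sub>m\<^sup>-\<^sup>1\<close> or \<open>F\<^sub>m\<close> (\<open>ebar_snoc\<close>, \<open>fbar_snoc\<close>), and the step is
\<open>bar_main\<close>. The induction starts with \<open>bar_base\<close>, where the prescribed product of the two character
values is exactly what cancels the square of the inverse of \<open>K\<^sub>i\<close>.

The mixed relations move every shifted \<open>E\<close> to the right past the shifted \<open>F\<close>. Hence the span of the
products is stable under left multiplication by generators and is an algebra (\<open>CV_alg\<close>); it is a
right coideal because the left factors in the coproduct of a shifted root vector are again shifted root
vectors (\<open>coprod_ebar\<close>, \<open>coprod_fbar\<close>).

In an irreducible finite-dimensional representation the commutator \<open>z\<close> of the two shifted vectors at
\<open>i\<close> commutes up to scalars with all generators and is singular, since the spectrum of \<open>z\<close> would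
otherwise be stable under a scalar that is not a root of unity (\<open>weyl_pair_commutator\<close>). By Schur's
lemma it vanishes; then so do all other shifted root vectors, one after the other along the paths, and
what remains is commutative (\<open>one_dimensional\<close>).

All computations take place in type-class algebras rather than with cosets: the quotient of a monoid
algebra by an ideal acts faithfully on a space of finitely supported functions (\<open>ex_faithful_rep\<close>),
and its image there consists of honest operators. The coproduct, the Lusztig automorphisms and \<open>psi\<close>
become the homomorphisms \<open>lift f\<close> attached to families \<open>f\<close> of elements that satisfy the defining
relations (\<open>qgroup\<close>).\<close>

section \<open>Complex algebras\<close>

text \<open>A complex algebra as a type class with its own scalar multiplication, so that simplification by ring laws is available for operators on spaces whose elements are not real vectors.\<close>
class calg = ring_1 +
 fixes scaleC :: "complex => 'a => 'a" (infixr "*." 75)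
 assumes sc_add_r: "c *. (x + y) = c *. x + c *. y"
 and sc_add_l: "(c + d) *. x = c *. x + d *. x"
 and scc: "c *. d *. x = (c * d) *. x"
 and sc1: "1 *. x = x"
 and scl: "(c *. x) * y = c *. (x * y)"
 and scr: "x * (c *. y) = c *. (x * y)"

interpretation calg: vector_space "scaleC :: complex => 'a::calg => 'a"
 by standard (simp_all add: sc_add_r sc_add_l scc sc1)

interpretation pm: vector_space "%c (p :: 'k::monoid_add \<Rightarrow>\<^sub>0 complex). scalar c * p"
 by standard (simp_all add: scalar_def algebra_simps single_add mult_single
 flip: mult.assoc)

interpretation pm_calg: vector_space_pair "%c (p :: 'k::monoid_add \<Rightarrow>\<^sub>0 complex). scalar c * p"
 "scaleC :: complex => 'a::calg => 'a"
 by standard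

interpretation pm_pm: vector_space_pair "%c (p :: 'k::monoid_add \<Rightarrow>\<^sub>0 complex). scalar c * p"
 "%c (p :: 'l::monoid_add \<Rightarrow>\<^sub>0 complex). scalar c * p"
 by standard

instantiation complex :: calg
begin
definition scaleC_complex :: "complex => complex => complex" where
 "scaleC_complex c x = c * x"
instance by standard (simp_all add: scaleC_complex_def algebra_simps)
end

lemma lookup_scalar_mult: "Poly_Mapping.lookup (scalar c * p) k = c * Poly_Mapping.lookup p k"
proof -
 have "scalar c * p = Poly_Mapping.map ((*) c) p"
 by (simp add: scalar_def mult_map_scale_conv_mult)
 thus ?thesis by (simp add: Poly_Mapping.map.rep_eq when_def)
qed

lemma pm_sum_single: "(\<Sum>k\<in>Poly_Mapping.keys p. Poly_Mapping.single k (Poly_Mapping.lookup p k)) = (p :: 'k \<Rightarrow>\<^sub>0 complex)"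
proof (rule poly_mapping_eqI)
 fix i
 have "(\<Sum>k\<in>Poly_Mapping.keys p. Poly_Mapping.lookup (Poly_Mapping.single k (Poly_Mapping.lookup p k)) i)
 = (\<Sum>k\<in>Poly_Mapping.keys p. if k = i then Poly_Mapping.lookup p k else 0)"
 by (intro sum.cong) (auto simp: lookup_single when_def)
 thus "Poly_Mapping.lookup (\<Sum>k\<in>Poly_Mapping.keys p. Poly_Mapping.single k (Poly_Mapping.lookup p k)) i = Poly_Mapping.lookup p i"
 by (simp add: lookup_sum sum.delta' in_keys_iff)
qed

lemma pm_induct [consumes 1, case_names zero add]:
 fixes p :: "'k \<Rightarrow>\<^sub>0 complex"
 assumes "Poly_Mapping.keys p <= S" and "P 0"
 and "!!k c p. k : S ==> Poly_Mapping.keys p <= S ==> P p ==> P (Poly_Mapping.single k c + p)"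
 shows "P p"
proof -
 have "P (\<Sum>k\<in>X. Poly_Mapping.single k (Poly_Mapping.lookup p k))" if "finite X" "X <= S" for X
 using that
 proof (induction X rule: finite_induct)
 case (insert x X)
 have "Poly_Mapping.keys (\<Sum>k\<in>X. Poly_Mapping.single k (Poly_Mapping.lookup p k)) <= S"
 by (rule order_trans[OF keys_sum]) (use insert in \<open>auto split: if_splits\<close>)
 with insert show ?case by (auto intro: assms(3))
 qed (simp add: assms(2))
 from this[of "Poly_Mapping.keys p"] assms(1) show ?thesis by (simp add: pm_sum_single)
qed

lemma scalar_commute: "(p::'k::monoid_add \<Rightarrow>\<^sub>0 complex) * (scalar c * r) = scalar c * (p * r)"
proof -
 have *: "p * scalar c = scalar c * p" for p :: "'k \<Rightarrow>\<^sub>0 complex"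
 by (rule pm_induct[of p UNIV]) (simp_all add: scalar_def mult_single mult.commute algebra_simps)
 show ?thesis
 using *[of p] by (simp flip: mult.assoc)
qed

lemma functional_extend:
 fixes f :: "('k::monoid_add \<Rightarrow>\<^sub>0 complex) => complex"
 assumes B: "pm.subspace B"
 and add: "!!x y. x : B ==> y : B ==> f (x + y) = f x + f y"
 and sc: "!!c x. x : B ==> f (scalar c * x) = c * f x"
 obtains g where "!!x y. g (x + y) = g x + g y" "!!c x. g (scalar c * x) = c * g x"
 "!!x. x : B ==> g x = f x"
proof -
 obtain X where X: "X <= B" "pm.independent X" "B <= pm.span X"
 by (rule pm.maximal_independent_subset)
 define g where "g = pm_calg.construct X f"
 interpret g: Vector_Spaces.linear "%c (p :: 'k \<Rightarrow>\<^sub>0 complex). scalar c * p" "scaleC :: complex => complex => complex" g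
 unfolding g_def using X(2) by (rule pm_calg.linear_construct)
 have *: "x : B & g x = f x" if "x : pm.span X" for x
 using that
 proof (induction rule: pm.span_induct_alt)
 case base
 thus ?case using pm.subspace_0[OF B] sc[of 0 0] by (simp add: g.zero)
 next
 case (step c x y)
 hence xB: "x : B" and gx: "g x = f x" 
 using X by (auto simp: g_def pm_calg.construct_basis)
 thus ?case using step
 by (auto simp: g.add g.scale add sc scaleC_complex_def pm.subspace_add[OF B] pm.subspace_scale[OF B])
 qed
 show thesis
 by (rule that[of g]) (use * X in \<open>auto simp: g.add g.scale scaleC_complex_def\<close>)
qed

lemma ex_projection:
 fixes I C :: "('k::monoid_add \<Rightarrow>\<^sub>0 complex) set"
 assumes "pm.subspace I" "pm.subspace C" "I <= C"
 obtains p :: "('k \<Rightarrow>\<^sub>0 complex) => ('k \<Rightarrow>\<^sub>0 complex)"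
 where "!!x y. p (x + y) = p x + p y" "!!c x. p (scalar c * x) = scalar c * p x"
 "!!x. p x : C" "!!x. x : I ==> p x = 0" "!!x. x : C ==> x - p x : I" "!!x. p (p x) = p x"
proof -
 obtain X where X: "X <= I" "pm.independent X" "I <= pm.span X"
 by (rule pm.maximal_independent_subset)
 then obtain Y where Y: "X <= Y" "Y <= C" "pm.independent Y" "C <= pm.span Y"
 using pm.maximal_independent_subset_extend[of X C] assms(3) by blast
 define h where "h = (%b. if b : X then 0 else b)"
 define p where "p = pm_pm.construct Y h"
 interpret p: Vector_Spaces.linear "%c (p :: 'k \<Rightarrow>\<^sub>0 complex). scalar c * p" "%c (p :: 'k \<Rightarrow>\<^sub>0 complex). scalar c * p" p
 unfolding p_def using Y(3) by (rule pm_pm.linear_construct)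
 have pY: "p y = h y" if "y : Y" for y
 unfolding p_def using Y(3) that by (rule pm_pm.construct_basis)
 have pC: "p x : C" for x
 proof -
 have "p x : pm.span (h ` Y)"
 unfolding p_def using Y(3) by (rule pm_pm.construct_in_span)
 moreover have "h ` Y <= C"
 using Y pm.subspace_0[OF assms(2)] by (auto simp: h_def)
 ultimately show ?thesis using pm.span_minimal[OF _ assms(2)] by blast
 qed
 have pI: "p x = 0" if "x : I" for x
 proof -
 have "x : pm.span X" using that X by auto
 thus ?thesis
 by (induction rule: pm.span_induct_alt)
 (use Y in \<open>auto simp: p.zero p.add p.scale pY h_def\<close>)
 qed
 have diff: "x - p x : I" if "x : C" for x
 proof -
 have "x : pm.span Y" using that Y by auto
 thus ?thesis
 proof (induction rule: pm.span_induct_alt)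
 case (step c x y)
 have "x - p x : I"
 using step(1) X pm.subspace_0[OF assms(1)] by (auto simp: pY h_def)
 hence "scalar c * (x - p x) + (y - p y) : I"
 using step pm.subspace_add[OF assms(1)] pm.subspace_scale[OF assms(1)] by blast
 thus ?case by (simp add: p.add p.scale algebra_simps)
 qed (simp add: p.zero pm.subspace_0[OF assms(1)])
 qed
 have pp: "p (p x) = p x" for x
 proof -
 have "p (p x - p (p x)) = 0" using diff[OF pC] pI by blast
 moreover have "p x - p (p x) : I" by (rule diff[OF pC])
 ultimately have "p (p x) = p (p (p x))" by (simp add: p.diff)
 moreover have "p (x - p x) = p x - p (p x)" by (simp add: p.diff)
 obtain B' where "pm.independent B'" "Y <= B'" "pm.span B' = UNIV"
 using pm.independent_extend_basis[OF Y(3)] pm.extend_basis_superset[OF Y(3)] pm.span_extend_basis[OF Y(3)]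
 by blast
 have "p x : pm.span (h ` Y)"
 unfolding p_def using Y(3) by (rule pm_pm.construct_in_span)
 thus ?thesis
 by (induction rule: pm.span_induct_alt)
 (auto simp: p.zero p.add p.scale pY h_def)
 qed
 show thesis by (rule that[of p]) (use p.add p.scale pC pI diff pp in auto)
qed

text \<open>Linear endomorphisms of a space with basis \<open>'k\<close>; the target of all faithful representations below.\<close>
typedef (overloaded) 'k lend =
 "{f :: ('k::monoid_add \<Rightarrow>\<^sub>0 complex) => ('k \<Rightarrow>\<^sub>0 complex).
 (ALL x y. f (x + y) = f x + f y) & (ALL c x. f (scalar c * x) = scalar c * f x)}"
 by (rule exI[of _ id]) simp

setup_lifting type_definition_lend

instantiation lend :: (monoid_add) calg
begin
lift_definition zero_lend :: "'a lend" is "%x. 0" by simp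
lift_definition one_lend :: "'a lend" is "%x. x" by simp
lift_definition plus_lend :: "'a lend => 'a lend => 'a lend" is "%f g x. f x + g x"
 by (simp add: algebra_simps)
lift_definition uminus_lend :: "'a lend => 'a lend" is "%f x. - f x"
 by simp
lift_definition minus_lend :: "'a lend => 'a lend => 'a lend" is "%f g x. f x - g x"
 by (simp add: algebra_simps)
lift_definition times_lend :: "'a lend => 'a lend => 'a lend" is "%f g x. f (g x)"
 by simp
lift_definition scaleC_lend :: "complex => 'a lend => 'a lend" is "%c f x. scalar c * f x"
 by (simp add: distrib_left mult.commute)
instance
proof
 show "(0::'a lend) ~= 1"
 by transfer (metis one_neq_zero)
qed (transfer; simp add: algebra_simps fun_eq_iff pm.scale_left_distrib)+
end

text \<open>The operators are left multiplications on the algebra, transported to a complement of the ideal by a projection with kernel \<open>I\<close>. Left multiplication respects the ideal, so this is multiplicative; applied to the unit it recovers the coset, so it is faithful.\<close>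
lemma ex_faithful_rep:
 fixes I C :: "('k::monoid_add \<Rightarrow>\<^sub>0 complex) set" and \<epsilon> :: "('k \<Rightarrow>\<^sub>0 complex) => complex"
 assumes I: "pm.subspace I" and C: "pm.subspace C" and IC: "I <= C"
 and C1: "1 : C" and CC: "!!x y. x : C ==> y : C ==> x * y : C"
 and CI: "!!x y. x : C ==> y : I ==> x * y : I" and IC': "!!x y. x : I ==> y : C ==> x * y : I"
 and e_add: "!!x y. \<epsilon> (x + y) = \<epsilon> x + \<epsilon> y" and e_mult: "!!x y. \<epsilon> (x * y) = \<epsilon> x * \<epsilon> y"
 and e_scalar: "!!c. \<epsilon> (scalar c) = c" and eI: "!!x. x : I ==> \<epsilon> x = 0"
 obtains \<rho> :: "('k \<Rightarrow>\<^sub>0 complex) => 'k lend" where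
 "!!x y. \<rho> (x + y) = \<rho> x + \<rho> y" "!!c x. \<rho> (scalar c * x) = c *. \<rho> x"
 "!!x y. x : C ==> y : C ==> \<rho> (x * y) = \<rho> x * \<rho> y" "\<rho> 1 = 1"
 "!!x. x : C ==> \<rho> x = 0 \<longleftrightarrow> x : I"
proof -
 obtain p :: "('k \<Rightarrow>\<^sub>0 complex) => ('k \<Rightarrow>\<^sub>0 complex)" where
 p: "!!x y. p (x + y) = p x + p y" "!!c x. p (scalar c * x) = scalar c * p x"
 "!!x. p x : C" "!!x. x : I ==> p x = 0" "!!x. x : C ==> x - p x : I" "!!x. p (p x) = p x"
 by (rule ex_projection[OF I C IC]) (rule that; assumption)
 define f where "f x z = p (x * p z) + scalar (\<epsilon> x) * (z - p z)" for x z
 have sc: "scalar (c * d) = scalar c * scalar d" "scalar (c + d) = scalar c + scalar d"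
 "scalar 1 = (1 :: 'k \<Rightarrow>\<^sub>0 complex)" "scalar 0 = (0 :: 'k \<Rightarrow>\<^sub>0 complex)" for c d
 by (simp_all add: scalar_def mult_single single_add)
 define \<rho> where "\<rho> x = Abs_lend (f x)" for x
 have f: "Rep_lend (\<rho> x) = f x" for x
 unfolding \<rho>_def
 proof (rule Abs_lend_inverse, safe)
 fix y z c
 show "f x (y + z) = f x y + f x z"
 by (simp add: f_def p algebra_simps)
 show "f x (scalar c * y) = scalar c * f x y"
 proof -
 have "p (x * p (scalar c * y)) = scalar c * p (x * p y)"
 by (simp only: p scalar_commute[of x])
 moreover have "scalar (\<epsilon> x) * (scalar c * y - p (scalar c * y)) = scalar c * (scalar (\<epsilon> x) * (y - p y))"
 by (simp only: p pm.scale_left_commute[of c "\<epsilon> x"] flip: pm.scale_right_diff_distrib)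
 ultimately show ?thesis unfolding f_def distrib_left by simp
 qed
 qed
 have eq: "a = b" if "Rep_lend a = Rep_lend b" for a b :: "'k lend"
 using that by (simp add: Rep_lend_inject)
 have p0: "p 0 = 0" using p(4) pm.subspace_0[OF I] by blast
 have pminus: "p (x - y) = p x - p y" for x y
 proof -
 have "p (x - y) + p y = p x" by (simp flip: p(1))
 thus ?thesis by (simp add: algebra_simps)
 qed
 show thesis
 proof (rule that[of \<rho>])
 fix x y
 show "\<rho> (x + y) = \<rho> x + \<rho> y"
 by (intro eq ext) (simp add: f plus_lend.rep_eq f_def p e_add sc algebra_simps del: pm.scale_scale)
 show "\<rho> (scalar c * x) = c *. \<rho> x" for c
 proof (intro eq ext)
 fix z
 have "scalar c * x * p z = scalar c * (x * p z)" by (simp add: mult.assoc)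
 thus "Rep_lend (\<rho> (scalar c * x)) z = Rep_lend (c *. \<rho> x) z"
 by (simp add: f scaleC_lend.rep_eq f_def p e_mult e_scalar sc distrib_left mult.assoc del: pm.scale_scale)
 qed
 show "\<rho> 1 = 1"
 proof (intro eq ext)
 have "\<epsilon> 1 = 1" using e_scalar[of 1] by (simp add: sc)
 thus "Rep_lend (\<rho> 1) z = Rep_lend 1 z" for z
 by (simp add: f one_lend.rep_eq f_def p sc)
 qed
 show "\<rho> (x * y) = \<rho> x * \<rho> y" if "x : C" "y : C"
 proof (intro eq ext)
 fix z
 have 1: "p (f y z) = p (y * p z)"
 by (simp add: f_def p pminus)
 have "y * p z - p (y * p z) : I" using p(3,5) that CC by blast
 hence "x * (y * p z - p (y * p z)) : I" using CI that by blast
 hence 2: "p (x * (y * p z)) = p (x * p (y * p z))"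
 using p(4)[of "x * (y * p z - p (y * p z))"] by (simp add: right_diff_distrib pminus)
 have "f x (f y z) = p (x * (y * p z)) + scalar (\<epsilon> x) * (scalar (\<epsilon> y) * (z - p z))"
 unfolding f_def[of x "f y z"] 1 2 by (simp add: f_def)
 thus "Rep_lend (\<rho> (x * y)) z = Rep_lend (\<rho> x * \<rho> y) z"
 by (simp add: f times_lend.rep_eq f_def[of "x * y"] e_mult sc mult.assoc del: pm.scale_scale)
 qed
 show "\<rho> x = 0 \<longleftrightarrow> x : I" if x: "x : C"
 proof
 assume "\<rho> x = 0"
 hence "f x (p 1) = 0" using f[of x] by (simp add: zero_lend.rep_eq fun_eq_iff)
 hence "p (x * p 1) = 0" by (simp add: f_def p)
 with p(5)[OF CC[OF x p(3)[of 1]]] have *: "x * p 1 : I" by simp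
 have "x * (1 - p 1) : I" using CI x p(5) C1 by blast
 with * have "x * p 1 + x * (1 - p 1) : I" using pm.subspace_add[OF I] by blast
 thus "x : I" by (simp add: algebra_simps)
 next
 assume "x : I"
 thus "\<rho> x = 0"
 by (intro eq ext) (simp add: f zero_lend.rep_eq f_def eI sc IC' p)
 qed
 qed
qed

definition lext :: "('k => 'r) => ('k::monoid_add \<Rightarrow>\<^sub>0 complex) => 'r::calg" where
 "lext \<chi> p = (\<Sum>k\<in>Poly_Mapping.keys p. Poly_Mapping.lookup p k *. \<chi> k)"

lemma lext_superset:
 assumes "finite X" "Poly_Mapping.keys p <= X"
 shows "lext \<chi> p = (\<Sum>k\<in>X. Poly_Mapping.lookup p k *. \<chi> k)"
 unfolding lext_def by (rule sum.mono_neutral_left) (use assms in \<open>auto simp: in_keys_iff\<close>)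

lemma lext_0 [simp]: "lext \<chi> 0 = 0"
 by (simp add: lext_def)

lemma lext_add: "lext \<chi> (p + r) = lext \<chi> p + lext \<chi> r"
proof -
 let ?X = "Poly_Mapping.keys p \<union> Poly_Mapping.keys r"
 have "lext \<chi> (p + r) = (\<Sum>k\<in>?X. Poly_Mapping.lookup (p + r) k *. \<chi> k)"
 using keys_add[of p r] by (intro lext_superset) auto
 also have "... = lext \<chi> p + lext \<chi> r"
 by (simp add: lext_superset[of ?X] lookup_add calg.scale_left_distrib sum.distrib)
 finally show ?thesis .
qed

lemma lext_single [simp]: "lext \<chi> (Poly_Mapping.single k c) = c *. \<chi> k"
 by (simp add: lext_def)

lemma lext_scalar_mult: "lext \<chi> (scalar c * p) = c *. lext \<chi> p"
proof -
 have "lext \<chi> (scalar c * p) = (\<Sum>k\<in>Poly_Mapping.keys p. Poly_Mapping.lookup (scalar c * p) k *. \<chi> k)"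
 by (rule lext_superset) (auto simp: in_keys_iff lookup_scalar_mult)
 thus ?thesis
 by (simp add: lookup_scalar_mult lext_def calg.scale_sum_right)
qed

lemma lext_uminus: "lext \<chi> (- p) = - lext \<chi> p"
 using lext_add[of \<chi> p "- p"] by (simp add: eq_neg_iff_add_eq_0 add.commute)

lemma lext_diff: "lext \<chi> (p - r) = lext \<chi> p - lext \<chi> r"
 using lext_add[of \<chi> p "- r"] by (simp add: lext_uminus)

lemma lext_mult:
 assumes "!!k l. \<chi> (k + l) = \<chi> k * \<chi> l"
 shows "lext \<chi> (p * r) = lext \<chi> p * lext \<chi> r"
proof (rule pm_induct[of p UNIV])
 fix k c p assume p: "lext \<chi> (p * r) = lext \<chi> p * lext \<chi> r"
 have "lext \<chi> (Poly_Mapping.single k c * r) = c *. (\<chi> k * lext \<chi> r)"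
 by (rule pm_induct[of r UNIV])
 (simp_all add: mult_single lext_add algebra_simps assms scr calg.scale_scale calg.scale_right_distrib)
 with p show "lext \<chi> ((Poly_Mapping.single k c + p) * r) = lext \<chi> (Poly_Mapping.single k c + p) * lext \<chi> r"
 by (simp add: algebra_simps lext_add scl)
qed simp_all

lemma lext_1: "\<chi> 0 = 1 ==> lext \<chi> 1 = 1"
 using lext_single[of \<chi> 0 1] by (simp add: sc1)

text \<open>A finite sum over a set cannot record a repeated pair. Since a pair may be rescaled without changing its value, two sums can be made disjoint before they are joined.\<close>
lemma psum_add:
 fixes f :: "'a::calg \<times> 'b::calg => 'v::ab_group_add"
 assumes B: "!!c b. b : B ==> c *. b : B" and C: "!!c u. u : C ==> c *. u : C"
 and f: "!!t b u. b : B ==> u : C ==> t ~= 0 ==> f (t *. b, inverse t *. u) = f (b, u)"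
 and f0: "!!u. u : C ==> f (0, u) = 0" "!!b. b : B ==> f (b, 0) = 0"
 and P: "finite P" "P <= B \<times> C" and Q: "finite Q" "Q <= B \<times> C"
 obtains R where "finite R" "R <= B \<times> C" "sum f R = sum f P + sum f Q"
proof -
 have "EX R. finite R & R <= B \<times> C & sum f R = sum f P + sum f Q"
 using Q
 proof (induction Q rule: finite_induct)
 case empty
 thus ?case using P by (intro exI[of _ P]) auto
 next
 case (insert z Q)
 then obtain R where R: "finite R" "R <= B \<times> C" "sum f R = sum f P + sum f Q" by auto
 obtain b u where z: "z = (b, u)" "b : B" "u : C" using insert by (cases z) auto
 show ?case
 proof (cases "b = 0 \<or> u = 0")
 case True
 hence "f z = 0" using f0 z by auto
 with R insert show ?thesis by (intro exI[of _ R]) auto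
 next
 case False
 let ?g = "%t. (t *. b, inverse t *. u)"
 have "inj_on ?g (UNIV - {0})"
 using False by (auto simp: inj_on_def)
 moreover have "infinite (UNIV - {0::complex})"
 by (simp add: infinite_UNIV_char_0)
 ultimately have "infinite (?g ` (UNIV - {0}))"
 using finite_imageD by blast
 hence "\<not> ?g ` (UNIV - {0}) <= R" using R(1) finite_subset by blast
 then obtain t where t: "t ~= 0" "?g t \<notin> R" by blast
 with R insert z B C f[of b u t] show ?thesis
 by (intro exI[of _ "insert (?g t) R"]) (auto simp: algebra_simps)
 qed
 qed
 thus thesis using that by blast
qed

inductive_set alg :: "'a::calg set => 'a set" for X where
 base: "x : X ==> x : alg X"
| one: "1 : alg X"
| add: "x : alg X ==> y : alg X ==> x + y : alg X"
| mult: "x : alg X ==> y : alg X ==> x * y : alg X"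
| scale: "x : alg X ==> c *. x : alg X"

lemma alg_zero: "0 : alg X"
 using alg.scale[OF alg.one, where c = 0] by simp

lemma alg_uminus: "x : alg X ==> - x : alg X"
 using alg.scale[where c = "-1"] by (simp add: calg.scale_minus_left)

lemma alg_diff: "x : alg X ==> y : alg X ==> x - y : alg X"
 using alg.add[of x X "- y"] by (simp add: alg_uminus)

lemma alg_sum: "(!!i. i : I ==> f i : alg X) ==> sum f I : alg X"
 by (induction I rule: infinite_finite_induct) (auto intro: alg.add alg_zero)

lemma alg_subspace: "calg.subspace (alg X)"
 by (auto simp: calg.subspace_def alg_zero intro: alg.intros)

lemma alg_mono: "X <= alg Y ==> alg X <= alg Y"
proof
 fix x assume X: "X <= alg Y" and "x : alg X"
 show "x : alg Y" using \<open>x : alg X\<close>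
 by (induction rule: alg.induct) (use X in \<open>auto intro: alg.intros\<close>)
qed

section \<open>The root form\<close>

lemma root_form_add_left: "root_form n (\<mu> + \<nu>) \<xi> = root_form n \<mu> \<xi> + root_form n \<nu> \<xi>"
 by (simp add: root_form_def algebra_simps sum.distrib)

lemma root_form_add_right: "root_form n \<xi> (\<mu> + \<nu>) = root_form n \<xi> \<mu> + root_form n \<xi> \<nu>"
 by (simp add: root_form_def algebra_simps sum.distrib)

lemma root_form_uminus_left: "root_form n (- \<mu>) \<xi> = - root_form n \<mu> \<xi>"
 by (simp add: root_form_def sum_negf)

lemma root_form_uminus_right: "root_form n \<xi> (- \<mu>) = - root_form n \<xi> \<mu>"
 by (simp add: root_form_def sum_negf)

lemma root_form_zero [simp]: "root_form n 0 \<xi> = 0" "root_form n \<xi> 0 = 0"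
 by (simp_all add: root_form_def)

lemma root_form_diff_left: "root_form n (\<mu> - \<nu>) \<xi> = root_form n \<mu> \<xi> - root_form n \<nu> \<xi>"
 by (simp add: root_form_def algebra_simps sum_subtractf)

lemma root_form_diff_right: "root_form n \<xi> (\<mu> - \<nu>) = root_form n \<xi> \<mu> - root_form n \<xi> \<nu>"
 by (simp add: root_form_def algebra_simps sum_subtractf)

lemma root_form_scale_left: "root_form n (%b. c * \<mu> b) \<xi> = c * root_form n \<mu> \<xi>"
 by (simp add: root_form_def sum_distrib_left mult.assoc)

lemma cartan_sym: "cartan a b = cartan b a"
 by (auto simp: cartan_def)

lemma root_form_sym: "root_form n \<mu> \<nu> = root_form n \<nu> \<mu>"
 unfolding root_form_def by (subst sum.swap) (simp add: cartan_sym mult.commute mult.left_commute)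

lemma root_form_simple_left:
 assumes "a : {1..n}"
 shows "root_form n (simple_root a) \<mu> = (\<Sum>b\<in>{1..n}. \<mu> b * cartan a b)"
proof -
 have "root_form n (simple_root a) \<mu> = (\<Sum>c\<in>{1..n}. if c = a then \<Sum>b\<in>{1..n}. \<mu> b * cartan a b else 0)"
 unfolding root_form_def by (intro sum.cong) (auto simp: simple_root_def)
 thus ?thesis using assms by simp
qed

lemma root_form_simple:
 assumes "a : {1..n}" "b : {1..n}"
 shows "root_form n (simple_root a) (simple_root b) = cartan a b"
proof -
 have "root_form n (simple_root a) (simple_root b) = (\<Sum>c\<in>{1..n}. if c = b then cartan a b else 0)"
 unfolding root_form_simple_left[OF assms(1)] by (intro sum.cong) (auto simp: simple_root_def)
 thus ?thesis using assms by simp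
qed

lemma root_form_expand_left:
 "root_form n \<nu> \<mu> = (\<Sum>a\<in>{1..n}. \<nu> a * root_form n (simple_root a) \<mu>)"
proof -
 have "(\<Sum>a\<in>{1..n}. \<nu> a * root_form n (simple_root a) \<mu>) = (\<Sum>a\<in>{1..n}. \<nu> a * (\<Sum>b\<in>{1..n}. \<mu> b * cartan a b))"
 by (intro sum.cong refl) (simp add: root_form_simple_left)
 thus ?thesis by (simp add: root_form_def sum_distrib_left mult.assoc)
qed

lemma reflection_simple:
 assumes "a : {1..n}" "b : {1..n}"
 shows "reflection n a (simple_root b) = simple_root b - (%c. cartan b a * simple_root a c)"
 using assms by (auto simp: reflection_def root_form_simple fun_eq_iff)

lemma reflection_alt: "reflection n a \<mu> = \<mu> - (%b. root_form n \<mu> (simple_root a) * simple_root a b)"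
 by (simp add: reflection_def fun_eq_iff)

lemma reflection_form:
 assumes "a : {1..n}"
 shows "root_form n (reflection n a \<mu>) (reflection n a \<nu>) = root_form n \<mu> \<nu>"
proof -
 have 1: "root_form n \<xi> (%b. c * simple_root a b) = c * root_form n \<xi> (simple_root a)" for \<xi> c
 by (metis root_form_sym root_form_scale_left)
 have 2: "root_form n (simple_root a) (simple_root a) = 2"
 using assms by (simp add: root_form_simple cartan_def)
 have "root_form n (simple_root a) \<nu> = root_form n \<nu> (simple_root a)" by (rule root_form_sym)
 thus ?thesis
 by (simp add: reflection_alt root_form_diff_left root_form_diff_right 1 root_form_scale_left 2)
qed

lemma reflection_reflection:
 assumes "a : {1..n}"
 shows "reflection n a (reflection n a \<mu>) = \<mu>"
proof -
 have "root_form n (reflection n a \<mu>) (simple_root a) = - root_form n \<mu> (simple_root a)"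
 using assms by (simp add: reflection_alt root_form_diff_left root_form_scale_left root_form_simple cartan_def)
 thus ?thesis by (simp add: reflection_def fun_eq_iff)
qed

lemma reflection_uminus: "reflection n a (- \<mu>) = - reflection n a \<mu>"
 by (simp add: reflection_def fun_eq_iff root_form_uminus_left)

section \<open>Twisted commutation\<close>

text \<open>Elements that commute up to a scalar. The torus acts in this way on weight vectors.\<close>
definition tw :: "'a::calg => complex => 'a => bool" where
 "tw u c x \<longleftrightarrow> u * x = c *. (x * u)"

lemma tw_1_left [simp]: "tw 1 1 x" by (simp add: tw_def)
lemma tw_1_right [simp]: "tw u 1 1" by (simp add: tw_def)

lemma tw_mult_left:
 assumes "tw u c x" "tw v d x"
 shows "tw (u * v) (c * d) x"
proof -
 have "u * v * x = d *. ((u * x) * v)"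
 using assms(2) by (simp add: tw_def mult.assoc scr)
 also have "u * x = c *. (x * u)" using assms(1) by (simp add: tw_def)
 finally show ?thesis
 by (simp add: tw_def scl mult.assoc mult.commute)
qed

lemma tw_mult_right: "tw u c x ==> tw u d y ==> tw u (c * d) (x * y)"
 unfolding tw_def
 by (simp add: scr scl flip: mult.assoc)
 (simp add: mult.assoc scr scl)

lemma tw_add_right: "tw u c x ==> tw u c y ==> tw u c (x + y)"
 by (simp add: tw_def algebra_simps sc_add_r)

lemma tw_diff_right: "tw u c x ==> tw u c y ==> tw u c (x - y)"
 by (simp add: tw_def algebra_simps calg.scale_right_diff_distrib)

lemma tw_scale_right: "tw u c x ==> tw u c (d *. x)"
 by (simp add: tw_def scr scl mult.commute)

lemma tw_uminus_right: "tw u c x ==> tw u c (- x)"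
 by (simp add: tw_def)

lemma tw_add_left: "tw u c x ==> tw v c x ==> tw (u + v) c x"
 by (simp add: tw_def algebra_simps sc_add_r)

lemma tw_diff_left: "tw u c x ==> tw v c x ==> tw (u - v) c x"
 by (simp add: tw_def algebra_simps calg.scale_right_diff_distrib)

lemma tw_scale_left: "tw u c x ==> tw (d *. u) c x"
 by (simp add: tw_def scr scl mult.commute)

lemma tw_flip: "tw u c x ==> c ~= 0 ==> tw x (inverse c) u"
 by (simp add: tw_def)

lemma tw_inverse_left:
 assumes "tw u c x" "c ~= 0" "u * v = 1" "v * u = 1"
 shows "tw v (inverse c) x"
proof -
 have "v * x = v * (x * u) * v" using assms(3) by (simp add: mult.assoc)
 also have "x * u = inverse c *. (u * x)" using assms(1,2) by (simp add: tw_def)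
 also have "v * (inverse c *. (u * x)) * v = inverse c *. ((v * u) * x * v)"
 by (simp add: scr scl mult.assoc)
 finally show ?thesis using assms(4) by (simp add: tw_def)
qed

lemma tw_power_left: "tw u c x ==> tw (u ^ k) (c ^ k) x"
 by (induction k) (auto intro: tw_mult_left)

lemma twD: "tw u c x ==> u * x = c *. (x * u)"
 by (simp add: tw_def)

lemma twD3: "tw u c x ==> u * (x * z) = c *. (x * (u * z))"
 by (simp add: tw_def scl flip: mult.assoc)

definition ipow :: "'a::calg => 'a => int => 'a" where
 "ipow u v z = u ^ nat z * v ^ nat (- z)"

lemma ipow_simps [simp]: "ipow u v 0 = 1" "ipow u v 1 = u" "ipow u v (- 1) = v"
 by (simp_all add: ipow_def)

lemma ipow_tw:
 assumes "tw u c x" "c ~= 0" "u * v = 1" "v * u = 1"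
 shows "tw (ipow u v z) (c powi z) x"
proof -
 have "tw (ipow u v z) (c ^ nat z * inverse c ^ nat (- z)) x"
 unfolding ipow_def by (intro tw_mult_left tw_power_left tw_inverse_left[OF assms] assms)
 also have "c ^ nat z * inverse c ^ nat (- z) = c powi z"
 by (simp add: power_int_def)
 finally show ?thesis .
qed

lemma ipow_suc:
 assumes "u * v = 1" "v * u = 1"
 shows "ipow u v (z + 1) = ipow u v z * u"
proof (cases "z \<ge> 0")
 case True
 hence "nat (z + 1) = Suc (nat z)" "nat (- z) = 0" "nat (- (z + 1)) = 0" by auto
 thus ?thesis by (simp add: ipow_def power_commutes)
next
 case False
 hence "nat (- z) = Suc (nat (- (z + 1)))" "nat z = 0" "nat (z + 1) = 0" by auto
 thus ?thesis using assms by (simp add: ipow_def mult.assoc power_Suc2 del: power_Suc)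
qed

lemma ipow_add:
 assumes "u * v = 1" "v * u = 1"
 shows "ipow u v (y + z) = ipow u v y * ipow u v z"
proof (induction z rule: int_induct[of _ 0])
 case (step1 z)
 thus ?case using ipow_suc[OF assms, of "y + z"] ipow_suc[OF assms, of z]
 by (simp add: add.assoc mult.assoc)
next
 case (step2 z)
 have a: "ipow u v (w - 1) = ipow u v w * v" for w
 using ipow_suc[OF assms, of "w - 1"] assms by (simp add: mult.assoc)
 have "y + (z - 1) = (y + z) - 1" by simp
 thus ?case using step2 by (simp only: a mult.assoc)
qed simp

lemma prod_list_tw:
 assumes "!!a. a : set xs ==> tw (g a) (c a) x"
 shows "tw (prod_list (map g xs)) (prod_list (map c xs)) x"
 using assms by (induction xs) (auto intro: tw_mult_left)

lemma prod_list_mult_commuting: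
 fixes g h :: "'b => 'a::calg"
 assumes "!!a b. a : set xs ==> b : set xs ==> g a * h b = h b * g a"
 shows "prod_list (map (%a. g a * h a) xs) = prod_list (map g xs) * prod_list (map h xs)"
 using assms
proof (induction xs)
 case (Cons a xs)
 have "tw (prod_list (map g xs)) (prod_list (map (%_. 1) xs)) (h a)"
 by (rule prod_list_tw) (use Cons(2) in \<open>auto simp: tw_def\<close>)
 hence "prod_list (map g xs) * h a = h a * prod_list (map g xs)"
 by (simp add: tw_def map_replicate_const)
 hence "prod_list (map g xs) * (h a * z) = h a * (prod_list (map g xs) * z)" for z
 by (metis mult.assoc)
 moreover have "prod_list (map (%a. g a * h a) xs) = prod_list (map g xs) * prod_list (map h xs)"
 using Cons by simp
 ultimately show ?case by (simp only: list.map prod_list.Cons mult.assoc)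
qed simp

lemma power_int_sum: "(x::complex) ~= 0 ==> x powi (\<Sum>a\<in>A. h a) = (\<Prod>a\<in>A. x powi h a)"
 by (induction A rule: infinite_finite_induct) (simp_all add: power_int_add)

lemma prod_list_concat_map:
 "prod_list (map f (concat (map g xs))) = prod_list (map (%a. prod_list (map f (g a))) xs)"
 for f :: "'b => 'a::calg"
 by (induction xs) simp_all

lemma prod_list_replicate_calg: "prod_list (replicate k u) = (u :: 'a::calg) ^ k"
 by (induction k) simp_all

definition kword :: "nat => (letter => 'r::calg) => (nat => int) => 'r" where
 "kword n f \<mu> = prod_list (map f (Kword n \<mu>))"

lemma kword_ipow: "kword n f \<mu> = prod_list (map (%a. ipow (f (LK a)) (f (LKinv a)) (\<mu> a)) [1..<Suc n])"
 unfolding kword_def Kword_def prod_list_concat_map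
 by (simp add: ipow_def prod_list_replicate_calg)

locale torus =
 fixes n :: nat and f :: "letter => 'r::calg"
 assumes KL: "a : {1..n} ==> f (LK a) * f (LKinv a) = 1"
 and LK: "a : {1..n} ==> f (LKinv a) * f (LK a) = 1"
 and KK: "a : {1..n} ==> b : {1..n} ==> f (LK a) * f (LK b) = f (LK b) * f (LK a)"
begin

abbreviation "Kf \<equiv> kword n f"

lemma Kf_tw:
 assumes "!!a. a : {1..n} ==> tw (f (LK a)) (c a) x" "!!a. a : {1..n} ==> c a ~= 0"
 shows "tw (Kf \<mu>) (\<Prod>a\<in>{1..n}. c a powi \<mu> a) x"
proof -
 have "tw (Kf \<mu>) (prod_list (map (%a. c a powi \<mu> a) [1..<Suc n])) x"
 unfolding kword_ipow
 by (intro prod_list_tw ipow_tw assms KL LK) auto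
 also have "prod_list (map (%a. c a powi \<mu> a) [1..<Suc n]) = (\<Prod>a\<in>{1..n}. c a powi \<mu> a)"
 by (subst prod.distinct_set_conv_list[symmetric]) (auto intro: prod.cong)
 finally show ?thesis .
qed

lemma ipow_comm: 
 assumes "a : {1..n}" "b : {1..n}"
 shows "ipow (f (LK a)) (f (LKinv a)) y * ipow (f (LK b)) (f (LKinv b)) z =
 ipow (f (LK b)) (f (LKinv b)) z * ipow (f (LK a)) (f (LKinv a)) y"
proof -
 have "tw (f (LK a)) 1 (f (LK b))" using KK assms by (simp add: tw_def)
 from ipow_tw[OF this _ KL LK, of y] assms have "tw (ipow (f (LK a)) (f (LKinv a)) y) 1 (f (LK b))"
 by simp
 from tw_flip[OF this] have "tw (f (LK b)) 1 (ipow (f (LK a)) (f (LKinv a)) y)" by simp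
 from ipow_tw[OF this _ KL LK, of z] assms show ?thesis by (simp add: tw_def)
qed

lemma Kf_add: "Kf (\<mu> + \<nu>) = Kf \<mu> * Kf \<nu>"
proof -
 let ?i = "%a. ipow (f (LK a)) (f (LKinv a))"
 have "Kf (\<mu> + \<nu>) = prod_list (map (%a. ?i a (\<mu> a) * ?i a (\<nu> a)) [1..<Suc n])"
 unfolding kword_ipow by (intro arg_cong[where f = prod_list] map_cong) (auto simp: ipow_add KL LK)
 also have "... = prod_list (map (%a. ?i a (\<mu> a)) [1..<Suc n]) * prod_list (map (%a. ?i a (\<nu> a)) [1..<Suc n])"
 by (rule prod_list_mult_commuting) (auto intro: ipow_comm)
 finally show ?thesis by (simp only: kword_ipow)
qed

lemma Kf_0 [simp]: "Kf 0 = 1" "Kf (%b. 0) = 1"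
proof -
 have "prod_list (map (%_. 1) xs) = (1 :: 'r)" for xs :: "nat list"
 by (induction xs) simp_all
 thus "Kf (%b. 0) = 1" by (simp only: kword_ipow ipow_simps)
 thus "Kf 0 = 1" by (simp add: zero_fun_def)
qed

lemma Kf_comm: "Kf \<mu> * Kf \<nu> = Kf \<nu> * Kf \<mu>"
 by (metis Kf_add add.commute)

lemma Kf_inverse [simp]: "Kf \<mu> * Kf (- \<mu>) = 1" "Kf (- \<mu>) * Kf \<mu> = 1"
 by (simp_all flip: Kf_add)

lemma Kf_single:
 assumes "a : {1..n}"
 shows "Kf (%b. if b = a then z else 0) = ipow (f (LK a)) (f (LKinv a)) z"
proof -
 have *: "prod_list (map (%b. ipow (f (LK b)) (f (LKinv b)) (if b = a then z else 0)) xs) =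
 (if a : set xs then ipow (f (LK a)) (f (LKinv a)) z else 1)" if "distinct xs" for xs
 using that by (induction xs) auto
 show ?thesis unfolding kword_ipow using assms by (subst *) auto
qed

lemma Kf_simple: assumes "a : {1..n}" shows "Kf (simple_root a) = f (LK a)" "Kf (- simple_root a) = f (LKinv a)"
proof -
 show "Kf (simple_root a) = f (LK a)" unfolding simple_root_def by (simp add: Kf_single[OF assms])
 have "- simple_root a = (%b. if b = a then - 1 else 0)" by (auto simp: simple_root_def)
 thus "Kf (- simple_root a) = f (LKinv a)" by (simp add: Kf_single[OF assms])
qed

lemma kword_subst:
 assumes g: "!!b. b : {1..n} ==> g (LK b) = Kf (\<sigma> b)" "!!b. b : {1..n} ==> g (LKinv b) = Kf (- \<sigma> b)"
 shows "kword n g \<mu> = Kf (%c. \<Sum>b\<in>{1..n}. \<mu> b * \<sigma> b c)"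
proof -
 have p: "Kf (%c. int k * \<tau> c) = Kf \<tau> ^ k" for k \<tau>
 proof (induction k)
 case (Suc k)
 have "(%c. int (Suc k) * \<tau> c) = \<tau> + (%c. int k * \<tau> c)" by (simp add: fun_eq_iff algebra_simps)
 thus ?case using Suc by (simp add: Kf_add)
 qed simp
 have i: "ipow (Kf \<tau>) (Kf (- \<tau>)) z = Kf (%c. z * \<tau> c)" for \<tau> z
 proof (cases "z \<ge> 0")
 case True
 thus ?thesis using p[of "nat z" \<tau>] by (simp add: ipow_def)
 next
 case False
 thus ?thesis using p[of "nat (- z)" "- \<tau>"] by (simp add: ipow_def)
 qed
 have *: "prod_list (map (%a. ipow (g (LK a)) (g (LKinv a)) (\<mu> a)) xs) = Kf (%c. \<Sum>b\<in>set xs. \<mu> b * \<sigma> b c)"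
 if "distinct xs" "set xs <= {1..n}" for xs
 using that
 proof (induction xs)
 case (Cons a xs)
 have "(%c. \<Sum>b\<in>set (a # xs). \<mu> b * \<sigma> b c) = (%c. \<mu> a * \<sigma> a c) + (%c. \<Sum>b\<in>set xs. \<mu> b * \<sigma> b c)"
 using Cons by (auto simp: fun_eq_iff)
 with Cons show ?case by (simp add: Kf_add g i)
 qed (simp)
 have "set [1..<Suc n] = {1..n}" by auto
 with *[of "[1..<Suc n]"] show ?thesis unfolding kword_ipow[of n g] by simp
qed

end

section \<open>Families satisfying the defining relations\<close>

definition qserre :: "complex => 'a::calg => 'a => bool" where
 "qserre q x y \<longleftrightarrow> x * x * y - (q + inverse q) *. (x * y * x) + y * x * x = 0"

definition qc :: "complex => 'a::calg => 'a => 'a" where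
 "qc c x y = x * y - c *. (y * x)"

lemmas csimps = scl scr sc_add_r sc_add_l
 calg.scale_right_diff_distrib calg.scale_left_diff_distrib

text \<open>The same shape of relations governs the generators of the quantum group, their images under the Lusztig automorphisms and under psi, and their coproducts. The restrictions on \<open>q\<close> are those that the rank two computations need.\<close>
locale qgroup = torus n f for n :: nat and f :: "letter => 'r::calg" +
 fixes q :: complex
 assumes q0: "q ~= 0" and q2: "q\<^sup>2 ~= 1" and q4: "q\<^sup>2 ~= - 1"
 and KE: "a : {1..n} ==> b : {1..n} ==> tw (f (LK a)) (q powi cartan a b) (f (LE b))"
 and KF: "a : {1..n} ==> b : {1..n} ==> tw (f (LK a)) (q powi (- cartan a b)) (f (LF b))"
 and EF: "a : {1..n} ==> b : {1..n} ==> f (LE a) * f (LF b) - f (LF b) * f (LE a) =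
 (if a = b then (1 / (q - inverse q)) *. (f (LK a) - f (LKinv a)) else 0)"
 and EE: "a : {1..n} ==> b : {1..n} ==> cartan a b = 0 ==> f (LE a) * f (LE b) = f (LE b) * f (LE a)"
 and FF: "a : {1..n} ==> b : {1..n} ==> cartan a b = 0 ==> f (LF a) * f (LF b) = f (LF b) * f (LF a)"
 and serreE: "a : {1..n} ==> b : {1..n} ==> cartan a b = -1 ==> qserre q (f (LE a)) (f (LE b))"
 and serreF: "a : {1..n} ==> b : {1..n} ==> cartan a b = -1 ==> qserre q (f (LF a)) (f (LF b))"

lemma qserre_scale:
 assumes "qserre q x y" shows "qserre q (c *. x) (d *. y)"
proof -
 have "c *. x * c *. x * d *. y - (q + inverse q) *. (c *. x * d *. y * c *. x) + d *. y * c *. x * c *. x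
 = (c * c * d) *. (x * x * y - (q + inverse q) *. (x * y * x) + y * x * x)"
 by (simp add: scl scr sc_add_r calg.scale_right_diff_distrib ac_simps)
 thus ?thesis using assms by (simp add: qserre_def)
qed

lemma qserre_inverse: "qserre (inverse q) x y = qserre q x y"
 by (simp add: qserre_def add.commute)

lemma qserre_qc: "qserre q x y \<longleftrightarrow> x * qc (inverse q) x y = q *. (qc (inverse q) x y * x)" if "q ~= 0"
 using that by (auto simp: qserre_def qc_def algebra_simps csimps)

lemma qserre_qc': "qserre q x y \<longleftrightarrow> qc (inverse q) y x * x = q *. (x * qc (inverse q) y x)" if "q ~= 0"
 using that by (auto simp: qserre_def qc_def algebra_simps csimps)

lemma ipow_swap: "ipow v u z = ipow u v (- z)"
 by (cases "z \<ge> 0") (simp_all add: ipow_def)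

definition swapK :: "letter => letter" where
 "swapK x = (case x of LE a => LE a | LF a => LF a | LK a => LKinv a | LKinv a => LK a)"

definition swapEF :: "letter => letter" where
 "swapEF x = (case x of LE a => LF a | LF a => LE a | LK a => LKinv a | LKinv a => LK a)"

lemma swapK_simps [simp]: "swapK (LE a) = LE a" "swapK (LF a) = LF a" "swapK (LK a) = LKinv a" "swapK (LKinv a) = LK a"
 by (simp_all add: swapK_def)

lemma swapEF_simps [simp]: "swapEF (LE a) = LF a" "swapEF (LF a) = LE a" "swapEF (LK a) = LKinv a" "swapEF (LKinv a) = LK a"
 by (simp_all add: swapEF_def)

definition rescale :: "(nat => complex) => (letter => 'r::calg) => letter => 'r" where
 "rescale c f x = (case x of LE a => c a *. f x | LF a => inverse (c a) *. f x | _ => f x)"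

lemma rescale_simps [simp]: "rescale c f (LE a) = c a *. f (LE a)" "rescale c f (LF a) = inverse (c a) *. f (LF a)"
 "rescale c f (LK a) = f (LK a)" "rescale c f (LKinv a) = f (LKinv a)"
 by (simp_all add: rescale_def)

context torus begin

lemma inv_comm: 
 assumes "a : {1..n}" "b : {1..n}"
 shows "f (LKinv a) * f (LKinv b) = f (LKinv b) * f (LKinv a)"
 "f (LKinv a) * f (LK b) = f (LK b) * f (LKinv a)"
 using ipow_comm[OF assms, of "-1" "-1"] ipow_comm[OF assms, of "-1" 1] by simp_all

lemma torus_swapK: "torus n (f \<circ> swapK)"
 by unfold_locales (simp_all add: KL LK inv_comm)

lemma torus_swapEF: "torus n (f \<circ> swapEF)"
 by unfold_locales (simp_all add: KL LK inv_comm)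

lemma kword_swap: "kword n (f \<circ> swapK) \<mu> = Kf (- \<mu>)" "kword n (f \<circ> swapEF) \<mu> = Kf (- \<mu>)"
 by (simp_all add: kword_ipow ipow_swap[of "f (LKinv _)"])

end

lemma q_nonzero_diff: "(q::complex) ~= 0 ==> q\<^sup>2 ~= 1 ==> q - inverse q ~= 0"
 by (auto simp: field_simps power2_eq_square)

context qgroup begin

lemma LE_tw: "a : {1..n} ==> b : {1..n} ==> tw (f (LKinv a)) (q powi (- cartan a b)) (f (LE b))"
 using tw_inverse_left[OF KE[of a b] _ KL LK] q0 by (simp add: power_int_minus)

lemma LF_tw: "a : {1..n} ==> b : {1..n} ==> tw (f (LKinv a)) (q powi cartan a b) (f (LF b))"
 using tw_inverse_left[OF KF[of a b] _ KL LK] q0 by (simp add: power_int_minus)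

lemma qgroup_swapK: "qgroup n (f \<circ> swapK) (inverse q)"
proof -
 interpret t: torus n "f \<circ> swapK" by (rule torus_swapK)
 have p: "inverse q powi z = q powi (- z)" for z by (simp add: power_int_minus power_int_inverse)
 have d: "1 / (inverse q - q) = - (1 / (q - inverse q))"
 by (simp add: minus_divide_right)
 show ?thesis
 proof
 show "(inverse q)\<^sup>2 ~= 1" "(inverse q)\<^sup>2 ~= - 1" using q0 q2 q4
 by (simp_all add: power_inverse flip: power2_eq_square) (metis inverse_inverse_eq inverse_minus_eq inverse_1)+
 qed (use q0 EF in \<open>auto simp: p LE_tw LF_tw serreE serreF qserre_inverse d csimps intro: EE FF\<close>)
qed

lemma qgroup_swapEF: "qgroup n (f \<circ> swapEF) q"
proof -
 interpret t: torus n "f \<circ> swapEF" by (rule torus_swapEF)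
 show ?thesis
 proof
 fix a b assume "a : {1..n}" "b : {1..n}"
 with EF[of b a] show "(f \<circ> swapEF) (LE a) * (f \<circ> swapEF) (LF b) - (f \<circ> swapEF) (LF b) * (f \<circ> swapEF) (LE a) =
 (if a = b then (1 / (q - inverse q)) *. ((f \<circ> swapEF) (LK a) - (f \<circ> swapEF) (LKinv a)) else 0)"
 by (auto simp: csimps algebra_simps split: if_splits)
 qed (use q0 q2 q4 in \<open>auto simp: LE_tw LF_tw serreE serreF intro: EE FF\<close>)
qed

lemma qgroup_rescale:
 assumes "!!a. a : {1..n} ==> c a ~= 0"
 shows "qgroup n (rescale c f) q"
proof -
 interpret t: torus n "rescale c f" by unfold_locales (simp_all add: KL LK KK)
 show ?thesis
 proof
 fix a b assume ab: "a : {1..n}" "b : {1..n}"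
 have "rescale c f (LE a) * rescale c f (LF b) - rescale c f (LF b) * rescale c f (LE a) =
 (c a * inverse (c b)) *. (f (LE a) * f (LF b) - f (LF b) * f (LE a))"
 by (simp add: csimps mult.commute)
 also have "... = (if a = b then (1 / (q - inverse q)) *. (rescale c f (LK a) - rescale c f (LKinv a)) else 0)"
 using assms[OF ab(1)] EF[OF ab] by (cases "a = b") (simp_all add: right_inverse del: right_minus_eq)
 finally show "rescale c f (LE a) * rescale c f (LF b) - rescale c f (LF b) * rescale c f (LE a) =
 (if a = b then (1 / (q - inverse q)) *. (rescale c f (LK a) - rescale c f (LKinv a)) else 0)" .
 show "rescale c f (LE a) * rescale c f (LE b) = rescale c f (LE b) * rescale c f (LE a)" if "cartan a b = 0"
 using EE[OF ab that] by (simp add: scl scr mult.commute)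
 show "rescale c f (LF a) * rescale c f (LF b) = rescale c f (LF b) * rescale c f (LF a)" if "cartan a b = 0"
 using FF[OF ab that] by (simp add: scl scr mult.commute)
 qed (use q0 q2 q4 in \<open>auto simp: KE KF serreE serreF tw_scale_right qserre_scale\<close>)
qed

definition wt :: "'r => (nat => int) => bool" where
 "wt x \<mu> \<longleftrightarrow> (ALL a:{1..n}. tw (f (LK a)) (q powi root_form n (simple_root a) \<mu>) x)"

lemma Kf_wt: "wt x \<mu> ==> tw (Kf \<nu>) (q powi root_form n \<nu> \<mu>) x"
proof -
 assume x: "wt x \<mu>"
 have "tw (Kf \<nu>) (\<Prod>a\<in>{1..n}. (q powi root_form n (simple_root a) \<mu>) powi \<nu> a) x"
 by (rule Kf_tw) (use x q0 in \<open>auto simp: wt_def\<close>)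
 also have "(\<Prod>a\<in>{1..n}. (q powi root_form n (simple_root a) \<mu>) powi \<nu> a) = q powi root_form n \<nu> \<mu>"
 unfolding root_form_expand_left[of n \<nu> \<mu>] using q0
 by (simp add: power_int_sum flip: power_int_mult) (simp add: mult.commute)
 finally show ?thesis .
qed

lemma wt_E: "b : {1..n} ==> wt (f (LE b)) (simple_root b)"
 by (simp add: wt_def root_form_simple KE)

lemma wt_F: "b : {1..n} ==> wt (f (LF b)) (- simple_root b)"
 by (simp add: wt_def root_form_simple root_form_uminus_right KF)

lemma wt_K: "wt (Kf \<mu>) 0"
 using Kf_comm by (auto simp: wt_def tw_def simp flip: Kf_simple)

lemma wt_mult: "wt x \<mu> ==> wt y \<nu> ==> wt (x * y) (\<mu> + \<nu>)"
 using q0 by (auto simp: wt_def root_form_add_right power_int_add intro!: tw_mult_right)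

lemma wt_diff: "wt x \<mu> ==> wt y \<mu> ==> wt (x - y) \<mu>"
 by (auto simp: wt_def intro: tw_diff_right)

lemma wt_uminus: "wt x \<mu> ==> wt (- x) \<mu>"
 by (auto simp: wt_def intro: tw_uminus_right)

lemma wt_scale: "wt x \<mu> ==> wt (c *. x) \<mu>"
 by (auto simp: wt_def intro: tw_scale_right)

lemma wt_1: "wt 1 0"
 using wt_K[of 0] by simp

lemma wt_qc: "wt x \<mu> ==> wt y \<nu> ==> wt (qc c x y) (\<mu> + \<nu>)"
 unfolding qc_def using wt_mult[of y \<nu> x \<mu>] by (auto intro!: wt_diff wt_scale wt_mult simp: add.commute)

lemma qgroup_wtI:
 fixes g :: "letter => 'r"
 assumes K: "!!b. b : {1..n} ==> g (LK b) = Kf (\<sigma> b)" "!!b. b : {1..n} ==> g (LKinv b) = Kf (- \<sigma> b)"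
 and iso: "!!a b. a : {1..n} ==> b : {1..n} ==> root_form n (\<sigma> a) (\<sigma> b) = cartan a b"
 and E: "!!b. b : {1..n} ==> wt (g (LE b)) (\<sigma> b)" and F: "!!b. b : {1..n} ==> wt (g (LF b)) (- \<sigma> b)"
 and EF': "!!a b. a : {1..n} ==> b : {1..n} ==> g (LE a) * g (LF b) - g (LF b) * g (LE a) =
 (if a = b then (1 / (q - inverse q)) *. (g (LK a) - g (LKinv a)) else 0)"
 and EE': "!!a b. a : {1..n} ==> b : {1..n} ==> cartan a b = 0 ==> g (LE a) * g (LE b) = g (LE b) * g (LE a)"
 and FF': "!!a b. a : {1..n} ==> b : {1..n} ==> cartan a b = 0 ==> g (LF a) * g (LF b) = g (LF b) * g (LF a)"
 and serreE': "!!a b. a : {1..n} ==> b : {1..n} ==> cartan a b = -1 ==> qserre q (g (LE a)) (g (LE b))"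
 and serreF': "!!a b. a : {1..n} ==> b : {1..n} ==> cartan a b = -1 ==> qserre q (g (LF a)) (g (LF b))"
 shows "qgroup n g q"
proof unfold_locales
 fix a b assume "a : {1..n}" "b : {1..n}"
 thus "tw (g (LK a)) (q powi cartan a b) (g (LE b))" "tw (g (LK a)) (q powi (- cartan a b)) (g (LF b))"
 using Kf_wt[OF E, of b "\<sigma> a"] Kf_wt[OF F, of b "\<sigma> a"] iso by (simp_all add: K root_form_uminus_right)
qed (use K Kf_comm q0 q2 q4 EF' serreE' serreF' in \<open>auto intro: EE' FF'\<close>)

end

lemma qserre_middle:
 fixes A B C :: "'a::calg"
 assumes q: "q ~= 0" "q\<^sup>2 ~= - 1" and AC: "A * C = C * A" and BA: "qserre q B A" and BC: "qserre q B C"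
 shows "qc (inverse q) (qc (inverse q) A B) C = qc (inverse q) A (qc (inverse q) B C)" (is ?th1)
 and "B * qc (inverse q) A (qc (inverse q) B C) = qc (inverse q) A (qc (inverse q) B C) * B" (is ?th2)
proof -
 define p where "p = inverse q"
 have pq: "p * q = 1" "q * p = 1" using q by (simp_all add: p_def)
 define y where "y = qc p A B"
 define x where "x = qc p B C"
 define z where "z = qc p A x"
 have CA: "C * (A * t) = A * (C * t)" for t using AC by (metis mult.assoc)
 have z': "z = qc p y C"
 by (simp add: z_def x_def y_def qc_def algebra_simps csimps AC CA)
 thus ?th1 by (simp add: z_def x_def y_def p_def)
 have By: "B * y = p *. (y * B)"
 using BA q by (simp add: qserre_qc' y_def p_def)
 have Bx: "B * x = q *. (x * B)"
 using BC q by (simp add: qserre_qc x_def p_def)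
 have BC': "B * C = x + p *. (C * B)" by (simp add: x_def qc_def)
 have BA': "B * A = q *. (A * B) - q *. y" using pq by (simp add: y_def qc_def csimps)
 have "B * z = (B * y) * C - p *. ((B * C) * y)"
 by (simp add: z' qc_def algebra_simps csimps)
 also have "... = p *. (y * (B * C)) - p *. ((B * C) * y)"
 by (simp add: By mult.assoc csimps)
 also have "... = p *. (y * x - x * y) + (p * p) *. (y * C * B) - (p * p) *. (C * (B * y))"
 by (simp add: BC' algebra_simps csimps)
 also have "... = p *. (y * x - x * y) + (p * p) *. (z * B)"
 by (simp add: By z' qc_def algebra_simps csimps)
 finally have 1: "B * z = p *. (y * x - x * y) + (p * p) *. (z * B)" .
 have "B * z = (B * A) * x - p *. ((B * x) * A)"
 by (simp add: z_def qc_def algebra_simps csimps)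
 also have "... = (B * A) * x - x * (B * A)"
 using pq by (simp add: Bx mult.assoc csimps)
 also have "... = q *. (A * (B * x)) - q *. (x * A * B) - q *. (y * x - x * y)"
 by (simp add: BA' algebra_simps csimps)
 also have "... = (q * q) *. (z * B) - q *. (y * x - x * y)"
 using pq by (simp add: Bx z_def qc_def algebra_simps csimps)
 finally have 2: "B * z = (q * q) *. (z * B) - q *. (y * x - x * y)" .
 have qp: "q * q * p = q" "q * q * (p * p) = 1"
 using pq by (simp_all add: mult.assoc) (metis mult.left_commute mult_1_right)
 have "(q * q + 1) *. (B * z) = (q * q) *. (B * z) + B * z"
 by (simp add: sc_add_l sc1)
 also have "... = (q * q) *. (p *. (y * x - x * y) + (p * p) *. (z * B)) +
 ((q * q) *. (z * B) - q *. (y * x - x * y))"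
 by (subst 1, subst 2) (rule refl)
 also have "... = (q * q + 1) *. (z * B)"
 unfolding sc_add_r calg.scale_scale qp by (simp add: sc_add_l sc1)
 finally have "(q * q + 1) *. (B * z) = (q * q + 1) *. (z * B)" .
 moreover have "q * q + 1 ~= 0" using q(2) by (simp add: power2_eq_square eq_neg_iff_add_eq_0)
 ultimately have "B * z = z * B" by simp
 thus ?th2 by (simp add: z_def x_def p_def)
qed

lemma qserre_neighbours:
 fixes A B C :: "'a::calg"
 assumes q: "q ~= 0" "q\<^sup>2 ~= - 1" and AC: "A * C = C * A" and BA: "qserre q B A" and BC: "qserre q B C"
 shows "qc (inverse q) B A * qc (inverse q) B C = qc (inverse q) B C * qc (inverse q) B A"
proof -
 define p where "p = inverse q"
 have pq: "p * q = 1" "q * p = 1" using q by (simp_all add: p_def)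
 define x where "x = qc p B A"
 define y where "y = qc p B C"
 define z where "z = qc p A y"
 have Bz: "B * z = z * B"
 using qserre_middle(2)[OF assms] by (simp add: z_def y_def p_def)
 have Ay: "A * y = z + p *. (y * A)" by (simp add: z_def qc_def)
 have Ay': "A * (y * t) = z * t + p *. (y * (A * t))" for t
 by (simp add: z_def qc_def algebra_simps csimps)
 have By: "B * y = q *. (y * B)"
 using BC q by (simp add: qserre_qc y_def p_def)
 have By': "B * (y * t) = q *. (y * (B * t))" for t
 using By by (metis mult.assoc scl)
 have "x * y = B * (A * y) - p *. (A * (B * y))"
 by (simp add: x_def qc_def algebra_simps csimps)
 also have "... = B * z + p *. ((B * y) * A) - (A * y) * B"
 using pq by (simp add: Ay Ay' By By' algebra_simps csimps)
 also have "... = y * (B * A) - p *. (y * A * B)"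
 using pq by (simp add: Ay Ay' By By' Bz algebra_simps csimps)
 also have "... = y * x"
 by (simp add: x_def qc_def algebra_simps csimps)
 finally show ?thesis by (simp add: x_def y_def p_def)
qed

lemma qserre_extend:
 fixes A B C :: "'a::calg"
 assumes q: "q ~= 0" "q\<^sup>2 ~= - 1" and AC: "A * C = C * A" and AB: "qserre q A B" and BA: "qserre q B A"
 and BC: "qserre q B C" and CB: "qserre q C B"
 shows "qserre q (qc (inverse q) A B) C" "qserre q C (qc (inverse q) A B)"
proof -
 define p where "p = inverse q"
 have pq: "p * q = 1" "q * p = 1" using q by (simp_all add: p_def)
 define y where "y = qc p A B"
 define z where "z = qc p y C"
 have Bz: "B * z = z * B"
 using qserre_middle[OF q AC BA BC] by (simp add: z_def y_def p_def)
 have Ay: "A * y = q *. (y * A)"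
 using AB q by (simp add: qserre_qc y_def p_def)
 have CA: "A * (C * t) = C * (A * t)" for t using AC by (metis mult.assoc)
 have Ay': "A * (y * t) = q *. (y * (A * t))" for t
 using Ay by (metis mult.assoc scl)
 have Az: "A * z = q *. (z * A)"
 by (simp add: z_def qc_def algebra_simps csimps Ay Ay' CA AC mult.commute)
 have Az': "A * (z * t) = q *. (z * (A * t))" for t
 using Az by (metis mult.assoc scl)
 have Bz': "B * (z * t) = z * (B * t)" for t using Bz by (metis mult.assoc)
 have "y * z = q *. (z * y)"
 using pq by (simp add: y_def qc_def algebra_simps csimps Az Az' Bz Bz')
 thus "qserre q (qc (inverse q) A B) C"
 using q by (simp add: qserre_qc y_def z_def p_def)
 have CA': "C * (A * t) = A * (C * t)" for t using AC by (metis mult.assoc)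
 have "C * C * y - (q + p) *. (C * y * C) + y * C * C =
 A * (C * C * B - (q + p) *. (C * B * C) + B * C * C) - p *. ((C * C * B - (q + p) *. (C * B * C) + B * C * C) * A)"
 by (simp add: y_def qc_def algebra_simps csimps CA' AC)
 thus "qserre q C (qc (inverse q) A B)"
 using CB by (simp add: qserre_def y_def p_def)
qed

lemma triple_comm_E:
 fixes E F K L C :: "'a::calg"
 assumes d: "d * (q - inverse q) = 1"
 and EF: "E * F - F * E = d *. (K - L)" and FC: "F * C = C * F"
 and KC: "tw K (inverse q) C" and LC: "tw L q C"
 shows "qc (inverse q) E C * F - F * qc (inverse q) E C = - (C * L)"
proof -
 define p where "p = inverse q"
 have FC': "F * (C * t) = C * (F * t)" for t using FC by (metis mult.assoc)
 have "qc p E C * F - F * qc p E C = (E * F - F * E) * C - p *. (C * (E * F - F * E))"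
 by (simp add: qc_def algebra_simps csimps FC FC')
 also have "... = (d * p - d * q - p * d + p * d) *. (C * K) - (d * q - p * d) *. (C * L) + (d * q - p * d - d * q + p * d) *. (C * K) + (d * q - d * p) *. (C * K)"
 using twD[OF KC] twD[OF LC] by (simp add: EF algebra_simps csimps p_def)
 also have "... = - ((d * (q - p)) *. (C * L))"
 by (simp add: algebra_simps csimps)
 finally show ?thesis using d by (simp add: p_def)
qed

lemma triple_comm_F:
 fixes E F K L C :: "'a::calg"
 assumes q: "q ~= 0" and d: "d * (q - inverse q) = 1"
 and EF: "E * F - F * E = d *. (K - L)" and EC: "E * C = C * E"
 and KC: "tw K q C" and LC: "tw L (inverse q) C"
 shows "E * qc q C F - qc q C F * E = - (q *. (C * K))"
proof -
 have EC': "E * (C * t) = C * (E * t)" for t using EC by (metis mult.assoc)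
 have "E * qc q C F - qc q C F * E = C * (E * F - F * E) - q *. ((E * F - F * E) * C)"
 by (simp add: qc_def algebra_simps csimps EC EC')
 also have "... = - ((q * (d * (q - inverse q))) *. (C * K))"
 using twD[OF KC] twD[OF LC] q by (simp add: EF algebra_simps csimps)
 finally show ?thesis by (simp only: d mult_1_right)
qed

lemma triple_serre:
 fixes E F K L C :: "'a::calg"
 assumes q: "q ~= 0" and d: "d * (q - inverse q) = 1"
 and EF: "E * F - F * E = d *. (K - L)" and FC: "F * C = C * F" and LK: "L * K = 1"
 and KC: "tw K (inverse q) C" and LC: "tw L q C" and KE: "tw K (q\<^sup>2) E"
 and CE: "qserre q C E"
 shows "F * K * qc (inverse q) E C = q *. (qc (inverse q) E C * (F * K)) + q *. C" (is ?th0)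
 and "qserre q (- (F * K)) (qc (inverse q) E C)" "qserre q (qc (inverse q) E C) (- (F * K))"
proof -
 define y where "y = qc (inverse q) E C"
 have "tw K (q\<^sup>2 * inverse q) (E * C)" "tw K (inverse q * q\<^sup>2) (C * E)"
 by (intro tw_mult_right KE KC)+
 moreover have "q\<^sup>2 * inverse q = q" "inverse q * q\<^sup>2 = q" using q by (simp_all add: power2_eq_square)
 ultimately have Ky: "tw K q y"
 unfolding y_def qc_def by (intro tw_diff_right tw_scale_right) simp_all
 have yF: "F * y = y * F + C * L"
 using triple_comm_E[OF d EF FC KC LC] by (simp add: y_def algebra_simps)
 have "F * K * y = q *. ((F * y) * K)" using twD[OF Ky] by (simp add: mult.assoc scr)
 also have "... = q *. (y * (F * K)) + q *. C" by (simp add: yF algebra_simps csimps LK)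
 finally have FKy: "F * K * y = q *. (y * (F * K)) + q *. C" .
 thus ?th0 by (simp add: y_def)
 define u where "u = - (F * K)"
 have u: "qc q u y = - (q *. C)" using FKy by (simp add: u_def qc_def algebra_simps csimps)
 have "F * K * C = inverse q *. (C * (F * K))"
 using twD[OF KC] FC by (metis mult.assoc scr)
 hence uC: "u * C = inverse q *. (C * u)" by (simp add: u_def)
 have "C * y = inverse q *. (y * C)"
 using CE q by (simp add: qserre_qc' y_def)
 hence 1: "qc q u y * y = inverse q *. (y * qc q u y)" by (simp add: u csimps mult.commute)
 have 2: "u * qc q u y = inverse q *. (qc q u y * u)" by (simp add: u uC csimps mult.commute)
 have q': "inverse q ~= 0" using q by simp
 from 2 have "qserre (inverse q) u y" unfolding qserre_qc[OF q'] by simp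
 thus "qserre q (- (F * K)) (qc (inverse q) E C)" by (simp add: qserre_inverse u_def y_def)
 from 1 have "qserre (inverse q) y u" unfolding qserre_qc'[OF q'] by simp
 thus "qserre q (qc (inverse q) E C) (- (F * K))" by (simp add: qserre_inverse u_def y_def)
qed

lemma pair_comm:
 fixes E F K L E' F' K' L' :: "'a::calg"
 assumes q: "q ~= 0" and d: "d * (q - inverse q) = 1"
 and EF: "E * F - F * E = d *. (K - L)" and EF': "E' * F' - F' * E' = d *. (K' - L')"
 and c: "E * F' = F' * E" "E' * F = F * E'" and KL: "K' * K = K * K'" "L' * K = K * L'"
 and KF: "tw K q F'" "tw L (inverse q) F'" "tw K' q F" "tw L' (inverse q) F"
 and KE: "tw K (inverse q) E'" "tw L' q E"
 shows "qc (inverse q) E E' * qc q F' F - qc q F' F * qc (inverse q) E E' = d *. (K * K' - L * L')"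
proof -
 define w where "w = qc q F' F"
 have Ew: "E * w = w * E - q *. (F' * K)"
 using triple_comm_F[OF q d EF c(1) KF(1,2)] by (simp add: w_def algebra_simps)
 have c': "E' * (F * t) = F * (E' * t)" for t using c(2) by (metis mult.assoc)
 have "E' * w - w * E' = (E' * F' - F' * E') * F - q *. (F * (E' * F' - F' * E'))"
 by (simp add: w_def qc_def algebra_simps csimps c c')
 also have "... = (d * (q - inverse q)) *. (F * L')"
 using twD[OF KF(3)] twD[OF KF(4)] by (simp add: EF' algebra_simps csimps)
 finally have E'w: "E' * w = w * E' + F * L'" unfolding d sc1 by (simp add: algebra_simps)
 have Ew': "E * (w * t) = w * (E * t) - q *. (F' * (K * t))" for t
 using arg_cong[OF Ew, of "%x. x * t"] by (simp add: algebra_simps csimps)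
 have E'w': "E' * (w * t) = w * (E' * t) + F * (L' * t)" for t
 using arg_cong[OF E'w, of "%x. x * t"] by (simp add: algebra_simps csimps)
 have "qc (inverse q) E E' * w - w * qc (inverse q) E E' =
 (E * F - F * E) * L' + (E' * F' - F' * E') * K"
 using q by (simp add: qc_def algebra_simps csimps Ew Ew' E'w E'w' twD[OF KE(1)] twD[OF KE(2)])
 also have "... = d *. (K * K' - L * L')"
 by (simp add: EF EF' algebra_simps csimps KL)
 finally show ?thesis by (simp add: w_def)
qed

section \<open>Lusztig automorphisms on generators\<close>

text \<open>The Lusztig automorphism on generators, for an arbitrary family in place of the letters.\<close>
fun TT :: "nat => complex => nat => (letter => 'r::calg) => letter => 'r" where
 "TT n q a f (LE b) = (if a = b then - (f (LF a) * f (LK a))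
 else if cartan a b = -1 then qc (inverse q) (f (LE a)) (f (LE b)) else f (LE b))"
| "TT n q a f (LF b) = (if a = b then - (f (LKinv a) * f (LE a))
 else if cartan a b = -1 then qc q (f (LF b)) (f (LF a)) else f (LF b))"
| "TT n q a f (LK b) = kword n f (reflection n a (simple_root b))"
| "TT n q a f (LKinv b) = kword n f (- reflection n a (simple_root b))"

lemma cartan_cases: "a ~= b ==> cartan a b = -1 \<or> cartan a b = 0"
 by (auto simp: cartan_def)

lemma cartan_same [simp]: "cartan a a = 2" by (simp add: cartan_def)

context qgroup begin

lemma d1: "1 / (q - inverse q) * (q - inverse q) = 1"
 using q_nonzero_diff[OF q0 q2] by simp

lemma EF_same: "a : {1..n} ==> f (LE a) * f (LF a) - f (LF a) * f (LE a) = (1 / (q - inverse q)) *. (f (LK a) - f (LKinv a))"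
 using EF[of a a] by simp

lemma EF_diff: "a : {1..n} ==> b : {1..n} ==> a ~= b ==> f (LE a) * f (LF b) = f (LF b) * f (LE a)"
 using EF[of a b] by simp

lemma tw_adj:
 assumes "a : {1..n}" "b : {1..n}" "cartan a b = -1"
 shows "tw (f (LK a)) (inverse q) (f (LE b))" "tw (f (LKinv a)) q (f (LE b))"
 "tw (f (LK a)) q (f (LF b))" "tw (f (LKinv a)) (inverse q) (f (LF b))"
 using KE[of a b] LE_tw[of a b] KF[of a b] LF_tw[of a b] assms by (simp_all add: power_int_minus)

lemma tw_nonadj:
 assumes "a : {1..n}" "b : {1..n}" "cartan a b = 0"
 shows "f (LK a) * f (LE b) = f (LE b) * f (LK a)" "f (LKinv a) * f (LE b) = f (LE b) * f (LKinv a)"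
 "f (LK a) * f (LF b) = f (LF b) * f (LK a)" "f (LKinv a) * f (LF b) = f (LF b) * f (LKinv a)"
 using KE[of a b] LE_tw[of a b] KF[of a b] LF_tw[of a b] assms by (simp_all add: tw_def)

lemma tw_same:
 assumes "a : {1..n}"
 shows "tw (f (LK a)) (q\<^sup>2) (f (LE a))" "tw (f (LKinv a)) (inverse (q\<^sup>2)) (f (LE a))"
 "tw (f (LK a)) (inverse (q\<^sup>2)) (f (LF a))" "tw (f (LKinv a)) (q\<^sup>2) (f (LF a))"
 using KE[of a a] LE_tw[of a a] KF[of a a] LF_tw[of a a] assms by (simp_all add: power_int_minus)

lemma TT_E_comm:
 assumes a: "a : {1..n}" and b: "b : {1..n}" and c: "c : {1..n}" and bc: "cartan b c = 0"
 shows "TT n q a f (LE b) * TT n q a f (LE c) = TT n q a f (LE c) * TT n q a f (LE b)"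
proof -
 have *: "TT n q a f (LE b) * TT n q a f (LE c) = TT n q a f (LE c) * TT n q a f (LE b)"
 if b: "b : {1..n}" and c: "c : {1..n}" and bc: "cartan b c = 0" and ca: "cartan a c = 0" for b c
 proof -
 have ne: "c ~= a" "c ~= b" using ca bc by auto
 have comm: "f (LE c) * f (LE a) = f (LE a) * f (LE c)" "f (LE c) * f (LE b) = f (LE b) * f (LE c)"
 "f (LE c) * f (LF a) = f (LF a) * f (LE c)" "f (LE c) * f (LK a) = f (LK a) * f (LE c)"
 using EE[of c a] EE[of c b] EF_diff[of c a] tw_nonadj[of a c] a b c bc ca ne
 by (simp_all add: cartan_sym)
 have comm': "f (LE c) * (f (LE a) * t) = f (LE a) * (f (LE c) * t)" "f (LE c) * (f (LE b) * t) = f (LE b) * (f (LE c) * t)"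
 "f (LE c) * (f (LF a) * t) = f (LF a) * (f (LE c) * t)" for t
 using comm by (metis mult.assoc)+
 show ?thesis
 using ca ne by (cases "b = a") (auto simp: qc_def algebra_simps csimps comm comm')
 qed
 consider "cartan a c = 0" | "cartan a b = 0" | "cartan a b = -1" "cartan a c = -1" | "b = a" | "c = a"
 using cartan_cases[of a b] cartan_cases[of a c] by blast
 thus ?thesis
 proof cases
 case 1
 thus ?thesis using * b c bc by blast
 next
 case 2
 thus ?thesis using *[of c b] b c bc by (simp add: cartan_sym)
 next
 case 3
 hence "a ~= b" "a ~= c" by auto
 thus ?thesis
 using qserre_neighbours[OF q0 q4 EE[OF b c bc] serreE[OF a b 3(1)] serreE[OF a c 3(2)]] 3 by simp
 next
 case 4
 thus ?thesis using *[of b c] b c bc by simp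
 next
 case 5
 thus ?thesis using *[of c b] b c bc by (simp add: cartan_sym)
 qed
qed

lemma TT_E_serre:
 assumes a: "a : {1..n}" and b: "b : {1..n}" and c: "c : {1..n}" and bc: "cartan b c = -1"
 shows "qserre q (TT n q a f (LE b)) (TT n q a f (LE c))"
proof -
 have ne: "b ~= c" using bc by auto
 have cb: "cartan c b = -1" using bc by (simp add: cartan_sym)
 have "\<not> (cartan a b = -1 & cartan a c = -1)" using bc by (auto simp: cartan_def split: if_splits)
 then consider "b = a" | "c = a" | "cartan a b = 0" "cartan a c = 0" | "cartan a b = -1" "cartan a c = 0"
 | "cartan a c = -1" "cartan a b = 0"
 using cartan_cases[of a b] cartan_cases[of a c] by metis
 thus ?thesis
 proof cases
 case 1
 with bc ne triple_serre(2)[OF q0 d1 EF_same[OF a] _ LK[OF a] tw_adj(1)[OF a c] tw_adj(2)[OF a c] tw_same(1)[OF a] serreE[OF c a]]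
 show ?thesis using EF_diff[OF c a] a c cb by simp
 next
 case 2
 with bc ne triple_serre(3)[OF q0 d1 EF_same[OF a] _ LK[OF a] tw_adj(1)[OF a b] tw_adj(2)[OF a b] tw_same(1)[OF a] serreE[OF b a]]
 show ?thesis using EF_diff[OF b a] a b cb by simp
 next
 case 3
 thus ?thesis using serreE[OF b c bc] by auto
 next
 case 4
 hence "a ~= b" "a ~= c" by auto
 with qserre_extend(1)[OF q0 q4 EE[OF a c 4(2)] serreE[OF a b 4(1)] serreE[OF b a] serreE[OF b c bc] serreE[OF c b cb]] 4
 show ?thesis by (simp add: cartan_sym)
 next
 case 5
 hence "a ~= b" "a ~= c" by auto
 with qserre_extend(2)[OF q0 q4 EE[OF a b 5(2)] serreE[OF a c 5(1)] serreE[OF c a] serreE[OF c b cb] serreE[OF b c bc]] 5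
 show ?thesis by (simp add: cartan_sym)
 qed
qed

lemma TT_F_swap:
 assumes a: "a : {1..n}" and b: "b : {1..n}"
 obtains r where "TT n q a f (LF b) = r *. TT n q a (f \<circ> swapEF) (LE b)"
proof -
 have "f (LKinv a) * f (LE a) = inverse (q\<^sup>2) *. (f (LE a) * f (LKinv a))"
 using tw_same(2)[OF a] by (simp add: tw_def)
 moreover have "qc q (f (LF b)) (f (LF a)) = (- q) *. qc (inverse q) (f (LF a)) (f (LF b))"
 using q0 by (simp add: qc_def csimps)
 ultimately consider "a = b" "TT n q a f (LF b) = inverse (q\<^sup>2) *. TT n q a (f \<circ> swapEF) (LE b)"
 | "TT n q a f (LF b) = (- q) *. TT n q a (f \<circ> swapEF) (LE b)"
 | "TT n q a f (LF b) = 1 *. TT n q a (f \<circ> swapEF) (LE b)"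
 by (cases "a = b"; cases "cartan a b = -1") (auto simp: sc1)
 thus thesis using that by cases blast+
qed

lemma wt_TT_E: assumes a: "a : {1..n}" and b: "b : {1..n}" shows "wt (TT n q a f (LE b)) (reflection n a (simple_root b))"
proof -
 have K: "wt (f (LK a)) 0" using wt_K[of "simple_root a"] Kf_simple[OF a] by simp
 consider "a = b" | "cartan a b = -1" "a ~= b" | "cartan a b = 0" "a ~= b"
 using cartan_cases[of a b] by blast
 thus ?thesis
 proof cases
 case 1
 have "reflection n a (simple_root b) = - simple_root a + 0"
 using 1 by (auto simp: reflection_simple[OF b b] fun_eq_iff)
 thus ?thesis using wt_uminus[OF wt_mult[OF wt_F[OF a] K]] 1 by (simp del: add_0_right)
 next
 case 2
 hence "reflection n a (simple_root b) = simple_root a + simple_root b"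
 unfolding reflection_simple[OF a b] by (auto simp: fun_eq_iff cartan_sym)
 thus ?thesis using wt_qc[OF wt_E[OF a] wt_E[OF b]] 2 by simp
 next
 case 3
 hence "reflection n a (simple_root b) = simple_root b"
 unfolding reflection_simple[OF a b] by (auto simp: fun_eq_iff cartan_sym)
 thus ?thesis using wt_E[OF b] 3 by simp
 qed
qed

lemma wt_TT_F: assumes a: "a : {1..n}" and b: "b : {1..n}" shows "wt (TT n q a f (LF b)) (- reflection n a (simple_root b))"
proof -
 have K: "wt (f (LKinv a)) 0" using wt_K[of "- simple_root a"] Kf_simple[OF a] by simp
 consider "a = b" | "cartan a b = -1" "a ~= b" | "cartan a b = 0" "a ~= b"
 using cartan_cases[of a b] by blast
 thus ?thesis
 proof cases
 case 1
 have "- reflection n a (simple_root b) = 0 + simple_root a"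
 using 1 by (auto simp: reflection_simple[OF b b] fun_eq_iff)
 thus ?thesis using wt_uminus[OF wt_mult[OF K wt_E[OF a]]] 1 by (simp del: add_0_left)
 next
 case 2
 hence "- reflection n a (simple_root b) = - simple_root b + - simple_root a"
 unfolding reflection_simple[OF a b] by (auto simp: fun_eq_iff cartan_sym)
 thus ?thesis using wt_qc[OF wt_F[OF b] wt_F[OF a]] 2 by simp
 next
 case 3
 hence "reflection n a (simple_root b) = simple_root b"
 unfolding reflection_simple[OF a b] by (auto simp: fun_eq_iff cartan_sym)
 thus ?thesis using wt_F[OF b] 3 by simp
 qed
qed

lemma TT_EF:
 assumes a: "a : {1..n}" and b: "b : {1..n}" and c: "c : {1..n}"
 shows "TT n q a f (LE b) * TT n q a f (LF c) - TT n q a f (LF c) * TT n q a f (LE b) =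
 (if b = c then (1 / (q - inverse q)) *. (TT n q a f (LK b) - TT n q a f (LKinv b)) else 0)"
proof -
 let ?E = "%b. f (LE b)" and ?F = "%b. f (LF b)" and ?K = "f (LK a)" and ?L = "f (LKinv a)"
 have assoc: "x * y = c *. (y * x) ==> x * (y * t) = c *. (y * (x * t))" for x y t :: 'r and c
 by (metis mult.assoc scl)
 have comm3: "x * y = y * x ==> x * (y * t) = y * (x * t)" for x y t :: 'r
 by (metis mult.assoc)
 have b_cases: P if "b = a ==> P" "b ~= a ==> cartan a b = -1 ==> P" "b ~= a ==> cartan a b = 0 ==> P" for P
 using that cartan_cases[of a b] by blast
 have c_cases: P if "c = a ==> P" "c ~= a ==> cartan a c = -1 ==> P" "c ~= a ==> cartan a c = 0 ==> P" for P
 using that cartan_cases[of a c] by blast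
 consider "b = a" "c = a" | "b = a" "c ~= a" "cartan a c = -1" | "b = a" "c ~= a" "cartan a c = 0"
 | "b ~= a" "cartan a b = -1" "c = a" | "b ~= a" "cartan a b = 0" "c = a"
 | "b ~= a" "c ~= a" "c = b" "cartan a b = -1" | "b ~= a" "c ~= a" "c = b" "cartan a b = 0"
 | "b ~= a" "c ~= a" "b ~= c" "cartan a b = -1" "cartan a c = -1"
 | "b ~= a" "c ~= a" "b ~= c" "cartan a b = -1" "cartan a c = 0"
 | "b ~= a" "c ~= a" "b ~= c" "cartan a b = 0" "cartan a c = -1"
 | "b ~= a" "c ~= a" "b ~= c" "cartan a b = 0" "cartan a c = 0"
 by (rule b_cases; rule c_cases; cases "b = c"; blast)
 thus ?thesis
 proof cases
 case 1
 have r: "reflection n a (simple_root a) = - simple_root a"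
 unfolding reflection_simple[OF a a] by (auto simp: fun_eq_iff)
 have "?L * (?E a * (?F a * ?K)) = ?E a * ?F a"
 proof -
 have "?L * (?E a * ?F a) = (?E a * ?F a) * ?L"
 using tw_mult_right[OF tw_same(2)[OF a] tw_same(4)[OF a]] q0 by (simp add: tw_def)
 hence "?L * (?E a * ?F a) * ?K = ?E a * ?F a" by (simp add: mult.assoc LK[OF a])
 thus ?thesis by (simp add: mult.assoc)
 qed
 moreover have "?F a * (?K * (?L * ?E a)) = ?F a * ?E a"
 using arg_cong[OF KL[OF a], of "%x. ?F a * (x * ?E a)"] by (simp add: mult.assoc)
 ultimately have "TT n q a f (LE b) * TT n q a f (LF c) - TT n q a f (LF c) * TT n q a f (LE b) = - (?E a * ?F a - ?F a * ?E a)"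
 using 1 by (simp add: mult.assoc)
 thus ?thesis using 1 EF_same[OF a] by (simp add: r Kf_simple[OF a] csimps)
 next
 case 2
 have "qc q (?F c) (?F a) = - (q *. qc (inverse q) (?F a) (?F c))"
 using q0 by (simp add: qc_def csimps)
 moreover have "?F a * qc (inverse q) (?F a) (?F c) = q *. (qc (inverse q) (?F a) (?F c) * ?F a)"
 using serreF[OF a c 2(3)] by (simp add: qserre_qc q0)
 ultimately have Fw: "?F a * qc q (?F c) (?F a) = q *. (qc q (?F c) (?F a) * ?F a)"
 by (simp add: csimps)
 have "tw ?K (q * inverse (q\<^sup>2)) (qc q (?F c) (?F a))"
 unfolding qc_def using tw_mult_right[OF tw_adj(3)[OF a c 2(3)] tw_same(3)[OF a]]
 tw_mult_right[OF tw_same(3)[OF a] tw_adj(3)[OF a c 2(3)]]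
 by (intro tw_diff_right tw_scale_right) (simp_all add: mult.commute)
 moreover have "q * inverse (q\<^sup>2) = inverse q" using q0 by (simp add: power2_eq_square)
 ultimately have "?K * qc q (?F c) (?F a) = inverse q *. (qc q (?F c) (?F a) * ?K)"
 by (simp add: tw_def)
 thus ?thesis using 2 assoc[OF Fw] q0 by (simp add: mult.assoc csimps)
 next
 case 3
 thus ?thesis using tw_nonadj(3)[OF a c] FF[OF a c] comm3[OF FF[OF a c]] by (simp add: mult.assoc)
 next
 case 4
 have Ey: "?E a * qc (inverse q) (?E a) (?E b) = q *. (qc (inverse q) (?E a) (?E b) * ?E a)"
 using serreE[OF a b 4(2)] by (simp add: qserre_qc q0)
 have "tw ?L (q * inverse (q\<^sup>2)) (qc (inverse q) (?E a) (?E b))"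
 unfolding qc_def using tw_mult_right[OF tw_adj(2)[OF a b 4(2)] tw_same(2)[OF a]]
 tw_mult_right[OF tw_same(2)[OF a] tw_adj(2)[OF a b 4(2)]]
 by (intro tw_diff_right tw_scale_right) (simp_all add: mult.commute)
 moreover have "q * inverse (q\<^sup>2) = inverse q" using q0 by (simp add: power2_eq_square)
 ultimately have Ly: "?L * qc (inverse q) (?E a) (?E b) = inverse q *. (qc (inverse q) (?E a) (?E b) * ?L)"
 by (simp add: tw_def)
 thus ?thesis using 4 Ey assoc[OF Ly] q0 by (simp add: mult.assoc csimps)
 next
 case 5
 thus ?thesis using tw_nonadj(2)[OF a b] EE[OF a b] comm3[OF tw_nonadj(2)[OF a b]] by (simp add: mult.assoc)
 next
 case 6
 have ba: "cartan b a = -1" using 6 by (simp add: cartan_sym)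
 have r: "reflection n a (simple_root b) = simple_root a + simple_root b"
 using 6 unfolding reflection_simple[OF a b] by (auto simp: fun_eq_iff cartan_sym)
 hence r': "- reflection n a (simple_root b) = - simple_root a + - simple_root b"
 by (auto simp: fun_eq_iff)
 have "qc (inverse q) (?E a) (?E b) * qc q (?F b) (?F a) - qc q (?F b) (?F a) * qc (inverse q) (?E a) (?E b) =
 (1 / (q - inverse q)) *. (?K * f (LK b) - ?L * f (LKinv b))"
 by (rule pair_comm[OF q0 d1 EF_same[OF a] EF_same[OF b]])
 (use 6 ba a b in \<open>auto intro: EF_diff KK inv_comm tw_adj\<close>)
 moreover have "Kf (reflection n a (simple_root b)) = ?K * f (LK b)"
 unfolding r Kf_add by (simp add: Kf_simple[OF a] Kf_simple[OF b])
 moreover have "Kf (- reflection n a (simple_root b)) = ?L * f (LKinv b)"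
 unfolding r' Kf_add by (simp add: Kf_simple[OF a] Kf_simple[OF b])
 ultimately show ?thesis using 6 by simp
 next
 case 7
 hence r: "reflection n a (simple_root b) = simple_root b"
 unfolding reflection_simple[OF a b] by (auto simp: fun_eq_iff cartan_sym)
 thus ?thesis using 7 EF_same[OF b] by (simp add: Kf_simple[OF b])
 next
 case 8
 have Ew: "?E a * qc q (?F c) (?F a) - qc q (?F c) (?F a) * ?E a = - (q *. (?F c * ?K))"
 by (rule triple_comm_F[OF q0 d1 EF_same[OF a]]) (use 8 a c in \<open>auto intro: EF_diff tw_adj\<close>)
 define w where "w = qc q (?F c) (?F a)"
 have Ew1: "?E a * w = w * ?E a - q *. (?F c * ?K)" using Ew by (simp add: w_def algebra_simps)
 have Ew2: "?E a * (w * t) = w * (?E a * t) - q *. (?F c * (?K * t))" for t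
 using arg_cong[OF Ew1, of "%x. x * t"] by (simp add: algebra_simps csimps)
 have bc: "?E b * ?F c = ?F c * ?E b" "?E b * ?F a = ?F a * ?E b" using EF_diff[OF b] a c 8 by auto
 have Ew3: "?E b * w = w * ?E b"
 by (simp add: w_def qc_def algebra_simps csimps bc comm3[OF bc(1)] comm3[OF bc(2)])
 have KEb: "?K * ?E b = inverse q *. (?E b * ?K)" using tw_adj(1)[OF a b 8(4)] by (simp add: tw_def)
 have "qc (inverse q) (?E a) (?E b) * w - w * qc (inverse q) (?E a) (?E b) = 0"
 using q0 by (simp add: qc_def algebra_simps csimps Ew1 Ew2 Ew3 comm3[OF Ew3] KEb bc comm3[OF bc(1)])
 thus ?thesis using 8 by (simp add: w_def)
 next
 case 9
 have bc: "?E b * ?F c = ?F c * ?E b" "?E a * ?F c = ?F c * ?E a" using EF_diff a b c 9 by auto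
 show ?thesis using 9 by (simp add: qc_def algebra_simps csimps bc comm3[OF bc(1)] comm3[OF bc(2)])
 next
 case 10
 have bc: "?E b * ?F c = ?F c * ?E b" "?E b * ?F a = ?F a * ?E b" using EF_diff a b c 10 by auto
 show ?thesis using 10 by (simp add: qc_def algebra_simps csimps bc comm3[OF bc(1)] comm3[OF bc(2)])
 next
 case 11
 thus ?thesis using EF_diff[OF b c] by simp
 qed
qed

text \<open>The image of a family satisfying the relations satisfies them again, which is what makes the Lusztig map well defined on the quotient.\<close>
lemma qgroup_TT:
 assumes a: "a : {1..n}"
 shows "qgroup n (TT n q a f) q"
proof (rule qgroup_wtI[where \<sigma> = "%b. reflection n a (simple_root b)"])
 interpret s: qgroup n "f \<circ> swapEF" q by (rule qgroup_swapEF)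
 fix b c assume bc: "b : {1..n}" "c : {1..n}"
 obtain r r' where r: "TT n q a f (LF b) = r *. TT n q a (f \<circ> swapEF) (LE b)"
 "TT n q a f (LF c) = r' *. TT n q a (f \<circ> swapEF) (LE c)"
 using TT_F_swap[OF a bc(1)] TT_F_swap[OF a bc(2)] by metis
 show "TT n q a f (LF b) * TT n q a f (LF c) = TT n q a f (LF c) * TT n q a f (LF b)" if "cartan b c = 0"
 unfolding r using s.TT_E_comm[OF a bc that] by (simp add: scl scr mult.commute del: TT.simps)
 show "qserre q (TT n q a f (LF b)) (TT n q a f (LF c))" if "cartan b c = -1"
 unfolding r by (intro qserre_scale s.TT_E_serre[OF a bc that])
 show "TT n q a f (LE b) * TT n q a f (LF c) - TT n q a f (LF c) * TT n q a f (LE b) =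
 (if b = c then (1 / (q - inverse q)) *. (TT n q a f (LK b) - TT n q a f (LKinv b)) else 0)"
 by (rule TT_EF[OF a bc])
qed (use a in \<open>auto simp del: TT.simps(1,2) simp: reflection_form root_form_simple intro: wt_TT_E wt_TT_F TT_E_comm TT_E_serre\<close>)

end

text \<open>The inverse Lusztig automorphism on generators.\<close>
fun TI :: "nat => complex => nat => (letter => 'r::calg) => letter => 'r" where
 "TI n q a f (LE b) = (if a = b then - (f (LKinv a) * f (LF a))
 else if cartan a b = -1 then qc (inverse q) (f (LE b)) (f (LE a)) else f (LE b))"
| "TI n q a f (LF b) = (if a = b then - (f (LE a) * f (LK a))
 else if cartan a b = -1 then qc q (f (LF a)) (f (LF b)) else f (LF b))"
| "TI n q a f (LK b) = kword n f (reflection n a (simple_root b))"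
| "TI n q a f (LKinv b) = kword n f (- reflection n a (simple_root b))"

lemma reflection_sum:
 assumes "a : {1..n}" "\<mu> : root_lattice n"
 shows "(%x. \<Sum>b\<in>{1..n}. \<mu> b * reflection n a (simple_root b) x) = reflection n a \<mu>"
proof
 fix x
 have "(\<Sum>b\<in>{1..n}. \<mu> b * reflection n a (simple_root b) x) =
 (\<Sum>b\<in>{1..n}. \<mu> b * simple_root b x) - (\<Sum>b\<in>{1..n}. \<mu> b * root_form n (simple_root b) (simple_root a)) * simple_root a x"
 by (simp add: reflection_def algebra_simps sum_subtractf sum_distrib_left)
 also have "(\<Sum>b\<in>{1..n}. \<mu> b * simple_root b x) = (\<Sum>b\<in>{1..n}. if b = x then \<mu> x else 0)"
 by (intro sum.cong) (auto simp: simple_root_def)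
 also have "... = \<mu> x" using assms(2) by (auto simp: root_lattice_def)
 also have "(\<Sum>b\<in>{1..n}. \<mu> b * root_form n (simple_root b) (simple_root a)) = root_form n \<mu> (simple_root a)"
 by (rule root_form_expand_left[symmetric])
 finally show "(\<Sum>b\<in>{1..n}. \<mu> b * reflection n a (simple_root b) x) = reflection n a \<mu> x"
 by (simp add: reflection_def)
qed

lemma simple_root_lattice: "a : {1..n} ==> simple_root a : root_lattice n"
 by (auto simp: root_lattice_def simple_root_def)

lemma reflection_lattice: "a : {1..n} ==> \<mu> : root_lattice n ==> reflection n a \<mu> : root_lattice n"
 by (auto simp: root_lattice_def simple_root_def reflection_def)

lemma uminus_lattice: "\<mu> : root_lattice n ==> - \<mu> : root_lattice n"
 by (auto simp: root_lattice_def)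

context qgroup begin

lemma TI_eq_TT:
 assumes a: "a : {1..n}"
 shows "TI n q a f = rescale (%b. if a = b then q\<^sup>2 else if cartan a b = -1 then - inverse q else 1)
 (TT n (inverse q) a (f \<circ> swapK) \<circ> swapK)"
proof
 fix x
 show "TI n q a f x = rescale (%b. if a = b then q\<^sup>2 else if cartan a b = -1 then - inverse q else 1)
 (TT n (inverse q) a (f \<circ> swapK) \<circ> swapK) x"
 proof (cases x)
 case (LE b)
 have "f (LKinv a) * f (LF a) = q\<^sup>2 *. (f (LF a) * f (LKinv a))"
 using tw_same(4)[OF a] by (simp add: tw_def)
 thus ?thesis using LE q0 by (auto simp: qc_def csimps sc1)
 next
 case (LF b)
 have "f (LE a) * f (LK a) = inverse (q\<^sup>2) *. (f (LK a) * f (LE a))"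
 using tw_same(1)[OF a] q0 by (simp add: tw_def)
 thus ?thesis using LF q0 by (auto simp: qc_def csimps sc1)
 next
 case (LK b)
 thus ?thesis by (simp add: kword_swap)
 next
 case (LKinv b)
 thus ?thesis by (simp add: kword_swap)
 qed
qed

lemma qgroup_TI:
 assumes a: "a : {1..n}"
 shows "qgroup n (TI n q a f) q"
proof -
 interpret s: qgroup n "f \<circ> swapK" "inverse q" by (rule qgroup_swapK)
 interpret t: qgroup n "TT n (inverse q) a (f \<circ> swapK)" "inverse q" by (rule s.qgroup_TT[OF a])
 interpret u: qgroup n "TT n (inverse q) a (f \<circ> swapK) \<circ> swapK" q
 using t.qgroup_swapK by simp
 show ?thesis unfolding TI_eq_TT[OF a] by (rule u.qgroup_rescale) (use q0 in auto)
qed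

lemma kword_refl:
 assumes a: "a : {1..n}" and \<mu>: "\<mu> : root_lattice n"
 shows "kword n (TT n q a f) \<mu> = Kf (reflection n a \<mu>)" "kword n (TI n q a f) \<mu> = Kf (reflection n a \<mu>)"
 using kword_subst[of "TT n q a f" "%b. reflection n a (simple_root b)" \<mu>]
 kword_subst[of "TI n q a f" "%b. reflection n a (simple_root b)" \<mu>] reflection_sum[OF a \<mu>]
 by simp_all

lemma reflection_self: "a : {1..n} ==> reflection n a (simple_root a) = - simple_root a"
 using reflection_simple[of a n a] by (auto simp: fun_eq_iff)

lemma TT_TI_E:
 assumes a: "a : {1..n}" and b: "b : {1..n}"
 shows "TT n q a (TI n q a f) (LE b) = f (LE b)"
proof -
 consider "b = a" | "b ~= a" "cartan a b = -1" | "b ~= a" "cartan a b = 0"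
 using cartan_cases[of a b] by blast
 thus ?thesis
 proof cases
 case 1
 thus ?thesis
 by (simp add: reflection_self[OF a] Kf_simple[OF a] mult.assoc KL[OF a])
 next
 case 2
 let ?E = "f (LE a)" and ?F = "f (LF a)" and ?L = "f (LKinv a)" and ?C = "f (LE b)"
 have d: "1 / (inverse q - q) * (inverse q - inverse (inverse q)) = 1"
 using qgroup.d1[OF qgroup_swapK] by simp
 have EF': "?E * ?F - ?F * ?E = (1 / (inverse q - q)) *. (?L - f (LK a))"
 proof -
 have "1 / (inverse q - q) = - (1 / (q - inverse q))" by (simp add: minus_divide_right)
 thus ?thesis using EF_same[OF a] by (simp add: csimps)
 qed
 have y: "?F * ?L * qc q ?E ?C = inverse q *. (qc q ?E ?C * (?F * ?L)) + inverse q *. ?C"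
 using triple_serre(1)[OF _ d EF' _ KL[OF a], of ?C] q0 2 EF_diff[OF b a] tw_adj[OF a b 2(2)] tw_same(2)[OF a]
 serreE[OF b a] by (simp add: cartan_sym qserre_inverse power_inverse)
 have LF: "?L * ?F = q\<^sup>2 *. (?F * ?L)" using tw_same(4)[OF a] by (simp add: tw_def)
 have yy: "qc (inverse q) ?C ?E = - (inverse q) *. qc q ?E ?C" using q0 by (simp add: qc_def csimps)
 have "TT n q a (TI n q a f) (LE b) = qc (inverse q) (- (?L * ?F)) (qc (inverse q) ?C ?E)"
 using 2 by simp
 also have "... = q *. (?F * ?L * qc q ?E ?C - inverse q *. (qc q ?E ?C * (?F * ?L)))"
 proof -
 have "inverse q * (q * q) = q" "inverse q * (q * q * inverse q) = 1" using q0 by (simp_all add: field_simps)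
 thus ?thesis unfolding LF yy unfolding qc_def[of "inverse q"] using q0 by (simp add: csimps power2_eq_square sc1)
 qed
 also have "... = ?C" using q0 by (simp add: y sc1)
 finally show ?thesis .
 next
 case 3
 thus ?thesis by simp
 qed
qed

lemma TT_TI_F:
 assumes a: "a : {1..n}" and b: "b : {1..n}"
 shows "TT n q a (TI n q a f) (LF b) = f (LF b)"
proof -
 consider "b = a" | "b ~= a" "cartan a b = -1" | "b ~= a" "cartan a b = 0"
 using cartan_cases[of a b] by blast
 thus ?thesis
 proof cases
 case 1
 thus ?thesis
 by (simp add: reflection_self[OF a] Kf_simple[OF a] KL[OF a] flip: mult.assoc)
 next
 case 2
 let ?E = "f (LE a)" and ?F = "f (LF a)" and ?K = "f (LK a)" and ?C = "f (LF b)"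
 have d: "1 / (inverse q - q) * (inverse q - inverse (inverse q)) = 1"
 using qgroup.d1[OF qgroup_swapK] by simp
 have EF': "?F * ?E - ?E * ?F = (1 / (inverse q - q)) *. (?K - f (LKinv a))"
 proof -
 have "1 / (inverse q - q) = - (1 / (q - inverse q))" by (simp add: minus_divide_right)
 thus ?thesis using EF_same[OF a] by (simp add: algebra_simps)
 qed
 have y: "?E * ?K * qc q ?F ?C = inverse q *. (qc q ?F ?C * (?E * ?K)) + inverse q *. ?C"
 using triple_serre(1)[OF _ d EF' _ LK[OF a], of ?C] q0 2 EF_diff[OF a b] tw_adj[OF a b 2(2)] tw_same(3)[OF a]
 serreF[OF b a] by (simp add: cartan_sym qserre_inverse power_inverse)
 have "TT n q a (TI n q a f) (LF b) = qc q (qc q ?F ?C) (- (?E * ?K))"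
 using 2 by simp
 also have "... = q *. (?E * ?K * qc q ?F ?C - inverse q *. (qc q ?F ?C * (?E * ?K)))"
 using q0 unfolding qc_def[of q "qc q ?F ?C"] by (simp add: csimps sc1)
 also have "... = ?C" using q0 by (simp add: y sc1)
 finally show ?thesis .
 next
 case 3
 thus ?thesis by simp
 qed
qed

lemma TI_TT_F:
 assumes a: "a : {1..n}" and b: "b : {1..n}"
 shows "TI n q a (TT n q a f) (LF b) = f (LF b)"
proof -
 consider "b = a" | "b ~= a" "cartan a b = -1" | "b ~= a" "cartan a b = 0"
 using cartan_cases[of a b] by blast
 thus ?thesis
 proof cases
 case 1
 thus ?thesis
 by (simp add: reflection_self[OF a] Kf_simple[OF a] KL[OF a] mult.assoc)
 next
 case 2
 let ?E = "f (LE a)" and ?F = "f (LF a)" and ?L = "f (LKinv a)" and ?C = "f (LF b)"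
 have EF': "?F * ?E - ?E * ?F = (1 / (q - inverse q)) *. (?L - f (LK a))"
 using EF_same[OF a] by (simp add: algebra_simps csimps)
 have y: "?E * ?L * qc (inverse q) ?F ?C = q *. (qc (inverse q) ?F ?C * (?E * ?L)) + q *. ?C"
 using triple_serre(1)[OF q0 d1 EF' _ KL[OF a], of ?C] q0 2 EF_diff[OF a b] tw_adj[OF a b 2(2)] tw_same(4)[OF a]
 serreF[OF b a] by (simp add: cartan_sym)
 have LE: "?L * ?E = inverse (q\<^sup>2) *. (?E * ?L)" using tw_same(2)[OF a] by (simp add: tw_def)
 have yy: "qc q ?C ?F = - q *. qc (inverse q) ?F ?C" using q0 by (simp add: qc_def csimps)
 have "TI n q a (TT n q a f) (LF b) = qc q (- (?L * ?E)) (qc q ?C ?F)"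
 using 2 by simp
 also have "... = inverse q *. (?E * ?L * qc (inverse q) ?F ?C - q *. (qc (inverse q) ?F ?C * (?E * ?L)))"
 proof -
 have "q * (inverse q * inverse q) = inverse q" "q * (inverse q * inverse q * q) = 1" using q0 by (simp_all add: field_simps)
 thus ?thesis unfolding LE yy unfolding qc_def[of q] using q0 by (simp add: csimps power2_eq_square sc1)
 qed
 also have "... = ?C" using q0 by (simp add: y sc1)
 finally show ?thesis .
 next
 case 3
 thus ?thesis by simp
 qed
qed

lemma TT_TI_K:
 assumes a: "a : {1..n}" and b: "b : {1..n}"
 shows "TT n q a (TI n q a f) (LK b) = f (LK b)" "TT n q a (TI n q a f) (LKinv b) = f (LKinv b)"
 using a b by (simp_all add: kword_refl reflection_lattice simple_root_lattice uminus_lattice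
 reflection_reflection reflection_uminus Kf_simple)

end

section \<open>The coproduct on generators\<close>

text \<open>Coproducts of the generators, where the two tensor factors are replaced by two commuting families.\<close>
fun DD :: "(letter => 'r::calg) => (letter => 'r) => letter => 'r" where
 "DD f g (LE a) = f (LE a) + f (LK a) * g (LE a)"
| "DD f g (LF a) = f (LF a) * g (LKinv a) + g (LF a)"
| "DD f g (LK a) = f (LK a) * g (LK a)"
| "DD f g (LKinv a) = f (LKinv a) * g (LKinv a)"

lemma qserre_sum:
 fixes X Y X' Y' :: "'a::calg"
 assumes q: "q ~= 0" and YX: "Y * X = q\<^sup>2 *. (X * Y)" and YX': "Y * X' = inverse q *. (X' * Y)"
 and Y'X: "Y' * X = inverse q *. (X * Y')" and X: "qserre q X X'" and Y: "qserre q Y Y'"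
 shows "qserre q (X + Y) (X' + Y')"
proof -
 define p where "p = inverse q"
 have pq: "p * q = 1" "q * p = 1" "p * (q * c) = c" "q * (p * c) = c" for c using q by (simp_all add: p_def)
 have r: "Y * X = (q * q) *. (X * Y)" "Y * X' = p *. (X' * Y)" "Y' * X = p *. (X * Y')"
 using YX YX' Y'X by (simp_all add: p_def power2_eq_square)
 have r': "Y * (X * t) = (q * q) *. (X * (Y * t))" "Y * (X' * t) = p *. (X' * (Y * t))"
 "Y' * (X * t) = p *. (X * (Y' * t))" for t
 using r by (metis mult.assoc scl)+
 have "(X + Y) * (X + Y) * (X' + Y') - (q + p) *. ((X + Y) * (X' + Y') * (X + Y)) + (X' + Y') * (X + Y) * (X + Y) =
 (X * X * X' - (q + p) *. (X * X' * X) + X' * X * X) + (Y * Y * Y' - (q + p) *. (Y * Y' * Y) + Y' * Y * Y)"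
 by (simp add: algebra_simps csimps r r' pq sc1)
 thus ?thesis using X Y by (simp add: qserre_def p_def)
qed

lemma qserre_twist:
 fixes E E' L L' :: "'a::calg"
 assumes q: "q ~= 0" and E: "qserre q E E'"
 and t: "tw L c E" "tw L d E'" "tw L' d E" and LL: "L' * L = L * L'" 
 shows "qserre q (E * L) (E' * L')"
proof -
 have t3: "L * E = c *. (E * L)" "L * E' = d *. (E' * L)" "L' * E = d *. (E * L')"
 "L * (E * s) = c *. (E * (L * s))" "L * (E' * s) = d *. (E' * (L * s))" "L' * (E * s) = d *. (E * (L' * s))" for s
 using t by (auto simp: twD twD3)
 have LL': "L' * (L * s) = L * (L' * s)" for s using LL by (metis mult.assoc)
 have "E * L * (E * L) * (E' * L') - (q + inverse q) *. (E * L * (E' * L') * (E * L)) + E' * L' * (E * L) * (E * L) =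
 (c * d * d) *. ((E * E * E' - (q + inverse q) *. (E * E' * E) + E' * E * E) * (L * L * L'))"
 by (simp add: algebra_simps csimps t3 LL LL')
 thus ?thesis using E by (simp add: qserre_def)
qed

lemma comm_mult:
 assumes "a * c = c * a" "a * d = d * a" "b * c = c * b" "b * d = d * b"
 shows "(a * b) * (c * d) = (c * d) * (a * b :: 'a::calg)"
 using assms by (metis mult.assoc)

lemma qgroup_DD:
 fixes f g :: "letter => 'r::calg"
 assumes "qgroup n f q" "qgroup n g q"
 and comm: "!!x y. x : letters n ==> y : letters n ==> g y * f x = f x * g y"
 shows "qgroup n (DD f g) q"
proof -
 interpret f: qgroup n f q by fact
 interpret g: qgroup n g q by fact
 have comm': "g y * (f x * t) = f x * (g y * t)" if "x : letters n" "y : letters n" for x y t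
 using comm[OF that] by (metis mult.assoc)
 have lt: "LE a : letters n" "LF a : letters n" "LK a : letters n" "LKinv a : letters n" if "a : {1..n}" for a
 using that by (auto simp: letters_def)
 note c = comm[OF lt(1) lt(1)] comm[OF lt(1) lt(2)] comm[OF lt(1) lt(3)] comm[OF lt(1) lt(4)]
 comm[OF lt(2) lt(1)] comm[OF lt(2) lt(2)] comm[OF lt(2) lt(3)] comm[OF lt(2) lt(4)]
 comm[OF lt(3) lt(1)] comm[OF lt(3) lt(2)] comm[OF lt(3) lt(3)] comm[OF lt(3) lt(4)]
 comm[OF lt(4) lt(1)] comm[OF lt(4) lt(2)] comm[OF lt(4) lt(3)] comm[OF lt(4) lt(4)]
 note c' = comm'[OF lt(1) lt(1)] comm'[OF lt(1) lt(2)] comm'[OF lt(1) lt(3)] comm'[OF lt(1) lt(4)]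
 comm'[OF lt(2) lt(1)] comm'[OF lt(2) lt(2)] comm'[OF lt(2) lt(3)] comm'[OF lt(2) lt(4)]
 comm'[OF lt(3) lt(1)] comm'[OF lt(3) lt(2)] comm'[OF lt(3) lt(3)] comm'[OF lt(3) lt(4)]
 comm'[OF lt(4) lt(1)] comm'[OF lt(4) lt(2)] comm'[OF lt(4) lt(3)] comm'[OF lt(4) lt(4)]
 have KL: "f (LK a) * (f (LKinv a) * t) = t" "f (LKinv a) * (f (LK a) * t) = t" if "a : {1..n}" for a t
 using f.KL[OF that] f.LK[OF that] by (metis mult.assoc mult_1)+
 have q0: "q ~= 0" by (rule f.q0)
 show ?thesis
 proof
 fix a b assume ab: "a : {1..n}" "b : {1..n}"
 have comm1: "tw (f x) 1 (g y)" "tw (g y) 1 (f x)" if "x : letters n" "y : letters n" for x y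
 using comm[OF that] by (simp_all add: tw_def)
 show "DD f g (LK a) * DD f g (LKinv a) = 1" "DD f g (LKinv a) * DD f g (LK a) = 1"
 using ab by (simp_all add: mult.assoc c' KL f.KL f.LK g.KL g.LK)
 show "DD f g (LK a) * DD f g (LK b) = DD f g (LK b) * DD f g (LK a)"
 using ab by (simp add: comm_mult f.KK g.KK c)
 have "tw (f (LK a) * g (LK a)) (q powi cartan a b * 1) (f (LE b))"
 by (intro tw_mult_left f.KE comm1 lt ab)
 moreover have "tw (f (LK a) * g (LK a)) (1 * (1 * q powi cartan a b)) (f (LK b) * g (LE b))"
 using tw_mult_right[of "f (LK a) * g (LK a)" "1 * 1" "f (LK b)" "1 * q powi cartan a b" "g (LE b)"]
 tw_mult_left[of "f (LK a)" 1 "f (LK b)" "g (LK a)" 1] tw_mult_left[of "f (LK a)" 1 "g (LE b)" "g (LK a)" "q powi cartan a b"]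
 comm1 lt ab g.KE[OF ab] f.KK[OF ab] by (simp add: tw_def)
 ultimately show "tw (DD f g (LK a)) (q powi cartan a b) (DD f g (LE b))"
 by (simp add: tw_add_right)
 have "tw (f (LK a) * g (LK a)) (1 * q powi (- cartan a b)) (g (LF b))"
 by (intro tw_mult_left g.KF comm1 lt ab)
 moreover have "tw (f (LK a) * g (LK a)) ((q powi (- cartan a b) * 1) * (1 * 1)) (f (LF b) * g (LKinv b))"
 using f.KF[OF ab] comm1 lt ab f.KK[OF ab] g.inv_comm(2)[OF ab(2,1)]
 by (intro tw_mult_right tw_mult_left) (auto simp: tw_def)
 ultimately show "tw (DD f g (LK a)) (q powi (- cartan a b)) (DD f g (LF b))"
 by (simp add: tw_add_right)
 show "DD f g (LE a) * DD f g (LF b) - DD f g (LF b) * DD f g (LE a) =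
 (if a = b then (1 / (q - inverse q)) *. (DD f g (LK a) - DD f g (LKinv a)) else 0)"
 proof -
 have 1: "f (LK a) * f (LF b) = q powi (- cartan a b) *. (f (LF b) * f (LK a))"
 "f (LK a) * (f (LF b) * t) = q powi (- cartan a b) *. (f (LF b) * (f (LK a) * t))" for t
 using f.KF[OF ab] by (simp_all add: twD twD3)
 have 2: "g (LKinv b) * g (LE a) = q powi (- cartan a b) *. (g (LE a) * g (LKinv b))"
 "g (LKinv b) * (g (LE a) * t) = q powi (- cartan a b) *. (g (LE a) * (g (LKinv b) * t))" for t
 using g.LE_tw[OF ab(2,1)] by (simp_all add: twD twD3 cartan_sym)
 have "DD f g (LE a) * DD f g (LF b) - DD f g (LF b) * DD f g (LE a) =
 (f (LE a) * f (LF b) - f (LF b) * f (LE a)) * g (LKinv b) + f (LK a) * (g (LE a) * g (LF b) - g (LF b) * g (LE a))"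
 using ab by (simp add: algebra_simps csimps c c' 1 2)
 also have "... = (if a = b then (1 / (q - inverse q)) *. (DD f g (LK a) - DD f g (LKinv a)) else 0)"
 unfolding f.EF[OF ab] g.EF[OF ab] by (cases "a = b") (simp_all add: algebra_simps csimps)
 finally show ?thesis .
 qed
 have E: "g (LE x) * f (LK y) = f (LK y) * g (LE x)" if "x : {1..n}" "y : {1..n}" for x y
 using that by (simp add: c)
 show "DD f g (LE a) * DD f g (LE b) = DD f g (LE b) * DD f g (LE a)" if z: "cartan a b = 0"
 proof -
 have z': "cartan b a = 0" using z by (simp add: cartan_sym)
 note r = f.tw_nonadj(1)[OF ab z] f.tw_nonadj(1)[OF ab(2,1) z'] f.KK[OF ab] f.EE[OF ab z] g.EE[OF ab z]
 have r3: "x * y = y * x ==> x * (y * t) = y * (x * t)" for x y t :: 'r by (metis mult.assoc)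
 show ?thesis using ab by (simp add: algebra_simps c c' r r3[OF r(1)] r3[OF r(2)] r3[OF r(3)] r3[OF r(4)] r3[OF r(5)])
 qed
 show "DD f g (LF a) * DD f g (LF b) = DD f g (LF b) * DD f g (LF a)" if z: "cartan a b = 0"
 proof -
 have z': "cartan b a = 0" using z by (simp add: cartan_sym)
 note r = g.tw_nonadj(4)[OF ab z] g.tw_nonadj(4)[OF ab(2,1) z'] g.inv_comm(1)[OF ab] f.FF[OF ab z] g.FF[OF ab z]
 have r3: "x * y = y * x ==> x * (y * t) = y * (x * t)" for x y t :: 'r by (metis mult.assoc)
 show ?thesis using ab by (simp add: algebra_simps c c' r r3[OF r(1)] r3[OF r(2)] r3[OF r(3)] r3[OF r(4)] r3[OF r(5)])
 qed
 show "qserre q (DD f g (LE a)) (DD f g (LE b))" if z: "cartan a b = -1"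
 proof -
 have z': "cartan b a = -1" using z by (simp add: cartan_sym)
 have "qserre q (g (LE a) * f (LK a)) (g (LE b) * f (LK b))"
 by (rule qserre_twist[OF q0 g.serreE[OF ab z], of _ 1 1]) (use ab in \<open>simp_all add: tw_def c f.KK\<close>)
 hence "qserre q (f (LK a) * g (LE a)) (f (LK b) * g (LE b))" using ab by (simp add: c)
 thus ?thesis unfolding DD.simps
 by (intro qserre_sum q0 f.serreE[OF ab z])
 (use ab f.tw_same(1)[OF ab(1)] f.tw_adj(1)[OF ab z] f.tw_adj(1)[OF ab(2,1) z'] in
 \<open>simp_all add: mult.assoc c tw_def scl scr flip: mult.assoc[of "f (LK _)" "f (LE _)"]\<close>)
 qed
 show "qserre q (DD f g (LF a)) (DD f g (LF b))" if z: "cartan a b = -1"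
 proof -
 have z': "cartan b a = -1" using z by (simp add: cartan_sym)
 have Y: "qserre q (f (LF a) * g (LKinv a)) (f (LF b) * g (LKinv b))"
 by (rule qserre_twist[OF q0 f.serreF[OF ab z], of _ 1 1]) (use ab in \<open>simp_all add: tw_def c g.inv_comm\<close>)
 have "qserre q (g (LF a) + f (LF a) * g (LKinv a)) (g (LF b) + f (LF b) * g (LKinv b))"
 by (intro qserre_sum q0 g.serreF[OF ab z] Y)
 (use ab g.tw_same(4)[OF ab(1)] g.tw_adj(4)[OF ab z] g.tw_adj(4)[OF ab(2,1) z'] in
 \<open>simp_all add: mult.assoc c' tw_def scl scr\<close>)
 thus ?thesis by (simp add: add.commute)
 qed
 qed (use f.q0 f.q2 f.q4 in auto)
qed

section \<open>The automorphism psi on generators\<close>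

fun PP :: "complex => (letter => 'r::calg) => letter => 'r" where
 "PP q f (LE a) = inverse q *. (f (LE a) * f (LKinv a))"
| "PP q f (LF a) = inverse q *. (f (LF a) * f (LK a))"
| "PP q f (LK a) = f (LK a)"
| "PP q f (LKinv a) = f (LKinv a)"

lemma (in qgroup) qgroup_PP: "qgroup n (PP q f) q"
proof (rule qgroup_wtI[where \<sigma> = simple_root])
 fix a b assume ab: "a : {1..n}" "b : {1..n}"
 have L: "wt (f (LKinv b)) 0" "wt (f (LK b)) 0"
 using wt_K[of "simple_root b"] wt_K[of "- simple_root b"] Kf_simple[OF ab(2)] by simp_all
 show "wt (PP q f (LE b)) (simple_root b)" "wt (PP q f (LF b)) (- simple_root b)"
 using wt_scale[OF wt_mult[OF wt_E[OF ab(2)] L(1)]] wt_scale[OF wt_mult[OF wt_F[OF ab(2)] L(2)]] by simp_all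
 have t: "f (LKinv a) * f (LF b) = q powi cartan a b *. (f (LF b) * f (LKinv a))"
 "f (LKinv a) * (f (LF b) * s) = q powi cartan a b *. (f (LF b) * (f (LKinv a) * s))"
 "f (LK b) * f (LE a) = q powi cartan a b *. (f (LE a) * f (LK b))"
 "f (LK b) * (f (LE a) * s) = q powi cartan a b *. (f (LE a) * (f (LK b) * s))" for s
 using LF_tw[OF ab] KE[OF ab(2,1)] by (simp_all add: twD twD3 cartan_sym)
 have "PP q f (LE a) * PP q f (LF b) - PP q f (LF b) * PP q f (LE a) =
 (inverse q * inverse q * q powi cartan a b) *. ((f (LE a) * f (LF b) - f (LF b) * f (LE a)) * (f (LKinv a) * f (LK b)))"
 using inv_comm(2)[OF ab] by (simp add: algebra_simps csimps t)
 also have "... = (if a = b then (1 / (q - inverse q)) *. (PP q f (LK a) - PP q f (LKinv a)) else 0)"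
 proof -
 have "inverse q * inverse q * (q * q) = 1" using q0 by (simp add: field_simps)
 thus ?thesis unfolding EF[OF ab]
 by (cases "a = b") (simp_all add: LK[OF ab(2)] power2_eq_square sc1)
 qed
 finally show "PP q f (LE a) * PP q f (LF b) - PP q f (LF b) * PP q f (LE a) =
 (if a = b then (1 / (q - inverse q)) *. (PP q f (LK a) - PP q f (LKinv a)) else 0)" .
 have r3: "x * y = y * x ==> x * (y * t) = y * (x * t)" for x y t :: 'r by (metis mult.assoc)
 show "PP q f (LE a) * PP q f (LE b) = PP q f (LE b) * PP q f (LE a)" if z: "cartan a b = 0"
 proof -
 have z': "cartan b a = 0" using z by (simp add: cartan_sym)
 have "f (LE a) * f (LKinv a) * (f (LE b) * f (LKinv b)) = f (LE b) * f (LKinv b) * (f (LE a) * f (LKinv a))"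
 using EE[OF ab z] tw_nonadj[OF ab z] tw_nonadj[OF ab(2,1) z'] inv_comm[OF ab] by (intro comm_mult) simp_all
 thus ?thesis by (simp add: scl scr)
 qed
 show "PP q f (LF a) * PP q f (LF b) = PP q f (LF b) * PP q f (LF a)" if z: "cartan a b = 0"
 proof -
 have z': "cartan b a = 0" using z by (simp add: cartan_sym)
 have "f (LF a) * f (LK a) * (f (LF b) * f (LK b)) = f (LF b) * f (LK b) * (f (LF a) * f (LK a))"
 using FF[OF ab z] tw_nonadj[OF ab z] tw_nonadj[OF ab(2,1) z'] KK[OF ab] by (intro comm_mult) simp_all
 thus ?thesis by (simp add: scl scr)
 qed
 show "qserre q (PP q f (LE a)) (PP q f (LE b))" if z: "cartan a b = -1"
 proof -
 have z': "cartan b a = -1" using z by (simp add: cartan_sym)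
 show ?thesis unfolding PP.simps
 by (intro qserre_scale qserre_twist[OF q0 serreE[OF ab z] tw_same(2) tw_adj(2) tw_adj(2)])
 (use ab z z' inv_comm in auto)
 qed
 show "qserre q (PP q f (LF a)) (PP q f (LF b))" if z: "cartan a b = -1"
 proof -
 have z': "cartan b a = -1" using z by (simp add: cartan_sym)
 show ?thesis unfolding PP.simps
 by (intro qserre_scale qserre_twist[OF q0 serreF[OF ab z] tw_same(3) tw_adj(3) tw_adj(3)])
 (use ab z z' KK in auto)
 qed
qed (use Kf_simple root_form_simple in auto)

section \<open>Root vectors along paths\<close>

text \<open>Nested to the right: the first vertex of the path is added last.\<close>
fun lroot :: "complex => (nat => 'r::calg) => nat list => 'r" where
 "lroot c g [] = 1"
| "lroot c g [a] = g a"
| "lroot c g (a # b # xs) = qc c (g a) (lroot c g (b # xs))"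

text \<open>A path in the Dynkin diagram without repetition: consecutive vertices are adjacent and no other two are.\<close>
fun path :: "nat => nat list => bool" where
 "path n [] = False"
| "path n [a] = (a : {1..n})"
| "path n (a # b # xs) = (a : {1..n} & cartan a b = -1 & (ALL c:set xs. cartan a c = 0) & path n (b # xs))"

definition rsum :: "nat list => nat => int" where
 "rsum xs = sum_list (map simple_root xs)"

lemma rsum_simps [simp]: "rsum [] = 0" "rsum (a # xs) = simple_root a + rsum xs" "rsum (xs @ ys) = rsum xs + rsum ys"
 by (simp_all add: rsum_def)

lemma path_set: "path n xs ==> set xs <= {1..n}"
 by (induction n xs rule: path.induct) auto

lemma path_Cons: "path n (a # xs) ==> xs ~= [] ==> path n xs"
 by (cases xs) auto

lemma path_Cons_iff: "xs ~= [] ==> path n (a # xs) \<longleftrightarrow>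
 a : {1..n} & cartan a (hd xs) = -1 & (ALL c:set (tl xs). cartan a c = 0) & path n xs"
 by (cases xs) auto

lemma path_append1: "path n (xs @ ys) ==> xs ~= [] ==> path n xs"
proof (induction xs)
 case (Cons a xs)
 show ?case
 proof (cases "xs = []")
 case True
 thus ?thesis using path_set[OF Cons.prems(1)] by auto
 next
 case False
 thus ?thesis using Cons by (auto simp: path_Cons_iff)
 qed
qed simp

lemma path_snoc:
 assumes "path n (xs @ [m])" "xs ~= []"
 shows "cartan (last xs) m = -1" "!!c. c : set (butlast xs) ==> cartan c m = 0"
proof -
 have "cartan (last xs) m = -1 & (ALL c:set (butlast xs). cartan c m = 0)"
 using assms
 proof (induction xs)
 case (Cons a xs)
 thus ?case by (cases "xs = []") (auto simp: path_Cons_iff)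
 qed simp
 thus "cartan (last xs) m = -1" "!!c. c : set (butlast xs) ==> cartan c m = 0" by auto
qed

lemma path_snoc_notin:
 assumes "path n (xs @ [m])" shows "m \<notin> set xs"
proof
 assume m: "m : set xs"
 hence ne: "xs ~= []" by auto
 have "set xs = insert (last xs) (set (butlast xs))"
 using ne by (metis append_butlast_last_id list.simps(15) rotate1.simps(2) set_rotate1)
 with m path_snoc(1)[OF assms ne] path_snoc(2)[OF assms ne, of m] show False by auto
qed

lemma root_form_rsum:
 assumes "set xs <= {1..n}" "m : {1..n}"
 shows "root_form n (rsum xs) (simple_root m) = (\<Sum>c\<leftarrow>xs. cartan c m)"
 using assms by (induction xs) (auto simp: root_form_add_left root_form_simple)

lemma rsum_form_snoc:
 assumes "path n (xs @ [m])" "xs ~= []"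
 shows "root_form n (rsum xs) (simple_root m) = -1"
proof -
 have "xs = butlast xs @ [last xs]" using assms(2) by simp
 hence "(\<Sum>c\<leftarrow>xs. cartan c m) = (\<Sum>c\<leftarrow>butlast xs. cartan c m) + cartan (last xs) m"
 by (metis (no_types, lifting) map_append sum_list_append sum_list_simps list.simps(8,9) add_0_right)
 also have "(\<Sum>c\<leftarrow>butlast xs. cartan c m) = (\<Sum>c\<leftarrow>butlast xs. 0)"
 using path_snoc(2)[OF assms] by (intro arg_cong[where f = sum_list] map_cong) auto
 finally show ?thesis using root_form_rsum[of xs n m] path_set[OF assms(1)] path_snoc(1)[OF assms] by simp
qed

lemma rsum_form_zero:
 assumes "set xs <= {1..n}" "m : {1..n}" "!!c. c : set xs ==> cartan c m = 0"
 shows "root_form n (rsum xs) (simple_root m) = 0"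
proof -
 have "(\<Sum>c\<leftarrow>xs. cartan c m) = (\<Sum>c\<leftarrow>xs. 0)"
 using assms(3) by (intro arg_cong[where f = sum_list] map_cong) auto
 thus ?thesis using root_form_rsum[OF assms(1,2)] by simp
qed

lemma rsum_form_Cons:
 assumes "path n (a # xs)" "xs ~= []"
 shows "root_form n (rsum xs) (simple_root a) = -1"
proof -
 obtain b ys where xs: "xs = b # ys" using assms by (cases xs) auto
 hence "(\<Sum>c\<leftarrow>xs. cartan c a) = -1 + (\<Sum>c\<leftarrow>ys. cartan c a)" using assms by (simp add: cartan_sym)
 also have "(\<Sum>c\<leftarrow>ys. cartan c a) = (\<Sum>c\<leftarrow>ys. 0)"
 using assms xs by (intro arg_cong[where f = sum_list] map_cong) (auto simp: cartan_sym)
 finally show ?thesis using root_form_rsum[of xs n a] path_set[OF assms(1)] by simp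
qed

lemma qc_comm: "u * a = a * u ==> u * b = b * u ==> u * qc c a b = qc c a b * (u::'a::calg)"
proof -
 assume a: "u * a = a * u" "u * b = b * u"
 hence "u * (a * t) = a * (u * t)" "u * (b * t) = b * (u * t)" for t by (metis mult.assoc)+
 thus ?thesis using a by (simp add: qc_def algebra_simps csimps)
qed

lemma lroot_comm: "(!!a. a : set xs ==> u * g a = g a * u) ==> u * lroot c g xs = lroot c g xs * u"
 by (induction c g xs rule: lroot.induct) (auto intro!: qc_comm)

lemma lroot_cong: "(!!a. a : set xs ==> g a = h a) ==> lroot c g xs = lroot c h xs"
 by (induction c g xs rule: lroot.induct) auto

lemma qc_assoc: "A * X = X * A ==> qc c (qc c A B) X = qc c A (qc c B (X::'a::calg))"
proof -
 assume a: "A * X = X * A"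
 hence "A * (X * t) = X * (A * t)" for t by (metis mult.assoc)
 with a show ?thesis by (simp add: qc_def algebra_simps csimps)
qed

lemma lroot_Cons: "xs ~= [] ==> lroot c g (a # xs) = qc c (g a) (lroot c g xs)"
 by (cases xs) auto

lemma lroot_snoc:
 assumes "path n (xs @ [m])" "xs ~= []"
 and "!!a b. a : {1..n} ==> b : {1..n} ==> cartan a b = 0 ==> g a * g b = g b * g a"
 shows "lroot c g (xs @ [m]) = qc c (lroot c g xs) (g m)"
 using assms(1,2)
proof (induction xs)
 case (Cons a xs)
 show ?case
 proof (cases "xs = []")
 case False
 hence p: "path n (xs @ [m])" "cartan a m = 0" using Cons.prems by (auto simp: path_Cons_iff)
 have "g a * g m = g m * g a"
 using path_set[OF Cons.prems(1)] p(2) by (intro assms(3)) auto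
 thus ?thesis using Cons.IH[OF p(1) False] False by (simp add: lroot_Cons qc_assoc)
 qed simp
qed simp

lemma lroot_T:
 assumes p: "path n (a # xs)" "xs ~= []"
 and g: "!!a b. a : {1..n} ==> b : {1..n} ==> cartan a b = 0 ==> g a * g b = g b * g a"
 and h: "!!b. b : {1..n} ==> h b = (if a = b then u else if cartan a b = -1 then qc c (g a) (g b) else g b)"
 shows "lroot c h xs = lroot c g (a # xs)"
proof (cases xs)
 case (Cons b ys)
 have ab: "a : {1..n}" "b : {1..n}" "cartan a b = -1" "a ~= b" "set ys <= {1..n}"
 using p path_set[OF p(1)] Cons by auto
 have hb: "h b = qc c (g a) (g b)" using h[OF ab(2)] ab by simp
 have ya: "cartan a x = 0" if "x : set ys" for x using p Cons that by simp
 hence yne: "a ~= x" if "x : set ys" for x using that by force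
 have hy: "h x = g x" if "x : set ys" for x
 using h[of x] ab(5) ya[OF that] yne[OF that] that by auto
 have 1: "lroot c h ys = lroot c g ys" by (rule lroot_cong) (rule hy)
 have 2: "g a * lroot c g ys = lroot c g ys * g a"
 by (rule lroot_comm) (use ab ya in \<open>auto intro!: g\<close>)
 show ?thesis
 using Cons by (cases "ys = []") (simp_all add: hb lroot_Cons 1 qc_assoc[OF 2])
qed (use p in simp)

context qgroup begin

abbreviation "Ef a \<equiv> f (LE a)"
abbreviation "Ff a \<equiv> f (LF a)"

definition "eroot xs = lroot (inverse q) (%a. f (LE a)) xs"
definition "froot xs = lroot q (%a. f (LF a)) xs"

lemma wt_eroot: "set xs <= {1..n} ==> wt (eroot xs) (rsum xs)"
 unfolding eroot_def by (induction xs rule: induct_list012) (auto intro!: wt_qc wt_E wt_1 simp: add.assoc wt_1[unfolded zero_fun_def])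

lemma wt_froot: "set xs <= {1..n} ==> wt (froot xs) (- rsum xs)"
 unfolding froot_def
proof (induction xs rule: induct_list012)
 case (3 a b xs)
 have "wt (qc q (f (LF a)) (lroot q (%a. f (LF a)) (b # xs))) (- simple_root a + - rsum (b # xs))"
 using 3 by (intro wt_qc wt_F "3.IH"(2)) auto
 moreover have "- simple_root a + - rsum (b # xs) = - rsum (a # b # xs)" by (simp add: fun_eq_iff)
 ultimately show ?case by (simp only: lroot.simps)
qed (auto intro: wt_F wt_1)

lemma eroot_snoc: "path n (xs @ [m]) ==> xs ~= [] ==> eroot (xs @ [m]) = qc (inverse q) (eroot xs) (Ef m)"
 unfolding eroot_def by (rule lroot_snoc) (auto intro: EE)

lemma froot_snoc: "path n (xs @ [m]) ==> xs ~= [] ==> froot (xs @ [m]) = qc q (froot xs) (Ff m)"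
 unfolding froot_def by (rule lroot_snoc) (auto intro: FF)

lemma eroot_single [simp]: "eroot [a] = Ef a" by (simp add: eroot_def)
lemma froot_single [simp]: "froot [a] = Ff a" by (simp add: froot_def)
lemma eroot_Cons: "xs ~= [] ==> eroot (a # xs) = qc (inverse q) (Ef a) (eroot xs)" by (simp add: eroot_def lroot_Cons)
lemma froot_Cons: "xs ~= [] ==> froot (a # xs) = qc q (Ff a) (froot xs)" by (simp add: froot_def lroot_Cons)

lemma eroot_TT: "path n (a # xs) ==> xs ~= [] ==> lroot (inverse q) (%b. TT n q a f (LE b)) xs = eroot (a # xs)"
 unfolding eroot_def by (rule lroot_T) (auto intro: EE)

lemma froot_TI: "path n (a # xs) ==> xs ~= [] ==> lroot q (%b. TI n q a f (LF b)) xs = froot (a # xs)"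
 unfolding froot_def by (rule lroot_T) (auto intro: FF)

lemma froot_TT:
 assumes p: "path n (a # xs)" "xs ~= []"
 shows "lroot q (%b. TT n q a f (LF b)) (a # xs) = froot xs"
proof -
 have a: "a : {1..n}" using path_set[OF p(1)] by auto
 interpret t: qgroup n "TT n q a f" q by (rule qgroup_TT[OF a])
 have "lroot q (%b. TT n q a f (LF b)) (a # xs) = lroot q (%b. TI n q a (TT n q a f) (LF b)) xs"
 using t.froot_TI[OF p] by (simp add: t.froot_def)
 also have "... = froot xs"
 unfolding froot_def using path_set[OF p(1)] by (intro lroot_cong TI_TT_F[OF a]) auto
 finally show ?thesis .
qed

lemma eroot_prefix_base:
 assumes p: "path n (a # ys)" "ys ~= []"
 shows "Ef a * eroot (a # ys) = q *. (eroot (a # ys) * Ef a)"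
proof -
 obtain b zs where ys: "ys = b # zs" using p by (cases ys) auto
 have ab: "a : {1..n}" "b : {1..n}" "cartan a b = -1" "set zs <= {1..n}"
 using p path_set[OF p(1)] ys by auto
 let ?y = "qc (inverse q) (Ef a) (Ef b)"
 have y: "Ef a * ?y = q *. (?y * Ef a)"
 using serreE[OF ab(1-3)] by (simp add: qserre_qc[OF q0])
 show ?thesis
 proof (cases "zs = []")
 case True
 thus ?thesis using y ys by (simp add: eroot_Cons)
 next
 case False
 have 2: "Ef a * eroot zs = eroot zs * Ef a"
 unfolding eroot_def by (rule lroot_comm) (use ab p ys in \<open>auto intro!: EE\<close>)
 have "eroot (a # ys) = qc (inverse q) ?y (eroot zs)"
 using False by (simp add: ys eroot_Cons qc_assoc[OF 2])
 moreover have t: "tw (Ef a) q ?y" "tw (Ef a) 1 (eroot zs)"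
 using y 2 by (simp_all add: tw_def)
 moreover have "tw (Ef a) q (?y * eroot zs)" "tw (Ef a) q (eroot zs * ?y)"
 using tw_mult_right[OF t(1) t(2)] tw_mult_right[OF t(2) t(1)] by simp_all
 ultimately have "tw (Ef a) q (eroot (a # ys))"
 unfolding qc_def[of _ ?y] by (auto intro!: tw_diff_right tw_scale_right)
 thus ?thesis by (simp add: tw_def)
 qed
qed

end

text \<open>Moving the first vertex of the path across reduces the claim to the same claim for shorter paths, since the Lusztig map at that vertex removes it; the base case is a Serre relation.\<close>
lemma eroot_prefix:
 fixes f :: "letter => 'r::calg"
 assumes "qgroup n f q" "path n (xs @ ys)" "xs ~= []" "ys ~= []"
 shows "qgroup.eroot f q xs * qgroup.eroot f q (xs @ ys) = q *. (qgroup.eroot f q (xs @ ys) * qgroup.eroot f q xs)"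
 using assms
proof (induction xs arbitrary: f)
 case (Cons a xs)
 interpret qgroup n f q by fact
 have a: "a : {1..n}" using path_set[OF Cons.prems(2)] by auto
 show ?case
 proof (cases "xs = []")
 case True
 thus ?thesis using eroot_prefix_base[of a ys] Cons.prems by simp
 next
 case False
 interpret t: qgroup n "TT n q a f" q by (rule qgroup_TT[OF a])
 have p: "path n (xs @ ys)" "path n (a # xs)" using Cons.prems False path_append1[of n "a # xs" ys]
 by (auto dest: path_Cons)
 have "t.eroot xs * t.eroot (xs @ ys) = q *. (t.eroot (xs @ ys) * t.eroot xs)"
 by (rule Cons.IH[OF t.qgroup_axioms p(1) False Cons.prems(4)])
 thus ?thesis
 using eroot_TT[OF p(2) False] eroot_TT[of a "xs @ ys"] Cons.prems False by (simp add: t.eroot_def)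
 qed
qed simp

context qgroup begin

text \<open>The two paths leave \<open>a\<close> on opposite sides; the remaining vertices commute, which leaves a Serre-type identity for the triple at \<open>a\<close>.\<close>
lemma eroot_opposite:
 assumes p: "path n (a # xs)" "path n (a # ys)" "xs ~= []" "ys ~= []"
 and c: "!!b c. b : set xs ==> c : set ys ==> cartan b c = 0"
 shows "eroot (a # xs) * eroot (a # ys) = eroot (a # ys) * eroot (a # xs)"
proof -
 have a: "a : {1..n}" using path_set[OF p(1)] by auto
 interpret t: qgroup n "TT n q a f" q by (rule qgroup_TT[OF a])
 have "t.eroot xs * TT n q a f (LE c) = TT n q a f (LE c) * t.eroot xs" if "c : set ys" for c
 unfolding t.eroot_def
 by (rule lroot_comm[symmetric])
 (use that c path_set[OF p(1)] path_set[OF p(2)] in \<open>auto simp del: TT.simps simp: cartan_sym intro!: t.EE\<close>)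
 hence "t.eroot xs * t.eroot ys = t.eroot ys * t.eroot xs"
 unfolding t.eroot_def[of ys] by (rule lroot_comm)
 thus ?thesis
 using eroot_TT[OF p(1,3)] eroot_TT[OF p(2,4)] by (simp add: t.eroot_def)
qed

text \<open>The \<open>F\<close>-relations follow from the \<open>E\<close>-relations: interchanging \<open>E\<close> with \<open>F\<close> gives a family with parameter \<open>q\<^sup>-\<^sup>1\<close>.\<close>
lemma qgroup_flip: "qgroup n (f \<circ> swapEF \<circ> swapK) (inverse q)"
 using qgroup.qgroup_swapK[OF qgroup_swapEF] .

lemma froot_flip: "qgroup.eroot (f \<circ> swapEF \<circ> swapK) (inverse q) xs = froot xs"
 using qgroup.eroot_def[OF qgroup_flip] by (simp add: froot_def)

lemma froot_prefix:
 assumes "path n (xs @ ys)" "xs ~= []" "ys ~= []"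
 shows "froot xs * froot (xs @ ys) = inverse q *. (froot (xs @ ys) * froot xs)"
 using eroot_prefix[OF qgroup_flip assms] by (simp add: froot_flip)

lemma froot_opposite:
 assumes p: "path n (a # xs)" "path n (a # ys)" "xs ~= []" "ys ~= []"
 and c: "!!b c. b : set xs ==> c : set ys ==> cartan b c = 0"
 shows "froot (a # xs) * froot (a # ys) = froot (a # ys) * froot (a # xs)"
 using qgroup.eroot_opposite[OF qgroup_flip p c] by (simp add: froot_flip)

section \<open>Shifted root vectors\<close>

text \<open>The image of a root vector under psi, up to a power of \<open>q\<close>.\<close>
definition Gr :: "nat list => 'r" where
 "Gr xs = eroot xs * Kf (- rsum xs)"

text \<open>The factor \<open>E\<^sub>m K\<^sub>m\<^sup>-\<^sup>1\<close> with which a path is prolonged.\<close>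
definition Xf :: "nat => 'r" where
 "Xf m = f (LE m) * f (LKinv m)"

text \<open>The shifted root vector with character value \<open>lam\<close>. A path of one vertex is special because what is left after removing the first vertex is empty, and the coefficient \<open>1 - q\<^sup>-\<^sup>2\<close> comes from cutting an edge.\<close>
definition ebar :: "complex => nat list => 'r" where
 "ebar lam xs = eroot xs * Kf (- rsum xs) + (if tl xs = [] then lam *. Kf (- rsum xs)
 else ((1 - inverse q * inverse q) * lam) *. (eroot (tl xs) * Kf (- rsum xs)))"

definition fbar :: "complex => nat list => 'r" where
 "fbar kap xs = froot xs + (if tl xs = [] then kap *. f (LKinv (hd xs))
 else ((inverse q - q) * kap) *. (froot (tl xs) * f (LKinv (hd xs))))"

lemma powi_m1: "q powi (-1) = inverse q" by (simp add: power_int_minus)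

lemma tl_snoc: "xs ~= [] ==> tl (xs @ [m]) = tl xs @ [m]" by (cases xs) auto

lemma snoc_step:
 assumes m: "m : {1..n}" and \<beta>: "root_form n \<beta> (simple_root m) = -1" and A: "wt A \<alpha>"
 shows "inverse q *. qc (inverse q) (A * Kf (- \<beta>)) (Xf m) =
 (A * Ef m - (inverse q * inverse q * q powi (- root_form n (simple_root m) \<alpha>)) *. (Ef m * A)) * Kf (- \<beta> + - simple_root m)"
proof -
 have L: "f (LKinv m) = Kf (- simple_root m)" using Kf_simple[OF m] by simp
 have 1: "Kf (- \<beta>) * (Ef m * t) = q *. (Ef m * (Kf (- \<beta>) * t))" for t
 using Kf_wt[OF wt_E[OF m], of "- \<beta>"] \<beta> by (simp add: root_form_uminus_left twD3)
 have 2: "Kf (- simple_root m) * (A * t) = q powi (- root_form n (simple_root m) \<alpha>) *. (A * (Kf (- simple_root m) * t))" for t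
 using Kf_wt[OF A, of "- simple_root m"] by (simp add: root_form_uminus_left twD3)
 show ?thesis unfolding Kf_add
 using q0 Kf_comm[of "- simple_root m" "- \<beta>"]
 by (simp add: qc_def Xf_def L algebra_simps csimps 1 2 sc1)
qed

text \<open>The shifted vector of a path arises from that of a shorter path just as for unshifted vectors: the correction term concerns the first vertex only, far from the new end.\<close>
lemma ebar_snoc:
 assumes p: "path n (xs @ [m])" "xs ~= []"
 shows "ebar lam (xs @ [m]) = inverse q *. qc (inverse q) (ebar lam xs) (Xf m)"
proof -
 have m: "m : {1..n}" and xs: "set xs <= {1..n}" using path_set[OF p(1)] by auto
 have \<beta>: "root_form n (rsum xs) (simple_root m) = -1" by (rule rsum_form_snoc[OF p])
 have qq: "inverse q * inverse q * q = inverse q" using q0 by simp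
 have K: "Kf (- rsum (xs @ [m])) = Kf (- rsum xs + - simple_root m)" by (simp add: algebra_simps)
 have 1: "inverse q *. qc (inverse q) (eroot xs * Kf (- rsum xs)) (Xf m) = eroot (xs @ [m]) * Kf (- rsum xs + - simple_root m)"
 using snoc_step[OF m \<beta> wt_eroot[OF xs]] \<beta> eroot_snoc[OF p] root_form_sym[of n "rsum xs" "simple_root m"]
 by (simp add: qq qc_def)
 have lin: "inverse q *. qc (inverse q) (u + c *. v) w = inverse q *. qc (inverse q) u w + c *. inverse q *. qc (inverse q) v w" for u v w :: 'r and c
 by (simp add: qc_def algebra_simps csimps)
 show ?thesis
 proof (cases "tl xs = []")
 case True
 then obtain a where a: "xs = [a]" using p by (cases xs) auto
 have "inverse q *. qc (inverse q) (Kf (- rsum xs)) (Xf m) = (1 - inverse q * inverse q) *. (Ef m * Kf (- rsum xs + - simple_root m))"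
 using snoc_step[OF m \<beta> wt_1] by (simp add: algebra_simps csimps sc1)
 thus ?thesis
 unfolding ebar_def K using True 1 a by (simp add: lin mult.commute)
 next
 case False
 then obtain a b ys where a: "xs = a # b # ys" by (cases xs; cases "tl xs") auto
 have p2: "path n (tl xs @ [m])" using path_Cons[of n a "tl xs @ [m]"] p(1) a by simp
 have \<beta>2: "root_form n (simple_root m) (rsum (tl xs)) = -1"
 using rsum_form_snoc[OF p2] False by (simp add: root_form_sym)
 have "set (tl xs) <= {1..n}" using xs a by auto
 from snoc_step[OF m \<beta> wt_eroot[OF this]] have
 "inverse q *. qc (inverse q) (eroot (tl xs) * Kf (- rsum xs)) (Xf m) = eroot (tl xs @ [m]) * Kf (- rsum xs + - simple_root m)"
 using eroot_snoc[OF p2 False] by (simp add: qq qc_def \<beta>2)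
 thus ?thesis
 unfolding ebar_def K using False 1 p(2) by (simp add: lin tl_snoc)
 qed
qed

lemma fbar_snoc:
 assumes p: "path n (xs @ [m])" "xs ~= []"
 shows "fbar kap (xs @ [m]) = qc q (fbar kap xs) (Ff m)"
proof -
 have m: "m : {1..n}" and xs: "set xs <= {1..n}" using path_set[OF p(1)] by auto
 have lin: "qc q (u + c *. v) w = qc q u w + c *. qc q v w" for u v w :: 'r and c
 by (simp add: qc_def algebra_simps csimps)
 show ?thesis
 proof (cases "tl xs = []")
 case True
 then obtain a where a: "xs = [a]" using p by (cases xs) auto
 have "cartan a m = -1" "a : {1..n}" using p a by auto
 hence "qc q (f (LKinv a)) (Ff m) = (inverse q - q) *. (Ff m * f (LKinv a))"
 using tw_adj(4)[of a m] m by (simp add: qc_def twD csimps)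
 thus ?thesis
 unfolding fbar_def froot_snoc[OF p] using a by (simp add: lin mult.commute)
 next
 case False
 then obtain a b ys where a: "xs = a # b # ys" by (cases xs; cases "tl xs") auto
 have p2: "path n (tl xs @ [m])" using path_Cons[of n a "tl xs @ [m]"] p(1) a by simp
 have "cartan a m = 0" "a : {1..n}" using p a by auto
 from tw_nonadj(4)[OF this(2) m this(1)] have c: "f (LKinv a) * Ff m = Ff m * f (LKinv a)" .
 have "qc q (froot (tl xs) * f (LKinv a)) (Ff m) = qc q (froot (tl xs)) (Ff m) * f (LKinv a)"
 using c by (simp add: qc_def algebra_simps csimps)
 hence "qc q (froot (tl xs) * f (LKinv a)) (Ff m) = froot (tl xs @ [m]) * f (LKinv a)"
 using froot_snoc[OF p2 False] by simp
 thus ?thesis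
 unfolding fbar_def froot_snoc[OF p] using False a by (simp add: lin)
 qed
qed

lemma ebar_F:
 assumes xs: "set xs <= {1..n}" and m: "m : {1..n}" "m \<notin> set xs"
 shows "tw (ebar lam xs) (q powi root_form n (rsum xs) (simple_root m)) (Ff m)"
proof -
 have E: "tw (eroot ys) (1::complex) (Ff m)" if "set ys <= set xs" for ys
 proof -
 have "Ff m * eroot ys = eroot ys * Ff m"
 unfolding eroot_def by (rule lroot_comm) (use EF_diff[symmetric] that xs m in blast)
 thus ?thesis by (simp add: tw_def)
 qed
 have K: "tw (Kf (- rsum xs)) (q powi root_form n (rsum xs) (simple_root m)) (Ff m)"
 using Kf_wt[OF wt_F[OF m(1)], of "- rsum xs"] by (simp add: root_form_uminus_left root_form_uminus_right)
 have t: "set (tl xs) <= set xs" by (cases xs) auto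
 have "tw (eroot ys * Kf (- rsum xs)) (q powi root_form n (rsum xs) (simple_root m)) (Ff m)" if "set ys <= set xs" for ys
 using tw_mult_left[OF E[OF that] K] by simp
 thus ?thesis unfolding ebar_def using K t by (auto intro!: tw_add_left tw_scale_left)
qed

lemma fbar_X:
 assumes xs: "set xs <= {1..n}" "xs ~= []" and m: "m : {1..n}" "m \<notin> set xs"
 shows "tw (Xf m) (q powi root_form n (rsum xs) (simple_root m)) (fbar kap xs)"
proof -
 have L: "f (LKinv m) = Kf (- simple_root m)" using Kf_simple[OF m(1)] by simp
 have F: "tw (Xf m) (q powi root_form n (rsum ys) (simple_root m)) (froot ys)" if "set ys <= set xs" for ys
 proof -
 have "Ef m * froot ys = froot ys * Ef m"
 unfolding froot_def by (rule lroot_comm) (use EF_diff that xs m in blast)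
 hence "tw (Ef m) 1 (froot ys)" by (simp add: tw_def)
 moreover have "tw (f (LKinv m)) (q powi root_form n (rsum ys) (simple_root m)) (froot ys)"
 using Kf_wt[OF wt_froot, of ys "- simple_root m"] that xs
 by (simp add: L root_form_uminus_left root_form_uminus_right root_form_sym[of n "simple_root m"])
 ultimately show ?thesis unfolding Xf_def using tw_mult_left by fastforce
 qed
 obtain a ys where a: "xs = a # ys" using xs by (cases xs) auto
 have La: "f (LKinv a) = Kf (- simple_root a)" using Kf_simple[of a] xs a by simp
 have K: "tw (Xf m) (q powi root_form n (simple_root a) (simple_root m)) (f (LKinv a))"
 proof -
 have "tw (Ef m) (inverse (q powi root_form n (- simple_root a) (simple_root m))) (f (LKinv a))"
 unfolding La by (rule tw_flip[OF Kf_wt[OF wt_E[OF m(1)]]]) (use q0 in simp)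
 moreover have "tw (f (LKinv m)) 1 (f (LKinv a))"
 using Kf_comm by (simp add: tw_def L La)
 ultimately show ?thesis unfolding Xf_def using tw_mult_left q0
 by (fastforce simp: root_form_uminus_left power_int_minus)
 qed
 have "tw (Xf m) (q powi root_form n (rsum xs) (simple_root m)) (froot ys * f (LKinv a))"
 using tw_mult_right[OF F K, of ys] a q0
 by (simp add: root_form_add_left power_int_add mult.commute subset_insertI)
 thus ?thesis unfolding fbar_def using a F[of xs] K
 by (auto intro!: tw_add_right tw_scale_right)
qed

end

text \<open>With \<open>e\<close>, \<open>f\<close> the shifted vectors of a path and \<open>x\<close>, \<open>y\<close> the factors of the new vertex, the relations of the prolonged path are formal consequences of those of \<open>e\<close>, \<open>f\<close> and of \<open>x\<close>, \<open>y\<close>.\<close>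
lemma bar_step:
 fixes e f x y M :: "'a::calg"
 assumes q: "q ~= 0" and d: "d * (q - inverse q) = 1"
 and xf: "x * f = inverse q *. (f * x)" and ey: "e * y = inverse q *. (y * e)"
 and xy: "x * y - (q * q) *. (y * x) = (q * q * d) *. (1 - M)"
 and z: "(e * f - (q * q) *. (f * e)) * x = x * (e * f - (q * q) *. (f * e))"
 "(e * f - (q * q) *. (f * e)) * y = y * (e * f - (q * q) *. (f * e))"
 and N: "(q *. (e * M) - inverse q *. (M * e)) * f = f * (q *. (e * M) - inverse q *. (M * e))"
 defines "e' \<equiv> inverse q *. qc (inverse q) e x" and "f' \<equiv> qc q f y"
 shows "e * f' = q *. (f' * e)" "e' * f = q *. (f * e')" 
 "e' * f' - (q * q) *. (f' * e') = (- q) *. (e * f - f * e)"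
proof -
 define p where "p = inverse q"
 define Z where "Z = e * f - (q * q) *. (f * e)"
 have pq: "p * q = 1" "q * p = 1" "p * (q * c) = c" "q * (p * c) = c" for c using q by (simp_all add: p_def)
 have ye: "y * e = q *. (e * y)" "y * (e * t) = q *. (e * (y * t))" for t
 proof -
 show "y * e = q *. (e * y)" using ey q by simp
 thus "y * (e * t) = q *. (e * (y * t))" by (metis mult.assoc scl)
 qed
 have xf': "x * f = p *. (f * x)" "x * (f * t) = p *. (f * (x * t))" for t
 using xf by (simp_all add: p_def) (metis mult.assoc scl)
 have "e * f' - q *. (f' * e) = Z * y - y * Z"
 by (simp add: f'_def qc_def Z_def algebra_simps csimps ye pq sc1)
 thus 1: "e * f' = q *. (f' * e)" using z(2) by (simp add: Z_def)
 have "e' * f - q *. (f * e') = (p * p) *. (Z * x - x * Z)"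
 unfolding e'_def p_def[symmetric]
 by (simp add: qc_def Z_def algebra_simps csimps xf' pq sc1)
 thus 2: "e' * f = q *. (f * e')" using z(1) by (simp add: Z_def)
 define D where "D = e' * y - q *. (y * e')"
 have 2: "e' * (f * t) = q *. (f * (e' * t))" for t using 2 by (metis mult.assoc scl)
 have 3: "e' * f' - (q * q) *. (f' * e') = q *. (f * D - D * f)"
 by (simp add: f'_def qc_def D_def algebra_simps csimps 2 \<open>e' * f = q *. (f * e')\<close>)
 have "D = p *. (e * (x * y - (q * q) *. (y * x))) - (p * p * p) *. ((x * y - (q * q) *. (y * x)) * e)"
 unfolding D_def e'_def p_def[symmetric]
 by (simp add: qc_def algebra_simps csimps ye pq sc1)
 also have "... = (d * (q - p)) *. e - d *. (q *. (e * M) - p *. (M * e))"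
 unfolding xy by (simp add: algebra_simps csimps pq)
 finally have D: "D = e - d *. (q *. (e * M) - p *. (M * e))" using d by (simp add: p_def sc1)
 have "f * D - D * f = f * e - e * f - d *. (f * (q *. (e * M) - p *. (M * e)) - (q *. (e * M) - p *. (M * e)) * f)"
 unfolding D by (simp add: algebra_simps csimps)
 also have "... = f * e - e * f" using N by (simp add: p_def)
 finally show "e' * f' - (q * q) *. (f' * e') = (- q) *. (e * f - f * e)"
 unfolding 3 by (simp add: csimps)
qed

context qgroup begin

lemma XF: "m : {1..n} ==> Xf m * Ff m - (q * q) *. (Ff m * Xf m) = (q * q * (1 / (q - inverse q))) *. (1 - f (LKinv m) * f (LKinv m))"
proof -
 assume m: "m : {1..n}"
 have "Xf m * Ff m = (q * q) *. (Ef m * Ff m * f (LKinv m))"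
 using tw_same(4)[OF m] by (simp add: Xf_def mult.assoc twD scr power2_eq_square)
 hence "Xf m * Ff m - (q * q) *. (Ff m * Xf m) = (q * q) *. ((Ef m * Ff m - Ff m * Ef m) * f (LKinv m))"
 by (simp add: Xf_def algebra_simps csimps)
 thus ?thesis using EF_same[OF m] KL[OF m] by (simp add: algebra_simps csimps)
qed

text \<open>The terms quadratic in the inverse torus element come from the commutator of \<open>E\<close> and \<open>F\<close> and from the product of the two character terms; the hypothesis says that they cancel.\<close>
lemma bar_base:
 assumes a: "a : {1..n}" and lk: "lam * kap * (1 - q * q) = q * q / (q - inverse q)"
 shows "ebar lam [a] * fbar kap [a] - (q * q) *. (fbar kap [a] * ebar lam [a]) = (q * q / (q - inverse q)) *. 1"
proof -
 let ?L = "f (LKinv a)" and ?d = "1 / (q - inverse q)"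
 have L: "Kf (- simple_root a) = ?L" using Kf_simple[OF a] by simp
 have e: "ebar lam [a] = Xf a + lam *. ?L" by (simp add: ebar_def Xf_def L)
 have ff: "fbar kap [a] = Ff a + kap *. ?L" by (simp add: fbar_def)
 have LF: "?L * Ff a = (q * q) *. (Ff a * ?L)" using tw_same(4)[OF a] by (simp add: twD power2_eq_square)
 have "?L * Ef a = inverse (q * q) *. (Ef a * ?L)" using tw_same(2)[OF a] by (simp add: twD power2_eq_square)
 hence "?L * Xf a = inverse (q * q) *. (Xf a * ?L)"
 by (simp add: Xf_def scl flip: mult.assoc)
 moreover have "q * q ~= 0" using q0 by simp
 ultimately have LX: "(q * q) *. (?L * Xf a) = Xf a * ?L"
 by (metis calg.scale_scale right_inverse sc1)
 have "ebar lam [a] * fbar kap [a] - (q * q) *. (fbar kap [a] * ebar lam [a]) =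
 (Xf a * Ff a - (q * q) *. (Ff a * Xf a)) + kap *. (Xf a * ?L - (q * q) *. (?L * Xf a))
 + lam *. (?L * Ff a - (q * q) *. (Ff a * ?L)) + (lam * kap * (1 - q * q)) *. (?L * ?L)"
 by (simp add: e ff algebra_simps csimps)
 also have "... = (q * q * ?d) *. (1 - ?L * ?L) + (q * q / (q - inverse q)) *. (?L * ?L)"
 by (simp only: XF[OF a] LX LF lk) simp
 finally show ?thesis by (simp add: csimps)
qed

text \<open>The combination of \<open>e\<close> and the square of the inverse torus element at \<open>m\<close> that occurs in the step commutes with \<open>f\<close>; only the part of \<open>e\<close> and \<open>f\<close> that touches the last vertex matters.\<close>
lemma bar_N:
 fixes lam kap :: complex
 assumes p: "path n (xs @ [m])" "xs ~= []"
 defines "M \<equiv> f (LKinv m) * f (LKinv m)" and "e \<equiv> ebar lam xs"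
 shows "(q *. (e * M) - inverse q *. (M * e)) * fbar kap xs = fbar kap xs * (q *. (e * M) - inverse q *. (M * e))"
proof -
 have m: "m : {1..n}" and xs: "set xs <= {1..n}" using path_set[OF p(1)] by auto
 have L: "f (LKinv m) = Kf (- simple_root m)" using Kf_simple[OF m] by simp
 have E: "tw M (q * q) (eroot ys * Kf \<nu>)" if "path n (ys @ [m])" "ys ~= []" for ys \<nu>
 proof -
 have "tw (f (LKinv m)) (q powi 1 * 1) (eroot ys * Kf \<nu>)"
 using Kf_wt[OF wt_eroot, of ys "- simple_root m"] rsum_form_snoc[OF that] path_set[OF that(1)] Kf_comm
 by (intro tw_mult_right) (auto simp: L root_form_uminus_left root_form_sym[of n "simple_root m"] tw_def)
 thus ?thesis unfolding M_def using tw_mult_left by fastforce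
 qed
 show ?thesis
 proof (cases "tl xs = []")
 case True
 then obtain a where a: "xs = [a]" using p by (cases xs) auto
 have ac: "a : {1..n}" "cartan a m = -1" using p a by auto
 have La: "f (LKinv a) = Kf (- simple_root a)" using Kf_simple[OF ac(1)] by simp
 have LM: "f (LKinv a) * M = M * f (LKinv a)" unfolding M_def L La by (metis Kf_comm mult.assoc)
 have e: "e = Ef a * f (LKinv a) + lam *. f (LKinv a)" by (simp add: e_def ebar_def a La)
 have X: "M * (Ef a * f (LKinv a)) = (q * q) *. (Ef a * f (LKinv a) * M)"
 using E[OF p, of "- rsum xs"] a by (simp add: La tw_def)
 have N: "q *. (e * M) - inverse q *. (M * e) = (lam * (q - inverse q)) *. (f (LKinv a) * M)"
 unfolding e by (simp add: distrib_left distrib_right X LM csimps) (use q0 in \<open>simp add: algebra_simps\<close>)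
 have tF: "tw (f (LKinv m)) (inverse q) (Ff a)" using tw_adj(4)[of m a] ac m by (simp add: cartan_sym)
 have "tw (f (LKinv a) * M) (q\<^sup>2 * (inverse q * inverse q)) (Ff a)"
 unfolding M_def by (intro tw_mult_left tF tw_same ac)
 moreover have "q\<^sup>2 * (inverse q * inverse q) = 1" using q0 by (simp add: field_simps power2_eq_square)
 ultimately have "(f (LKinv a) * M) * Ff a = Ff a * (f (LKinv a) * M)" by (simp add: tw_def sc1)
 moreover have "(f (LKinv a) * M) * f (LKinv a) = f (LKinv a) * (f (LKinv a) * M)"
 using LM by (metis mult.assoc)
 ultimately have "(f (LKinv a) * M) * fbar kap xs = fbar kap xs * (f (LKinv a) * M)"
 by (simp add: fbar_def a distrib_left distrib_right scl scr)
 thus ?thesis unfolding N by (simp add: scl scr)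
 next
 case False
 then obtain a b ys where a: "xs = a # b # ys" by (cases xs; cases "tl xs") auto
 have p2: "path n (tl xs @ [m])" using path_Cons[of n a "tl xs @ [m]"] p(1) a by simp
 have "tw M (q * q) e" unfolding e_def ebar_def using False E[OF p] E[OF p2 False]
 by (auto intro!: tw_add_right tw_scale_right)
 hence "q *. (e * M) - inverse q *. (M * e) = 0" using q0 by (simp add: tw_def)
 thus ?thesis by simp
 qed
qed

text \<open>The step of the induction along a path: it expresses the commutator of the prolonged pair by that of the shorter pair.\<close>
lemma bar_main:
 assumes lk: "lam * kap * (1 - q * q) = q * q / (q - inverse q)"
 and "path n (xs @ [m])" "xs ~= []"
 shows "ebar lam xs * fbar kap (xs @ [m]) = q *. (fbar kap (xs @ [m]) * ebar lam xs) &
 ebar lam (xs @ [m]) * fbar kap xs = q *. (fbar kap xs * ebar lam (xs @ [m])) &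
 ebar lam (xs @ [m]) * fbar kap (xs @ [m]) - (q * q) *. (fbar kap (xs @ [m]) * ebar lam (xs @ [m])) =
 (- q) *. (ebar lam xs * fbar kap xs - fbar kap xs * ebar lam xs)"
 using assms(2,3)
proof (induction xs arbitrary: m rule: rev_induct)
 case (snoc m' xs)
 let ?ys = "xs @ [m']"
 let ?e = "ebar lam ?ys" and ?f = "fbar kap ?ys"
 have p: "path n (?ys @ [m])" and ne: "?ys ~= []" using snoc.prems by auto
 have m: "m : {1..n}" and xs: "set ?ys <= {1..n}" using path_set[OF p] by auto
 have notin: "m \<notin> set ?ys" by (rule path_snoc_notin[OF p])
 have form: "q powi root_form n (rsum ?ys) (simple_root m) = inverse q"
 by (simp only: rsum_form_snoc[OF p ne] powi_m1)
 have xf: "Xf m * ?f = inverse q *. (?f * Xf m)"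
 using fbar_X[OF xs ne m notin, of kap] by (simp only: form tw_def)
 have ey: "?e * Ff m = inverse q *. (Ff m * ?e)"
 using ebar_F[OF xs m notin, of lam] by (simp only: form tw_def)
 have z: "(?e * ?f - (q * q) *. (?f * ?e)) * x = x * (?e * ?f - (q * q) *. (?f * ?e))"
 if x: "x = Xf m \<or> x = Ff m" for x
 proof (cases "xs = []")
 case True
 thus ?thesis using bar_base[OF _ lk, of m'] xs by (simp add: scl scr)
 next
 case False
 have p': "path n ?ys" using path_append1[OF p] by simp
 have zz: "?e * ?f - (q * q) *. (?f * ?e) = (- q) *. (ebar lam xs * fbar kap xs - fbar kap xs * ebar lam xs)"
 using snoc.IH[OF p' False] by blast
 have nm: "m \<notin> set xs" "set xs <= {1..n}" using notin xs by auto
 have 0: "root_form n (rsum xs) (simple_root m) = 0"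
 by (rule rsum_form_zero[OF nm(2) m]) (use path_snoc(2)[OF p ne] in auto)
 have 3: "x * ebar lam xs = ebar lam xs * x & x * fbar kap xs = fbar kap xs * x"
 proof -
 have L: "f (LKinv m) = Kf (- simple_root m)" using Kf_simple[OF m] by simp
 have c: "Ef m * f y = f y * Ef m & Ff m * f y' = f y' * Ff m"
 if "c : set xs" "y = LE c" "y' = LF c" for c y y'
 using that EE[OF m, of c] FF[OF m, of c] path_snoc(2)[OF p ne, of c] nm by (auto simp: cartan_sym)
 have Ek: "Ef m * eroot zs = eroot zs * Ef m" "Ff m * froot zs = froot zs * Ff m" if "set zs <= set xs" for zs
 unfolding eroot_def froot_def using that c by (auto intro!: lroot_comm)
 have t: "set (tl xs) <= set xs" by (cases xs) auto
 have Kz: "Kf (- rsum xs) * Ef m = Ef m * Kf (- rsum xs)"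
 using Kf_wt[OF wt_E[OF m], of "- rsum xs"] 0 by (simp add: root_form_uminus_left tw_def)
 have LE: "f (LKinv m) * eroot zs = eroot zs * f (LKinv m)" "f (LKinv m) * froot zs = froot zs * f (LKinv m)"
 if "set zs <= set xs" for zs
 proof -
 have "root_form n (rsum zs) (simple_root m) = 0"
 by (rule rsum_form_zero) (use that nm m path_snoc(2)[OF p ne] in auto)
 thus "f (LKinv m) * eroot zs = eroot zs * f (LKinv m)" "f (LKinv m) * froot zs = froot zs * f (LKinv m)"
 using Kf_wt[OF wt_eroot, of zs "- simple_root m"] Kf_wt[OF wt_froot, of zs "- simple_root m"] that nm
 by (auto simp: L root_form_uminus_left root_form_uminus_right root_form_sym[of n "simple_root m"] tw_def)
 qed
 have hd: "hd xs : set xs" using False by simp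
 have Lh: "f (LKinv (hd xs)) * Ff m = Ff m * f (LKinv (hd xs))"
 using tw_nonadj(4)[of "hd xs" m] path_snoc(2)[OF p ne, of "hd xs"] nm m hd by auto
 have Xe: "Xf m * (eroot zs * Kf (- rsum xs)) = (eroot zs * Kf (- rsum xs)) * Xf m" if "set zs <= set xs" for zs
 unfolding Xf_def using Ek(1)[OF that] LE(1)[OF that] Kz Kf_comm by (intro comm_mult) (auto simp: L)
 have Xk: "Xf m * Kf (- rsum xs) = Kf (- rsum xs) * Xf m"
 using Xe[of "[]"] by (simp add: eroot_def)
 have "Xf m * ebar lam xs = ebar lam xs * Xf m"
 unfolding ebar_def using Xe[OF t] Xe[of xs] Xk by (simp add: distrib_left distrib_right scl scr)
 moreover have "Ff m * ebar lam xs = ebar lam xs * Ff m"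
 using ebar_F[OF nm(2) m nm(1), of lam] 0 by (simp add: tw_def)
 moreover have "Xf m * fbar kap xs = fbar kap xs * Xf m"
 using fbar_X[OF nm(2) False m nm(1), of kap] 0 by (simp add: tw_def)
 moreover have "Ff m * fbar kap xs = fbar kap xs * Ff m"
 proof -
 have "Ff m * (froot (tl xs) * f (LKinv (hd xs))) = (froot (tl xs) * f (LKinv (hd xs))) * Ff m"
 using Ek(2)[OF t] Lh by (metis mult.assoc)
 thus ?thesis unfolding fbar_def using Ek(2)[of xs] Lh
 by (simp add: distrib_left distrib_right scl scr)
 qed
 ultimately show ?thesis using x by auto
 qed
 hence "x * (ebar lam xs * fbar kap xs) = (ebar lam xs * fbar kap xs) * x"
 "x * (fbar kap xs * ebar lam xs) = (fbar kap xs * ebar lam xs) * x"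
 by (metis mult.assoc)+
 thus ?thesis unfolding zz
 by (simp only: left_diff_distrib right_diff_distrib scl scr)
 qed
 have e': "ebar lam (?ys @ [m]) = inverse q *. qc (inverse q) ?e (Xf m)" by (rule ebar_snoc[OF p ne])
 have f': "fbar kap (?ys @ [m]) = qc q ?f (Ff m)" by (rule fbar_snoc[OF p ne])
 note st = bar_step[OF q0 d1 xf ey XF[OF m] z z bar_N[OF p ne]]
 show ?case unfolding e' f' using st by blast
qed simp

lemma bar_prefix:
 assumes lk: "lam * kap * (1 - q * q) = q * q / (q - inverse q)"
 and "path n (xs @ ys)" "xs ~= []" "ys ~= []"
 shows "ebar lam xs * fbar kap (xs @ ys) = q *. (fbar kap (xs @ ys) * ebar lam xs) &
 ebar lam (xs @ ys) * fbar kap xs = q *. (fbar kap xs * ebar lam (xs @ ys))"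
 using assms(2-)
proof (induction ys rule: rev_induct)
 case (snoc m ys)
 show ?case
 proof (cases "ys = []")
 case True
 thus ?thesis using bar_main[OF lk, of xs m] snoc.prems by simp
 next
 case False
 let ?zs = "xs @ ys"
 have p: "path n (?zs @ [m])" "?zs ~= []" "path n ?zs" using snoc.prems path_append1[of n ?zs "[m]"] by auto
 have m: "m : {1..n}" and xs: "set xs <= {1..n}" "m \<notin> set xs"
 using path_set[OF p(1)] path_snoc_notin[OF p(1)] by auto
 have "set xs <= set (butlast ?zs)" using False by (auto simp: butlast_append)
 hence 0: "root_form n (rsum xs) (simple_root m) = 0"
 by (intro rsum_form_zero[OF xs(1) m]) (use path_snoc(2)[OF p(1,2)] in auto)
 have eF: "ebar lam xs * Ff m = Ff m * ebar lam xs"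
 using ebar_F[OF xs(1) m xs(2), of lam] 0 by (simp add: tw_def)
 have Xf: "Xf m * fbar kap xs = fbar kap xs * Xf m"
 using fbar_X[OF xs(1) snoc.prems(2) m xs(2), of kap] 0 by (simp add: tw_def)
 have IH: "tw (ebar lam xs) q (fbar kap ?zs)" "tw (ebar lam ?zs) q (fbar kap xs)"
 using snoc.IH[OF p(3) snoc.prems(2) False] by (simp_all add: tw_def)
 have 1: "tw (ebar lam xs) 1 (Ff m)" "tw (Xf m) 1 (fbar kap xs)" using eF Xf by (simp_all add: tw_def)
 have "tw (ebar lam xs) q (fbar kap (?zs @ [m]))"
 unfolding fbar_snoc[OF p(1,2)] qc_def
 using tw_mult_right[OF IH(1) 1(1)] tw_mult_right[OF 1(1) IH(1)] by (intro tw_diff_right tw_scale_right) simp_all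
 moreover have "tw (ebar lam (?zs @ [m])) q (fbar kap xs)"
 unfolding ebar_snoc[OF p(1,2)] qc_def
 using tw_mult_left[OF IH(2) 1(2)] tw_mult_left[OF 1(2) IH(2)] by (intro tw_scale_left tw_diff_left) simp_all
 ultimately show ?thesis by (simp add: tw_def)
 qed
qed simp

lemma bar_opposite:
 assumes lk: "lam * kap * (1 - q * q) = q * q / (q - inverse q)"
 and p: "path n (a # xs)" "path n (a # ys)" "xs ~= []" "ys ~= []"
 and c: "!!b c. b : set xs ==> c : set ys ==> cartan b c = 0"
 shows "ebar lam (a # xs) * fbar kap (a # ys) = fbar kap (a # ys) * ebar lam (a # xs)"
 using p(2,4) c
proof (induction ys rule: rev_induct)
 case (snoc m ys)
 let ?e = "ebar lam (a # xs)"
 have p2: "path n ((a # ys) @ [m])" "a # ys ~= []" using snoc.prems by auto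
 have m: "m : {1..n}" "a : {1..n}" using path_set[OF p2(1)] by auto
 have c': "cartan b m = 0" if "b : set xs" for b using snoc.prems(3)[OF that] by simp
 have mn: "m \<notin> set (a # xs)"
 using path_snoc_notin[OF p2(1)] c'[of m] by auto
 have xs: "set (a # xs) <= {1..n}" using path_set[OF p(1)] .
 have 0: "root_form n (rsum xs) (simple_root m) = 0"
 by (rule rsum_form_zero) (use xs m c' in auto)
 have F: "tw ?e (q powi cartan a m) (Ff m)"
 using ebar_F[OF xs m(1) mn, of lam] 0 m by (simp add: root_form_add_left root_form_simple)
 have f: "fbar kap (a # ys @ [m]) = qc q (fbar kap (a # ys)) (Ff m)"
 using fbar_snoc[OF p2] by simp
 show ?case
 proof (cases "ys = []")
 case True
 have am: "cartan a m = -1" using path_snoc(1)[OF p2] True by simp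
 have "tw ?e q (fbar kap [a])"
 using bar_prefix[OF lk, of "[a]" xs] p by (simp add: tw_def)
 moreover have "tw ?e (inverse q) (Ff m)" using F am by (simp add: powi_m1)
 ultimately have "tw ?e 1 (qc q (fbar kap [a]) (Ff m))"
 unfolding qc_def using tw_mult_right[of ?e q "fbar kap [a]" "inverse q" "Ff m"]
 tw_mult_right[of ?e "inverse q" "Ff m" q "fbar kap [a]"] q0
 by (intro tw_diff_right tw_scale_right) simp_all
 thus ?thesis using f True by (simp add: tw_def)
 next
 case False
 have am: "cartan a m = 0" using path_snoc(2)[OF p2, of a] False by simp
 have "path n (a # ys)" using path_append1[OF p2(1)] by simp
 hence "tw ?e 1 (fbar kap (a # ys))" using snoc.IH False snoc.prems(3) by (simp add: tw_def)
 moreover have "tw ?e 1 (Ff m)" using F am by simp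
 ultimately have "tw ?e 1 (qc q (fbar kap (a # ys)) (Ff m))"
 unfolding qc_def using tw_mult_right[of ?e 1 _ 1]
 by (intro tw_diff_right tw_scale_right) fastforce+
 thus ?thesis unfolding f by (simp add: tw_def)
 qed
qed simp

end

section \<open>Coproducts of root vectors\<close>

lemma set_Kword: "set (Kword n \<mu>) <= (\<Union>a\<in>{1..n}. {LK a, LKinv a})"
 by (auto simp: Kword_def)

lemma Kword_letters: "set (Kword n \<mu>) <= letters n"
 using set_Kword[of n \<mu>] by (fastforce simp: letters_def)

lemma prod_list_comm: "(!!x. x : set xs ==> u * g x = g x * u) ==> u * prod_list (map g xs) = prod_list (map g xs) * (u::'a::calg)"
proof (induction xs)
 case (Cons x xs)
 hence "u * g x = g x * u" "u * prod_list (map g xs) = prod_list (map g xs) * u" by auto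
 thus ?case by (simp add: mult.assoc) (metis mult.assoc)
qed simp

lemma qc_sum_right: "qc c u (\<Sum>i\<in>I. h i) = (\<Sum>i\<in>I. qc c u (h i))"
 by (simp add: qc_def sum_distrib_left sum_distrib_right calg.scale_sum_right sum_subtractf)

lemma qc_add_right: "qc c u (x + y) = qc c u x + qc c u y"
 by (simp add: qc_def algebra_simps csimps)
lemma qc_add_left: "qc c (x + y) u = qc c x u + qc c y u"
 by (simp add: qc_def algebra_simps csimps)
lemma qc_scale_right: "qc c u (d *. x) = d *. qc c u x"
 by (simp add: qc_def algebra_simps csimps)

text \<open>Two commuting families stand for the two tensor factors of the generators; their coproduct is the family \<open>h\<close>.\<close>
locale qpair = f: qgroup n f q + g: qgroup n g q
 for n :: nat and f g :: "letter => 'r::calg" and q :: complex +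
 assumes comm: "!!x y. x : letters n ==> y : letters n ==> g y * f x = f x * g y"

sublocale qpair < h: qgroup n "DD f g" q
 by (rule qgroup_DD[OF f.qgroup_axioms g.qgroup_axioms comm])

context qpair begin

definition fs :: "'r => bool" where "fs x \<longleftrightarrow> (ALL y:letters n. g y * x = x * g y)"
definition gs :: "'r => bool" where "gs u \<longleftrightarrow> (ALL x. fs x \<longrightarrow> u * x = x * u)"

lemma fs_letter: "x : letters n ==> fs (f x)" by (simp add: fs_def comm)
lemma gs_letter: "x : letters n ==> gs (g x)" by (simp add: fs_def gs_def)
lemma fs_K: "fs (f.Kf \<mu>)" unfolding fs_def kword_def using Kword_letters comm by (blast intro!: prod_list_comm)
lemma gs_K: "gs (g.Kf \<mu>)" unfolding gs_def kword_def
proof safe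
 fix x assume "fs x"
 hence "x * prod_list (map g (Kword n \<mu>)) = prod_list (map g (Kword n \<mu>)) * x"
 using Kword_letters[of n \<mu>] unfolding fs_def by (intro prod_list_comm) auto
 thus "prod_list (map g (Kword n \<mu>)) * x = x * prod_list (map g (Kword n \<mu>))" by simp
qed

lemma letters_in: "a : {1..n} ==> LE a : letters n & LF a : letters n & LK a : letters n & LKinv a : letters n"
 by (auto simp: letters_def)

lemma fs_root: assumes "set xs <= {1..n}" shows "fs (f.eroot xs)" "fs (f.froot xs)"
 unfolding fs_def f.eroot_def f.froot_def using assms letters_in comm by (blast intro!: lroot_comm)+

lemma gs_root: assumes "set xs <= {1..n}" shows "gs (g.eroot xs)" "gs (g.froot xs)"
proof -
 have *: "x * g.eroot xs = g.eroot xs * x" "x * g.froot xs = g.froot xs * x" if "fs x" for x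
 using that assms letters_in unfolding g.eroot_def g.froot_def fs_def by (auto intro!: lroot_comm)
 show "gs (g.eroot xs)" "gs (g.froot xs)" unfolding gs_def by (simp_all add: *)
qed

lemma gf: "gs u ==> fs x ==> u * x = x * u" by (simp add: gs_def)
lemma gf3: "gs u ==> fs x ==> u * (x * t) = x * (u * t)" unfolding gs_def by (metis mult.assoc)

lemma kword_DD: "h.Kf \<mu> = f.Kf \<mu> * g.Kf \<mu>"
proof -
 have "map (DD f g) (Kword n \<mu>) = map (%x. f x * g x) (Kword n \<mu>)"
 using set_Kword[of n \<mu>] by (intro map_cong) auto
 moreover have "prod_list (map (%x. f x * g x) (Kword n \<mu>)) = f.Kf \<mu> * g.Kf \<mu>"
 unfolding kword_def using Kword_letters[of n \<mu>] comm
 by (intro prod_list_mult_commuting) (auto simp: subset_iff)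
 ultimately show ?thesis unfolding kword_def by (simp only:)
qed

lemma comm3: "x * y = y * x ==> x * (y * t) = y * (x * t :: 'r)"
 by (metis mult.assoc)

text \<open>Induction on the path: adding a vertex in front either prolongs the left piece or, if the left piece is empty, starts it. All other terms cancel by the commutation rule for the torus.\<close>
lemma coprod_eroot:
 assumes "path n xs"
 shows "h.eroot xs = f.eroot xs + f.Kf (rsum xs) * g.eroot xs + (1 - inverse q * inverse q) *.
 (\<Sum>r\<in>{1..<length xs}. f.eroot (take r xs) * f.Kf (rsum (drop r xs)) * g.eroot (drop r xs))"
 using assms
proof (induction xs)
 case (Cons a ys)
 have a: "a : {1..n}" "set ys <= {1..n}" using path_set[OF Cons.prems] by auto
 show ?case
 proof (cases "ys = []")
 case True
 thus ?thesis using a by (simp add: f.Kf_simple)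
 next
 case False
 let ?p = "inverse q" and ?c = "1 - inverse q * inverse q"
 let ?T = "%r. f.eroot (take r ys) * f.Kf (rsum (drop r ys)) * g.eroot (drop r ys)"
 let ?T' = "%r. f.eroot (take r (a # ys)) * f.Kf (rsum (drop r (a # ys))) * g.eroot (drop r (a # ys))"
 let ?E = "f (LE a)" and ?K = "f (LK a)" and ?E' = "g (LE a)"
 have p: "path n ys" using Cons.prems False by (auto dest: path_Cons)
 have K: "?K = f.Kf (simple_root a)" using f.Kf_simple[OF a(1)] by simp
 have lt: "fs ?E" "fs ?K" "gs ?E'" using letters_in[OF a(1)] by (auto intro: fs_letter gs_letter)
 have sub: "set (take r ys) <= {1..n}" "set (drop r ys) <= {1..n}" for r
 using a(2) set_take_subset[of r ys] set_drop_subset[of r ys] by blast+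
 have form: "root_form n (simple_root a) (rsum ys) = -1"
 using rsum_form_Cons[OF Cons.prems False] by (simp add: root_form_sym)
 have dropform: "root_form n (rsum (drop r ys)) (simple_root a) = 0" if "r \<ge> 1" for r
 proof (rule rsum_form_zero[OF sub(2) a(1)])
 fix c assume "c : set (drop r ys)"
 hence "c : set (tl ys)" using that by (cases ys; cases r) (auto dest: in_set_dropD)
 thus "cartan c a = 0" unfolding cartan_sym[of c] using Cons.prems False by (simp add: path_Cons_iff)
 qed
 have takeform: "root_form n (simple_root a) (rsum (take r ys)) = -1" if "r \<ge> 1" for r
 proof -
 have "path n (a # take r ys)" using path_append1[of n "a # take r ys" "drop r ys"] Cons.prems by simp
 moreover have "take r ys ~= []" using that False by simp
 ultimately show ?thesis using rsum_form_Cons[of n a "take r ys"] by (simp add: root_form_sym)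
 qed
 have 1: "qc ?p ?E (f.eroot ys) = f.eroot (a # ys)" using False by (simp add: f.eroot_Cons)
 have KS: "?K * f.eroot zs = ?p *. (f.eroot zs * ?K)" "?K * (f.eroot zs * t) = ?p *. (f.eroot zs * (?K * t))"
 if "set zs <= {1..n}" "root_form n (simple_root a) (rsum zs) = -1" for zs t
 using f.Kf_wt[OF f.wt_eroot[OF that(1)], of "simple_root a"] that(2)
 by (simp_all add: K f.powi_m1 twD twD3)
 have 2: "qc ?p (?K * ?E') (f.eroot ys) = 0"
 using gf[OF lt(3) fs_root(1)[OF a(2)]] KS[OF a(2) form] by (simp add: qc_def mult.assoc)
 have KE: "f.Kf (rsum ys) * ?E = ?p *. (?E * f.Kf (rsum ys))"
 using f.Kf_wt[OF f.wt_E[OF a(1)], of "rsum ys"] form by (simp add: f.powi_m1 twD root_form_sym)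
 have KE': "f.Kf (rsum ys) * (?E * t) = ?p *. (?E * (f.Kf (rsum ys) * t))" for t
 using KE by (metis mult.assoc scl)
 have 3: "qc ?p ?E (f.Kf (rsum ys) * g.eroot ys) = ?c *. ?T' 1"
 using gf[OF gs_root(1)[OF a(2)] lt(1)] by (simp add: qc_def mult.assoc KE' csimps sc1)
 have KK: "?K * f.Kf \<mu> = f.Kf \<mu> * ?K" "?K * (f.Kf \<mu> * t) = f.Kf \<mu> * (?K * t)" for \<mu> t
 unfolding K by (rule f.Kf_comm) (rule comm3[OF f.Kf_comm])
 have 4: "qc ?p (?K * ?E') (f.Kf (rsum ys) * g.eroot ys) = f.Kf (rsum (a # ys)) * g.eroot (a # ys)"
 proof -
 have "qc ?p (?K * ?E') (f.Kf (rsum ys) * g.eroot ys) = ?K * f.Kf (rsum ys) * qc ?p ?E' (g.eroot ys)"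
 using gf3[OF lt(3) fs_K] gf3[OF gs_root(1)[OF a(2)] lt(2)]
 by (simp add: qc_def algebra_simps csimps KK)
 also have "?K * f.Kf (rsum ys) = f.Kf (rsum (a # ys))" by (simp add: K f.Kf_add)
 finally show ?thesis using False by (simp add: g.eroot_Cons)
 qed
 have 5: "qc ?p ?E (?T r) = ?T' (Suc r)" if "r \<ge> 1" for r
 proof -
 have c: "f.Kf (rsum (drop r ys)) * ?E = ?E * f.Kf (rsum (drop r ys))"
 using f.Kf_wt[OF f.wt_E[OF a(1)], of "rsum (drop r ys)"] dropform[OF that] by (simp add: tw_def)
 have "take r ys ~= []" using that False by simp
 thus ?thesis
 using gf[OF gs_root(1)[OF sub(2)] lt(1), of r] c comm3[OF c]
 by (simp add: qc_def f.eroot_Cons algebra_simps csimps)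
 qed
 have 6: "qc ?p (?K * ?E') (?T r) = 0" if "r \<ge> 1" for r
 proof -
 have "?E' * g.eroot (drop r ys) = g.eroot (drop r ys) * ?E'"
 unfolding g.eroot_def
 proof (rule lroot_comm)
 fix c assume "c : set (drop r ys)"
 hence "c : set (tl ys)" using that by (cases ys; cases r) (auto dest: in_set_dropD)
 thus "?E' * g (LE c) = g (LE c) * ?E'" using Cons.prems False a
 by (intro g.EE) (auto simp: path_Cons_iff dest: list.set_sel(2)[OF False])
 qed
 thus ?thesis
 using gf3[OF lt(3) fs_root(1)[OF sub(1)[of r]]] gf3[OF lt(3) fs_K] gf3[OF gs_root(1)[OF sub(2)] lt(2)] KS[OF sub(1) takeform[OF that]]
 by (simp add: qc_def KK mult.assoc)
 qed
 have "h.eroot (a # ys) = qc ?p (?E + ?K * ?E') (h.eroot ys)" using False by (simp add: h.eroot_Cons)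
 also have "... = f.eroot (a # ys) + f.Kf (rsum (a # ys)) * g.eroot (a # ys) + ?c *. ?T' 1
 + ?c *. ((\<Sum>r\<in>{1..<length ys}. qc ?p ?E (?T r)) + (\<Sum>r\<in>{1..<length ys}. qc ?p (?K * ?E') (?T r)))"
 unfolding Cons.IH[OF p] by (simp only: qc_add_left qc_add_right qc_scale_right qc_sum_right 1 2 3 4 sc_add_r) (simp add: sc_add_r)
 also have "(\<Sum>r\<in>{1..<length ys}. qc ?p ?E (?T r)) = (\<Sum>r\<in>{1..<length ys}. ?T' (Suc r))"
 by (intro sum.cong refl 5) auto
 also have "(\<Sum>r\<in>{1..<length ys}. qc ?p (?K * ?E') (?T r)) = 0"
 by (intro sum.neutral ballI 6) auto
 also have "f.eroot (a # ys) + f.Kf (rsum (a # ys)) * g.eroot (a # ys) + ?c *. ?T' 1 + ?c *. ((\<Sum>r\<in>{1..<length ys}. ?T' (Suc r)) + 0)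
 = f.eroot (a # ys) + f.Kf (rsum (a # ys)) * g.eroot (a # ys) + ?c *. (?T' 1 + (\<Sum>r\<in>{1..<length ys}. ?T' (Suc r)))"
 by (simp only: sc_add_r add.assoc add_0_right)
 also have "?T' 1 + (\<Sum>r\<in>{1..<length ys}. ?T' (Suc r)) = (\<Sum>r\<in>{1..<length (a # ys)}. ?T' r)"
 using False by (simp add: sum.atLeast_Suc_lessThan sum.shift_bounds_Suc_ivl del: sum.op_ivl_Suc)
 finally show ?thesis .
 qed
qed simp

lemma coprod_froot:
 assumes "path n xs"
 shows "h.froot xs = f.froot xs * g.Kf (- rsum xs) + g.froot xs + (inverse q - q) *.
 (\<Sum>r\<in>{1..<length xs}. f.froot (take r xs) * (g.froot (drop r xs) * g.Kf (- rsum (take r xs))))"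
 using assms
proof (induction xs)
 case (Cons a ys)
 have a: "a : {1..n}" "set ys <= {1..n}" using path_set[OF Cons.prems] by auto
 show ?case
 proof (cases "ys = []")
 case True
 thus ?thesis using a g.Kf_simple(2)[OF a(1)] by (simp add: fun_Compl_def)
 next
 case False
 let ?c = "inverse q - q"
 let ?T = "%r. f.froot (take r ys) * (g.froot (drop r ys) * g.Kf (- rsum (take r ys)))"
 let ?T' = "%r. f.froot (take r (a # ys)) * (g.froot (drop r (a # ys)) * g.Kf (- rsum (take r (a # ys))))"
 let ?F = "f (LF a)" and ?L = "g (LKinv a)" and ?F' = "g (LF a)"
 have p: "path n ys" using Cons.prems False by (auto dest: path_Cons)
 have L: "?L = g.Kf (- simple_root a)" using g.Kf_simple[OF a(1)] by simp
 have LL: "?L * g.Kf (- rsum zs) = g.Kf (- rsum (a # zs))" for zs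
 unfolding L by (simp flip: g.Kf_add)
 have lt: "fs ?F" "gs ?L" "gs ?F'" using letters_in[OF a(1)] by (auto intro: fs_letter gs_letter)
 have sub: "set (take r ys) <= {1..n}" "set (drop r ys) <= {1..n}" for r
 using a(2) set_take_subset[of r ys] set_drop_subset[of r ys] by blast+
 have dropc: "cartan a c = 0 & c : {1..n}" if "r \<ge> 1" "c : set (drop r ys)" for r c
 proof -
 have "c : set (tl ys)" using that by (cases ys; cases r) (auto dest: in_set_dropD)
 moreover have "c : {1..n}" using sub(2)[of r] that(2) by blast
 ultimately show ?thesis using Cons.prems False by (auto simp: path_Cons_iff)
 qed
 have takeform: "root_form n (rsum (take r ys)) (simple_root a) = -1" if "r \<ge> 1" for r
 proof -
 have "path n (a # take r ys)" using path_append1[of n "a # take r ys" "drop r ys"] Cons.prems by simp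
 moreover have "take r ys ~= []" using that False by simp
 ultimately show ?thesis using rsum_form_Cons[of n a "take r ys"] by simp
 qed
 have KF: "g.Kf (- rsum zs) * ?F' = inverse q *. (?F' * g.Kf (- rsum zs))"
 if "root_form n (rsum zs) (simple_root a) = -1" for zs
 using g.Kf_wt[OF g.wt_F[OF a(1)], of "- rsum zs"] that
 by (simp add: g.powi_m1 twD root_form_uminus_left root_form_uminus_right)
 have 1: "qc q (?F * ?L) (f.froot ys * g.Kf (- rsum ys)) = f.froot (a # ys) * g.Kf (- rsum (a # ys))"
 proof -
 have "qc q (?F * ?L) (f.froot ys * g.Kf (- rsum ys)) = qc q ?F (f.froot ys) * (?L * g.Kf (- rsum ys))"
 using gf3[OF lt(2) fs_root(2)[OF a(2)]] gf3[OF gs_K lt(1)] g.Kf_comm[of "- simple_root a"]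
 by (simp add: qc_def algebra_simps csimps L)
 thus ?thesis unfolding LL using f.froot_Cons[OF False, of a] by (simp del: rsum_simps)
 qed
 have 2: "qc q ?F' (f.froot ys * g.Kf (- rsum ys)) = 0"
 using gf3[OF lt(3) fs_root(2)[OF a(2)]] KF[OF rsum_form_Cons[OF Cons.prems False]] f.q0
 by (simp add: qc_def mult.assoc scr)
 have Lg: "?L * g.froot ys = inverse q *. (g.froot ys * ?L)"
 using g.Kf_wt[OF g.wt_froot[OF a(2)], of "- simple_root a"] rsum_form_Cons[OF Cons.prems False]
 by (simp add: L g.powi_m1 twD root_form_uminus_left root_form_uminus_right root_form_sym[of n "simple_root a"])
 have 3: "qc q (?F * ?L) (g.froot ys) = ?c *. ?T' 1"
 proof -
 have "qc q (?F * ?L) (g.froot ys) = ?F * (?L * g.froot ys) - q *. (?F * (g.froot ys * ?L))"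
 using gf3[OF gs_root(2)[OF a(2)] lt(1)] by (simp add: qc_def mult.assoc)
 thus ?thesis unfolding Lg using L by (simp add: csimps)
 qed
 have 4: "qc q ?F' (g.froot ys) = g.froot (a # ys)" using False by (simp add: g.froot_Cons)
 have 5: "qc q (?F * ?L) (?T r) = ?T' (Suc r)" if "r \<ge> 1" for r
 proof -
 have c: "?L * g.froot (drop r ys) = g.froot (drop r ys) * ?L"
 unfolding g.froot_def by (rule lroot_comm) (use dropc[OF that] a g.tw_nonadj(4) in blast)
 have "take r ys ~= []" using that False by simp
 hence "?T' (Suc r) = qc q ?F (f.froot (take r ys)) * (g.froot (drop r ys) * (?L * g.Kf (- rsum (take r ys))))"
 unfolding LL by (simp add: f.froot_Cons)
 also have "... = qc q (?F * ?L) (?T r)"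
 using gf3[OF lt(2) fs_root(2)[OF sub(1)], of r] comm3[OF c] gf3[OF gs_root(2)[OF sub(2)] lt(1)] gf3[OF gs_K lt(1)]
 g.Kf_comm[of "- simple_root a"]
 by (simp add: qc_def algebra_simps csimps L)
 finally show ?thesis by simp
 qed
 have 6: "qc q ?F' (?T r) = 0" if "r \<ge> 1" for r
 proof -
 have c: "?F' * g.froot (drop r ys) = g.froot (drop r ys) * ?F'"
 unfolding g.froot_def by (rule lroot_comm) (use dropc[OF that] a g.FF in blast)
 show ?thesis
 using gf3[OF lt(3) fs_root(2)[OF sub(1)], of r] comm3[OF c] KF[OF takeform[OF that]] f.q0
 by (simp add: qc_def mult.assoc scr)
 qed
 have "h.froot (a # ys) = qc q (?F * ?L + ?F') (h.froot ys)" using False by (simp add: h.froot_Cons)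
 also have "... = f.froot (a # ys) * g.Kf (- rsum (a # ys)) + g.froot (a # ys) + ?c *. ?T' 1
 + ?c *. ((\<Sum>r\<in>{1..<length ys}. qc q (?F * ?L) (?T r)) + (\<Sum>r\<in>{1..<length ys}. qc q ?F' (?T r)))"
 unfolding Cons.IH[OF p] by (simp only: qc_add_left qc_add_right qc_scale_right qc_sum_right 1 2 3 4 sc_add_r) (simp add: sc_add_r)
 also have "(\<Sum>r\<in>{1..<length ys}. qc q (?F * ?L) (?T r)) = (\<Sum>r\<in>{1..<length ys}. ?T' (Suc r))"
 by (intro sum.cong refl 5) auto
 also have "(\<Sum>r\<in>{1..<length ys}. qc q ?F' (?T r)) = 0"
 by (intro sum.neutral ballI 6) auto
 also have "f.froot (a # ys) * g.Kf (- rsum (a # ys)) + g.froot (a # ys) + ?c *. ?T' 1 + ?c *. ((\<Sum>r\<in>{1..<length ys}. ?T' (Suc r)) + 0)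
 = f.froot (a # ys) * g.Kf (- rsum (a # ys)) + g.froot (a # ys) + ?c *. (?T' 1 + (\<Sum>r\<in>{1..<length ys}. ?T' (Suc r)))"
 by (simp only: sc_add_r add.assoc add_0_right)
 also have "?T' 1 + (\<Sum>r\<in>{1..<length ys}. ?T' (Suc r)) = (\<Sum>r\<in>{1..<length (a # ys)}. ?T' r)"
 using False by (simp add: sum.atLeast_Suc_lessThan sum.shift_bounds_Suc_ivl del: sum.op_ivl_Suc)
 finally show ?thesis .
 qed
qed simp

lemma coprod_eroot_K:
 assumes p: "path n xs" and \<beta>: "\<beta> = \<gamma> + rsum xs"
 shows "h.eroot xs * h.Kf (- \<beta>) = (f.eroot xs * f.Kf (- \<beta>)) * g.Kf (- \<beta>) + f.Kf (- \<gamma>) * (g.eroot xs * g.Kf (- \<beta>)) +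
 (1 - inverse q * inverse q) *. (\<Sum>r\<in>{1..<length xs}. (f.eroot (take r xs) * f.Kf (- (\<gamma> + rsum (take r xs)))) * (g.eroot (drop r xs) * g.Kf (- \<beta>)))"
proof -
 have sub: "set (take r xs) <= {1..n}" "set (drop r xs) <= {1..n}" "set xs <= {1..n}" for r
 using path_set[OF p] set_take_subset[of r xs] set_drop_subset[of r xs] by blast+
 have K: "f.Kf (rsum (drop r xs)) * f.Kf (- \<beta>) = f.Kf (- (\<gamma> + rsum (take r xs)))" for r
 proof -
 have "rsum (drop r xs) + - \<beta> = - (\<gamma> + rsum (take r xs))"
 using rsum_simps(3)[of "take r xs" "drop r xs"] \<beta> by (simp add: fun_eq_iff)
 thus ?thesis by (simp only: flip: f.Kf_add)
 qed
 have K0: "f.Kf (rsum xs) * f.Kf (- \<beta>) = f.Kf (- \<gamma>)" using K[of 0] by simp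
 have K3: "f.Kf (rsum (drop r xs)) * (f.Kf (- \<beta>) * t) = f.Kf (- (\<gamma> + rsum (take r xs))) * t" for r t
 by (simp only: K flip: mult.assoc)
 have K03: "f.Kf (rsum xs) * (f.Kf (- \<beta>) * t) = f.Kf (- \<gamma>) * t" for t
 by (simp only: K0 flip: mult.assoc)
 have 1: "f.Kf (rsum xs) * g.eroot xs * (f.Kf (- \<beta>) * g.Kf (- \<beta>)) = f.Kf (- \<gamma>) * (g.eroot xs * g.Kf (- \<beta>))"
 by (simp only: mult.assoc gf3[OF gs_root(1)[OF sub(3)] fs_K] K03)
 have 2: "f.eroot (take r xs) * f.Kf (rsum (drop r xs)) * g.eroot (drop r xs) * (f.Kf (- \<beta>) * g.Kf (- \<beta>))
 = (f.eroot (take r xs) * f.Kf (- (\<gamma> + rsum (take r xs)))) * (g.eroot (drop r xs) * g.Kf (- \<beta>))" for r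
 by (simp only: mult.assoc gf3[OF gs_root(1)[OF sub(2)] fs_K] K3)
 show ?thesis
 unfolding coprod_eroot[OF p] kword_DD distrib_right scl sum_distrib_right 1 2
 by (simp add: mult.assoc)
qed

lemma coprod_Gr:
 assumes p: "path n xs"
 shows "h.Gr xs = f.Gr xs * g.Kf (- rsum xs) + g.Gr xs +
 (1 - inverse q * inverse q) *. (\<Sum>r\<in>{1..<length xs}. f.Gr (take r xs) * (g.eroot (drop r xs) * g.Kf (- rsum xs)))"
 using coprod_eroot_K[OF p, of "rsum xs" 0] by (simp add: h.Gr_def f.Gr_def g.Gr_def)

text \<open>Left factors are shifted vectors of initial pieces again. This is the coideal property of the shifted algebra, obtained by collecting the terms of the coproduct of the correction term.\<close>
lemma coprod_ebar:
 assumes p: "path n xs"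
 shows "h.ebar lam xs = f.ebar lam xs * g.Kf (- rsum xs) + g.Gr xs +
 (1 - inverse q * inverse q) *. (\<Sum>r\<in>{1..<length xs}. f.ebar lam (take r xs) * (g.eroot (drop r xs) * g.Kf (- rsum xs)))"
proof -
 obtain a ys where a: "xs = a # ys" using p by (cases xs) auto
 let ?c = "1 - inverse q * inverse q"
 show ?thesis
 proof (cases "ys = []")
 case True
 thus ?thesis using coprod_Gr[OF p]
 by (simp add: h.ebar_def f.ebar_def a kword_DD h.Gr_def f.Gr_def algebra_simps csimps)
 next
 case False
 have p': "path n ys" using p a False by (auto dest: path_Cons)
 let ?K = "g.Kf (- rsum xs)"
 let ?T = "%r. f.Gr (take r xs) * (g.eroot (drop r xs) * ?K)"
 let ?S = "%r. (f.eroot (take r ys) * f.Kf (- (simple_root a + rsum (take r ys)))) * (g.eroot (drop r ys) * ?K)"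
 let ?U = "%r. f.ebar lam (take r xs) * (g.eroot (drop r xs) * ?K)"
 have split: "(\<Sum>r\<in>{1..<length xs}. u r) = u 1 + (\<Sum>r\<in>{1..<length ys}. u (Suc r))" for u :: "nat => 'r"
 using False a by (simp add: sum.atLeast_Suc_lessThan sum.shift_bounds_Suc_ivl del: sum.op_ivl_Suc)
 have U1: "?U 1 = ?T 1 + lam *. (f.Kf (- simple_root a) * (g.eroot ys * ?K))"
 by (simp add: a f.ebar_def f.Gr_def algebra_simps csimps)
 have US: "?U (Suc r) = ?T (Suc r) + (?c * lam) *. ?S r" if "r : {1..<length ys}" for r
 proof -
 have "take r ys ~= []" using that False by auto
 thus ?thesis by (simp add: a f.ebar_def f.Gr_def distrib_right scl)
 qed
 have "(\<Sum>r\<in>{1..<length ys}. ?U (Suc r)) = (\<Sum>r\<in>{1..<length ys}. ?T (Suc r) + (?c * lam) *. ?S r)"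
 by (rule sum.cong[OF refl US])
 also have "... = (\<Sum>r\<in>{1..<length ys}. ?T (Suc r)) + (?c * lam) *. (\<Sum>r\<in>{1..<length ys}. ?S r)"
 by (simp add: sum.distrib calg.scale_sum_right)
 finally have US': "(\<Sum>r\<in>{1..<length ys}. ?U (Suc r)) = (\<Sum>r\<in>{1..<length ys}. ?T (Suc r)) + (?c * lam) *. (\<Sum>r\<in>{1..<length ys}. ?S r)" .
 have "h.ebar lam xs = h.Gr xs + (?c * lam) *. (h.eroot ys * h.Kf (- rsum xs))"
 using False a by (simp add: h.ebar_def h.Gr_def)
 also have "h.eroot ys * h.Kf (- rsum xs) = f.eroot ys * f.Kf (- rsum xs) * ?K + f.Kf (- simple_root a) * (g.eroot ys * ?K) + ?c *. (\<Sum>r\<in>{1..<length ys}. ?S r)"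
 by (rule coprod_eroot_K[OF p']) (simp add: a)
 finally have H: "h.ebar lam xs = h.Gr xs + (?c * lam) *. (f.eroot ys * f.Kf (- rsum xs) * ?K + f.Kf (- simple_root a) * (g.eroot ys * ?K) + ?c *. (\<Sum>r\<in>{1..<length ys}. ?S r))" .
 have E: "f.ebar lam xs = f.Gr xs + (?c * lam) *. (f.eroot ys * f.Kf (- rsum xs))"
 using False a by (simp add: f.ebar_def f.Gr_def)
 show ?thesis
 unfolding H coprod_Gr[OF p] split U1 US' E
 by (simp only: sc_add_r distrib_right scl calg.scale_scale) (simp add: add_ac mult_ac)
 qed
qed

lemma coprod_fbar:
 assumes p: "path n xs"
 shows "h.fbar kap xs = f.fbar kap xs * g.Kf (- rsum xs) + g.froot xs +
 (inverse q - q) *. (\<Sum>r\<in>{1..<length xs}. f.fbar kap (take r xs) * (g.froot (drop r xs) * g.Kf (- rsum (take r xs))))"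
proof -
 obtain a ys where a: "xs = a # ys" using p by (cases xs) auto
 have an: "a : {1..n}" "set ys <= {1..n}" using path_set[OF p] a by auto
 let ?c = "inverse q - q"
 have L: "f (LKinv a) = f.Kf (- simple_root a)" "g (LKinv a) = g.Kf (- simple_root a)"
 using f.Kf_simple[OF an(1)] g.Kf_simple[OF an(1)] by simp_all
 show ?thesis
 proof (cases "ys = []")
 case True
 thus ?thesis
 by (simp add: h.fbar_def f.fbar_def a L algebra_simps csimps)
 next
 case False
 have p': "path n ys" using p a False by (auto dest: path_Cons)
 have sub: "set (take r ys) <= {1..n}" "set (drop r ys) <= {1..n}" for r
 using an(2) set_take_subset[of r ys] set_drop_subset[of r ys] by blast+
 let ?L = "f (LKinv a)"
 let ?T = "%r. f.froot (take r xs) * (g.froot (drop r xs) * g.Kf (- rsum (take r xs)))"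
 let ?S = "%r. (f.froot (take r ys) * ?L) * (g.froot (drop r ys) * g.Kf (- rsum (take (Suc r) xs)))"
 let ?U = "%r. f.fbar kap (take r xs) * (g.froot (drop r xs) * g.Kf (- rsum (take r xs)))"
 have split: "(\<Sum>r\<in>{1..<length xs}. u r) = u 1 + (\<Sum>r\<in>{1..<length ys}. u (Suc r))" for u :: "nat => 'r"
 using False a by (simp add: sum.atLeast_Suc_lessThan sum.shift_bounds_Suc_ivl del: sum.op_ivl_Suc)
 have U1: "?U 1 = ?T 1 + kap *. (?L * (g.froot ys * g.Kf (- simple_root a)))"
 by (simp add: a f.fbar_def algebra_simps csimps)
 have US: "?U (Suc r) = ?T (Suc r) + (?c * kap) *. ?S r" if "r : {1..<length ys}" for r
 proof -
 have "take r ys ~= []" using that False by auto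
 thus ?thesis by (simp add: a f.fbar_def distrib_right scl)
 qed
 have "(\<Sum>r\<in>{1..<length ys}. ?U (Suc r)) = (\<Sum>r\<in>{1..<length ys}. ?T (Suc r) + (?c * kap) *. ?S r)"
 by (rule sum.cong[OF refl US])
 also have "... = (\<Sum>r\<in>{1..<length ys}. ?T (Suc r)) + (?c * kap) *. (\<Sum>r\<in>{1..<length ys}. ?S r)"
 by (simp add: sum.distrib calg.scale_sum_right)
 finally have US': "(\<Sum>r\<in>{1..<length ys}. ?U (Suc r)) = (\<Sum>r\<in>{1..<length ys}. ?T (Suc r)) + (?c * kap) *. (\<Sum>r\<in>{1..<length ys}. ?S r)" .
 have KL: "g.Kf (- rsum zs) * g.Kf (- simple_root a) = g.Kf (- rsum (a # zs))" for zs
 by (simp add: algebra_simps flip: g.Kf_add)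
 have 1: "f.froot ys * g.Kf (- rsum ys) * (?L * g (LKinv a)) = (f.froot ys * ?L) * g.Kf (- rsum xs)"
 unfolding L a by (simp only: mult.assoc gf3[OF gs_K fs_K] KL)
 have 2: "g.froot ys * (?L * g (LKinv a)) = ?L * (g.froot ys * g.Kf (- simple_root a))"
 unfolding L by (simp only: gf3[OF gs_root(2)[OF an(2)] fs_K])
 have 3: "f.froot (take r ys) * (g.froot (drop r ys) * g.Kf (- rsum (take r ys))) * (?L * g (LKinv a)) = ?S r" for r
 proof -
 have "f.froot (take r ys) * (g.froot (drop r ys) * g.Kf (- rsum (take r ys))) * (?L * g (LKinv a)) =
 f.froot (take r ys) * (?L * (g.froot (drop r ys) * (g.Kf (- rsum (take r ys)) * g (LKinv a))))"
 unfolding L by (simp only: mult.assoc gf3[OF gs_K fs_K] gf3[OF gs_root(2)[OF sub(2)] fs_K])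
 thus ?thesis unfolding L KL by (simp add: a mult.assoc)
 qed
 have "h.fbar kap xs = h.froot xs + (?c * kap) *. (h.froot ys * (?L * g (LKinv a)))"
 using False a by (simp add: h.fbar_def)
 also have "h.froot ys * (?L * g (LKinv a)) = (f.froot ys * ?L) * g.Kf (- rsum xs) + ?L * (g.froot ys * g.Kf (- simple_root a)) + ?c *. (\<Sum>r\<in>{1..<length ys}. ?S r)"
 unfolding coprod_froot[OF p'] distrib_right scl sum_distrib_right 1 2 3 ..
 finally have H: "h.fbar kap xs = h.froot xs + (?c * kap) *. ((f.froot ys * ?L) * g.Kf (- rsum xs) + ?L * (g.froot ys * g.Kf (- simple_root a)) + ?c *. (\<Sum>r\<in>{1..<length ys}. ?S r))" .
 have E: "f.fbar kap xs = f.froot xs + (?c * kap) *. (f.froot ys * ?L)"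
 using False a by (simp add: f.fbar_def)
 show ?thesis
 unfolding H coprod_froot[OF p] split U1 US' E
 by (simp only: sc_add_r distrib_right scl calg.scale_scale) (simp add: add_ac mult_ac)
 qed
qed

end

section \<open>Quotients of monoid algebras\<close>

text \<open>Value of a function that is constant on a coset.\<close>
definition coset_val :: "('a => 'b) => 'a set => 'b" where
 "coset_val h X = the_elem (h ` X)"

locale monoid_algebra =
 fixes S :: "'k::monoid_add set"
 assumes S0: "0 : S" and S_add: "!!k l. k : S ==> l : S ==> k + l : S"
begin

abbreviation "A \<equiv> monoid_alg S"
definition "C = {p :: 'k \<Rightarrow>\<^sub>0 complex. Poly_Mapping.keys p <= S}"

lemma A_sel [simp]: "carrier A = C" "mult A = (*)" "one A = 1" "zero A = 0" "add A = (+)"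
 "smult A = (%c p. scalar c * p)"
 by (simp_all add: monoid_alg_def C_def scalar_def)

lemma C_add: "x : C ==> y : C ==> x + y : C"
 using keys_add[of x y] by (auto simp: C_def)
lemma C_mult: "x : C ==> y : C ==> x * y : C"
 using keys_mult[of x y] S_add by (fastforce simp: C_def)
lemma C_0: "0 : C" by (simp add: C_def)
lemma C_single: "k : S ==> Poly_Mapping.single k c : C" by (simp add: C_def)
lemma C_scalar: "scalar c : C" by (simp add: C_def scalar_def S0)
lemma C_1: "1 : C" using C_scalar[of 1] by (simp add: scalar_def)
lemma C_uminus: "x : C ==> - x : C" by (simp add: C_def)
lemma C_diff: "x : C ==> y : C ==> x - y : C" using C_add[of x "- y"] C_uminus by simp
lemma C_smult: "x : C ==> scalar c * x : C" using C_mult C_scalar by blast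
lemma C_sum: "(!!i. i : X ==> g i : C) ==> sum g X : C"
 by (induction X rule: infinite_finite_induct) (auto simp: C_0 intro: C_add)
lemma C_prod_list: "(!!x. x : set xs ==> g x : C) ==> prod_list (map g xs) : C"
 by (induction xs) (auto simp: C_1 intro: C_mult)
lemma C_subspace: "pm.subspace C"
 by (auto simp: pm.subspace_def C_0 C_add C_smult)

lemma ring_A: "ring A"
proof (rule ringI)
 show "abelian_group A"
 by (rule abelian_groupI) (auto simp: C_add C_0 add.assoc add.commute intro!: bexI[of _ "- _"] C_uminus)
 show "monoid A" by (rule monoidI) (auto simp: C_mult C_1 mult.assoc)
qed (auto simp: algebra_simps)

end

text \<open>A character \<open>\<epsilon>\<close> that vanishes on the ideal keeps the quotient from being trivial.\<close>
locale quotient_algebra = monoid_algebra S for S :: "'k::monoid_add set" +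
 fixes I :: "('k \<Rightarrow>\<^sub>0 complex) set" and \<epsilon> :: "('k \<Rightarrow>\<^sub>0 complex) => complex"
 assumes I: "ideal I A"
 and e_add: "!!x y. \<epsilon> (x + y) = \<epsilon> x + \<epsilon> y" and e_mult: "!!x y. \<epsilon> (x * y) = \<epsilon> x * \<epsilon> y"
 and e_scalar: "!!c. \<epsilon> (scalar c) = c" and eI: "!!x. x : I ==> \<epsilon> x = 0"
begin

lemma I_C: "I <= C"
 using ideal.Icarr[OF I] by auto
lemma I_mult: "x : C ==> y : I ==> x * y : I" "x : I ==> y : C ==> x * y : I"
 using ideal.I_l_closed[OF I] ideal.I_r_closed[OF I] by auto
lemma I_add: "x : I ==> y : I ==> x + y : I"
 using additive_subgroup.a_closed[OF ideal.axioms(1)[OF I]] by auto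
lemma I_0: "0 : I"
 using additive_subgroup.zero_closed[OF ideal.axioms(1)[OF I]] by auto
lemma I_subspace: "pm.subspace I"
 by (auto simp: pm.subspace_def I_0 I_add I_mult C_scalar)
lemma I_diff: "x : I ==> y : I ==> x - y : I"
 by (rule pm.subspace_diff[OF I_subspace])

definition \<pi> :: "('k \<Rightarrow>\<^sub>0 complex) => 'k lend" where
 "\<pi> = (SOME \<rho>. (ALL x y. \<rho> (x + y) = \<rho> x + \<rho> y) & (ALL c x. \<rho> (scalar c * x) = c *. \<rho> x) &
 (ALL x:C. ALL y:C. \<rho> (x * y) = \<rho> x * \<rho> y) & \<rho> 1 = 1 & (ALL x:C. \<rho> x = 0 \<longleftrightarrow> x : I))"

lemma \<pi>_all: "(ALL x y. \<pi> (x + y) = \<pi> x + \<pi> y) & (ALL c x. \<pi> (scalar c * x) = c *. \<pi> x) &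
 (ALL x:C. ALL y:C. \<pi> (x * y) = \<pi> x * \<pi> y) & \<pi> 1 = 1 & (ALL x:C. \<pi> x = 0 \<longleftrightarrow> x : I)"
proof -
 let ?Q = "%\<rho> :: ('k \<Rightarrow>\<^sub>0 complex) => 'k lend. (ALL x y. \<rho> (x + y) = \<rho> x + \<rho> y) & (ALL c x. \<rho> (scalar c * x) = c *. \<rho> x) &
 (ALL x:C. ALL y:C. \<rho> (x * y) = \<rho> x * \<rho> y) & \<rho> 1 = 1 & (ALL x:C. \<rho> x = 0 \<longleftrightarrow> x : I)"
 have "EX \<rho>. ?Q \<rho>"
 proof (rule ex_faithful_rep[OF I_subspace C_subspace I_C C_1, where \<epsilon> = \<epsilon>])
 fix \<rho> :: "('k \<Rightarrow>\<^sub>0 complex) => 'k lend"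
 assume "!!x y. \<rho> (x + y) = \<rho> x + \<rho> y" "!!c x. \<rho> (scalar c * x) = c *. \<rho> x"
 "!!x y. x : C ==> y : C ==> \<rho> (x * y) = \<rho> x * \<rho> y" "\<rho> 1 = 1"
 "!!x. x : C ==> \<rho> x = 0 \<longleftrightarrow> x : I"
 hence "?Q \<rho>" by simp
 thus "EX \<rho>. ?Q \<rho>" by (rule exI[where P = ?Q])
 qed (simp_all add: C_mult I_mult e_add e_mult e_scalar eI)
 thus ?thesis unfolding \<pi>_def by (rule someI_ex)
qed

lemma \<pi>_add: "\<pi> (x + y) = \<pi> x + \<pi> y" and \<pi>_smult: "\<pi> (scalar c * x) = c *. \<pi> x"
 and \<pi>_mult: "x : C ==> y : C ==> \<pi> (x * y) = \<pi> x * \<pi> y" and \<pi>_1: "\<pi> 1 = 1"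
 and \<pi>_eq_0: "x : C ==> \<pi> x = 0 \<longleftrightarrow> x : I"
 using \<pi>_all by blast+

lemma \<pi>_0: "\<pi> 0 = 0" using \<pi>_add[of 0 0] by simp
lemma \<pi>_diff: "\<pi> (x - y) = \<pi> x - \<pi> y" using \<pi>_add[of "x - y" y] by simp
lemma \<pi>_eq: "x : C ==> y : C ==> \<pi> x = \<pi> y \<longleftrightarrow> x - y : I"
 using \<pi>_eq_0[OF C_diff, of x y] by (simp add: \<pi>_diff)
lemma \<pi>_sum: "\<pi> (sum g X) = (\<Sum>i\<in>X. \<pi> (g i))"
 by (induction X rule: infinite_finite_induct) (auto simp: \<pi>_0 \<pi>_add)
lemma \<pi>_single: "\<pi> (Poly_Mapping.single k c) = c *. \<pi> (Poly_Mapping.single k 1)"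
proof -
 have "Poly_Mapping.single k c = scalar c * Poly_Mapping.single k 1"
 by (simp add: scalar_def mult_single)
 thus ?thesis by (simp add: \<pi>_smult)
qed
lemma \<pi>_lext: "\<pi> p = lext (%k. \<pi> (Poly_Mapping.single k 1)) p"
proof -
 have "\<pi> p = (\<Sum>k\<in>Poly_Mapping.keys p. \<pi> (Poly_Mapping.single k (Poly_Mapping.lookup p k)))"
 by (simp flip: \<pi>_sum add: pm_sum_single)
 also have "... = lext (%k. \<pi> (Poly_Mapping.single k 1)) p"
 unfolding lext_def by (intro sum.cong refl) (rule \<pi>_single)
 finally show ?thesis .
qed
lemma \<pi>_prod_list: "(!!x. x : set xs ==> g x : C) ==> \<pi> (prod_list (map g xs)) = prod_list (map (%x. \<pi> (g x)) xs)"
 by (induction xs) (simp_all add: \<pi>_1 \<pi>_mult C_prod_list)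

abbreviation "U \<equiv> quot_alg A I"
definition "cl x = I +>\<^bsub>A\<^esub> x"
definition "V = \<pi> ` C"

abbreviation "val \<equiv> coset_val \<pi>"

lemma cl_alt: "cl x = {y + x | y. y : I}"
 by (auto simp: cl_def a_r_coset_def')

lemma cl_eq: "x : C ==> y : C ==> cl x = cl y \<longleftrightarrow> x - y : I"
proof
 assume xy: "x : C" "y : C"
 assume "cl x = cl y"
 hence "x : cl y" using I_0 unfolding cl_alt by (force intro: exI[of _ 0])
 thus "x - y : I" unfolding cl_alt by auto
next
 assume d: "x - y : I"
 have "EX z'. u + x = z' + y & z' : I" if "u : I" for u
 using I_add[OF that d] by (intro exI[of _ "u + (x - y)"]) (simp add: algebra_simps)
 moreover have "EX z'. u + y = z' + x & z' : I" if "u : I" for u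
 using I_diff[OF that d] by (intro exI[of _ "u - (x - y)"]) (simp add: algebra_simps)
 ultimately show "cl x = cl y" unfolding cl_alt by blast
qed

lemma cl_mem: "x : C ==> y : cl x \<longleftrightarrow> y : C & y - x : I"
proof -
 assume x: "x : C"
 have "y : cl x \<longleftrightarrow> y - x : I" unfolding cl_alt by (auto intro: exI[of _ "y - x"])
 moreover have "y : C" if "y - x : I" using C_add[of "y - x" x] I_C that x by auto
 ultimately show ?thesis by blast
qed

lemma U_carrier: "carrier U = cl ` C"
 by (auto simp: quot_alg_def FactRing_def A_RCOSETS_def' cl_def)

lemma U_mult: "x : C ==> y : C ==> cl x \<otimes>\<^bsub>U\<^esub> cl y = cl (x * y)"
 using ideal.rcoset_mult_add[OF I, of x y] by (simp add: quot_alg_def FactRing_def cl_def)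

lemma U_add: "x : C ==> y : C ==> cl x \<oplus>\<^bsub>U\<^esub> cl y = cl (x + y)"
 using abelian_subgroup.a_rcos_sum[OF abelian_subgroupI3[OF ideal.axioms(1)[OF I] ring.is_abelian_group[OF ring_A]], of x y]
 by (simp add: quot_alg_def FactRing_def cl_def)

lemma U_one: "\<one>\<^bsub>U\<^esub> = cl 1"
 by (simp add: quot_alg_def FactRing_def cl_def)

lemma U_zero: "\<zero>\<^bsub>U\<^esub> = cl 0"
 by (auto simp: quot_alg_def FactRing_def cl_alt)

lemma U_smult: "x : C ==> c \<odot>\<^bsub>U\<^esub> cl x = cl (scalar c * x)"
proof -
 assume x: "x : C"
 have "c \<odot>\<^bsub>U\<^esub> cl x = (\<Union>y\<in>cl x. cl (scalar c * y))"
 by (simp add: quot_alg_def cl_def)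
 also have "... = (\<Union>y\<in>cl x. cl (scalar c * x))"
 proof (intro SUP_cong refl)
 fix y assume "y : cl x"
 hence y: "y : C" "y - x : I" using cl_mem x by auto
 have "scalar c * y - scalar c * x = scalar c * (y - x)" by (simp add: right_diff_distrib)
 with y show "cl (scalar c * y) = cl (scalar c * x)"
 using cl_eq[OF C_smult C_smult] x I_mult(1)[OF C_scalar] by simp
 qed
 also have "... = cl (scalar c * x)"
 using cl_mem[OF x, of x] x I_0 by auto
 finally show ?thesis .
qed

lemma ring_U: "ring U"
proof (rule ringI)
 show "abelian_group U"
 proof (rule abelian_groupI)
 fix X assume "X : carrier U"
 then obtain x where x: "x : C" "X = cl x" by (auto simp: U_carrier)
 thus "EX Y:carrier U. Y \<oplus>\<^bsub>U\<^esub> X = \<zero>\<^bsub>U\<^esub>"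
 by (intro bexI[of _ "cl (- x)"]) (simp_all add: U_add C_uminus U_zero U_carrier)
 qed (auto simp: U_carrier U_add U_zero C_add C_0 add_ac)
 show "monoid U"
 by (rule monoidI) (auto simp: U_carrier U_mult U_one C_mult C_1 mult.assoc)
qed (auto simp: U_carrier U_mult U_add C_mult C_add algebra_simps)

lemma val_cl: "x : C ==> val (cl x) = \<pi> x"
proof -
 assume x: "x : C"
 have "\<pi> ` cl x = {\<pi> x}"
 using cl_mem[OF x] \<pi>_eq[of _ x] x I_0 by (auto intro!: image_eqI[of _ _ x])
 thus ?thesis by (simp add: coset_val_def)
qed

lemma V_iff: "X : carrier U ==> val X : V" by (auto simp: U_carrier V_def val_cl)
lemma val_image: "val ` carrier U = V" by (auto simp: U_carrier V_def val_cl image_image)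
lemma val_inj: "X : carrier U ==> Y : carrier U ==> val X = val Y \<longleftrightarrow> X = Y"
proof -
 assume "X : carrier U" "Y : carrier U"
 then obtain x y where "x : C" "X = cl x" "y : C" "Y = cl y" by (auto simp: U_carrier)
 thus ?thesis by (simp add: val_cl \<pi>_eq cl_eq)
qed
lemma val_inj_on: "inj_on val (carrier U)" using val_inj by (auto simp: inj_on_def)
lemma val_mult: "X : carrier U ==> Y : carrier U ==> val (X \<otimes>\<^bsub>U\<^esub> Y) = val X * val Y"
 by (auto simp: U_carrier val_cl U_mult C_mult \<pi>_mult)
lemma val_add: "X : carrier U ==> Y : carrier U ==> val (X \<oplus>\<^bsub>U\<^esub> Y) = val X + val Y"
 by (auto simp: U_carrier val_cl U_add C_add \<pi>_add)
lemma val_one: "val \<one>\<^bsub>U\<^esub> = 1" by (simp add: U_one val_cl C_1 \<pi>_1)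
lemma val_zero: "val \<zero>\<^bsub>U\<^esub> = 0" by (simp add: U_zero val_cl C_0 \<pi>_0)
lemma val_smult: "X : carrier U ==> val (c \<odot>\<^bsub>U\<^esub> X) = c *. val X"
 by (auto simp: U_carrier val_cl U_smult C_smult \<pi>_smult)
lemma smult_closed: "X : carrier U ==> c \<odot>\<^bsub>U\<^esub> X : carrier U"
 by (auto simp: U_carrier U_smult C_smult)
lemma val_minus: "X : carrier U ==> Y : carrier U ==> val (X \<ominus>\<^bsub>U\<^esub> Y) = val X - val Y"
proof -
 interpret ring U by (rule ring_U)
 assume X: "X : carrier U" and Y: "Y : carrier U"
 have "val (\<ominus>\<^bsub>U\<^esub> Y) + val Y = 0"
 using val_add[of "\<ominus>\<^bsub>U\<^esub> Y" Y] Y by (simp add: l_neg val_zero)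
 thus ?thesis using X Y by (simp add: a_minus_def val_add eq_neg_iff_add_eq_0)
qed
lemma val_finsum: "(!!i. i : P ==> g i : carrier U) ==> finite P ==> finsum U g P : carrier U & val (finsum U g P) = (\<Sum>i\<in>P. val (g i))"
proof -
 interpret ring U by (rule ring_U)
 assume "!!i. i : P ==> g i : carrier U" "finite P"
 from this(2,1) show ?thesis
 by (induction P rule: finite_induct) (auto simp: val_zero val_add Pi_def)
qed

lemma V_1: "1 : V" using C_1 \<pi>_1 unfolding V_def by (metis imageI)
lemma V_add: "v : V ==> w : V ==> v + w : V" by (auto simp: V_def C_add simp flip: \<pi>_add)
lemma V_mult: "v : V ==> w : V ==> v * w : V" by (auto simp: V_def C_mult simp flip: \<pi>_mult)
lemma V_scale: "v : V ==> c *. v : V" by (auto simp: V_def C_smult simp flip: \<pi>_smult)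
lemma V_diff: "v : V ==> w : V ==> v - w : V" by (auto simp: V_def C_diff simp flip: \<pi>_diff)
lemma V_0: "0 : V" using C_0 \<pi>_0 unfolding V_def by (metis imageI)

definition unval :: "'k lend => ('k \<Rightarrow>\<^sub>0 complex) set" where
 "unval v = inv_into (carrier U) val v"

lemma unval: "v : V ==> unval v : carrier U" "v : V ==> val (unval v) = v"
 unfolding unval_def using val_image by (auto intro: inv_into_into f_inv_into_f)
lemma unval_val: "X : carrier U ==> unval (val X) = X"
 unfolding unval_def by (rule inv_into_f_f[OF val_inj_on])

lemma val_qcomm: "X : carrier U ==> Y : carrier U ==> qcomm U X Y c : carrier U & val (qcomm U X Y c) = qc c (val X) (val Y)"
proof -
 interpret ring U by (rule ring_U)
 assume X: "X : carrier U" and Y: "Y : carrier U"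
 thus ?thesis unfolding qcomm_def qc_def
 by (simp add: val_minus val_mult val_smult smult_closed)
qed

lemma subalg_iff:
 assumes "B <= carrier U"
 shows "subalg U B \<longleftrightarrow> 1 : val ` B & (ALL v:val ` B. ALL w:val ` B. v + w : val ` B) &
 (ALL v:val ` B. ALL w:val ` B. v * w : val ` B) & (ALL c. ALL v:val ` B. c *. v : val ` B)"
proof -
 interpret ring U by (rule ring_U)
 have memB: "val X : val ` B \<longleftrightarrow> X : B" if "X : carrier U" for X
 using that assms val_inj by (auto simp: subset_iff image_iff)
 have B: "X : carrier U" if "X : B" for X using that assms by blast
 have "subalg U B \<longleftrightarrow> \<one>\<^bsub>U\<^esub> : B & (ALL X:B. ALL Y:B. X \<oplus>\<^bsub>U\<^esub> Y : B) & (ALL X:B. ALL Y:B. X \<otimes>\<^bsub>U\<^esub> Y : B) &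
 (ALL c. ALL X:B. c \<odot>\<^bsub>U\<^esub> X : B)" (is "_ = ?R")
 proof
 assume "subalg U B" thus ?R by (auto simp: subalg_def dest: subringE)
 next
 assume R: ?R
 have "\<ominus>\<^bsub>U\<^esub> X : B" if "X : B" for X
 proof -
 have "val (\<ominus>\<^bsub>U\<^esub> X) + val X = 0"
 using val_add[of "\<ominus>\<^bsub>U\<^esub> X" X] B[OF that] by (simp add: l_neg val_zero)
 hence "val (\<ominus>\<^bsub>U\<^esub> X) = val ((- 1) \<odot>\<^bsub>U\<^esub> X)"
 using B[OF that] by (simp add: val_smult eq_neg_iff_add_eq_0 sc1)
 hence "\<ominus>\<^bsub>U\<^esub> X = (- 1) \<odot>\<^bsub>U\<^esub> X" using val_inj B[OF that] smult_closed by simp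
 thus ?thesis using R that by simp
 qed
 thus "subalg U B" using R assms by (auto simp: subalg_def intro!: subringI)
 qed
 also have "... \<longleftrightarrow> val \<one>\<^bsub>U\<^esub> : val ` B & (ALL X:B. ALL Y:B. val (X \<oplus>\<^bsub>U\<^esub> Y) : val ` B) & (ALL X:B. ALL Y:B. val (X \<otimes>\<^bsub>U\<^esub> Y) : val ` B) &
 (ALL c. ALL X:B. val (c \<odot>\<^bsub>U\<^esub> X) : val ` B)"
 using memB[OF one_closed] memB[OF add.m_closed[OF B B]] memB[OF m_closed[OF B B]] memB[OF smult_closed[OF B]] by simp
 also have "... \<longleftrightarrow> 1 : val ` B & (ALL v:val ` B. ALL w:val ` B. v + w : val ` B) &
 (ALL v:val ` B. ALL w:val ` B. v * w : val ` B) & (ALL c. ALL v:val ` B. c *. v : val ` B)"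
 using B by (auto simp: val_one val_add val_mult val_smult)
 finally show ?thesis .
qed

lemma alg_V: "X <= V ==> alg X <= V"
proof
 fix x assume X: "X <= V" and "x : alg X"
 from this(2) show "x : V" by induction (use X V_1 V_add V_mult V_scale in auto)
qed

lemma val_gen_subalg:
 assumes "X <= carrier U"
 shows "gen_subalg U X <= carrier U" "val ` gen_subalg U X = alg (val ` X)"
proof -
 interpret ring U by (rule ring_U)
 let ?B = "unval ` alg (val ` X)"
 have XV: "val ` X <= V" using assms val_image by blast
 have BV: "?B <= carrier U" using alg_V[OF XV] unval by blast
 have vB: "val ` ?B = alg (val ` X)"
 proof -
 have "val ` ?B = (%v. v) ` alg (val ` X)"
 unfolding image_image using alg_V[OF XV] unval(2) by (intro image_cong) auto
 thus ?thesis by simp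
 qed
 have "subalg U ?B" unfolding subalg_iff[OF BV] vB by (auto intro: alg.intros)
 moreover have "X <= ?B" using assms unval_val by (auto simp: subset_iff image_iff intro!: bexI[of _ "val _"] alg.base)
 ultimately have sub: "gen_subalg U X <= ?B" unfolding gen_subalg_def by blast
 thus 1: "gen_subalg U X <= carrier U" using BV by blast
 have key: "v : val ` D" if D: "subalg U D" "X <= D" and v: "v : alg (val ` X)" for D v
 proof -
 have "D <= carrier U" using D(1) by (auto simp: subalg_def dest: subringE(1))
 from v D(1)[unfolded subalg_iff[OF this]] D(2) show ?thesis by (induction rule: alg.induct) auto
 qed
 have "unval v : D" if D: "subalg U D" "X <= D" and v: "v : alg (val ` X)" for D v
 proof -
 have "D <= carrier U" using D(1) by (auto simp: subalg_def dest: subringE(1))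
 moreover obtain Z where "Z : D" "v = val Z" using key[OF D v] by blast
 ultimately show ?thesis using unval_val by auto
 qed
 hence "?B <= gen_subalg U X" unfolding gen_subalg_def by blast
 with sub have "gen_subalg U X = ?B" by blast
 thus "val ` gen_subalg U X = alg (val ` X)" using vB by simp
qed

lemma quot_map_eq:
 assumes X: "x : C"
 and F: "!!y. y : C ==> y - x : I ==> J +>\<^bsub>B\<^esub> F y = J +>\<^bsub>B\<^esub> F x"
 shows "quot_map B J F (cl x) = J +>\<^bsub>B\<^esub> F x"
proof -
 have "(%x. J +>\<^bsub>B\<^esub> F x) ` cl x = {J +>\<^bsub>B\<^esub> F x}"
 proof -
 have "x : cl x" using cl_mem[OF X, of x] X I_0 by simp
 moreover have "(%x. J +>\<^bsub>B\<^esub> F x) ` cl x = (%_. J +>\<^bsub>B\<^esub> F x) ` cl x"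
 by (rule image_cong[OF refl], rule F) (use cl_mem[OF X] in auto)
 ultimately show ?thesis by (simp add: image_constant_conv) blast
 qed
 thus ?thesis by (simp add: quot_map_def)
qed

end

lemma ideal_kernel:
 assumes "monoid_algebra S"
 and add: "!!x y. h (x + y) = h x + (h y :: 'r::calg)" and mult: "!!x y. x : monoid_algebra.C S ==> y : monoid_algebra.C S ==> h (x * y) = h x * h y"
 shows "ideal {x : monoid_algebra.C S. h x = 0} (monoid_alg S)"
proof -
 interpret monoid_algebra S by fact
 have h0: "h 0 = 0" using add[of 0 0] by simp
 have hm: "h (- x) = - h x" for x using add[of x "- x"] h0 by (simp add: eq_neg_iff_add_eq_0 add.commute)
 have minus: "\<ominus>\<^bsub>A\<^esub> x = - x" if "x : C" for x
 proof -
 interpret ring A by (rule ring_A)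
 show ?thesis using that C_uminus[OF that] by (intro minus_equality) auto
 qed
 show ?thesis
 proof (rule idealI[OF ring_A])
 show "subgroup {x : C. h x = 0} (add_monoid A)"
 proof (rule subgroup.intro)
 have inv: "inv\<^bsub>add_monoid A\<^esub> x = - x" if "x : C" for x
 using minus[OF that] by (simp only: a_inv_def)
 show "inv\<^bsub>add_monoid A\<^esub> x : {x : C. h x = 0}" if "x : {x : C. h x = 0}" for x
 using that inv[of x] hm[of x] C_uminus[of x] by (simp del: A_sel)
 qed (auto simp: add h0 C_add C_0)
 qed (auto simp: C_mult mult)
qed

lemma genideal_subset:
 assumes "ideal J R" "X <= J" shows "Idl\<^bsub>R\<^esub> X <= J"
 using assms by (auto simp: genideal_def)

section \<open>The quantum group and its tensor square\<close>

definition hext :: "(letter => 'r::calg) => free => 'r" where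
 "hext f = lext (%w. prod_list (map f w))"

lemma hext_word [simp]: "hext f (word w) = prod_list (map f w)"
 by (simp add: hext_def word_def sc1)
lemma hext_mult: "hext f (x * y) = hext f x * hext f y"
 unfolding hext_def by (rule lext_mult) (simp add: plus_list_def)
lemma hext_add: "hext f (x + y) = hext f x + hext f y" by (simp add: hext_def lext_add)
lemma hext_diff: "hext f (x - y) = hext f x - hext f y" by (simp add: hext_def lext_diff)
lemma hext_uminus: "hext f (- y) = - hext f y" by (simp add: hext_def lext_uminus)
lemma hext_smult: "hext f (scalar c * x) = c *. hext f x" by (simp add: hext_def lext_scalar_mult)
lemma hext_1 [simp]: "hext f 1 = 1" unfolding hext_def by (rule lext_1) (simp add: zero_list_def)
lemma hext_0 [simp]: "hext f 0 = 0" by (simp add: hext_def)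
lemma hext_scalar: "hext f (scalar c) = c *. 1" using hext_smult[of f c 1] by simp
lemmas hext_simps = hext_add hext_diff hext_uminus hext_smult

definition relations :: "nat => complex => free set" where
 "relations n q = torus_relations n q \<union> commutator_relations n q \<union> serre_relations n q LE \<union> serre_relations n q LF"

lemma qserre_hext: "qserre q (f x) (f y) \<longleftrightarrow>
 hext f (word [x, x, y] - scalar (q + inverse q) * word [x, y, x] + word [y, x, x]) = 0"
 by (simp add: qserre_def hext_simps mult.assoc)

lemma qgroup_relations:
 assumes "qgroup n f q" "r : relations n q"
 shows "hext f r = 0"
proof -
 interpret qgroup n f q by fact
 from assms(2) show ?thesis unfolding relations_def
 proof (elim UnE)
 assume "r : torus_relations n q"
 then obtain a b where ab: "a : {1..n}" "b : {1..n}" and r: "r = word [LK a, LKinv a] - 1 \<or> r = word [LKinv a, LK a] - 1 \<or>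
 r = word [LK a, LK b] - word [LK b, LK a] \<or>
 r = word [LK a, LE b] - scalar (q powi cartan a b) * word [LE b, LK a] \<or>
 r = word [LK a, LF b] - scalar (q powi (- cartan a b)) * word [LF b, LK a]"
 unfolding torus_relations_def by blast
 from r show ?thesis using KL[OF ab(1)] LK[OF ab(1)] KK[OF ab] twD[OF KE[OF ab]] twD[OF KF[OF ab]]
 by (elim disjE) (simp_all add: hext_simps)
 next
 assume "r : commutator_relations n q"
 then obtain a b where ab: "a : {1..n}" "b : {1..n}" and r: "r = word [LE a, LF b] - word [LF b, LE a] -
 (if a = b then scalar (1 / (q - inverse q)) * (word [LK a] - word [LKinv a]) else 0)"
 unfolding commutator_relations_def by blast
 show ?thesis using EF[OF ab] unfolding r by (cases "a = b") (simp_all add: hext_simps)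
 next
 assume "r : serre_relations n q LE"
 then obtain a b where ab: "a : {1..n}" "b : {1..n}" and
 r: "r = word [LE a, LE b] - word [LE b, LE a] & cartan a b = 0 \<or>
 r = word [LE a, LE a, LE b] - scalar (q + inverse q) * word [LE a, LE b, LE a] + word [LE b, LE a, LE a] & cartan a b = -1"
 unfolding serre_relations_def by blast
 from r show ?thesis
 proof (elim disjE conjE)
 assume "r = word [LE a, LE b] - word [LE b, LE a]" "cartan a b = 0"
 thus ?thesis using EE[OF ab] by (simp add: hext_simps)
 next
 assume r: "r = word [LE a, LE a, LE b] - scalar (q + inverse q) * word [LE a, LE b, LE a] + word [LE b, LE a, LE a]"
 and "cartan a b = -1"
 hence "qserre q (f (LE a)) (f (LE b))" using serreE[OF ab] by simp
 thus ?thesis unfolding r qserre_hext .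
 qed
 next
 assume "r : serre_relations n q LF"
 then obtain a b where ab: "a : {1..n}" "b : {1..n}" and
 r: "r = word [LF a, LF b] - word [LF b, LF a] & cartan a b = 0 \<or>
 r = word [LF a, LF a, LF b] - scalar (q + inverse q) * word [LF a, LF b, LF a] + word [LF b, LF a, LF a] & cartan a b = -1"
 unfolding serre_relations_def by blast
 from r show ?thesis
 proof (elim disjE conjE)
 assume "r = word [LF a, LF b] - word [LF b, LF a]" "cartan a b = 0"
 thus ?thesis using FF[OF ab] by (simp add: hext_simps)
 next
 assume r: "r = word [LF a, LF a, LF b] - scalar (q + inverse q) * word [LF a, LF b, LF a] + word [LF b, LF a, LF a]"
 and "cartan a b = -1"
 hence "qserre q (f (LF a)) (f (LF b))" using serreF[OF ab] by simp
 thus ?thesis unfolding r qserre_hext .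
 qed
 qed
qed

lemma qgroupI_relations:
 assumes q: "q ~= 0" "q\<^sup>2 ~= 1" "q\<^sup>2 ~= - 1" and rel: "!!r. r : relations n q ==> hext f r = 0"
 shows "qgroup n f q"
proof
 fix a b assume ab: "a : {1..n}" "b : {1..n}"
 have t: "hext f r = 0" if "r : {word [LK a, LKinv a] - 1, word [LKinv a, LK a] - 1, word [LK a, LK b] - word [LK b, LK a],
 word [LK a, LE b] - scalar (q powi cartan a b) * word [LE b, LK a],
 word [LK a, LF b] - scalar (q powi (- cartan a b)) * word [LF b, LK a]}" for r
 by (rule rel) (use ab that in \<open>unfold relations_def torus_relations_def, blast\<close>)
 show "f (LK a) * f (LKinv a) = 1" using t[of "word [LK a, LKinv a] - 1"] by (simp add: hext_simps)
 show "f (LKinv a) * f (LK a) = 1" using t[of "word [LKinv a, LK a] - 1"] by (simp add: hext_simps)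
 show "f (LK a) * f (LK b) = f (LK b) * f (LK a)" using t[of "word [LK a, LK b] - word [LK b, LK a]"] by (simp add: hext_simps)
 show "tw (f (LK a)) (q powi cartan a b) (f (LE b))"
 using t[of "word [LK a, LE b] - scalar (q powi cartan a b) * word [LE b, LK a]"] by (simp add: hext_simps tw_def)
 show "tw (f (LK a)) (q powi (- cartan a b)) (f (LF b))"
 using t[of "word [LK a, LF b] - scalar (q powi (- cartan a b)) * word [LF b, LK a]"] by (simp add: hext_simps tw_def)
 have "hext f (word [LE a, LF b] - word [LF b, LE a] -
 (if a = b then scalar (1 / (q - inverse q)) * (word [LK a] - word [LKinv a]) else 0)) = 0"
 by (rule rel) (use ab in \<open>unfold relations_def commutator_relations_def, blast\<close>)
 thus "f (LE a) * f (LF b) - f (LF b) * f (LE a) = (if a = b then (1 / (q - inverse q)) *. (f (LK a) - f (LKinv a)) else 0)"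
 by (cases "a = b") (simp_all add: hext_simps)
 have c: "hext f (word [x a, x b] - word [x b, x a]) = 0" if "cartan a b = 0" "x = LE \<or> x = LF" for x
 by (rule rel) (use ab that in \<open>unfold relations_def serre_relations_def, blast\<close>)
 show "f (LE a) * f (LE b) = f (LE b) * f (LE a)" "f (LF a) * f (LF b) = f (LF b) * f (LF a)" if "cartan a b = 0"
 using c[OF that, of LE] c[OF that, of LF] by (simp_all add: hext_simps)
 have s: "hext f (word [x a, x a, x b] - scalar (q + inverse q) * word [x a, x b, x a] + word [x b, x a, x a]) = 0" if "cartan a b = -1" "x = LE \<or> x = LF" for x
 by (rule rel) (use ab that in \<open>unfold relations_def serre_relations_def, blast\<close>)
 show "qserre q (f (LE a)) (f (LE b))" "qserre q (f (LF a)) (f (LF b))" if "cartan a b = -1"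
 unfolding qserre_hext using s[OF that, of LE] s[OF that, of LF] by simp_all
qed (use q in auto)

lemma lookup_tens: "Poly_Mapping.lookup (tens_free x y) (u, v) = Poly_Mapping.lookup x u * Poly_Mapping.lookup y v"
proof -
 have "Poly_Mapping.lookup (tens_free x y) (u, v) =
 (\<Sum>a\<in>Poly_Mapping.keys x. \<Sum>b\<in>Poly_Mapping.keys y. if a = u & b = v then Poly_Mapping.lookup x a * Poly_Mapping.lookup y b else 0)"
 unfolding tens_free_def by (simp add: lookup_sum lookup_single when_def)
 also have "... = (\<Sum>a\<in>Poly_Mapping.keys x. if a = u then \<Sum>b\<in>Poly_Mapping.keys y. if b = v then Poly_Mapping.lookup x u * Poly_Mapping.lookup y v else 0 else 0)"
 by (intro sum.cong refl) auto
 also have "... = Poly_Mapping.lookup x u * Poly_Mapping.lookup y v"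
 by (simp add: sum.delta in_keys_iff)
 finally show ?thesis .
qed

lemma tens_add_left: "tens_free (x + x') y = tens_free x y + tens_free x' y"
 by (rule poly_mapping_eqI) (auto simp: lookup_tens lookup_add algebra_simps)
lemma tens_add_right: "tens_free x (y + y') = tens_free x y + tens_free x y'"
 by (rule poly_mapping_eqI) (auto simp: lookup_tens lookup_add algebra_simps)
lemma tens_scale_left: "tens_free (scalar c * x) y = scalar c * tens_free x y"
 by (rule poly_mapping_eqI) (auto simp: lookup_tens lookup_scalar_mult algebra_simps)
lemma tens_0 [simp]: "tens_free 0 y = 0" "tens_free x 0 = 0"
 by (rule poly_mapping_eqI; auto simp: lookup_tens)+
lemma tens_single: "tens_free (Poly_Mapping.single u c) (Poly_Mapping.single v d) = Poly_Mapping.single (u, v) (c * d)"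
 by (rule poly_mapping_eqI) (auto simp: lookup_tens lookup_single when_def split: if_splits)

lemma tens_mult: "tens_free x y * tens_free x' y' = tens_free (x * x') (y * y')"
proof (rule pm_induct[of x UNIV])
 fix u c x assume x: "tens_free x y * tens_free x' y' = tens_free (x * x') (y * y')"
 have "tens_free (Poly_Mapping.single u c) y * tens_free x' y' = tens_free (Poly_Mapping.single u c * x') (y * y')"
 proof (rule pm_induct[of y UNIV])
 fix v d y assume y: "tens_free (Poly_Mapping.single u c) y * tens_free x' y' = tens_free (Poly_Mapping.single u c * x') (y * y')"
 have "tens_free (Poly_Mapping.single u c) (Poly_Mapping.single v d) * tens_free x' y' =
 tens_free (Poly_Mapping.single u c * x') (Poly_Mapping.single v d * y')"
 proof (rule pm_induct[of x' UNIV])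
 fix u' c' x' assume x': "tens_free (Poly_Mapping.single u c) (Poly_Mapping.single v d) * tens_free x' y' =
 tens_free (Poly_Mapping.single u c * x') (Poly_Mapping.single v d * y')"
 have "tens_free (Poly_Mapping.single u c) (Poly_Mapping.single v d) * tens_free (Poly_Mapping.single u' c') y' =
 tens_free (Poly_Mapping.single u c * Poly_Mapping.single u' c') (Poly_Mapping.single v d * y')"
 by (rule pm_induct[of y' UNIV])
 (simp_all add: tens_add_right distrib_left tens_single mult_single ac_simps)
 with x' show "tens_free (Poly_Mapping.single u c) (Poly_Mapping.single v d) * tens_free (Poly_Mapping.single u' c' + x') y' =
 tens_free (Poly_Mapping.single u c * (Poly_Mapping.single u' c' + x')) (Poly_Mapping.single v d * y')"
 by (simp add: distrib_left tens_add_left)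
 qed simp_all
 with y show "tens_free (Poly_Mapping.single u c) (Poly_Mapping.single v d + y) * tens_free x' y' =
 tens_free (Poly_Mapping.single u c * x') ((Poly_Mapping.single v d + y) * y')"
 by (simp add: distrib_right tens_add_right)
 qed simp_all
 with x show "tens_free (Poly_Mapping.single u c + x) y * tens_free x' y' = tens_free ((Poly_Mapping.single u c + x) * x') (y * y')"
 by (simp add: distrib_right tens_add_left)
qed simp_all

lemma tens_1_1: "tens_free 1 1 = (1 :: free2)"
proof -
 have "tens_free 1 1 = Poly_Mapping.single (0 :: letter list \<times> letter list) 1"
 using tens_single[of 0 1 0 1] by (simp add: zero_prod_def)
 thus ?thesis by simp
qed

lemma lext_tens:
 assumes "!!u v. \<chi> (u, v) = \<alpha> u *. \<beta> v"
 shows "lext \<chi> (tens_free x y) = lext \<alpha> x *. lext \<beta> y"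
proof (rule pm_induct[of x UNIV])
 fix u c x assume x: "lext \<chi> (tens_free x y) = lext \<alpha> x *. lext \<beta> y"
 have "lext \<chi> (tens_free (Poly_Mapping.single u c) y) = (c * \<alpha> u) *. lext \<beta> y"
 by (rule pm_induct[of y UNIV])
 (simp_all add: tens_add_right lext_add tens_single assms sc_add_r mult_ac)
 with x show "lext \<chi> (tens_free (Poly_Mapping.single u c + x) y) = lext \<alpha> (Poly_Mapping.single u c + x) *. lext \<beta> y"
 by (simp add: tens_add_left lext_add sc_add_l scaleC_complex_def)
qed simp_all

context monoid_algebra begin

lemma minus_A: "x : C ==> \<ominus>\<^bsub>A\<^esub> x = - x"
proof -
 interpret ring A by (rule ring_A)
 show "x : C ==> \<ominus>\<^bsub>A\<^esub> x = - x" using C_uminus by (intro minus_equality) auto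
qed

lemma ideal_annihilator:
 assumes add: "!!x y. h (x + y) = h x + (h y :: 'r::calg)"
 shows "ideal {x : C. ALL a:C. ALL b:C. h (a * x * b) = 0} A"
proof -
 have h0: "h 0 = 0" using add[of 0 0] by simp
 have hm: "h (- x) = - h x" for x using add[of x "- x"] h0 by (simp add: eq_neg_iff_add_eq_0 add.commute)
 show ?thesis
 proof (rule idealI[OF ring_A])
 show "subgroup {x : C. ALL a:C. ALL b:C. h (a * x * b) = 0} (add_monoid A)"
 proof (rule subgroup.intro)
 have inv: "inv\<^bsub>add_monoid A\<^esub> x = - x" if "x : C" for x
 using minus_A[OF that] by (simp only: a_inv_def)
 show "inv\<^bsub>add_monoid A\<^esub> x : {x : C. ALL a:C. ALL b:C. h (a * x * b) = 0}" if "x : {x : C. ALL a:C. ALL b:C. h (a * x * b) = 0}" for x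
 using that inv[of x] hm C_uminus[of x] by (simp del: A_sel)
 qed (auto simp: add h0 C_add C_0 distrib_left distrib_right)
 next
 fix x y assume x: "x : {x : C. ALL a:C. ALL b:C. h (a * x * b) = 0}" and y: "y : carrier A"
 show "y \<otimes>\<^bsub>A\<^esub> x : {x : C. ALL a:C. ALL b:C. h (a * x * b) = 0}"
 using x y by (auto simp: C_mult mult.assoc[symmetric])
 have "h (a * (x * y) * b) = h (a * x * (y * b))" for a b by (simp add: mult.assoc)
 thus "x \<otimes>\<^bsub>A\<^esub> y : {x : C. ALL a:C. ALL b:C. h (a * x * b) = 0}"
 using x y by (auto simp: C_mult)
 qed
qed

end

locale uq =
 fixes n :: nat and q :: complex
 assumes q0: "q ~= 0" and nroot: "!!m. m > 0 ==> q ^ m ~= 1"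
begin

lemma q2: "q\<^sup>2 ~= 1" using nroot[of 2] by simp
lemma q4: "q\<^sup>2 ~= - 1"
proof
 assume "q\<^sup>2 = - 1"
 hence "q ^ 4 = 1" using power_mult[of q 2 2] by simp
 thus False using nroot[of 4] by simp
qed

definition eps :: "letter => complex" where
 "eps x = (case x of LE a => 0 | LF a => 0 | _ => 1)"

lemma qgroup_eps: "qgroup n eps q"
 by unfold_locales (use q0 q2 q4 in \<open>auto simp: eps_def tw_def qserre_def scaleC_complex_def\<close>)

end

sublocale uq < MA: monoid_algebra "lists (letters n)"
 by unfold_locales (auto simp: zero_list_def plus_list_def)

sublocale uq < MB: monoid_algebra "lists (letters n) \<times> lists (letters n)"
 by unfold_locales (auto simp: zero_list_def plus_list_def zero_prod_def plus_prod_def)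

context uq begin

lemma word_C: "set w <= letters n ==> word w : MA.C"
 by (auto simp: word_def intro!: MA.C_single)

lemma relations_C: "relations n q <= MA.C"
proof -
 have w: "word w : MA.C" if "set w <= letters n" for w by (rule word_C[OF that])
 have l: "LE a : letters n" "LF a : letters n" "LK a : letters n" "LKinv a : letters n" if "a : {1..n}" for a
 using that by (auto simp: letters_def)
 have "torus_relations n q <= MA.C" "commutator_relations n q <= MA.C"
 unfolding torus_relations_def commutator_relations_def using l
 by (auto intro!: MA.C_diff MA.C_add MA.C_smult MA.C_1 MA.C_0 w split: if_splits)
 moreover have "serre_relations n q LE <= MA.C" "serre_relations n q LF <= MA.C"
 unfolding serre_relations_def using l
 by (auto intro!: MA.C_diff MA.C_add MA.C_smult MA.C_1 MA.C_0 w)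
 ultimately show ?thesis by (auto simp: relations_def)
qed

lemma Uq_ideal_alt: "Uq_ideal n q = Idl\<^bsub>MA.A\<^esub> (relations n q)"
 by (simp add: Uq_ideal_def free_alg_def relations_def)

lemma ideal_Uq: "ideal (Uq_ideal n q) MA.A"
 unfolding Uq_ideal_alt using relations_C by (intro ring.genideal_ideal MA.ring_A) simp

lemma relations_ideal: "relations n q <= Uq_ideal n q"
 unfolding Uq_ideal_alt using relations_C by (intro ring.genideal_self MA.ring_A) simp

lemma hext_ideal:
 assumes "qgroup n f q" "x : Uq_ideal n q" shows "hext f x = 0"
proof -
 have "ideal {x : MA.C. hext f x = 0} MA.A"
 by (rule ideal_kernel) (simp_all add: MA.monoid_algebra_axioms hext_add hext_mult)
 hence "Uq_ideal n q <= {x : MA.C. hext f x = 0}"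
 unfolding Uq_ideal_alt using relations_C qgroup_relations[OF assms(1)] by (intro genideal_subset) auto
 thus ?thesis using assms(2) by blast
qed

definition eps2 :: "free2 => complex" where
 "eps2 = lext (%(u, v). prod_list (map eps u) * prod_list (map eps v))"

lemma eps2_add: "eps2 (x + y) = eps2 x + eps2 y" by (simp add: eps2_def lext_add)
lemma eps2_mult: "eps2 (x * y) = eps2 x * eps2 y"
 unfolding eps2_def by (rule lext_mult) (auto simp: plus_prod_def plus_list_def)
lemma eps2_tens: "eps2 (tens_free x y) = hext eps x * hext eps y"
 using lext_tens[of "%(u, v). prod_list (map eps u) * prod_list (map eps v)" "%w. prod_list (map eps w)" "%w. prod_list (map eps w)" x y]
 by (simp add: eps2_def hext_def scaleC_complex_def)

lemma tens_C: "x : MA.C ==> y : MA.C ==> tens_free x y : MB.C"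
 unfolding MA.C_def MB.C_def by (auto simp: in_keys_iff lookup_tens subset_iff)

lemma Uq_C: "Uq_ideal n q <= MA.C"
 using ideal.Icarr[OF ideal_Uq] by auto

lemma Uq2_ideal_alt: "Uq2_ideal n q = Idl\<^bsub>MB.A\<^esub> ((%x. tens_free x 1) ` Uq_ideal n q \<union> (%x. tens_free 1 x) ` Uq_ideal n q)"
 by (simp add: Uq2_ideal_def free_alg2_def)

lemma gen2_C: "(%x. tens_free x 1) ` Uq_ideal n q \<union> (%x. tens_free 1 x) ` Uq_ideal n q <= MB.C"
 using Uq_C by (auto intro!: tens_C MA.C_1)

lemma ideal_Uq2: "ideal (Uq2_ideal n q) MB.A"
 unfolding Uq2_ideal_alt using gen2_C by (intro ring.genideal_ideal MB.ring_A) simp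

lemma gen2_ideal: "(%x. tens_free x 1) ` Uq_ideal n q \<union> (%x. tens_free 1 x) ` Uq_ideal n q <= Uq2_ideal n q"
 unfolding Uq2_ideal_alt using gen2_C by (intro ring.genideal_self MB.ring_A) simp

lemma eps2_ideal: "x : Uq2_ideal n q ==> eps2 x = 0"
proof -
 have "ideal {x : MB.C. eps2 x = 0} MB.A"
 by (rule ideal_kernel) (simp_all add: MB.monoid_algebra_axioms eps2_add eps2_mult)
 hence "Uq2_ideal n q <= {x : MB.C. eps2 x = 0}"
 unfolding Uq2_ideal_alt using gen2_C hext_ideal[OF qgroup_eps]
 by (intro genideal_subset) (auto simp: eps2_tens)
 thus "x : Uq2_ideal n q ==> eps2 x = 0" by blast
qed

end

sublocale uq < A: quotient_algebra "lists (letters n)" "Uq_ideal n q" "hext eps"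
 by (intro quotient_algebra.intro[OF MA.monoid_algebra_axioms] quotient_algebra_axioms.intro)
 (simp_all add: ideal_Uq hext_add hext_mult hext_scalar scaleC_complex_def hext_ideal[OF qgroup_eps])

sublocale uq < B: quotient_algebra "lists (letters n) \<times> lists (letters n)" "Uq2_ideal n q" eps2
proof (intro quotient_algebra.intro[OF MB.monoid_algebra_axioms] quotient_algebra_axioms.intro)
 show "eps2 (scalar c) = c" for c
 by (simp add: eps2_def scalar_def zero_prod_def zero_list_def scaleC_complex_def)
qed (simp_all add: ideal_Uq2 eps2_add eps2_mult eps2_ideal)

context uq begin

lemma Uq_alt: "Uq n q = A.U" by (simp add: Uq_def free_alg_def)
lemma Uq2_alt: "Uq2 n q = B.U" by (simp add: Uq2_def free_alg2_def)

definition g :: "letter => letter list lend" where "g x = A.\<pi> (word [x])"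
definition f1 :: "letter => (letter list \<times> letter list) lend" where "f1 x = B.\<pi> (tens_free (word [x]) 1)"
definition f2 :: "letter => (letter list \<times> letter list) lend" where "f2 x = B.\<pi> (tens_free 1 (word [x]))"

lemma word_Cons: "word (x # w) = word [x] * word w"
 by (simp add: word_def mult_single plus_list_def)

lemma word_Nil: "word [] = 1" 
 by (simp add: word_def single_one[symmetric] zero_list_def del: single_one)

lemma hom_word:
 assumes "!!x y. x : MA.C ==> y : MA.C ==> h (x * y) = h x * (h y :: 'r::calg)" "h 1 = 1"
 shows "set w <= letters n ==> h (word w) = prod_list (map (%x. h (word [x])) w)"
proof (induction w)
 case (Cons x w)
 have "h (word (x # w)) = h (word [x]) * h (word w)"
 unfolding word_Cons[of x w] using Cons by (intro assms(1) word_C) auto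
 thus ?case using Cons by simp
qed (simp add: word_Nil assms)

lemma hom_hext:
 assumes "!!x y. x : MA.C ==> y : MA.C ==> h (x * y) = h x * (h y :: 'r::calg)" "h 1 = 1"
 and "!!x y. h (x + y) = h x + h y" "!!c x. h (scalar c * x) = c *. h x" and "x : MA.C"
 shows "h x = hext (%x. h (word [x])) x"
proof -
 have h0: "h 0 = 0" using assms(3)[of 0 0] by simp
 show ?thesis
 using assms(5)[unfolded MA.C_def mem_Collect_eq]
 proof (induction rule: pm_induct)
 case (add w c p)
 have "Poly_Mapping.single w c = scalar c * word w" by (simp add: scalar_def word_def mult_single)
 moreover have "h (word w) = prod_list (map (%x. h (word [x])) w)"
 by (rule hom_word[OF assms(1,2)]) (use add in auto)
 ultimately show ?case using add by (simp add: assms(3,4) hext_add hext_smult)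
 qed (simp add: h0)
qed

lemma \<pi>_hext: "x : MA.C ==> A.\<pi> x = hext g x"
 unfolding g_def by (rule hom_hext) (auto simp: A.\<pi>_mult A.\<pi>_1 A.\<pi>_add A.\<pi>_smult)

lemma tens_left_hext: "x : MA.C ==> B.\<pi> (tens_free x 1) = hext f1 x"
 unfolding f1_def
 by (rule hom_hext) (auto simp: B.\<pi>_mult[symmetric] tens_mult tens_C MA.C_1 tens_1_1 B.\<pi>_1 tens_add_left B.\<pi>_add tens_scale_left B.\<pi>_smult)

lemma tens_scale_right: "tens_free x (scalar c * y) = scalar c * tens_free x y"
 by (rule poly_mapping_eqI) (auto simp: lookup_tens lookup_scalar_mult algebra_simps)

lemma tens_right_hext: "x : MA.C ==> B.\<pi> (tens_free 1 x) = hext f2 x"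
 unfolding f2_def
 by (rule hom_hext) (auto simp: B.\<pi>_mult[symmetric] tens_mult tens_C MA.C_1 tens_1_1 B.\<pi>_1 tens_add_right B.\<pi>_add tens_scale_right B.\<pi>_smult)

lemma qgroup_g: "qgroup n g q"
proof (rule qgroupI_relations[OF q0 q2 q4])
 fix r assume r: "r : relations n q"
 hence "r : MA.C" "r : Uq_ideal n q" using relations_C relations_ideal by auto
 thus "hext g r = 0" using \<pi>_hext A.\<pi>_eq_0 by simp
qed

lemma qgroup_f1: "qgroup n f1 q"
proof (rule qgroupI_relations[OF q0 q2 q4])
 fix r assume r: "r : relations n q"
 hence r: "r : MA.C" "r : Uq_ideal n q" using relations_C relations_ideal by auto
 hence "tens_free r 1 : Uq2_ideal n q" using gen2_ideal by blast
 thus "hext f1 r = 0" using tens_left_hext[OF r(1)] B.\<pi>_eq_0[OF tens_C[OF r(1) MA.C_1]] by simp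
qed

lemma qgroup_f2: "qgroup n f2 q"
proof (rule qgroupI_relations[OF q0 q2 q4])
 fix r assume r: "r : relations n q"
 hence r: "r : MA.C" "r : Uq_ideal n q" using relations_C relations_ideal by auto
 hence "tens_free 1 r : Uq2_ideal n q" using gen2_ideal by blast
 thus "hext f2 r = 0" using tens_right_hext[OF r(1)] B.\<pi>_eq_0[OF tens_C[OF MA.C_1 r(1)]] by simp
qed

lemma f1_f2_comm: "x : letters n ==> y : letters n ==> f2 y * f1 x = f1 x * f2 y"
proof -
 assume "x : letters n" "y : letters n"
 hence "word [x] : MA.C" "word [y] : MA.C" by (auto intro!: word_C)
 thus ?thesis
 unfolding f1_def f2_def by (simp add: B.\<pi>_mult[symmetric] tens_C MA.C_1 tens_mult)
qed

end

sublocale uq < G: qgroup n g q by (rule qgroup_g)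
sublocale uq < P: qpair n f1 f2 q
 by (rule qpair.intro[OF qgroup_f1 qgroup_f2]) (rule qpair_axioms.intro[OF f1_f2_comm])

lemma hext_cong: "Poly_Mapping.keys p <= lists L ==> (!!x. x : L ==> f x = f' x) ==> hext f p = hext f' p"
 unfolding hext_def lext_def
 by (intro sum.cong refl arg_cong2[where f = scaleC] arg_cong[where f = prod_list] map_cong) auto

lemma root_form_zero' [simp]: "root_form n (%a. 0) \<xi> = 0" "root_form n \<xi> (%a. 0) = 0"
 by (simp_all add: root_form_def)

lemma letter_in [simp]: "LE a : letters n \<longleftrightarrow> a : {1..n}" "LF a : letters n \<longleftrightarrow> a : {1..n}"
 "LK a : letters n \<longleftrightarrow> a : {1..n}" "LKinv a : letters n \<longleftrightarrow> a : {1..n}"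
 by (auto simp: letters_def)

context uq begin

section \<open>Homomorphisms on the quantum group\<close>

text \<open>The homomorphism from the quantum group determined by a family that satisfies the defining relations. Elements are represented by arbitrary preimages in the free algebra.\<close>
definition lift :: "(letter => 'r::calg) => letter list lend => 'r" where
 "lift f v = hext f (SOME x. x : MA.C & A.\<pi> x = v)"

lemma lift_\<pi>:
 assumes f: "qgroup n f q" and x: "x : MA.C"
 shows "lift f (A.\<pi> x) = hext f x"
proof -
 define y where "y = (SOME y. y : MA.C & A.\<pi> y = A.\<pi> x)"
 have y: "y : MA.C & A.\<pi> y = A.\<pi> x" unfolding y_def by (rule someI[of _ x]) (simp add: x)
 hence "hext f (y - x) = 0" using hext_ideal[OF f] A.\<pi>_eq x by blast
 thus ?thesis by (simp add: lift_def y_def[symmetric] hext_diff)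
qed

lemma V_E: assumes "v : A.V" obtains x where "x : MA.C" "v = A.\<pi> x"
 using assms by (auto simp: A.V_def)

context
 fixes f :: "letter => 'r::calg"
 assumes f: "qgroup n f q"
begin

lemma lift_add: "v : A.V ==> w : A.V ==> lift f (v + w) = lift f v + lift f w"
 by (elim V_E) (simp add: lift_\<pi>[OF f] hext_add MA.C_add flip: A.\<pi>_add)
lemma lift_diff: "v : A.V ==> w : A.V ==> lift f (v - w) = lift f v - lift f w"
 by (elim V_E) (simp add: lift_\<pi>[OF f] hext_diff MA.C_diff flip: A.\<pi>_diff)
lemma lift_mult: "v : A.V ==> w : A.V ==> lift f (v * w) = lift f v * lift f w"
 by (elim V_E) (simp add: lift_\<pi>[OF f] hext_mult MA.C_mult flip: A.\<pi>_mult)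
lemma lift_scale: "v : A.V ==> lift f (c *. v) = c *. lift f v"
 by (elim V_E) (simp add: lift_\<pi>[OF f] hext_smult MA.C_smult flip: A.\<pi>_smult)
lemma lift_1: "lift f 1 = 1"
 using lift_\<pi>[OF f MA.C_1] by (simp add: A.\<pi>_1)
lemma lift_0: "lift f 0 = 0"
 using lift_\<pi>[OF f MA.C_0] by (simp add: A.\<pi>_0)
lemma lift_uminus: "v : A.V ==> lift f (- v) = - lift f v"
 using lift_scale[of v "- 1"] by (simp add: sc1)
lemma lift_g: "x : letters n ==> lift f (g x) = f x"
 using lift_\<pi>[OF f word_C[of "[x]"]] by (simp add: g_def)

end

lemma g_V: "x : letters n ==> g x : A.V"
 unfolding g_def A.V_def by (intro imageI word_C) simp

lemma V_alg: "A.V = alg (g ` letters n)"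
proof
 show "alg (g ` letters n) <= A.V" by (rule A.alg_V) (auto intro: g_V)
 show "A.V <= alg (g ` letters n)"
 proof
 fix v assume "v : A.V"
 then obtain x where x: "x : MA.C" "v = hext g x" by (auto simp: A.V_def \<pi>_hext)
 have "prod_list (map g w) : alg (g ` letters n)" if "w : lists (letters n)" for w
 using that by (induction w) (auto intro: alg.intros)
 hence "hext g x : alg (g ` letters n)"
 unfolding hext_def lext_def using x(1) by (intro alg_sum alg.scale) (auto simp: MA.C_def)
 thus "v : alg (g ` letters n)" using x by simp
 qed
qed

lemma V_hom_eq:
 fixes h h' :: "letter list lend => 'r::calg"
 assumes "!!v w. v : A.V ==> w : A.V ==> h (v + w) = h v + h w" "!!v w. v : A.V ==> w : A.V ==> h (v * w) = h v * h w"
 "!!c v. v : A.V ==> h (c *. v) = c *. h v" "h 1 = 1"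
 and "!!v w. v : A.V ==> w : A.V ==> h' (v + w) = h' v + h' w" "!!v w. v : A.V ==> w : A.V ==> h' (v * w) = h' v * h' w"
 "!!c v. v : A.V ==> h' (c *. v) = c *. h' v" "h' 1 = 1"
 and "!!x. x : letters n ==> h (g x) = h' (g x)" and "v : A.V"
 shows "h v = h' v"
 using assms(10)[unfolded V_alg]
proof induction
 case (base x)
 thus ?case using assms(9) by auto
qed (use assms(1-8) in \<open>simp_all add: V_alg\<close>)

lemma qc_V: "v : A.V ==> w : A.V ==> qc c v w : A.V"
 by (simp add: qc_def A.V_diff A.V_mult A.V_scale)

lemma lift_qc: "qgroup n f q ==> v : A.V ==> w : A.V ==> lift f (qc c v w) = qc c (lift f v) (lift f w)"
 by (simp add: qc_def lift_diff lift_mult lift_scale A.V_mult A.V_scale)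

lemma prod_list_V: "set w <= letters n ==> prod_list (map g w) : A.V"
 by (induction w) (auto intro: A.V_1 A.V_mult g_V)

lemma lift_prod_list: "qgroup n f q ==> set w <= letters n ==> lift f (prod_list (map g w)) = prod_list (map f w)"
 by (induction w) (auto simp: lift_1 lift_mult g_V prod_list_V lift_g)

lemma K_V: "kword n g \<mu> : A.V"
 unfolding kword_def by (rule prod_list_V) (rule Kword_letters)

lemma lift_K: "qgroup n f q ==> lift f (kword n g \<mu>) = kword n f \<mu>"
 unfolding kword_def by (intro lift_prod_list Kword_letters)

lemma lroot_V: "(!!a. a : set xs ==> h a : A.V) ==> lroot c h xs : A.V"
 by (induction c h xs rule: lroot.induct) (auto intro: A.V_1 qc_V)

lemma lift_lroot: "qgroup n f q ==> (!!a. a : set xs ==> h a : A.V) ==> lift f (lroot c h xs) = lroot c (%a. lift f (h a)) xs"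
proof (induction c h xs rule: lroot.induct)
 case (3 c h a b xs)
 thus ?case using lroot_V[of "b # xs" h c] by (simp add: lift_qc)
qed (simp_all add: lift_1)

lemma letters_n: "a : {1..n} ==> LE a : letters n" "a : {1..n} ==> LF a : letters n"
 "a : {1..n} ==> LK a : letters n" "a : {1..n} ==> LKinv a : letters n"
 by (auto simp: letters_def)

lemma eroot_V: "set xs <= {1..n} ==> G.eroot xs : A.V" and froot_V: "set xs <= {1..n} ==> G.froot xs : A.V"
 unfolding G.eroot_def G.froot_def using letters_n by (auto intro!: lroot_V g_V)

lemma lift_eroot:
 assumes f: "qgroup n f q" and xs: "set xs <= {1..n}"
 shows "lift f (G.eroot xs) = lroot (inverse q) (%a. f (LE a)) xs" "lift f (G.froot xs) = lroot q (%a. f (LF a)) xs"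
proof -
 have l: "LE a : letters n" "LF a : letters n" if "a : set xs" for a using that xs by auto
 have "lift f (G.eroot xs) = lroot (inverse q) (%a. lift f (g (LE a))) xs"
 unfolding G.eroot_def by (rule lift_lroot[OF f]) (intro g_V l)
 also have "... = lroot (inverse q) (%a. f (LE a)) xs"
 by (rule lroot_cong) (intro lift_g[OF f] l)
 finally show "lift f (G.eroot xs) = lroot (inverse q) (%a. f (LE a)) xs" .
 have "lift f (G.froot xs) = lroot q (%a. lift f (g (LF a))) xs"
 unfolding G.froot_def by (rule lift_lroot[OF f]) (intro g_V l)
 also have "... = lroot q (%a. f (LF a)) xs"
 by (rule lroot_cong) (intro lift_g[OF f] l)
 finally show "lift f (G.froot xs) = lroot q (%a. f (LF a)) xs" .
qed

lemma free_alg_alt: "free_alg n = MA.A" "free_alg2 n = MB.A"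
 by (simp_all add: free_alg_def free_alg2_def)

lemma free_ext_A:
 assumes "!!x. x : letters n ==> \<phi> x : MA.C" "p : MA.C"
 shows "free_ext \<phi> p : MA.C" "A.\<pi> (free_ext \<phi> p) = hext (%x. A.\<pi> (\<phi> x)) p"
proof -
 have w: "prod_list (map \<phi> w) : MA.C & A.\<pi> (prod_list (map \<phi> w)) = prod_list (map (%x. A.\<pi> (\<phi> x)) w)" if "w : Poly_Mapping.keys p" for w
 proof -
 have "x : letters n" if "x : set w" for x using that assms(2) \<open>w : Poly_Mapping.keys p\<close> by (auto simp: MA.C_def)
 thus ?thesis using assms(1) by (auto intro!: MA.C_prod_list A.\<pi>_prod_list)
 qed
 show "free_ext \<phi> p : MA.C" unfolding free_ext_def using w by (intro MA.C_sum MA.C_smult) auto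
 show "A.\<pi> (free_ext \<phi> p) = hext (%x. A.\<pi> (\<phi> x)) p"
 unfolding free_ext_def hext_def lext_def A.\<pi>_sum A.\<pi>_smult using w by (intro sum.cong) auto
qed

lemma free_ext_B:
 assumes "!!x. x : letters n ==> \<phi> x : MB.C" "p : MA.C"
 shows "free_ext \<phi> p : MB.C" "B.\<pi> (free_ext \<phi> p) = hext (%x. B.\<pi> (\<phi> x)) p"
proof -
 have w: "prod_list (map \<phi> w) : MB.C & B.\<pi> (prod_list (map \<phi> w)) = prod_list (map (%x. B.\<pi> (\<phi> x)) w)" if "w : Poly_Mapping.keys p" for w
 proof -
 have "x : letters n" if "x : set w" for x using that assms(2) \<open>w : Poly_Mapping.keys p\<close> by (auto simp: MA.C_def)
 thus ?thesis using assms(1) by (auto intro!: MB.C_prod_list B.\<pi>_prod_list)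
 qed
 show "free_ext \<phi> p : MB.C" unfolding free_ext_def using w by (intro MB.C_sum MB.C_smult) auto
 show "B.\<pi> (free_ext \<phi> p) = hext (%x. B.\<pi> (\<phi> x)) p"
 unfolding free_ext_def hext_def lext_def B.\<pi>_sum B.\<pi>_smult using w by (intro sum.cong) auto
qed

lemma quot_map_A:
 assumes f: "qgroup n f q" and F: "!!x. x : MA.C ==> F x : MA.C" "!!x. x : MA.C ==> A.\<pi> (F x) = hext f x"
 and X: "X : carrier A.U"
 shows "quot_map (free_alg n) (Uq_ideal n q) F X : carrier A.U & A.val (quot_map (free_alg n) (Uq_ideal n q) F X) = lift f (A.val X)"
proof -
 obtain x where x: "x : MA.C" "X = A.cl x" using X by (auto simp: A.U_carrier)
 have "quot_map MA.A (Uq_ideal n q) F (A.cl x) = Uq_ideal n q +>\<^bsub>MA.A\<^esub> F x"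
 proof (rule A.quot_map_eq[OF x(1)])
 fix y assume y: "y : MA.C" "y - x : Uq_ideal n q"
 have "A.\<pi> (F y) = A.\<pi> (F x)" using F(2) x(1) y hext_ideal[OF f y(2)] by (simp add: hext_diff)
 thus "Uq_ideal n q +>\<^bsub>MA.A\<^esub> F y = Uq_ideal n q +>\<^bsub>MA.A\<^esub> F x"
 using A.\<pi>_eq[of "F y" "F x"] A.cl_eq[of "F y" "F x"] F(1) x(1) y(1) by (simp add: A.cl_def)
 qed
 hence "quot_map (free_alg n) (Uq_ideal n q) F X = A.cl (F x)"
 by (simp add: free_alg_alt x(2) A.cl_def)
 thus ?thesis using x F by (simp add: A.val_cl lift_\<pi>[OF f] A.U_carrier)
qed

lemma quot_map_B:
 assumes f: "qgroup n f q" and F: "!!x. x : MA.C ==> F x : MB.C" "!!x. x : MA.C ==> B.\<pi> (F x) = hext f x"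
 and X: "X : carrier A.U"
 shows "quot_map (free_alg2 n) (Uq2_ideal n q) F X : carrier B.U & B.val (quot_map (free_alg2 n) (Uq2_ideal n q) F X) = lift f (A.val X)"
proof -
 obtain x where x: "x : MA.C" "X = A.cl x" using X by (auto simp: A.U_carrier)
 have "quot_map MB.A (Uq2_ideal n q) F (A.cl x) = Uq2_ideal n q +>\<^bsub>MB.A\<^esub> F x"
 proof (rule A.quot_map_eq[OF x(1)])
 fix y assume y: "y : MA.C" "y - x : Uq_ideal n q"
 have "B.\<pi> (F y) = B.\<pi> (F x)" using F(2) x(1) y hext_ideal[OF f y(2)] by (simp add: hext_diff)
 thus "Uq2_ideal n q +>\<^bsub>MB.A\<^esub> F y = Uq2_ideal n q +>\<^bsub>MB.A\<^esub> F x"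
 using B.\<pi>_eq[of "F y" "F x"] B.cl_eq[of "F y" "F x"] F(1) x(1) y(1) by (simp add: B.cl_def)
 qed
 hence "quot_map (free_alg2 n) (Uq2_ideal n q) F X = B.cl (F x)"
 by (simp add: free_alg_alt x(2) B.cl_def)
 thus ?thesis using x F by (simp add: B.val_cl A.val_cl lift_\<pi>[OF f] B.U_carrier)
qed

lemma lusztig_letter_C:
 assumes a: "a : {1..n}" and x: "x : letters n"
 shows "lusztig_letter n q a x : MA.C" "A.\<pi> (lusztig_letter n q a x) = TT n q a g x"
proof -
 have K: "word (Kword n \<mu>) : MA.C" for \<mu> by (rule word_C) (rule Kword_letters)
 have w: "set w <= letters n ==> word w : MA.C" for w by (rule word_C)
 show C: "lusztig_letter n q a x : MA.C"
 using x a by (cases x) (auto intro!: K w MA.C_uminus MA.C_diff MA.C_smult)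
 show "A.\<pi> (lusztig_letter n q a x) = TT n q a g x"
 unfolding \<pi>_hext[OF C] by (cases x) (auto simp: hext_simps qc_def kword_def)
qed

lemma lusztig_val:
 assumes a: "a : {1..n}" and X: "X : carrier A.U"
 shows "lusztig n q a X : carrier A.U & A.val (lusztig n q a X) = lift (TT n q a g) (A.val X)"
 unfolding lusztig_def
proof (rule quot_map_A[OF G.qgroup_TT[OF a] _ _ X])
 fix x assume x: "x : MA.C"
 show "free_ext (lusztig_letter n q a) x : MA.C" by (rule free_ext_A) (use lusztig_letter_C[OF a] x in auto)
 have "A.\<pi> (free_ext (lusztig_letter n q a) x) = hext (%y. A.\<pi> (lusztig_letter n q a y)) x"
 by (rule free_ext_A) (use lusztig_letter_C[OF a] x in auto)
 also have "... = hext (TT n q a g) x"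
 using x lusztig_letter_C[OF a] by (intro hext_cong[of x "letters n"]) (auto simp: MA.C_def)
 finally show "A.\<pi> (free_ext (lusztig_letter n q a) x) = hext (TT n q a g) x" .
qed

lemma coproduct_letter_C:
 assumes x: "x : letters n"
 shows "coproduct_letter x : MB.C" "B.\<pi> (coproduct_letter x) = DD f1 f2 x"
proof -
 have w: "set w <= letters n ==> word w : MA.C" for w by (rule word_C)
 show "coproduct_letter x : MB.C"
 using x by (cases x) (auto intro!: MB.C_add tens_C w MA.C_1)
 have t: "B.\<pi> (tens_free (word [y]) (word [z])) = f1 y * f2 z" if "y : letters n" "z : letters n" for y z
 unfolding f1_def f2_def using that
 by (subst B.\<pi>_mult[symmetric]) (auto intro!: tens_C w MA.C_1 simp: tens_mult)
 show "B.\<pi> (coproduct_letter x) = DD f1 f2 x"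
 using x by (cases x) (auto simp: B.\<pi>_add t f1_def[symmetric] f2_def[symmetric])
qed

lemma coproduct_val:
 assumes X: "X : carrier A.U"
 shows "coproduct n q X : carrier B.U & B.val (coproduct n q X) = lift (DD f1 f2) (A.val X)"
 unfolding coproduct_def
proof (rule quot_map_B[OF P.h.qgroup_axioms _ _ X])
 fix x assume x: "x : MA.C"
 show "free_ext coproduct_letter x : MB.C" by (rule free_ext_B) (use coproduct_letter_C x in auto)
 have "B.\<pi> (free_ext coproduct_letter x) = hext (%y. B.\<pi> (coproduct_letter y)) x"
 by (rule free_ext_B) (use coproduct_letter_C x in auto)
 also have "... = hext (DD f1 f2) x"
 using x coproduct_letter_C by (intro hext_cong[of x "letters n"]) (auto simp: MA.C_def)
 finally show "B.\<pi> (free_ext coproduct_letter x) = hext (DD f1 f2) x" .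
qed

lemma tens_val:
 assumes X: "X : carrier A.U" and Y: "Y : carrier A.U"
 shows "tens n q X Y : carrier B.U & B.val (tens n q X Y) = lift f1 (A.val X) * lift f2 (A.val Y)"
proof -
 obtain x y where x: "x : MA.C" "X = A.cl x" and y: "y : MA.C" "Y = A.cl y" using X Y by (auto simp: A.U_carrier)
 have t: "B.\<pi> (tens_free x' y') = hext f1 x' * hext f2 y'" if "x' : MA.C" "y' : MA.C" for x' y'
 proof -
 have "tens_free x' y' = tens_free x' 1 * tens_free 1 y'" by (simp add: tens_mult)
 thus ?thesis using that tens_C MA.C_1 by (simp add: B.\<pi>_mult tens_left_hext tens_right_hext)
 qed
 have "(%(x, y). Uq2_ideal n q +>\<^bsub>free_alg2 n\<^esub> tens_free x y) ` (X \<times> Y) = (%_. B.cl (tens_free x y)) ` (X \<times> Y)"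
 proof (rule image_cong[OF refl])
 fix z assume "z : X \<times> Y"
 then obtain x' y' where z: "z = (x', y')" "x' : MA.C" "x' - x : Uq_ideal n q" "y' : MA.C" "y' - y : Uq_ideal n q"
 using A.cl_mem x y by auto
 have "hext f1 x' = hext f1 x" "hext f2 y' = hext f2 y"
 using hext_ideal[OF qgroup_f1 z(3)] hext_ideal[OF qgroup_f2 z(5)] by (simp_all add: hext_diff)
 hence "B.cl (tens_free x' y') = B.cl (tens_free x y)"
 using t x y z B.cl_eq[OF tens_C tens_C, of x' y' x y] B.\<pi>_eq[OF tens_C tens_C, of x' y' x y] by simp
 thus "(case z of (x, y) => Uq2_ideal n q +>\<^bsub>free_alg2 n\<^esub> tens_free x y) = B.cl (tens_free x y)"
 by (simp add: z(1) free_alg_alt B.cl_def)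
 qed
 moreover have "(x, y) : X \<times> Y" using A.cl_mem[OF x(1), of x] A.cl_mem[OF y(1), of y] x y A.I_0 by simp
 ultimately have "tens n q X Y = B.cl (tens_free x y)"
 unfolding tens_def by (auto simp: image_constant_conv)
 thus ?thesis
 using x y t tens_C by (simp add: B.val_cl A.val_cl lift_\<pi>[OF qgroup_f1] lift_\<pi>[OF qgroup_f2] B.U_carrier)
qed

lemma UqE_val: "a : {1..n} ==> UqE n q a : carrier A.U & A.val (UqE n q a) = g (LE a)"
 using letters_n(1)[of a] word_C[of "[LE a]"] unfolding UqE_def free_alg_alt A.cl_def[symmetric]
 by (simp add: A.val_cl A.U_carrier g_def)
lemma UqF_val: "a : {1..n} ==> UqF n q a : carrier A.U & A.val (UqF n q a) = g (LF a)"
 using letters_n(2)[of a] word_C[of "[LF a]"] unfolding UqF_def free_alg_alt A.cl_def[symmetric]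
 by (simp add: A.val_cl A.U_carrier g_def)
lemma UqK_val: "UqK n q \<mu> : carrier A.U & A.val (UqK n q \<mu>) = kword n g \<mu>"
 using word_C[OF Kword_letters, of \<mu>] unfolding UqK_def free_alg_alt A.cl_def[symmetric]
 by (simp add: A.val_cl A.U_carrier \<pi>_hext kword_def)

lemma lift_TT_V: "a : {1..n} ==> v : A.V ==> lift (TT n q a g) v : A.V"
 using lusztig_val[of a "A.unval v"] A.unval[of v] A.V_iff by metis

lemma lift_TT:
 assumes a: "a : {1..n}" and f: "qgroup n f q" and x: "x : letters n"
 shows "lift f (TT n q a g x) = TT n q a f x"
 using a x by (cases x)
 (auto simp: lift_qc[OF f] lift_mult[OF f] lift_K[OF f] lift_g[OF f] g_V A.V_mult lift_uminus[OF f])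

lemma lift_TI_TT:
 assumes a: "a : {1..n}" and v: "v : A.V"
 shows "lift (TI n q a g) (lift (TT n q a g) v) = v"
proof -
 note t = G.qgroup_TT[OF a] and i = G.qgroup_TI[OF a]
 show ?thesis
 proof (rule V_hom_eq[where h' = "%v. v", OF _ _ _ _ _ _ _ _ _ v])
 fix x assume x: "x : letters n"
 have "lift (TI n q a g) (lift (TT n q a g) (g x)) = TT n q a (TI n q a g) x"
 using lift_g[OF t x] lift_TT[OF a i x] by simp
 also have "... = g x"
 using x G.TT_TI_E[OF a] G.TT_TI_F[OF a] G.TT_TI_K[OF a] by (auto simp: letters_def simp del: TT.simps)
 finally show "lift (TI n q a g) (lift (TT n q a g) (g x)) = g x" .
 qed (simp_all add: lift_add[OF t] lift_add[OF i] lift_mult[OF t] lift_mult[OF i] lift_scale[OF t] lift_scale[OF i] lift_TT_V[OF a] lift_1[OF t] lift_1[OF i])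
qed

lemma lusztig_inj: "a : {1..n} ==> inj_on (lusztig n q a) (carrier A.U)"
proof (rule inj_onI)
 fix X Y assume a: "a : {1..n}" and XY: "X : carrier A.U" "Y : carrier A.U" "lusztig n q a X = lusztig n q a Y"
 hence "lift (TT n q a g) (A.val X) = lift (TT n q a g) (A.val Y)" using lusztig_val[OF a] by metis
 hence "A.val X = A.val Y" using lift_TI_TT[OF a A.V_iff] XY by metis
 thus "X = Y" using A.val_inj XY by blast
qed

lemma lusztig_inv_val:
 assumes a: "a : {1..n}" and X: "X : carrier A.U" and v: "v : A.V" and eq: "A.val X = lift (TT n q a g) v"
 shows "lusztig_inv n q a X : carrier A.U & A.val (lusztig_inv n q a X) = v"
proof -
 have "lusztig n q a (A.unval v) = X"
 using lusztig_val[OF a A.unval(1)[OF v]] A.val_inj[of "lusztig n q a (A.unval v)" X] X eq A.unval(2)[OF v] by simp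
 hence "lusztig_inv n q a X = A.unval v"
 unfolding lusztig_inv_def Uq_alt using inv_into_f_f[OF lusztig_inj[OF a] A.unval(1)[OF v]] by simp
 thus ?thesis using A.unval[OF v] by simp
qed

lemma word_degree_Cons: "word_degree (x # w) = letter_degree x + word_degree w"
 by (simp add: word_degree_def fun_eq_iff)

lemma G_wt_letter: "x : letters n ==> G.wt (g x) (letter_degree x)"
proof -
 assume "x : letters n"
 then obtain a where a: "a : {1..n}" "x = LE a \<or> x = LF a \<or> x = LK a \<or> x = LKinv a" by (auto simp: letters_def)
 have "G.wt (g (LK a)) (%b. 0)" "G.wt (g (LKinv a)) (%b. 0)"
 using G.wt_K[of "simple_root a"] G.wt_K[of "- simple_root a"] G.Kf_simple[OF a(1)] by (simp_all add: zero_fun_def)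
 thus ?thesis using a G.wt_E G.wt_F by auto
qed

lemma even_letter: "x : letters n ==> even (root_form n (letter_degree x) (letter_degree x))"
 by (auto simp: letters_def root_form_simple root_form_uminus_left root_form_uminus_right zero_fun_def[symmetric])

lemma even_word: "set w <= letters n ==> even (root_form n (word_degree w) (word_degree w))"
proof (induction w)
 case Nil
 have d: "word_degree [] = 0" by (simp add: word_degree_def fun_eq_iff)
 show ?case unfolding d by simp
next
 case (Cons x w)
 thus ?case
 unfolding word_degree_Cons root_form_add_left root_form_add_right
 using even_letter[of x] root_form_sym[of n "word_degree w" "letter_degree x"] by simp
qed

lemma letter_degree_K: "letter_degree (LK a) = 0" "letter_degree (LKinv a) = 0"
 by (simp_all add: zero_fun_def)

lemma PP_letter:
 assumes "x : letters n"
 shows "PP q g x = q powi (- (root_form n (letter_degree x) (letter_degree x) div 2)) *. (g x * G.Kf (- letter_degree x))"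
proof -
 obtain a where a: "a : {1..n}" "x = LE a \<or> x = LF a \<or> x = LK a \<or> x = LKinv a" using assms by (auto simp: letters_def)
 thus ?thesis
 by (elim disjE) (simp_all add: root_form_simple root_form_uminus_left root_form_uminus_right G.powi_m1 G.Kf_simple
 letter_degree_K sc1 del: letter_degree.simps(3,4))
qed

lemma PP_word:
 "set w <= letters n ==> prod_list (map (PP q g) w) =
 q powi (- (root_form n (word_degree w) (word_degree w) div 2)) *. (prod_list (map g w) * G.Kf (- word_degree w))"
proof (induction w)
 case Nil
 have d: "word_degree [] = 0" by (simp add: word_degree_def fun_eq_iff)
 show ?case unfolding d by (simp add: sc1)
next
 case (Cons x w)
 let ?d = "word_degree w" and ?x = "letter_degree x"
 have xw: "x : letters n" "set w <= letters n" using Cons.prems by auto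
 have wt: "G.wt (prod_list (map g w)) ?d" using xw(2)
 proof (induction w)
 case Nil
 have d: "word_degree [] = 0" by (simp add: word_degree_def fun_eq_iff)
 show ?case unfolding d using G.wt_1 by (simp only: list.map prod_list.Nil)
 next
 case (Cons y w)
 hence "G.wt (g y * prod_list (map g w)) (letter_degree y + word_degree w)"
 by (intro G.wt_mult G_wt_letter) auto
 thus ?case unfolding word_degree_Cons by (simp only: list.map prod_list.Cons)
 qed
 have comm: "G.Kf (- ?x) * (prod_list (map g w) * t) = q powi (- root_form n ?x ?d) *. (prod_list (map g w) * (G.Kf (- ?x) * t))" for t
 using G.Kf_wt[OF wt, of "- ?x"] by (simp add: root_form_uminus_left twD3)
 have ev: "root_form n (?x + ?d) (?x + ?d) div 2 = root_form n ?x ?x div 2 + root_form n ?d ?d div 2 + root_form n ?x ?d"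
 using even_letter[OF xw(1)] even_word[OF xw(2)] root_form_sym[of n ?d ?x]
 by (auto simp: root_form_add_left root_form_add_right elim!: evenE)
 have "prod_list (map (PP q g) (x # w)) = PP q g x * (q powi (- (root_form n ?d ?d div 2)) *. (prod_list (map g w) * G.Kf (- ?d)))"
 unfolding list.map prod_list.Cons Cons.IH[OF xw(2)] ..
 also have "... = (q powi (- (root_form n ?x ?x div 2)) * q powi (- (root_form n ?d ?d div 2)) * q powi (- root_form n ?x ?d)) *.
 (g x * prod_list (map g w) * (G.Kf (- ?x) * G.Kf (- ?d)))"
 unfolding PP_letter[OF xw(1)] by (simp add: mult.assoc scl scr comm mult_ac)
 also have "q powi (- (root_form n ?x ?x div 2)) * q powi (- (root_form n ?d ?d div 2)) * q powi (- root_form n ?x ?d) =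
 q powi (- (root_form n (?x + ?d) (?x + ?d) div 2))"
 unfolding ev using q0 by (simp add: power_int_add[symmetric] algebra_simps)
 also have "G.Kf (- ?x) * G.Kf (- ?d) = G.Kf (- (?x + ?d))"
 by (simp flip: G.Kf_add)
 finally show ?case unfolding word_degree_Cons by (simp only: list.map prod_list.Cons)
qed

lemma psi_val:
 assumes X: "X : carrier A.U"
 shows "psi n q X : carrier A.U & A.val (psi n q X) = lift (PP q g) (A.val X)"
 unfolding psi_def
proof (rule quot_map_A[OF G.qgroup_PP _ _ X])
 fix p assume p: "p : MA.C"
 let ?s = "%w. Poly_Mapping.lookup p w * q powi (- (root_form n (word_degree w) (word_degree w) div 2))"
 have w: "word w : MA.C & word (Kword n \<mu>) : MA.C & set w <= letters n" if "w : Poly_Mapping.keys p" for w \<mu>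
 proof -
 have "set w <= letters n" using that p by (auto simp: MA.C_def)
 thus ?thesis using word_C[OF Kword_letters] word_C[of w] by blast
 qed
 show "psi_free n q p : MA.C" unfolding psi_free_def
 using w by (intro MA.C_sum MA.C_mult MA.C_scalar) auto
 have "A.\<pi> (psi_free n q p) = (\<Sum>w\<in>Poly_Mapping.keys p. ?s w *. (prod_list (map g w) * G.Kf (- word_degree w)))"
 unfolding psi_free_def A.\<pi>_sum
 proof (rule sum.cong[OF refl])
 fix w' assume "w' : Poly_Mapping.keys p"
 with w have w': "word w' : MA.C" "word (Kword n (- word_degree w')) : MA.C" by auto
 have "A.\<pi> (scalar (?s w') * word w' * word (Kword n (- word_degree w'))) = ?s w' *. (A.\<pi> (word w') * A.\<pi> (word (Kword n (- word_degree w'))))"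
 using w' by (simp add: mult.assoc A.\<pi>_smult A.\<pi>_mult)
 thus "A.\<pi> (scalar (?s w') * word w' * word (Kword n (- word_degree w'))) = ?s w' *. (prod_list (map g w') * G.Kf (- word_degree w'))"
 using w' by (simp add: \<pi>_hext kword_def)
 qed
 also have "... = hext (PP q g) p"
 unfolding hext_def lext_def using w by (intro sum.cong refl) (simp add: PP_word)
 finally show "A.\<pi> (psi_free n q p) = hext (PP q g) p" .
qed

text \<open>Applying a linear form to the left factor is well defined on the tensor product. A linear form on a subspace extends to the whole algebra, and the extension descends to the quotient because it kills the ideal in the left factor.\<close>
lemma ex_contraction:
 fixes Bs :: "letter list lend set" and \<phi> :: "letter list lend => complex"
 assumes Bs: "calg.subspace Bs" "Bs <= A.V"
 and add: "!!v w. v : Bs ==> w : Bs ==> \<phi> (v + w) = \<phi> v + \<phi> w"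
 and sc: "!!c v. v : Bs ==> \<phi> (c *. v) = c * \<phi> v"
 obtains Th :: "(letter list \<times> letter list) lend => letter list lend" where
 "!!z z'. z : B.V ==> z' : B.V ==> Th (z + z') = Th z + Th z'" "!!c z. z : B.V ==> Th (c *. z) = c *. Th z"
 "!!v w. v : Bs ==> w : A.V ==> Th (lift f1 v * lift f2 w) = \<phi> v *. w"
proof -
 define B' where "B' = {x : MA.C. A.\<pi> x : Bs}"
 have B': "pm.subspace B'"
 using Bs(1) by (auto simp: pm.subspace_def B'_def MA.C_0 MA.C_add MA.C_smult A.\<pi>_0 A.\<pi>_add A.\<pi>_smult calg.subspace_def)
 obtain \<phi>' where \<phi>': "!!x y. \<phi>' (x + y) = \<phi>' x + \<phi>' y" "!!c x. \<phi>' (scalar c * x) = c * \<phi>' x"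
 "!!x. x : B' ==> \<phi>' x = \<phi> (A.\<pi> x)"
 by (rule functional_extend[OF B', of "%x. \<phi> (A.\<pi> x)"])
 (auto simp: B'_def A.\<pi>_add A.\<pi>_smult add sc)
 have \<phi>0: "\<phi> 0 = 0" using sc[of 0 0] calg.subspace_0[OF Bs(1)] by simp
 have \<phi>I: "\<phi>' x = 0" if "x : Uq_ideal n q" for x
 proof -
 have "x : MA.C" "A.\<pi> x = 0" using that Uq_C A.\<pi>_eq_0 by auto
 thus ?thesis using \<phi>'(3)[of x] \<phi>0 calg.subspace_0[OF Bs(1)] by (simp add: B'_def)
 qed
 have \<phi>'0: "\<phi>' 0 = 0" using \<phi>'(2)[of 0 0] by simp
 have \<phi>'l: "\<phi>' x = lext (%u. \<phi>' (word u)) x" for x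
 proof (rule pm_induct[of x UNIV])
 fix u c p assume "\<phi>' p = lext (%u. \<phi>' (word u)) p"
 moreover have "Poly_Mapping.single u c = scalar c * word u" by (simp add: scalar_def word_def mult_single)
 ultimately show "\<phi>' (Poly_Mapping.single u c + p) = lext (%u. \<phi>' (word u)) (Poly_Mapping.single u c + p)"
 by (simp add: \<phi>'(1,2) lext_add lext_scalar_mult scaleC_complex_def) (simp add: word_def scaleC_complex_def)
 qed (simp_all add: \<phi>'0)
 define \<theta> where "\<theta> = lext (%(u, v). \<phi>' (word u) *. A.\<pi> (word v))"
 have \<theta>t: "\<theta> (tens_free x y) = \<phi>' x *. A.\<pi> y" for x y
 unfolding \<theta>_def using lext_tens[of "%(u, v). \<phi>' (word u) *. A.\<pi> (word v)" "%u. \<phi>' (word u)" "%v. A.\<pi> (word v)" x y]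
 by (simp add: \<phi>'l[of x] A.\<pi>_lext[of y] word_def)
 have \<theta>add: "\<theta> (x + y) = \<theta> x + \<theta> y" for x y by (simp add: \<theta>_def lext_add)
 have \<theta>sc: "\<theta> (scalar c * y) = c *. \<theta> y" for c y by (simp add: \<theta>_def lext_scalar_mult)
 have \<theta>0: "\<theta> 0 = 0" by (simp add: \<theta>_def)
 have bil: "\<theta> (a * z * b) = 0" if a: "a : MB.C" and b: "b : MB.C"
 and z: "!!u v u' v'. set u <= letters n ==> set v <= letters n ==> set u' <= letters n ==> set v' <= letters n ==>
 \<theta> (tens_free (word u) (word v) * z * tens_free (word u') (word v')) = 0" for a b z
 using a[unfolded MB.C_def mem_Collect_eq]
 proof (induction rule: pm_induct)
 case (add k c a)
 obtain u v where k: "k = (u, v)" "set u <= letters n" "set v <= letters n" using add(1) by auto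
 have s: "Poly_Mapping.single k c = scalar c * tens_free (word u) (word v)"
 by (simp add: k scalar_def word_def tens_single mult_single zero_prod_def[symmetric])
 have "\<theta> (tens_free (word u) (word v) * z * b) = 0"
 using b[unfolded MB.C_def mem_Collect_eq]
 proof (induction rule: pm_induct)
 case (add k' c' b)
 obtain u' v' where k': "k' = (u', v')" "set u' <= letters n" "set v' <= letters n" using add(1) by auto
 have s': "Poly_Mapping.single k' c' = scalar c' * tens_free (word u') (word v')"
 by (simp add: k' scalar_def word_def tens_single mult_single zero_prod_def[symmetric])
 have "tens_free (word u) (word v) * z * Poly_Mapping.single k' c' = scalar c' * (tens_free (word u) (word v) * z * tens_free (word u') (word v'))"
 unfolding s' by (rule scalar_commute)
 thus ?case using add z[OF k(2,3) k'(2,3)] by (simp add: distrib_left \<theta>add \<theta>sc del: mult.assoc)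
 qed (simp add: \<theta>0)
 hence "\<theta> (Poly_Mapping.single k c * z * b) = 0"
 unfolding s by (simp add: mult.assoc \<theta>sc)
 thus ?case using add by (simp add: distrib_right \<theta>add)
 qed (simp add: \<theta>0)
 have "Uq2_ideal n q <= {x : MB.C. ALL a:MB.C. ALL b:MB.C. \<theta> (a * x * b) = 0}"
 unfolding Uq2_ideal_alt
 proof (rule genideal_subset[OF MB.ideal_annihilator[OF \<theta>add]], intro Un_least image_subsetI CollectI conjI ballI)
 fix x a b assume x: "x : Uq_ideal n q"
 hence xC: "x : MA.C" using Uq_C by auto
 show "tens_free x 1 : MB.C" "tens_free 1 x : MB.C" using xC by (auto intro!: tens_C MA.C_1)
 assume ab: "a : MB.C" "b : MB.C"
 show "\<theta> (a * tens_free x 1 * b) = 0"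
 proof (rule bil[OF ab])
 fix u v u' v' assume "set u <= letters n" "set v <= letters n" "set u' <= letters n" "set v' <= letters n"
 hence "word u * x * word u' : Uq_ideal n q" using A.I_mult x word_C by blast
 thus "\<theta> (tens_free (word u) (word v) * tens_free x 1 * tens_free (word u') (word v')) = 0"
 by (simp add: tens_mult \<theta>t \<phi>I)
 qed
 show "\<theta> (a * tens_free 1 x * b) = 0"
 proof (rule bil[OF ab])
 fix u v u' v' assume "set u <= letters n" "set v <= letters n" "set u' <= letters n" "set v' <= letters n"
 hence *: "word v * x * word v' : Uq_ideal n q" using A.I_mult x word_C by blast
 hence "A.\<pi> (word v * x * word v') = 0" using A.\<pi>_eq_0 Uq_C by blast
 thus "\<theta> (tens_free (word u) (word v) * tens_free 1 x * tens_free (word u') (word v')) = 0"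
 by (simp add: tens_mult \<theta>t)
 qed
 qed
 note sub2 = this
 have \<theta>I: "\<theta> x = 0" if "x : Uq2_ideal n q" for x
 proof -
 have "\<theta> (1 * x * 1) = 0" using that MB.C_1 sub2 by blast
 thus ?thesis by simp
 qed
 have \<theta>eq: "\<theta> x = \<theta> y" if "x : MB.C" "y : MB.C" "B.\<pi> x = B.\<pi> y" for x y
 proof -
 have "\<theta> (x - y) = 0" using that B.\<pi>_eq \<theta>I by blast
 moreover have "\<theta> (x - y) + \<theta> y = \<theta> x" by (simp flip: \<theta>add)
 ultimately show ?thesis by simp
 qed
 define Th where "Th z = \<theta> (SOME x. x : MB.C & B.\<pi> x = z)" for z
 have Th: "Th (B.\<pi> x) = \<theta> x" if "x : MB.C" for x
 unfolding Th_def using someI[of "%y. y : MB.C & B.\<pi> y = B.\<pi> x" x] that by (intro \<theta>eq) auto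
 show thesis
 proof (rule that[of Th])
 fix z z' assume "z : B.V" "z' : B.V"
 then obtain x x' where "x : MB.C" "z = B.\<pi> x" "x' : MB.C" "z' = B.\<pi> x'" by (auto simp: B.V_def)
 thus "Th (z + z') = Th z + Th z'"
 using Th[of "x + x'"] by (simp add: Th MB.C_add B.\<pi>_add \<theta>add)
 next
 fix c z assume "z : B.V"
 then obtain x where "x : MB.C" "z = B.\<pi> x" by (auto simp: B.V_def)
 thus "Th (c *. z) = c *. Th z"
 using Th[of "scalar c * x"] by (simp add: Th MB.C_smult B.\<pi>_smult \<theta>sc)
 next
 fix v w assume v: "v : Bs" and w: "w : A.V"
 then obtain x y where x: "x : MA.C" "v = A.\<pi> x" and y: "y : MA.C" "w = A.\<pi> y"
 using Bs(2) by (auto simp: A.V_def)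
 have "lift f1 v * lift f2 w = B.\<pi> (tens_free x 1 * tens_free 1 y)"
 using x y by (simp add: lift_\<pi>[OF qgroup_f1] lift_\<pi>[OF qgroup_f2] B.\<pi>_mult tens_C MA.C_1 tens_left_hext tens_right_hext)
 also have "... = B.\<pi> (tens_free x y)" by (simp add: tens_mult)
 finally show "Th (lift f1 v * lift f2 w) = \<phi> v *. w"
 using x y v Th[OF tens_C] \<phi>'(3)[of x] by (simp add: \<theta>t B'_def)
 qed
qed

end

section \<open>Inversions\<close>

text \<open>Coordinates in which reflections are transpositions: roots become differences of unit vectors.\<close>
definition eps_root :: "nat => nat => nat => int" where
 "eps_root x y = (%c. (if x <= c then 1 else 0) - (if y <= c then 1 else 0))"

definition swap_adj :: "nat => nat => nat" where
 "swap_adj a x = (if x = a then Suc a else if x = Suc a then a else x)"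

lemma root_form_simple_right:
 assumes "a : {1..n}" "\<mu> 0 = 0" "\<mu> (Suc n) = 0"
 shows "root_form n \<mu> (simple_root a) = 2 * \<mu> a - \<mu> (a - 1) - \<mu> (Suc a)"
proof -
 have "root_form n \<mu> (simple_root a) = (\<Sum>b\<in>{1..n}. \<mu> b * cartan a b)"
 unfolding root_form_sym[of n \<mu>] root_form_simple_left[OF assms(1)] ..
 also have "... = (\<Sum>b\<in>{0..Suc n}. \<mu> b * cartan a b)"
 using assms(2,3) by (intro sum.mono_neutral_left) (auto simp: not_le Suc_le_eq le_Suc_eq)
 also have "... = (\<Sum>b\<in>{a - 1, a, Suc a}. \<mu> b * cartan a b)"
 using assms(1) by (intro sum.mono_neutral_right) (auto simp: cartan_def)
 also have "... = 2 * \<mu> a - \<mu> (a - 1) - \<mu> (Suc a)"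
 proof -
 obtain c where "a = Suc c" using assms(1) by (cases a) auto
 thus ?thesis by (simp add: cartan_def)
 qed
 finally show ?thesis .
qed

lemma swap_adj_le: "(if swap_adj a x <= c then 1 else 0 :: int) =
 (if x <= c then 1 else 0) - ((if x = a then 1 else 0) - (if x = Suc a then 1 else 0)) * (if c = a then 1 else 0)"
 by (auto simp: swap_adj_def)

lemma second_difference_le: "1 <= a ==> (if x <= a - 1 then 1 else 0 :: int) =
 2 * (if x <= a then 1 else 0) - (if x <= Suc a then 1 else 0) - ((if x = a then 1 else 0) - (if x = Suc a then 1 else 0))"
 by auto

lemma reflection_eps_root:
 assumes a: "a : {1..n}" and x: "x : {1..Suc n}" and y: "y : {1..Suc n}"
 shows "reflection n a (eps_root x y) = eps_root (swap_adj a x) (swap_adj a y)"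
proof
 fix c
 have "root_form n (eps_root x y) (simple_root a) = 2 * eps_root x y a - eps_root x y (a - 1) - eps_root x y (Suc a)"
 by (rule root_form_simple_right[OF a]) (use x y in \<open>auto simp: eps_root_def\<close>)
 hence "reflection n a (eps_root x y) c = eps_root x y c - (2 * eps_root x y a - eps_root x y (a - 1) - eps_root x y (Suc a)) * (if c = a then 1 else 0)"
 by (simp add: reflection_def simple_root_def)
 also have "... = eps_root (swap_adj a x) (swap_adj a y) c"
 proof -
 have a1: "1 <= a" using a by simp
 show ?thesis
 using a unfolding eps_root_def swap_adj_le second_difference_le[OF a1] by (simp add: algebra_simps)
 qed
 finally show "reflection n a (eps_root x y) c = eps_root (swap_adj a x) (swap_adj a y) c" .
qed

lemma foldr_reflection:
 assumes "set ws <= {1..n}" "x : {1..Suc n}" "y : {1..Suc n}"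
 shows "foldr (reflection n) ws (eps_root x y) = eps_root (foldr swap_adj ws x) (foldr swap_adj ws y) &
 foldr swap_adj ws x : {1..Suc n} & foldr swap_adj ws y : {1..Suc n}"
 using assms(1)
proof (induction ws)
 case (Cons a ws)
 hence a: "a : {1..n}" and IH: "foldr (reflection n) ws (eps_root x y) = eps_root (foldr swap_adj ws x) (foldr swap_adj ws y)"
 "foldr swap_adj ws x : {1..Suc n}" "foldr swap_adj ws y : {1..Suc n}" by auto
 have "swap_adj a z : {1..Suc n}" if "z : {1..Suc n}" for z
 using that a by (auto simp: swap_adj_def)
 thus ?case using reflection_eps_root[OF a IH(2,3)] IH by simp
qed (use assms in auto)

lemma foldr_swap_up: "foldr swap_adj (rev [i..<i + l]) x = (if x = i then i + l else if i < x & x <= i + l then x - 1 else x)"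
 by (induction l) (auto simp: swap_adj_def)

lemma foldr_swap_down: "k <= i ==> foldr swap_adj [i - k..<i] x = (if x = i then i - k else if i - k <= x & x < i then Suc x else x)"
proof (induction k)
 case (Suc k)
 define m where "m = i - Suc k"
 have m: "m < i" "i - k = Suc m" using Suc.prems by (auto simp: m_def)
 have step: "swap_adj m (if x = i then Suc m else if Suc m <= x & x < i then Suc x else x) =
 (if x = i then m else if m <= x & x < i then Suc x else x)"
 using m(1) by (cases "x = m") (auto simp: swap_adj_def)
 have "foldr swap_adj [m..<i] x = swap_adj m (foldr swap_adj [i - k..<i] x)"
 unfolding m(2) using m(1) by (simp add: upt_conv_Cons)
 also have "... = swap_adj m (if x = i then Suc m else if Suc m <= x & x < i then Suc x else x)"
 using Suc m(2) by simp
 finally have "foldr swap_adj [m..<i] x = (if x = i then m else if m <= x & x < i then Suc x else x)"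
 unfolding step .
 thus ?case unfolding m_def .
qed auto

lemma root_sum_eq: "root_sum a b = (%c. if a <= c & c <= b then 1 else 0)"
proof
 fix c
 have "root_sum a b c = (\<Sum>j\<in>{a..b}. if j = c then 1 else 0)"
 unfolding root_sum_def by (intro sum.cong) (auto simp: simple_root_def)
 thus "root_sum a b c = (if a <= c & c <= b then 1 else 0)" by simp
qed

lemma root_sum_eps: "a <= Suc b ==> root_sum a b = eps_root a (Suc b)"
 by (auto simp: root_sum_eq eps_root_def fun_eq_iff)

text \<open>Acting with the word and counting which pairs of positions change their order gives the inversions.\<close>
lemma inversions_vee:
 assumes i: "1 <= i" "i <= n" and l: "l <= n - i" and k: "k <= i - 1"
 shows "inversions n (vee i l k) = {root_sum i (i + r) | r. r <= l} \<union> {root_sum (i - s) i | s. s <= k}"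
proof -
 let ?\<pi> = "%x. foldr swap_adj (rev (vee i l k)) x"
 define lo where "lo = i - k"
 have lo: "1 <= lo" "lo <= i" using i k by (auto simp: lo_def)
 have \<pi>: "?\<pi> x = (if x = i then Suc (i + l) else if x = Suc i then lo else if Suc i < x & x <= Suc (i + l) then x - 1
 else if lo <= x & x < i then Suc x else x)" for x
 proof -
 have 1: "?\<pi> x = foldr swap_adj [i - k..<i] (foldr swap_adj (rev [i..<i + Suc l]) x)"
 by (simp add: vee_def del: upt_Suc)
 have "k <= i" using k by simp
 hence 2: "foldr swap_adj [i - k..<i] z = (if z = i then lo else if lo <= z & z < i then Suc z else z)" for z
 unfolding lo_def by (rule foldr_swap_down)
 show ?thesis unfolding 1 2 foldr_swap_up
 using lo by (cases "x = i"; cases "x = Suc i"; cases "x < i") (simp_all, auto)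
 qed
 have ws: "set (rev (vee i l k)) <= {1..n}" using i l k by (auto simp: vee_def)
 have act: "- weyl_act n (rev (vee i l k)) (root_sum a b) : pos_roots n \<longleftrightarrow> ?\<pi> (Suc b) < ?\<pi> a"
 if ab: "1 <= a" "a <= b" "b <= n" for a b
 proof -
 have in_n: "a : {1..Suc n}" "Suc b : {1..Suc n}" using ab by auto
 note f = foldr_reflection[OF ws in_n]
 have w: "- weyl_act n (rev (vee i l k)) (root_sum a b) = eps_root (?\<pi> (Suc b)) (?\<pi> a)"
 unfolding weyl_act_def using f ab by (simp add: root_sum_eps) (simp add: eps_root_def fun_eq_iff)
 have y: "?\<pi> (Suc b) \<ge> 1" and x: "?\<pi> a <= Suc n" using f by auto
 show ?thesis
 proof
 assume "?\<pi> (Suc b) < ?\<pi> a"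
 thus "- weyl_act n (rev (vee i l k)) (root_sum a b) : pos_roots n"
 unfolding w pos_roots_def using x y
 by (intro CollectI exI[of _ "?\<pi> (Suc b)"] exI[of _ "?\<pi> a - 1"]) (auto simp: root_sum_eps)
 next
 assume "- weyl_act n (rev (vee i l k)) (root_sum a b) : pos_roots n"
 then obtain a' b' where "a' <= b'" and e: "eps_root (?\<pi> (Suc b)) (?\<pi> a) = root_sum a' b'"
 unfolding w pos_roots_def by auto
 hence "eps_root (?\<pi> (Suc b)) (?\<pi> a) a' = 1" by (simp add: e root_sum_eq)
 thus "?\<pi> (Suc b) < ?\<pi> a" unfolding eps_root_def by (simp split: if_splits)
 qed
 qed
 have iff: "?\<pi> (Suc b) < ?\<pi> a \<longleftrightarrow> (a = i & b <= i + l) \<or> (b = i & i - k <= a)"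
 if ab: "1 <= a" "a <= b" "b <= n" for a b
 proof (cases "a < i")
 case True
 hence "?\<pi> a = (if lo <= a then Suc a else a)" by (simp add: \<pi>)
 moreover have "?\<pi> (Suc b) = (if b = i then lo else if Suc b = i then Suc (i + l) else if i < b & b <= i + l then b
 else if lo <= Suc b & Suc b < i then Suc (Suc b) else Suc b)" by (simp add: \<pi>)
 ultimately show ?thesis using ab lo True unfolding lo_def[symmetric] by (cases "lo <= a") auto
 next
 case False
 hence "?\<pi> (Suc b) = (if b = i then lo else if b <= i + l then b else Suc b)" using ab by (simp add: \<pi>)
 moreover have "?\<pi> a = (if a = i then Suc (i + l) else if a = Suc i then lo else if a <= Suc (i + l) then a - 1 else a)"
 using False by (simp add: \<pi>)
 ultimately show ?thesis using ab lo False unfolding lo_def[symmetric] by (cases "a = i") auto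
 qed
 show ?thesis
 proof (intro equalityI subsetI)
 fix \<beta> assume "\<beta> : inversions n (vee i l k)"
 then obtain a b where ab: "1 <= a" "a <= b" "b <= n" "\<beta> = root_sum a b" "- weyl_act n (rev (vee i l k)) \<beta> : pos_roots n"
 unfolding inversions_def pos_roots_def by blast
 hence "(a = i & b <= i + l) \<or> (b = i & i - k <= a)" using act iff by blast
 thus "\<beta> : {root_sum i (i + r) | r. r <= l} \<union> {root_sum (i - s) i | s. s <= k}"
 proof (elim disjE conjE)
 assume "a = i" "b <= i + l"
 thus ?thesis using ab by (intro UnI1 CollectI exI[of _ "b - i"]) auto
 next
 assume "b = i" "i - k <= a"
 thus ?thesis using ab by (intro UnI2 CollectI exI[of _ "i - a"]) auto
 qed
 next
 fix \<beta> assume "\<beta> : {root_sum i (i + r) | r. r <= l} \<union> {root_sum (i - s) i | s. s <= k}"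
 then obtain a b where ab: "1 <= a" "a <= b" "b <= n" "\<beta> = root_sum a b" "(a = i & b <= i + l) \<or> (b = i & i - k <= a)"
 proof (elim UnE CollectE exE conjE)
 fix r assume "\<beta> = root_sum i (i + r)" "r <= l"
 thus thesis using that[of i "i + r"] i l by simp
 next
 fix s assume "\<beta> = root_sum (i - s) i" "s <= k"
 moreover from this have "i - k <= i - s" "1 <= i - s" using i k by auto
 ultimately show thesis using that[of "i - s" i] i by simp
 qed
 thus "\<beta> : inversions n (vee i l k)"
 using act[OF ab(1-3)] iff[OF ab(1-3)] unfolding inversions_def by (auto simp: pos_roots_def)
 qed
qed

section \<open>Roots of a vee as paths\<close>

fun reach :: "nat => nat list => nat list => nat list => bool" where
 "reach n [] xs ys \<longleftrightarrow> xs = ys"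
| "reach n (a # ws) xs ys \<longleftrightarrow> a : {1..n} & (EX zs. reach n ws xs zs &
 (zs ~= [] & path n (a # zs) & ys = a # zs \<or> (ALL c:set zs. cartan a c = 0) & ys = zs))"

lemma reach_append: "reach n vs xs ys ==> reach n us ys zs ==> reach n (us @ vs) xs zs"
 by (induction us arbitrary: zs) auto

lemma path_upt: "1 <= i ==> i + r <= n ==> path n [i..<Suc (i + r)]"
proof (induction r arbitrary: i)
 case (Suc r)
 have e: "[i..<Suc (i + Suc r)] = i # [Suc i..<Suc (Suc i + r)]" by (simp add: upt_conv_Cons del: upt_Suc)
 have "path n [Suc i..<Suc (Suc i + r)]" using Suc.IH[of "Suc i"] Suc.prems by (simp del: upt_Suc)
 thus ?case unfolding e using Suc.prems
 by (subst path_Cons_iff) (auto simp: cartan_def tl_upt simp del: upt_Suc)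
qed simp

lemma path_rev_upt: "1 <= m ==> m + t <= n ==> path n (rev [m..<Suc (m + t)])"
proof (induction t)
 case (Suc t)
 have "path n (rev [m..<Suc (m + t)])" using Suc by simp
 moreover have "hd (rev [m..<Suc (m + t)]) = m + t" "tl (rev [m..<Suc (m + t)]) = rev [m..<m + t]" by simp_all
 ultimately have "path n ((m + Suc t) # rev [m..<Suc (m + t)])" using Suc.prems
 by (subst path_Cons_iff) (auto simp: cartan_def simp del: upt_Suc)
 thus ?case by simp
qed simp

text \<open>The path of the root with position \<open>j\<close> in the convex order: the upward arm comes first.\<close>
definition chain :: "nat => nat => nat => nat list" where
 "chain i l j = (if j <= l then [i..<Suc (i + j)] else rev [i - (j - l)..<Suc i])"

lemma reach_up: "1 <= i ==> i + j <= n ==> reach n [i..<i + j] [i + j] [i..<Suc (i + j)]"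
proof (induction j arbitrary: i)
 case (Suc j)
 have e: "[i..<i + Suc j] = i # [Suc i..<Suc i + j]" "[i..<Suc (i + Suc j)] = i # [Suc i..<Suc (Suc i + j)]"
 by (simp_all add: upt_conv_Cons del: upt_Suc)
 have "reach n [Suc i..<Suc i + j] [Suc i + j] [Suc i..<Suc (Suc i + j)]" using Suc.IH[of "Suc i"] Suc.prems by (simp del: upt_Suc)
 moreover have "path n (i # [Suc i..<Suc (Suc i + j)])"
 using path_upt[of i "Suc j" n] Suc.prems unfolding e(2) by (simp del: upt_Suc)
 ultimately show ?case unfolding e using Suc.prems by (auto simp del: upt_Suc intro!: exI[of _ "[Suc i..<Suc (Suc i + j)]"])
qed simp

lemma reach_down: "1 <= m ==> m + t <= n ==> reach n (rev [Suc m..<Suc (m + t)]) [m] (rev [m..<Suc (m + t)])"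
proof (induction t)
 case (Suc t)
 have "reach n (rev [Suc m..<Suc (m + t)]) [m] (rev [m..<Suc (m + t)])" using Suc by simp
 moreover have "path n ((m + Suc t) # rev [m..<Suc (m + t)])" using path_rev_upt[of m "Suc t" n] Suc.prems by simp
 moreover have "rev [Suc m..<Suc (m + Suc t)] = (m + Suc t) # rev [Suc m..<Suc (m + t)]"
 "rev [m..<Suc (m + Suc t)] = (m + Suc t) # rev [m..<Suc (m + t)]" by simp_all
 ultimately show ?case using Suc.prems
 by (auto simp del: upt_Suc intro!: exI[of _ "rev [m..<Suc (m + t)]"])
qed simp

lemma reach_stay: "set ws <= {1..n} ==> (!!a c. a : set ws ==> c : set xs ==> cartan a c = 0) ==> reach n ws xs xs"
 by (induction ws) auto

lemma reach_vee:
 assumes i: "1 <= i" "i <= n" and l: "l <= n - i" and k: "k <= i - 1" and j: "j < length (vee i l k)"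
 shows "reach n (take j (vee i l k)) [vee i l k ! j] (chain i l j)"
proof (cases "j <= l")
 case True
 hence "take j (vee i l k) = [i..<i + j]" "vee i l k ! j = i + j"
 by (auto simp: vee_def nth_append simp del: upt_Suc)
 thus ?thesis using reach_up[of i j n] True i l by (simp add: chain_def del: upt_Suc)
next
 case False
 define s where "s = j - l"
 have s: "1 <= s" "s <= k" "j = l + s" using False j k i by (auto simp: s_def vee_def)
 have nth: "vee i l k ! j = i - s"
 using s k i by (simp add: vee_def nth_append rev_nth del: upt_Suc)
 have "take (s - 1) (rev [i - k..<i]) = rev [Suc (i - s)..<i]"
 using s k i by (simp add: take_rev Suc_diff_le)
 hence tk: "take j (vee i l k) = [i..<Suc (i + l)] @ rev [Suc (i - s)..<i]"
 using s by (simp add: vee_def del: upt_Suc)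
 have "reach n (rev [Suc (i - s)..<Suc ((i - s) + (s - 1))]) [i - s] (rev [i - s..<Suc ((i - s) + (s - 1))])"
 by (rule reach_down) (use s i k in auto)
 moreover have "Suc ((i - s) + (s - 1)) = i" using s i k by simp
 ultimately have 1: "reach n (rev [Suc (i - s)..<i]) [i - s] (rev [i - s..<i])" by simp
 have e: "[i..<Suc (i + l)] = i # [Suc i..<Suc (i + l)]" by (simp add: upt_conv_Cons del: upt_Suc)
 have 2: "reach n [Suc i..<Suc (i + l)] (rev [i - s..<i]) (rev [i - s..<i])"
 by (rule reach_stay) (use i l in \<open>auto simp: cartan_def\<close>)
 have c: "chain i l j = i # rev [i - s..<i]" using False s i k by (simp add: chain_def)
 have "path n (rev [i - s..<Suc ((i - s) + s)])" by (rule path_rev_upt) (use s i k in auto)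
 moreover have "(i - s) + s = i" using s k i by simp
 ultimately have "path n (i # rev [i - s..<i])" by simp
 moreover have "rev [i - s..<i] ~= []" using s i by simp
 ultimately have "reach n [i..<Suc (i + l)] (rev [i - s..<i]) (chain i l j)"
 unfolding e c using 2 i by (auto simp del: upt_Suc)
 thus ?thesis unfolding tk nth using reach_append[OF 1, of "[i..<Suc (i + l)]" "chain i l j"] by (simp del: upt_Suc)
qed

lemma reach_path: "reach n ws xs ys ==> path n xs ==> path n ys"
 by (induction ws arbitrary: ys) auto

lemma path_distinct: "path n xs ==> distinct xs"
proof (induction n xs rule: path.induct)
 case (3 n a b xs)
 have "cartan a a ~= 0" by simp
 with 3 show ?case by (auto simp: cartan_def)
qed auto

lemma rsum_distinct: "distinct xs ==> rsum xs = (%c. if c : set xs then 1 else 0)"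
 by (induction xs) (auto simp: fun_eq_iff simple_root_def)

lemma reach_weyl:
 assumes "reach n ws xs ys" "path n xs"
 shows "weyl_act n ws (rsum xs) = rsum ys"
 using assms(1)
proof (induction ws arbitrary: ys)
 case (Cons a ws)
 then obtain zs where zs: "a : {1..n}" "reach n ws xs zs"
 "zs ~= [] & path n (a # zs) & ys = a # zs \<or> (ALL c:set zs. cartan a c = 0) & ys = zs" by auto
 have IH: "weyl_act n (a # ws) (rsum xs) = reflection n a (rsum zs)"
 using Cons.IH[OF zs(2)] by (simp add: weyl_act_def)
 have sub: "set zs <= {1..n}" using path_set[OF reach_path[OF zs(2) assms(2)]] .
 from zs(3) show ?case
 proof (elim disjE conjE)
 assume "zs ~= []" "path n (a # zs)" "ys = a # zs"
 thus ?thesis unfolding IH reflection_alt rsum_form_Cons[OF \<open>path n (a # zs)\<close> \<open>zs ~= []\<close>]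
 by (auto simp: fun_eq_iff)
 next
 assume "ALL c:set zs. cartan a c = 0" "ys = zs"
 hence "root_form n (rsum zs) (simple_root a) = 0"
 using rsum_form_zero[OF sub zs(1)] by (simp add: cartan_sym)
 thus ?thesis unfolding IH reflection_alt using \<open>ys = zs\<close> by (auto simp: fun_eq_iff)
 qed
qed (simp add: weyl_act_def)

locale vee_data =
 fixes n i l k :: nat
 assumes i: "1 <= i" "i <= n" and l: "l <= n - i" and k: "k <= i - 1"
begin

abbreviation "w \<equiv> vee i l k"
abbreviation "ch \<equiv> chain i l"
definition "arms = ch ` {..l + k}"

lemma length_w: "length w = Suc (l + k)" using i k by (auto simp: vee_def)

lemma w_in: "j <= l + k ==> w ! j : {1..n}"
proof -
 assume "j <= l + k"
 hence "w ! j : set w" by (simp add: length_w)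
 moreover have "set w <= {1..n}" using i l k by (auto simp: vee_def)
 ultimately show ?thesis by blast
qed

lemma reach_ch: "j <= l + k ==> reach n (take j w) [w ! j] (ch j)"
 by (rule reach_vee[OF i l k]) (simp add: length_w)

lemma path_ch: "j <= l + k ==> path n (ch j)"
 using reach_path[OF reach_ch] w_in by simp

lemma set_ch: "j <= l + k ==> set (ch j) = (if j <= l then {i..i + j} else {i - (j - l)..i})"
 by (auto simp: chain_def)

lemma beta_ch: "j <= l + k ==> beta n w j = rsum (ch j)"
 using reach_weyl[OF reach_ch, of j] w_in[of j] by (simp add: beta_def)

lemma rsum_ch: "j <= l + k ==> rsum (ch j) = (if j <= l then root_sum i (i + j) else root_sum (i - (j - l)) i)"
 using rsum_distinct[OF path_distinct[OF path_ch]] set_ch by (auto simp: root_sum_eq fun_eq_iff)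

lemma chain_length: "j <= l + k ==> length (ch j) = (if j <= l then Suc j else Suc (j - l))"
 using i k by (auto simp: chain_def)

lemma ch_inj: assumes "j <= l + k" "j' <= l + k" "rsum (ch j) = rsum (ch j')" shows "j = j'"
proof -
 have S: "set (ch j) = {c. rsum (ch j) c = 1}" if "j <= l + k" for j
 by (simp add: rsum_distinct[OF path_distinct[OF path_ch[OF that]]])
 have "set (ch j) = set (ch j')" using S assms by simp
 hence "card (set (ch j)) = card (set (ch j'))" by simp
 hence len: "length (ch j) = length (ch j')"
 using distinct_card[OF path_distinct[OF path_ch[OF assms(1)]]] distinct_card[OF path_distinct[OF path_ch[OF assms(2)]]] by simp
 have up: "Suc i : set (ch j) \<longleftrightarrow> 1 <= j & j <= l" if "j <= l + k" for j
 using set_ch[OF that] by auto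
 have "1 <= j & j <= l \<longleftrightarrow> 1 <= j' & j' <= l"
 using up[OF assms(1)] up[OF assms(2)] \<open>set (ch j) = set (ch j')\<close> by simp
 thus ?thesis
 using len unfolding chain_length[OF assms(1)] chain_length[OF assms(2)]
 by (cases "j <= l"; cases "j' <= l") simp_all
qed

lemma root_index_ch: "j <= l + k ==> root_index n w (rsum (ch j)) = j"
 unfolding root_index_def by (rule the_equality) (use ch_inj beta_ch in \<open>auto simp: length_w less_Suc_eq_le\<close>)

lemma inversions_ch: "inversions n w = (%j. rsum (ch j)) ` {..l + k}"
proof -
 have "(%j. rsum (ch j)) ` {..l + k} = {root_sum i (i + r) | r. r <= l} \<union> {root_sum (i - s) i | s. s <= k}"
 proof (intro equalityI subsetI)
 fix \<beta> assume "\<beta> : (%j. rsum (ch j)) ` {..l + k}"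
 then obtain j where j: "j <= l + k" "\<beta> = rsum (ch j)" by auto
 thus "\<beta> : {root_sum i (i + r) | r. r <= l} \<union> {root_sum (i - s) i | s. s <= k}"
 using rsum_ch[OF j(1)] by (cases "j <= l") (auto intro: exI[of _ j] exI[of _ "j - l"])
 next
 fix \<beta> assume "\<beta> : {root_sum i (i + r) | r. r <= l} \<union> {root_sum (i - s) i | s. s <= k}"
 then consider r where "r <= l" "\<beta> = root_sum i (i + r)" | s where "1 <= s" "s <= k" "\<beta> = root_sum (i - s) i"
 proof (elim UnE CollectE exE conjE)
 fix s assume s: "\<beta> = root_sum (i - s) i" "s <= k"
 show thesis
 proof (cases "s = 0")
 case True
 thus ?thesis using that(1)[of 0] s by simp
 next
 case False
 thus ?thesis using that(2)[of s] s by simp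
 qed
 qed (use that(1) in blast)
 thus "\<beta> : (%j. rsum (ch j)) ` {..l + k}"
 proof cases
 case 1
 thus ?thesis using rsum_ch[of r] by (intro image_eqI[of _ _ r]) auto
 next
 case 2
 thus ?thesis using rsum_ch[of "l + s"] by (intro image_eqI[of _ _ "l + s"]) auto
 qed
 qed
 thus ?thesis using inversions_vee[OF i l k] by simp
qed

lemma arms_hd: "xs : arms ==> xs ~= [] & hd xs = i & path n xs & set xs <= {1..n}"
proof -
 assume "xs : arms"
 then obtain j where j: "j <= l + k" "xs = ch j" by (auto simp: arms_def)
 hence "path n xs" using path_ch by blast
 moreover have "hd xs = i"
 proof (cases "j <= l")
 case False
 have "[i - (j - l)..<Suc i] = [i - (j - l)..<i] @ [i]" by (rule upt_Suc_append) simp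
 thus ?thesis using j(2) False by (simp add: chain_def del: upt_Suc)
 qed (use j(2) in \<open>simp add: chain_def hd_upt del: upt_Suc\<close>)
 ultimately show ?thesis using path_set[of n xs] by (cases xs) auto
qed

lemma ch_0: "ch 0 = [i]" by (simp add: chain_def)
lemma single_chain: "[i] : arms" unfolding arms_def using ch_0 by (intro image_eqI[of _ _ 0]) auto

lemma chain_take:
 assumes "j <= l + k" "1 <= r" "r <= length (ch j)"
 shows "take r (ch j) : arms"
proof (cases "j <= l")
 case True
 hence "take r (ch j) = ch (r - 1)" "r - 1 <= l + k"
 using assms by (auto simp: chain_def simp del: upt_Suc)
 thus ?thesis by (simp add: arms_def)
next
 case False
 show ?thesis
 proof (cases "r = 1")
 case True
 have "take 1 (ch j) = [i]" using False i k assms by (auto simp: chain_def)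
 thus ?thesis using True single_chain by simp
 next
 case r: False
 have "take r (ch j) = ch (l + (r - 1))"
 using False assms r i k by (auto simp: chain_def take_rev simp del: upt_Suc)
 moreover have "l + (r - 1) <= l + k" using False assms chain_length[OF assms(1)] by auto
 ultimately show ?thesis by (simp add: arms_def)
 qed
qed

lemma arms_take: "xs : arms ==> 1 <= r ==> r <= length xs ==> take r xs : arms"
 using chain_take by (auto simp: arms_def)

text \<open>Paths on the same arm are prefixes of each other, those on different arms share only their first vertex. Every relation between two root vectors falls into one of these cases.\<close>
lemma arms_cases:
 assumes "j <= l + k" "j' <= l + k" "j < j'"
 obtains zs where "ch j' = ch j @ zs" "zs ~= []"
 | us vs where "ch j = i # us" "ch j' = i # vs" "us ~= []" "vs ~= []" "!!b c. b : set us ==> c : set vs ==> cartan b c = 0"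
proof -
 consider "j' <= l" | "j > l" | "j = 0" "j' > l" | "1 <= j" "j <= l" "j' > l" using assms by linarith
 thus thesis
 proof cases
 case 1
 have "ch j' = [i..<Suc (i + j)] @ [Suc (i + j)..<Suc (i + j')]"
 using 1 assms upt_add_eq_append[of i "Suc (i + j)" "j' - j"] by (simp add: chain_def del: upt_Suc)
 thus thesis using 1 assms by (intro that(1)[of "[Suc (i + j)..<Suc (i + j')]"]) (auto simp: chain_def simp del: upt_Suc)
 next
 case 2
 let ?a = "i - (j' - l)" and ?b = "i - (j - l)"
 have ab: "?a < ?b" "?b <= i" using 2 assms i k by auto
 have "[?a..<Suc i] = [?a..<?b] @ [?b..<Suc i]"
 using upt_add_eq_append[of ?a ?b "Suc i - ?b"] ab by simp
 hence "ch j' = ch j @ rev [?a..<?b]" using 2 assms by (simp add: chain_def del: upt_Suc)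
 thus thesis using ab by (intro that(1)[of "rev [?a..<?b]"]) auto
 next
 case 3
 let ?a = "i - (j' - l)"
 have "?a < i" using 3 assms i k by auto
 hence "ch j' = [i] @ rev [?a..<i]" using 3 by (simp add: chain_def)
 thus thesis using \<open>?a < i\<close> 3 by (intro that(1)[of "rev [?a..<i]"]) (auto simp: ch_0)
 next
 case 4
 let ?a = "i - (j' - l)"
 have a: "?a < i" using 4 assms i k by auto
 have 1: "ch j = i # [Suc i..<Suc (i + j)]" using 4 by (simp add: chain_def upt_conv_Cons del: upt_Suc)
 have 2: "ch j' = i # rev [?a..<i]" using 4 a by (simp add: chain_def)
 show thesis
 by (rule that(2)[OF 1 2]) (use 4 a in \<open>auto simp: cartan_def\<close>)
 qed
qed

end

context uq begin

text \<open>One initial letter of the word prolongs the path at its front or, when it is not adjacent to the path, leaves it alone. In this way Lusztig automorphisms turn a generator into the commutator along the path.\<close>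
lemma reach_lusztig:
 assumes "reach n ws xs ys" "path n xs" "X : carrier A.U" "A.val X = G.eroot xs"
 shows "foldr (lusztig n q) ws X : carrier A.U & A.val (foldr (lusztig n q) ws X) = G.eroot ys"
 using assms(1)
proof (induction ws arbitrary: ys)
 case (Cons a ws)
 then obtain zs where zs: "a : {1..n}" "reach n ws xs zs"
 "zs ~= [] & path n (a # zs) & ys = a # zs \<or> (ALL c:set zs. cartan a c = 0) & ys = zs" by auto
 have sub: "set zs <= {1..n}" using path_set[OF reach_path[OF zs(2) assms(2)]] .
 have IH: "foldr (lusztig n q) ws X : carrier A.U" "A.val (foldr (lusztig n q) ws X) = G.eroot zs"
 using Cons.IH[OF zs(2)] by auto
 have "lift (TT n q a g) (G.eroot zs) = lroot (inverse q) (%b. TT n q a g (LE b)) zs"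
 by (rule lift_eroot[OF G.qgroup_TT[OF zs(1)] sub])
 also have "... = G.eroot ys"
 using zs(3)
 proof (elim disjE conjE)
 assume "zs ~= []" "path n (a # zs)" "ys = a # zs"
 thus ?thesis using G.eroot_TT by simp
 next
 assume c: "ALL c:set zs. cartan a c = 0" "ys = zs"
 hence "TT n q a g (LE b) = g (LE b)" if "b : set zs" for b using that by auto
 thus ?thesis unfolding G.eroot_def c(2) by (rule lroot_cong)
 qed
 finally show ?case using lusztig_val[OF zs(1) IH(1)] IH(2) by simp
qed (use assms in simp)

lemma reach_lusztig_inv:
 assumes "reach n ws xs ys" "path n xs" "X : carrier A.U" "A.val X = G.froot xs"
 shows "foldr (lusztig_inv n q) ws X : carrier A.U & A.val (foldr (lusztig_inv n q) ws X) = G.froot ys"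
 using assms(1)
proof (induction ws arbitrary: ys)
 case (Cons a ws)
 then obtain zs where zs: "a : {1..n}" "reach n ws xs zs"
 "zs ~= [] & path n (a # zs) & ys = a # zs \<or> (ALL c:set zs. cartan a c = 0) & ys = zs" by auto
 have subz: "set zs <= {1..n}" using path_set[OF reach_path[OF zs(2) assms(2)]] .
 have suby: "set ys <= {1..n}" using subz zs(1,3) by auto
 have IH: "foldr (lusztig_inv n q) ws X : carrier A.U" "A.val (foldr (lusztig_inv n q) ws X) = G.froot zs"
 using Cons.IH[OF zs(2)] by auto
 have "lift (TT n q a g) (G.froot ys) = lroot q (%b. TT n q a g (LF b)) ys"
 by (rule lift_eroot[OF G.qgroup_TT[OF zs(1)] suby])
 also have "... = G.froot zs"
 using zs(3)
 proof (elim disjE conjE)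
 assume "zs ~= []" "path n (a # zs)" "ys = a # zs"
 thus ?thesis using G.froot_TT by simp
 next
 assume c: "ALL c:set zs. cartan a c = 0" "ys = zs"
 hence "TT n q a g (LF b) = g (LF b)" if "b : set zs" for b using that by auto
 thus ?thesis unfolding G.froot_def c(2) by (rule lroot_cong)
 qed
 finally show ?case
 using lusztig_inv_val[OF zs(1) IH(1) froot_V[OF suby]] IH(2) by simp
qed (use assms in simp)

end

locale uq_vee = uq n q + vee_data n i l k for n q i l k
begin

lemma rootE_val: "j <= l + k ==> rootE n q w (rsum (ch j)) : carrier A.U & A.val (rootE n q w (rsum (ch j))) = G.eroot (ch j)"
 unfolding rootE_def Let_def root_index_ch
 by (rule reach_lusztig[OF reach_ch]) (use w_in UqE_val in auto)

lemma rootF_val: "j <= l + k ==> rootF n q w (rsum (ch j)) : carrier A.U & A.val (rootF n q w (rsum (ch j))) = G.froot (ch j)"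
 unfolding rootF_def Let_def root_index_ch
 by (rule reach_lusztig_inv[OF reach_ch]) (use w_in UqF_val in auto)

end

section \<open>Character shifts\<close>

lemma hom_image_alg:
 fixes h :: "'a::calg => 'b::calg"
 assumes "!!v w. v : alg X ==> w : alg X ==> h (v + w) = h v + h w" "!!v w. v : alg X ==> w : alg X ==> h (v * w) = h v * h w"
 "!!c v. v : alg X ==> h (c *. v) = c *. h v" "h 1 = 1"
 shows "h ` alg X = alg (h ` X)"
proof
 show "h ` alg X <= alg (h ` X)"
 proof safe
 fix v assume "v : alg X"
 thus "h v : alg (h ` X)"
 by induction (use assms in \<open>auto intro: alg.intros\<close>)
 qed
 show "alg (h ` X) <= h ` alg X"
 proof
 fix v assume "v : alg (h ` X)"
 thus "v : h ` alg X"
 proof induction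
 case (base x)
 then obtain y where "y : X" "x = h y" by (rule imageE)
 thus ?case using alg.base by blast
 next
 case one
 show ?case using imageI[OF alg.one, of h X] by (simp only: assms(4))
 next
 case (add x y)
 then obtain v w where vw: "v : alg X" "w : alg X" "x = h v" "y = h w" by blast
 show ?case using imageI[OF alg.add[OF vw(1,2)], of h] by (simp only: vw(3,4) assms(1)[OF vw(1,2)])
 next
 case (mult x y)
 then obtain v w where vw: "v : alg X" "w : alg X" "x = h v" "y = h w" by blast
 show ?case using imageI[OF alg.mult[OF vw(1,2)], of h] by (simp only: vw(3,4) assms(2)[OF vw(1,2)])
 next
 case (scale x c)
 then obtain v where v: "v : alg X" "x = h v" by blast
 show ?case using imageI[OF alg.scale[OF v(1)], of h] by (simp only: v(2) assms(3)[OF v(1)])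
 qed
 qed
qed

lemma span_induct_weak [consumes 1, case_names zero step]:
 assumes "x : calg.span S" "P 0" "!!c x y. x : S ==> y : calg.span S ==> P y ==> P (c *. x + y)"
 shows "P x"
proof -
 have "x : calg.span S & P x"
 using assms(1)
 proof (induction rule: calg.span_induct_alt)
 case (step c x y)
 thus ?case using assms(3) by (auto intro: calg.span_add calg.span_scale calg.span_base)
 qed (use assms(2) calg.span_zero in simp)
 thus ?thesis ..
qed

lemma span_mult:
 fixes T1 T2 :: "'a::calg set"
 assumes "!!x y. x : T1 ==> y : T2 ==> x * y : calg.span T3" "v : calg.span T1" "w : calg.span T2"
 shows "v * w : calg.span T3"
 using assms(2)
proof (induction rule: calg.span_induct_alt)
 case (step c x y)
 have "x * w : calg.span T3"
 using assms(3)
 proof (induction rule: calg.span_induct_alt)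
 case (step c' x' y')
 thus ?case using assms(1)[OF \<open>x : T1\<close> step(1)]
 by (auto simp: distrib_left scr intro: calg.span_add calg.span_scale)
 qed (simp add: calg.span_zero)
 thus ?case using step by (auto simp: distrib_right scl intro: calg.span_add calg.span_scale)
qed (simp add: calg.span_zero)

context uq begin

text \<open>Elements of the tensor square whose left factors lie in a given subspace.\<close>
definition tspan :: "letter list lend set => (letter list \<times> letter list) lend set" where
 "tspan Bs = calg.span {lift f1 b * lift f2 w | b w. b : Bs & w : A.V}"

lemma tspan_base: "b : Bs ==> w : A.V ==> lift f1 b * lift f2 w : tspan Bs"
 unfolding tspan_def by (rule calg.span_base) auto

lemma lift_V: "v : A.V ==> lift f1 v : B.V" "v : A.V ==> lift f2 v : B.V"
proof -
 assume "v : A.V"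
 then obtain x where x: "x : MA.C" "v = A.\<pi> x" by (rule V_E)
 show "lift f1 v : B.V" "lift f2 v : B.V"
 using x tens_C MA.C_1 by (auto simp: lift_\<pi>[OF qgroup_f1] lift_\<pi>[OF qgroup_f2] B.V_def tens_left_hext[symmetric] tens_right_hext[symmetric])
qed

lemma BV_subspace: "calg.subspace B.V"
 by (auto simp: calg.subspace_def B.V_0 B.V_add B.V_scale)

lemma tspan_BV: "Bs <= A.V ==> tspan Bs <= B.V"
 unfolding tspan_def by (rule calg.span_minimal[OF _ BV_subspace]) (auto intro!: B.V_mult lift_V)

lemma lift_comm: "v : A.V ==> w : A.V ==> lift f2 w * lift f1 v = lift f1 v * lift f2 w"
proof -
 assume "v : A.V" "w : A.V"
 then obtain x y where x: "x : MA.C" "v = A.\<pi> x" "y : MA.C" "w = A.\<pi> y" by (metis V_E)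
 thus ?thesis
 using tens_C MA.C_1 by (simp add: lift_\<pi>[OF qgroup_f1] lift_\<pi>[OF qgroup_f2] tens_left_hext[symmetric] tens_right_hext[symmetric]
 B.\<pi>_mult[symmetric] tens_mult)
qed

lemma tens_prod: "b : A.V ==> b' : A.V ==> w : A.V ==> w' : A.V ==>
 (lift f1 b * lift f2 w) * (lift f1 b' * lift f2 w') = lift f1 (b * b') * lift f2 (w * w')"
proof -
 assume *: "b : A.V" "b' : A.V" "w : A.V" "w' : A.V"
 have "(lift f1 b * lift f2 w) * (lift f1 b' * lift f2 w') = lift f1 b * (lift f2 w * lift f1 b') * lift f2 w'"
 by (simp only: mult.assoc)
 also have "... = lift f1 b * (lift f1 b' * lift f2 w) * lift f2 w'" by (simp only: lift_comm[OF *(2,3)])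
 finally show ?thesis
 by (simp only: lift_mult[OF qgroup_f1 *(1,2)] lift_mult[OF qgroup_f2 *(3,4)] mult.assoc)
qed

lemma tspan_mult:
 assumes "Bs <= A.V" "!!b b'. b : Bs ==> b' : Bs ==> b * b' : Bs" "z : tspan Bs" "z' : tspan Bs"
 shows "z * z' : tspan Bs"
 unfolding tspan_def
proof (rule span_mult[OF _ assms(3,4)[unfolded tspan_def]])
 fix x y assume "x : {lift f1 b * lift f2 w | b w. b : Bs & w : A.V}" "y : {lift f1 b * lift f2 w | b w. b : Bs & w : A.V}"
 then obtain b w b' w' where b: "b : Bs" "w : A.V" "b' : Bs" "w' : A.V" "x = lift f1 b * lift f2 w" "y = lift f1 b' * lift f2 w'" by blast
 hence "x * y = lift f1 (b * b') * lift f2 (w * w')" using assms(1) tens_prod by blast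
 thus "x * y : calg.span {lift f1 b * lift f2 w | b w. b : Bs & w : A.V}"
 using tspan_base[OF assms(2)[OF b(1,3)] A.V_mult[OF b(2,4)]] by (simp only: tspan_def)
qed

lemma tspan_1: "1 : Bs ==> 1 : tspan Bs"
 using tspan_base[of 1 Bs 1] by (simp add: A.V_1 lift_1[OF qgroup_f1] lift_1[OF qgroup_f2])

lemma tspan_add: "z : tspan Bs ==> z' : tspan Bs ==> z + z' : tspan Bs"
 and tspan_scale: "z : tspan Bs ==> c *. z : tspan Bs"
 and tspan_sum: "(!!i. i : I ==> h i : tspan Bs) ==> sum h I : tspan Bs"
 unfolding tspan_def by (auto intro: calg.span_add calg.span_scale calg.span_sum)

abbreviation cop :: "letter list lend => (letter list \<times> letter list) lend" where
 "cop \<equiv> lift (DD f1 f2)"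

lemma cop_alg:
 assumes X: "X <= A.V" "!!x. x : X ==> cop x : tspan (alg X)" and v: "v : alg X"
 shows "cop v : tspan (alg X)"
 using v
proof induction
 case (add x y)
 hence "x : A.V" "y : A.V" using A.alg_V[OF X(1)] by auto
 thus ?case using add by (simp add: lift_add[OF P.h.qgroup_axioms] tspan_add)
next
 case (mult x y)
 hence "x : A.V" "y : A.V" using A.alg_V[OF X(1)] by auto
 thus ?case using mult A.alg_V[OF X(1)]
 by (auto simp: lift_mult[OF P.h.qgroup_axioms] intro!: tspan_mult alg.mult)
next
 case (scale x c)
 hence "x : A.V" using A.alg_V[OF X(1)] by auto
 thus ?case using scale by (simp add: lift_scale[OF P.h.qgroup_axioms] tspan_scale)
qed (use X in \<open>auto simp: lift_1[OF P.h.qgroup_axioms] intro!: tspan_1 alg.one\<close>)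

lemma tspan_psum:
 assumes Bs: "calg.subspace Bs" "Bs <= A.V" and z: "z : tspan Bs"
 obtains Q where "finite Q" "Q <= Bs \<times> A.V" "z = (\<Sum>p\<in>Q. lift f1 (fst p) * lift f2 (snd p))"
proof -
 let ?f = "%p. lift f1 (fst p) * lift f2 (snd p)"
 have "EX Q. finite Q & Q <= Bs \<times> A.V & z = sum ?f Q"
 using z unfolding tspan_def
 proof (induction rule: calg.span_induct_alt)
 case base
 thus ?case by (intro exI[of _ "{}"]) auto
 next
 case (step c x y)
 then obtain b w Q where b: "b : Bs" "w : A.V" "x = lift f1 b * lift f2 w" and Q: "finite Q" "Q <= Bs \<times> A.V" "y = sum ?f Q"
 by blast
 have cb: "c *. b : Bs" using b(1) calg.subspace_scale[OF Bs(1)] by blast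
 have x: "c *. x = sum ?f {(c *. b, w)}" using b Bs(2) by (auto simp: lift_scale[OF qgroup_f1] scl)
 obtain R where "finite R" "R <= Bs \<times> A.V" "sum ?f R = sum ?f {(c *. b, w)} + sum ?f Q"
 proof (rule psum_add[of Bs A.V ?f "{(c *. b, w)}" Q])
 fix t :: complex and b u assume t: "b : Bs" "u : A.V" "t ~= 0"
 hence "b : A.V" using Bs(2) by blast
 with t show "?f (t *. b, inverse t *. u) = ?f (b, u)"
 by (simp add: lift_scale[OF qgroup_f1] lift_scale[OF qgroup_f2] scl scr sc1)
 qed (use Bs calg.subspace_scale[OF Bs(1)] A.V_scale cb b Q lift_0[OF qgroup_f1] lift_0[OF qgroup_f2] in auto)
 thus ?case using x Q(3) by (intro exI[of _ R]) auto
 qed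
 thus thesis using that by blast
qed

text \<open>Membership in the span inside the tensor product can be realised by pairs of cosets, which is the form in which tensors are given in the definitions.\<close>
lemma tens_pairs:
 assumes Bc: "Bc <= carrier A.U" "calg.subspace (A.val ` Bc)" and Z: "Z : carrier B.U" "B.val Z : tspan (A.val ` Bc)"
 obtains Q where "finite Q" "Q <= Bc \<times> carrier A.U" "Z = (\<Oplus>\<^bsub>B.U\<^esub>p\<in>Q. tens n q (fst p) (snd p))"
proof -
 have Bs: "A.val ` Bc <= A.V" using Bc A.val_image by blast
 obtain Q where Q: "finite Q" "Q <= A.val ` Bc \<times> A.V" "B.val Z = (\<Sum>p\<in>Q. lift f1 (fst p) * lift f2 (snd p))"
 by (rule tspan_psum[OF Bc(2) Bs Z(2)])
 define u where "u = (%p :: letter list lend \<times> letter list lend. (A.unval (fst p), A.unval (snd p)))"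
 have inQ: "fst p : A.V & snd p : A.V & A.unval (fst p) : Bc" if p: "p : Q" for p
 proof -
 obtain X where "X : Bc" "fst p = A.val X" using Q(2) p by auto
 thus ?thesis using A.unval_val[of X] Bc(1) Q(2) p Bs by auto
 qed
 have inj: "inj_on u Q"
 proof (rule inj_onI)
 fix p p' assume "p : Q" "p' : Q" "u p = u p'"
 hence "A.val (A.unval (fst p)) = A.val (A.unval (fst p'))" "A.val (A.unval (snd p)) = A.val (A.unval (snd p'))"
 by (auto simp: u_def)
 thus "p = p'" using inQ[OF \<open>p : Q\<close>] inQ[OF \<open>p' : Q\<close>] by (simp add: A.unval prod_eq_iff)
 qed
 have uQ: "u ` Q <= Bc \<times> carrier A.U" using inQ A.unval(1) by (auto simp: u_def)
 have t: "tens n q (fst p) (snd p) : carrier B.U" "B.val (tens n q (fst p) (snd p)) = lift f1 (A.val (fst p)) * lift f2 (A.val (snd p))"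
 if "p : u ` Q" for p
 using tens_val[of "fst p" "snd p"] subsetD[OF uQ that] Bc(1) by (auto simp: mem_Times_iff)
 have fin: "finite (u ` Q)" using Q(1) by simp
 note fs = B.val_finsum[of "u ` Q" "%p. tens n q (fst p) (snd p)", OF t(1) fin]
 have "B.val (\<Oplus>\<^bsub>B.U\<^esub>p\<in>u ` Q. tens n q (fst p) (snd p)) = (\<Sum>p\<in>u ` Q. lift f1 (A.val (fst p)) * lift f2 (A.val (snd p)))"
 using fs t(2) by simp
 also have "... = (\<Sum>p\<in>Q. lift f1 (A.val (fst (u p))) * lift f2 (A.val (snd (u p))))"
 by (rule sum.reindex_cong[OF inj refl refl])
 also have "... = B.val Z"
 unfolding Q(3) using inQ by (intro sum.cong refl) (simp add: u_def A.unval)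
 finally have "Z = (\<Oplus>\<^bsub>B.U\<^esub>p\<in>u ` Q. tens n q (fst p) (snd p))"
 using B.val_inj Z(1) fs by blast
 thus thesis using that[OF fin uQ] by blast
qed

end

text \<open>The data of a character shift: a right coideal subalgebra generated by \<open>X\<close>, and a character on it.\<close>
locale shift = uq n q for n q +
 fixes Bc :: "free set set" and X :: "letter list lend set" and \<phi> :: "free set => complex"
 assumes XV: "X <= A.V" and Bc: "Bc <= carrier A.U" "A.val ` Bc = alg X"
 and char: "character A.U Bc \<phi>"
 and cop_X: "!!x. x : X ==> cop x : tspan (alg X)"
begin

definition ph :: "letter list lend => complex" where "ph v = \<phi> (A.unval v)"

lemma alg_XV: "v : alg X ==> v : A.V" using A.alg_V[OF XV] by blast

lemma unval_Bc: "v : alg X ==> A.unval v : Bc"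
proof -
 assume "v : alg X"
 then obtain Y where Y: "Y : Bc" "v = A.val Y" using Bc(2) by blast
 show ?thesis unfolding Y(2) using A.unval_val[of Y] Bc(1) Y(1) by auto
qed

lemma unval_ops:
 assumes "v : A.V" "w : A.V"
 shows "A.unval (v + w) = A.unval v \<oplus>\<^bsub>A.U\<^esub> A.unval w" "A.unval (v * w) = A.unval v \<otimes>\<^bsub>A.U\<^esub> A.unval w"
 "A.unval (c *. v) = c \<odot>\<^bsub>A.U\<^esub> A.unval v" "A.unval 1 = \<one>\<^bsub>A.U\<^esub>"
proof -
 interpret ring A.U by (rule A.ring_U)
 have eq: "A.unval x = Y" if "x : A.V" "Y : carrier A.U" "x = A.val Y" for x Y
 using that A.unval_val by simp
 note u = A.unval[OF assms(1)] A.unval[OF assms(2)]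
 show "A.unval (v + w) = A.unval v \<oplus>\<^bsub>A.U\<^esub> A.unval w"
 by (rule eq) (use assms u in \<open>simp_all add: A.V_add A.val_add\<close>)
 show "A.unval (v * w) = A.unval v \<otimes>\<^bsub>A.U\<^esub> A.unval w"
 by (rule eq) (use assms u in \<open>simp_all add: A.V_mult A.val_mult\<close>)
 show "A.unval (c *. v) = c \<odot>\<^bsub>A.U\<^esub> A.unval v"
 by (rule eq) (use assms u in \<open>simp_all add: A.V_scale A.val_smult A.smult_closed\<close>)
 show "A.unval 1 = \<one>\<^bsub>A.U\<^esub>"
 by (rule eq) (simp_all add: A.V_1 A.val_one)
qed

lemma ph_add: "v : alg X ==> w : alg X ==> ph (v + w) = ph v + ph w"
 and ph_mult: "v : alg X ==> w : alg X ==> ph (v * w) = ph v * ph w"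
 and ph_scale: "v : alg X ==> ph (c *. v) = c * ph v" and ph_1: "ph 1 = 1"
 using char unval_Bc unval_ops[OF alg_XV alg_XV] unval_ops(3)[OF alg_XV alg_XV, of v v] unval_ops(4)[OF A.V_1 A.V_1]
 unfolding ph_def character_def by (auto simp: Ring.ring_hom_def)

text \<open>The defining property of the contraction with a character; the choice of its values outside the span is immaterial.\<close>
definition Th :: "(letter list \<times> letter list) lend => letter list lend" where
 "Th = (SOME Th. (ALL z:B.V. ALL z':B.V. Th (z + z') = Th z + Th z') & (ALL c. ALL z:B.V. Th (c *. z) = c *. Th z) &
 (ALL v:alg X. ALL w:A.V. Th (lift f1 v * lift f2 w) = ph v *. w))"

lemma Th_all: "(ALL z:B.V. ALL z':B.V. Th (z + z') = Th z + Th z') & (ALL c. ALL z:B.V. Th (c *. z) = c *. Th z) &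
 (ALL v:alg X. ALL w:A.V. Th (lift f1 v * lift f2 w) = ph v *. w)"
proof -
 let ?Q = "%Th :: (letter list \<times> letter list) lend => letter list lend. (ALL z:B.V. ALL z':B.V. Th (z + z') = Th z + Th z') & (ALL c. ALL z:B.V. Th (c *. z) = c *. Th z) &
 (ALL v:alg X. ALL w:A.V. Th (lift f1 v * lift f2 w) = ph v *. w)"
 have "EX Th. ?Q Th"
 proof (rule ex_contraction[where Bs = "alg X" and \<phi> = ph])
 fix Th :: "(letter list \<times> letter list) lend => letter list lend"
 assume "!!z z'. z : B.V ==> z' : B.V ==> Th (z + z') = Th z + Th z'" "!!c z. z : B.V ==> Th (c *. z) = c *. Th z"
 "!!v w. v : alg X ==> w : A.V ==> Th (lift f1 v * lift f2 w) = ph v *. w"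
 hence "?Q Th" by simp
 thus "EX Th. ?Q Th" by (rule exI[where P = ?Q])
 qed (use A.alg_V[OF XV] alg_subspace ph_add ph_scale in auto)
 thus ?thesis unfolding Th_def by (rule someI_ex)
qed

lemma Th_add: "z : B.V ==> z' : B.V ==> Th (z + z') = Th z + Th z'"
 and Th_scale: "z : B.V ==> Th (c *. z) = c *. Th z"
 and Th_tens: "v : alg X ==> w : A.V ==> Th (lift f1 v * lift f2 w) = ph v *. w"
 using Th_all by blast+

lemma Th_0: "Th 0 = 0" using Th_scale[OF B.V_0, of 0] by simp

lemma Th_sum: "(!!i. i : I ==> h i : B.V) ==> Th (sum h I) = (\<Sum>i\<in>I. Th (h i)) & sum h I : B.V"
 by (induction I rule: infinite_finite_induct) (auto simp: Th_0 Th_add B.V_0 B.V_add)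

lemma tsp_BV: "z : tspan (alg X) ==> z : B.V"
 using tspan_BV[OF A.alg_V[OF XV]] by blast

lemma Th_mult:
 assumes "z : tspan (alg X)" "z' : tspan (alg X)" shows "Th (z * z') = Th z * Th z'"
 using assms(1) unfolding tspan_def
proof (induction rule: span_induct_weak)
 case (step c x y)
 then obtain b w where b: "b : alg X" "w : A.V" "x = lift f1 b * lift f2 w" by blast
 have x: "x : tspan (alg X)" unfolding b(3) by (rule tspan_base[OF b(1,2)])
 have y: "y : tspan (alg X)" using step(2) by (simp add: tspan_def)
 have "Th (x * z') = Th x * Th z'"
 using assms(2) unfolding tspan_def
 proof (induction rule: span_induct_weak)
 case (step c' x' y')
 then obtain b' w' where b': "b' : alg X" "w' : A.V" "x' = lift f1 b' * lift f2 w'" by blast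
 have x': "x' : tspan (alg X)" unfolding b'(3) by (rule tspan_base[OF b'(1,2)])
 have y': "y' : tspan (alg X)" using step(2) by (simp add: tspan_def)
 have "x * x' = lift f1 (b * b') * lift f2 (w * w')" unfolding b(3) b'(3) by (rule tens_prod) (use b b' alg_XV in auto)
 hence "Th (x * x') = Th x * Th x'"
 using b b' by (simp add: Th_tens alg.mult A.V_mult ph_mult scl scr)
 moreover have "x * (c' *. x' + y') = c' *. (x * x') + x * y'" by (simp add: distrib_left scr)
 ultimately show ?case using step.IH tsp_BV[OF x] tsp_BV[OF x'] tsp_BV[OF y']
 by (simp add: Th_add Th_scale B.V_mult B.V_scale distrib_left scr)
 qed (simp add: Th_0)
 moreover have "(c *. x + y) * z' = c *. (x * z') + y * z'" by (simp add: distrib_right scl)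
 ultimately show ?case using step.IH tsp_BV[OF x] tsp_BV[OF y] tsp_BV[OF assms(2)]
 by (simp add: Th_add Th_scale B.V_mult B.V_scale distrib_right scl)
qed (simp add: Th_0)

definition sh :: "letter list lend => letter list lend" where "sh v = Th (cop v)"

lemma cop_in: "v : alg X ==> cop v : tspan (alg X)" by (rule cop_alg[OF XV cop_X])

lemma sh_add: "v : alg X ==> w : alg X ==> sh (v + w) = sh v + sh w"
 by (simp add: sh_def lift_add[OF P.h.qgroup_axioms] alg_XV Th_add tsp_BV cop_in)
lemma sh_scale: "v : alg X ==> sh (c *. v) = c *. sh v"
 by (simp add: sh_def lift_scale[OF P.h.qgroup_axioms] alg_XV Th_scale tsp_BV cop_in)
lemma sh_mult: "v : alg X ==> w : alg X ==> sh (v * w) = sh v * sh w"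
 by (simp add: sh_def lift_mult[OF P.h.qgroup_axioms] alg_XV Th_mult cop_in)
lemma sh_1: "sh 1 = 1"
 using Th_tens[OF alg.one A.V_1] by (simp add: sh_def lift_1[OF P.h.qgroup_axioms] lift_1[OF qgroup_f1] lift_1[OF qgroup_f2] ph_1 sc1)

lemma sh_alg: "sh ` alg X = alg (sh ` X)"
 by (rule hom_image_alg) (simp_all add: sh_add sh_mult sh_scale sh_1)

text \<open>Since the contraction is unique on the span, the description operator in the definition of the shift picks out this value.\<close>
lemma apply_left_val:
 assumes Z: "Z : carrier B.U" "B.val Z : tspan (alg X)"
 shows "apply_left n q Bc \<phi> Z : carrier A.U & A.val (apply_left n q Bc \<phi> Z) = Th (B.val Z)"
proof -
 let ?R = "%y. EX Q. finite Q & Q <= Bc \<times> carrier A.U &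
 Z = (\<Oplus>\<^bsub>B.U\<^esub>p\<in>Q. tens n q (fst p) (snd p)) & y = (\<Oplus>\<^bsub>A.U\<^esub>p\<in>Q. \<phi> (fst p) \<odot>\<^bsub>A.U\<^esub> snd p)"
 have R: "y : carrier A.U & A.val y = Th (B.val Z)" if y: "?R y" for y
 proof -
 obtain Q where Q': "finite Q & Q <= Bc \<times> carrier A.U &
 Z = (\<Oplus>\<^bsub>B.U\<^esub>p\<in>Q. tens n q (fst p) (snd p)) & y = (\<Oplus>\<^bsub>A.U\<^esub>p\<in>Q. \<phi> (fst p) \<odot>\<^bsub>A.U\<^esub> snd p)"
 using y by (elim exE)
 note Q = conjunct1[OF Q'] conjunct1[OF conjunct2[OF Q']] conjunct1[OF conjunct2[OF conjunct2[OF Q']]]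
 conjunct2[OF conjunct2[OF conjunct2[OF Q']]]
 have in_Q: "fst p : Bc & fst p : carrier A.U & snd p : carrier A.U" if "p : Q" for p
 using subsetD[OF Q(2) that] Bc(1) by (auto simp: mem_Times_iff)
 have t: "tens n q (fst p) (snd p) : carrier B.U" "B.val (tens n q (fst p) (snd p)) = lift f1 (A.val (fst p)) * lift f2 (A.val (snd p))"
 if "p : Q" for p using tens_val in_Q[OF that] by auto
 have s: "\<phi> (fst p) \<odot>\<^bsub>A.U\<^esub> snd p : carrier A.U" if "p : Q" for p using in_Q[OF that] A.smult_closed by blast
 have Zv: "B.val Z = (\<Sum>p\<in>Q. lift f1 (A.val (fst p)) * lift f2 (A.val (snd p)))"
 unfolding Q(3) using B.val_finsum[of Q "%p. tens n q (fst p) (snd p)", OF t(1) Q(1)] t(2) by simp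
 have e: "Th (lift f1 (A.val (fst p)) * lift f2 (A.val (snd p))) = A.val (\<phi> (fst p) \<odot>\<^bsub>A.U\<^esub> snd p)" if "p : Q" for p
 proof -
 have "A.val (fst p) : alg X" using in_Q[OF that] Bc(2) by blast
 thus ?thesis using in_Q[OF that] Th_tens A.V_iff by (simp add: ph_def A.unval_val A.val_smult)
 qed
 have "Th (B.val Z) = (\<Sum>p\<in>Q. A.val (\<phi> (fst p) \<odot>\<^bsub>A.U\<^esub> snd p))"
 unfolding Zv using Th_sum[of Q "%p. lift f1 (A.val (fst p)) * lift f2 (A.val (snd p))"] e in_Q
 by (simp add: B.V_mult lift_V A.V_iff)
 thus ?thesis unfolding Q(4) using A.val_finsum[of Q "%p. \<phi> (fst p) \<odot>\<^bsub>A.U\<^esub> snd p", OF s Q(1)] by simp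
 qed
 obtain Q where "finite Q" "Q <= Bc \<times> carrier A.U" "Z = (\<Oplus>\<^bsub>B.U\<^esub>p\<in>Q. tens n q (fst p) (snd p))"
 by (rule tens_pairs[OF Bc(1) _ Z(1)]) (use Bc(2) alg_subspace Z in auto)
 hence ex: "?R (\<Oplus>\<^bsub>A.U\<^esub>p\<in>Q. \<phi> (fst p) \<odot>\<^bsub>A.U\<^esub> snd p)" by (intro exI[of _ Q]) simp
 have al: "apply_left n q Bc \<phi> Z = (THE y. ?R y)"
 by (simp add: apply_left_def Uq_alt Uq2_alt)
 have "?R (THE y. ?R y)"
 proof (rule theI[of ?R, OF ex])
 fix y assume y: "?R y"
 show "y = (\<Oplus>\<^bsub>A.U\<^esub>p\<in>Q. \<phi> (fst p) \<odot>\<^bsub>A.U\<^esub> snd p)"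
 using R[OF y] R[OF ex] by (simp add: A.val_inj[symmetric])
 qed
 thus ?thesis unfolding al by (rule R)
qed

lemma apply_left_cop:
 assumes Y: "Y : carrier A.U" "A.val Y : alg X"
 shows "apply_left n q Bc \<phi> (coproduct n q Y) : carrier A.U & A.val (apply_left n q Bc \<phi> (coproduct n q Y)) = sh (A.val Y)"
 using apply_left_val[of "coproduct n q Y"] coproduct_val[OF Y(1)] cop_in[OF Y(2)] by (simp add: sh_def)

lemma char_shift_val: "char_shift n q Bc \<phi> <= carrier A.U" "A.val ` char_shift n q Bc \<phi> = alg (sh ` X)"
proof -
 have *: "apply_left n q Bc \<phi> (coproduct n q Y) : carrier A.U & A.val (apply_left n q Bc \<phi> (coproduct n q Y)) = sh (A.val Y)"
 if "Y : Bc" for Y using apply_left_cop[of Y] that Bc by blast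
 thus "char_shift n q Bc \<phi> <= carrier A.U" by (auto simp: char_shift_def)
 have "A.val ` char_shift n q Bc \<phi> = (%Y. sh (A.val Y)) ` Bc"
 unfolding char_shift_def image_image using * by (intro image_cong) auto
 also have "... = sh ` (A.val ` Bc)" by (simp add: image_image)
 finally show "A.val ` char_shift n q Bc \<phi> = alg (sh ` X)" using Bc(2) sh_alg by simp
qed

end

section \<open>Irreducible representations\<close>

lemma rescaled_shift:
 fixes x y :: "'a::calg"
 assumes "b = (p - 1) *. x + c *. y" "a = (p - 1) *. (p *. x + c *. y) + c *. y"
 shows "a = p *. b"
proof -
 have *: "((p - 1) * c) *. y + c *. y = (p * c) *. y"
 unfolding sc_add_l[symmetric] by (rule arg_cong[of _ _ "%t. t *. y"]) (simp add: algebra_simps)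
 have "a = ((p - 1) * p) *. x + (((p - 1) * c) *. y + c *. y)"
 unfolding assms by (simp only: sc_add_r scc add.assoc)
 also have "... = (p * (p - 1)) *. x + (p * c) *. y" by (simp only: * mult.commute[of "p - 1" p])
 also have "... = p *. b" unfolding assms by (simp only: sc_add_r scc)
 finally show ?thesis .
qed

text \<open>A module over the algebra generated by \<open>X\<close>, without nontrivial subspaces stable under \<open>X\<close>. The action is a function on vectors so that identities can be computed in the algebra.\<close>
locale irreducible_action =
 fixes X :: "'r::calg set" and d :: nat and act :: "'r => complex vec => complex vec"
 assumes d0: "d ~= 0"
 and act_mat: "!!v. v : alg X ==> EX A. A : carrier_mat d d & (ALL u:carrier_vec d. act v u = A *\<^sub>v u)"
 and act_add: "!!v w u. v : alg X ==> w : alg X ==> u : carrier_vec d ==> act (v + w) u = act v u + act w u"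
 and act_mult: "!!v w u. v : alg X ==> w : alg X ==> u : carrier_vec d ==> act (v * w) u = act v (act w u)"
 and act_scale: "!!c v u. v : alg X ==> u : carrier_vec d ==> act (c *. v) u = c \<cdot>\<^sub>v act v u"
 and act_1: "!!u. u : carrier_vec d ==> act 1 u = u"
 and irr: "!!W. linear_subspace d W ==> (!!x u. x : X ==> u : W ==> act x u : W) ==> W = {0\<^sub>v d} \<or> W = carrier_vec d"
begin

abbreviation "D \<equiv> carrier_vec d :: complex vec set"

definition eqv :: "'r => 'r => bool" (infix "\<approx>" 50) where
 "v \<approx> w \<longleftrightarrow> (ALL u:D. act v u = act w u)"

definition ker :: "'r => complex vec => bool" where
 "ker v u \<longleftrightarrow> u : D & u ~= 0\<^sub>v d & act v u = 0\<^sub>v d"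

lemma act_D: "v : alg X ==> u : D ==> act v u : D"
 using act_mat[of v] mult_mat_vec_carrier[of _ d d u] by auto

lemma act_vadd: "v : alg X ==> u : D ==> u' : D ==> act v (u + u') = act v u + act v u'"
proof -
 assume "v : alg X" and u: "u : D" "u' : D"
 then obtain A where "A : carrier_mat d d" "ALL u:D. act v u = A *\<^sub>v u" using act_mat by blast
 thus ?thesis using u by (simp add: mult_add_distrib_mat_vec)
qed

lemma act_vscale: "v : alg X ==> u : D ==> act v (c \<cdot>\<^sub>v u) = c \<cdot>\<^sub>v act v u"
proof -
 assume "v : alg X" and u: "u : D"
 then obtain A where "A : carrier_mat d d" "ALL u:D. act v u = A *\<^sub>v u" using act_mat by blast
 thus ?thesis using u by (simp add: mult_mat_vec)
qed

lemma smult_zero: "c \<cdot>\<^sub>v 0\<^sub>v d = (0\<^sub>v d :: complex vec)" "u : D ==> 0 \<cdot>\<^sub>v u = 0\<^sub>v d"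
 by (auto intro!: eq_vecI)

lemma act_v0: "v : alg X ==> act v (0\<^sub>v d) = 0\<^sub>v d"
 using act_vscale[of v "0\<^sub>v d" 0] act_D[of v "0\<^sub>v d"] by (simp add: smult_zero)

lemma act_0: "u : D ==> act 0 u = 0\<^sub>v d"
 using act_scale[OF alg.one, of u 0] act_1 by (simp add: smult_zero)

lemma smult_eq_0: "u : D ==> c \<cdot>\<^sub>v u = 0\<^sub>v d ==> c = 0 \<or> u = 0\<^sub>v d"
proof (rule disjCI)
 assume u: "u : D" "c \<cdot>\<^sub>v u = 0\<^sub>v d" "u ~= 0\<^sub>v d"
 then obtain a where a: "a < d" "u $ a ~= 0" by (metis carrier_vecD eq_vecI index_zero_vec)
 have "c * u $ a = (c \<cdot>\<^sub>v u) $ a" using u(1) a(1) by auto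
 also have "... = 0" using a(1) by (simp add: u(2))
 finally show "c = 0" using a by simp
qed

lemma smult_inj: "u : D ==> u ~= 0\<^sub>v d ==> c \<cdot>\<^sub>v u = t \<cdot>\<^sub>v u ==> c = t"
proof -
 assume u: "u : D" "u ~= 0\<^sub>v d" "c \<cdot>\<^sub>v u = t \<cdot>\<^sub>v u"
 then obtain a where a: "a < d" "u $ a ~= 0" by (metis carrier_vecD eq_vecI index_zero_vec)
 have "c * u $ a = (c \<cdot>\<^sub>v u) $ a" using u(1) a(1) by auto
 also have "... = t * u $ a" unfolding u(3) using u(1) a(1) by auto
 finally show ?thesis using a by simp
qed

lemma eqv_refl: "v \<approx> v" and eqv_sym: "v \<approx> w ==> w \<approx> v" and eqv_trans: "v \<approx> w ==> w \<approx> x ==> v \<approx> x"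
 by (auto simp: eqv_def)

lemma eqv_add: "v \<approx> v' ==> w \<approx> w' ==> v : alg X ==> v' : alg X ==> w : alg X ==> w' : alg X ==> v + w \<approx> v' + w'"
 by (simp add: eqv_def act_add)
lemma eqv_scale: "v \<approx> v' ==> v : alg X ==> v' : alg X ==> c *. v \<approx> c *. v'"
 by (simp add: eqv_def act_scale)
lemma eqv_mult: "v \<approx> v' ==> w \<approx> w' ==> v : alg X ==> v' : alg X ==> w : alg X ==> w' : alg X ==> v * w \<approx> v' * w'"
 by (simp add: eqv_def act_mult act_D)

text \<open>Schur's lemma for elements that commute with the generators up to scalars: the kernel is an invariant subspace.\<close>
lemma schur:
 assumes v: "v : alg X" and x: "!!x. x : X ==> EX c. v * x \<approx> c *. (x * v)" and u: "ker v u"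
 shows "v \<approx> 0"
proof -
 let ?W = "{u : D. act v u = 0\<^sub>v d}"
 have "linear_subspace d ?W"
 using v by (auto simp: linear_subspace_def act_v0 act_vadd act_vscale smult_zero)
 moreover have "act x w : ?W" if xw: "x : X" "w : ?W" for x w
 proof -
 have xX: "x : alg X" using xw(1) by (rule alg.base)
 obtain c where c: "v * x \<approx> c *. (x * v)" using x[OF xw(1)] by blast
 have "act v (act x w) = act (v * x) w" using v xX xw by (simp add: act_mult)
 also have "... = act (c *. (x * v)) w" using c xw by (simp add: eqv_def)
 also have "... = c \<cdot>\<^sub>v act x (act v w)" using v xX xw by (simp add: act_mult act_scale alg.mult)
 also have "... = 0\<^sub>v d" using xw xX by (simp add: act_v0 smult_zero)
 finally show ?thesis using act_D[OF xX] xw by simp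
 qed
 ultimately have "?W = {0\<^sub>v d} \<or> ?W = D" by (rule irr)
 moreover have "u : ?W" "u ~= 0\<^sub>v d" using u by (auto simp: ker_def)
 ultimately have "?W = D" by blast
 thus ?thesis by (auto simp: eqv_def act_0)
qed

lemma eigen:
 assumes "v : alg X" obtains t u where "u : D" "u ~= 0\<^sub>v d" "act v u = t \<cdot>\<^sub>v u"
proof -
 obtain A where A: "A : carrier_mat d d" "ALL u:D. act v u = A *\<^sub>v u" using act_mat[OF assms] by blast
 then obtain t where "t : spectrum A" using spectrum_non_empty[OF A(1)] d0 by blast
 then obtain u where "eigenvector A u t" by (auto simp: spectrum_def eigenvalue_def)
 thus thesis using A that by (auto simp: eigenvector_def)
qed

lemma central_scalar:
 assumes v: "v : alg X" and x: "!!x. x : X ==> v * x \<approx> x * v"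
 shows "EX t. v \<approx> t *. 1"
proof -
 obtain t u where u: "u : D" "u ~= 0\<^sub>v d" "act v u = t \<cdot>\<^sub>v u" by (rule eigen[OF v])
 define v' where "v' = v + (- t) *. 1"
 have v': "v' : alg X" unfolding v'_def by (intro alg.intros v)
 have t1: "(- t) *. 1 : alg X" by (intro alg.intros)
 have "v' \<approx> 0"
 proof (rule schur[OF v', of u])
 fix x assume "x : X"
 hence xX: "x : alg X" by (rule alg.base)
 have "v' * x = v * x + (- t) *. x" "1 *. (x * v') = x * v + (- t) *. x"
 by (simp_all add: v'_def algebra_simps scl scr sc1)
 moreover have "v * x + (- t) *. x \<approx> x * v + (- t) *. x"
 by (rule eqv_add[OF x[OF \<open>x : X\<close>] eqv_refl]) (intro alg.intros v xX)+
 ultimately show "EX c. v' * x \<approx> c *. (x * v')" by metis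
 next
 have "act v' u = act v u + act ((- t) *. 1) u" unfolding v'_def by (rule act_add[OF v t1 u(1)])
 also have "... = t \<cdot>\<^sub>v u + (- t) \<cdot>\<^sub>v u" by (simp only: u(3) act_scale[OF alg.one u(1)] act_1[OF u(1)])
 also have "... = 0\<^sub>v d" using u(1) by (auto intro!: eq_vecI)
 finally show "ker v' u" using u by (simp add: ker_def)
 qed
 hence "v' + t *. 1 \<approx> 0 + t *. 1"
 by (rule eqv_add[OF _ eqv_refl]) (intro v' alg_zero alg.scale alg.one)+
 hence "v \<approx> t *. 1" by (simp add: v'_def calg.scale_minus_left)
 thus ?thesis ..
qed

text \<open>The spectrum of an operator is finite and nonempty, so if multiplication by a scalar of infinite order preserves its nonzero part, there is none.\<close>
lemma closed_spectrum:
 assumes v: "v : alg X" and s: "s ~= 0" "!!m. m > 0 ==> s ^ m ~= (1::complex)"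
 and step: "!!t u. u : D ==> u ~= 0\<^sub>v d ==> act v u = t \<cdot>\<^sub>v u ==> t ~= 0 ==>
 EX u'. u' : D & u' ~= 0\<^sub>v d & act v u' = (s * t) \<cdot>\<^sub>v u'"
 shows "EX u. ker v u"
proof (rule ccontr)
 assume no: "\<nexists>u. ker v u"
 obtain t u where u: "u : D" "u ~= 0\<^sub>v d" "act v u = t \<cdot>\<^sub>v u" by (rule eigen[OF v])
 have nz: "r ~= 0" if "x : D" "x ~= 0\<^sub>v d" "act v x = r \<cdot>\<^sub>v x" for r x
 using no that by (auto simp: ker_def smult_zero)
 have ex: "EX x. x : D & x ~= 0\<^sub>v d & act v x = (s ^ m * t) \<cdot>\<^sub>v x" for m
 proof (induction m)
 case 0
 thus ?case using u by auto
 next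
 case (Suc m)
 then obtain x where x: "x : D" "x ~= 0\<^sub>v d" "act v x = (s ^ m * t) \<cdot>\<^sub>v x" by blast
 show ?case using step[OF x nz[OF x]] by (simp add: mult.assoc)
 qed
 obtain A where A: "A : carrier_mat d d" "ALL u:D. act v u = A *\<^sub>v u" using act_mat[OF v] by blast
 have "s ^ m * t : spectrum A" for m
 using ex[of m] A by (auto simp: spectrum_def eigenvalue_def eigenvector_def)
 hence "range (%m. s ^ m * t) <= spectrum A" by blast
 hence "finite (range (%m. s ^ m * t))" using card_finite_spectrum(1)[OF A(1)] finite_subset by blast
 moreover have "inj (%m. s ^ m * t)"
 proof (rule linorder_injI)
 fix m m' :: nat assume "m < m'"
 hence "s ^ m' = s ^ m * s ^ (m' - m)" by (simp flip: power_add)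
 thus "s ^ m * t ~= s ^ m' * t" using s(1) s(2)[of "m' - m"] \<open>m < m'\<close> nz[OF u] by simp
 qed
 ultimately show False using finite_imageD infinite_UNIV_nat by blast
qed

lemma ker_shift:
 assumes ab: "a : alg X" "b : alg X" and inj: "!!u. \<not> ker a u"
 and s: "s ~= 0" "!!m. m > 0 ==> s ^ m ~= (1::complex)" and rel: "b * a = s *. (a * b)"
 shows "EX u. ker b u"
proof (rule closed_spectrum[OF ab(2) s])
 fix t u assume u: "u : D" "u ~= 0\<^sub>v d" "act b u = t \<cdot>\<^sub>v u" "t ~= 0"
 have "act b (act a u) = act (s *. (a * b)) u" using ab u by (simp add: act_mult flip: rel)
 also have "... = s \<cdot>\<^sub>v (t \<cdot>\<^sub>v act a u)" using ab u by (simp add: act_mult act_scale alg.mult act_vscale)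
 also have "... = (s * t) \<cdot>\<^sub>v act a u" by (simp add: smult_smult_assoc)
 finally show "EX u'. u' : D & u' ~= 0\<^sub>v d & act b u' = (s * t) \<cdot>\<^sub>v u'"
 using inj[of u] act_D[OF ab(1) u(1)] u by (auto simp: ker_def)
qed

lemma ker_swap:
 assumes vw: "v : alg X" "w : alg X" and u: "ker (v * w) u"
 shows "EX u'. ker (w * v) u'"
proof -
 obtain A where A: "A : carrier_mat d d" "ALL u:D. act v u = A *\<^sub>v u" using act_mat[OF vw(1)] by blast
 obtain B where B: "B : carrier_mat d d" "ALL u:D. act w u = B *\<^sub>v u" using act_mat[OF vw(2)] by blast
 have AB: "act (v * w) x = (A * B) *\<^sub>v x" "act (w * v) x = (B * A) *\<^sub>v x" if "x : D" for x
 using that A B act_D vw by (simp_all add: act_mult assoc_mult_mat_vec[of _ d d _ d])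
 have "det (A * B) = 0" using det_0_iff_vec_prod_zero_field[of "A * B" d] A(1) B(1) u AB(1) by (auto simp: ker_def)
 hence "det (B * A) = 0" using A(1) B(1) by (auto simp: det_mult[of _ d])
 thus ?thesis using det_0_iff_vec_prod_zero_field[of "B * A" d] A(1) B(1) AB(2) by (auto simp: ker_def)
qed

text \<open>The vector \<open>e\<close> shifts eigenvectors of the commutator by \<open>q\<^sup>-\<^sup>2\<close>. If it kills one, then \<open>f e\<close> is singular, hence so is \<open>e f\<close>, and a vector in the kernel of the latter has the shifted eigenvalue too.\<close>
lemma weyl_pair_commutator:
 assumes ef: "e : alg X" "f : alg X" and q: "q ~= 0" "!!m. m > 0 ==> q ^ m ~= (1::complex)"
 and rel: "e * f = (q * q) *. (f * e) + c0 *. 1"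
 shows "EX u. ker (e * f - f * e) u"
proof -
 define z where "z = e * f - f * e"
 define s where "s = inverse (q * q)"
 have q2: "q * q ~= 0" using q(1) by simp
 have sq: "s * (q * q) = 1" using q(1) by (simp add: s_def field_simps)
 have z: "z : alg X" unfolding z_def by (intro alg_diff alg.mult ef)
 have fe: "z = (q * q - 1) *. (f * e) + c0 *. 1"
 unfolding z_def rel by (simp add: calg.scale_left_diff_distrib sc1)
 have efe: "f * e = s *. (e * f) + (- s * c0) *. 1"
 unfolding rel using sq by (simp add: sc_add_r calg.scale_scale sc1 calg.scale_minus_left mult.assoc)
 have ez': "z = (1 - s) *. (e * f) + (s * c0) *. 1"
 proof -
 have "z = e * f - (s *. (e * f) + (- s * c0) *. 1)" unfolding z_def by (simp only: efe[symmetric])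
 thus ?thesis by (simp add: calg.scale_left_diff_distrib sc1 calg.scale_minus_left)
 qed
 have "z * e = (q * q - 1) *. (f * e * e) + c0 *. e"
 unfolding fe by (simp add: distrib_right scl)
 moreover have "e * z = (q * q - 1) *. ((q * q) *. (f * e * e) + c0 *. e) + c0 *. e"
 using arg_cong[OF rel, of "%x. x * e"] unfolding fe
 by (simp add: distrib_left distrib_right scr scl mult.assoc)
 ultimately have "e * z = (q * q) *. (z * e)" by (rule rescaled_shift)
 hence "s *. (e * z) = z * e" using sq by (simp add: calg.scale_scale sc1)
 hence ze: "z * e = s *. (e * z)" by simp
 have sn: "s ~= 0" using q(1) by (simp add: s_def)
 have snr: "s ^ m ~= 1" if "m > 0" for m
 proof -
 have "s ^ m = inverse (q ^ (2 * m))"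
 unfolding s_def power_mult power2_eq_square by (rule power_inverse)
 thus ?thesis using q(2)[of "2 * m"] that by (simp only: inverse_eq_1_iff) simp
 qed
 have "EX u. ker z u"
 proof (rule closed_spectrum[OF z sn snr])
 fix t u assume u: "u : D" "u ~= 0\<^sub>v d" "act z u = t \<cdot>\<^sub>v u" "t ~= 0"
 show "EX u'. u' : D & u' ~= 0\<^sub>v d & act z u' = (s * t) \<cdot>\<^sub>v u'"
 proof (cases "act e u = 0\<^sub>v d")
 case False
 have "act z (act e u) = act (s *. (e * z)) u" using ef z u by (simp add: act_mult flip: ze)
 also have "... = s \<cdot>\<^sub>v (t \<cdot>\<^sub>v act e u)" using ef z u by (simp add: act_mult act_scale alg.mult act_vscale)
 also have "... = (s * t) \<cdot>\<^sub>v act e u" by (simp add: smult_smult_assoc)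
 finally show ?thesis using False act_D[OF ef(1) u(1)] by blast
 next
 case True
 have feX: "f * e : alg X" "e * f : alg X" by (intro alg.mult ef)+
 have fe0: "act (f * e) u = 0\<^sub>v d" using True ef u by (simp add: act_mult act_v0)
 have "act z u = (q * q - 1) \<cdot>\<^sub>v 0\<^sub>v d + c0 \<cdot>\<^sub>v u"
 unfolding fe using u feX fe0 by (simp add: act_add alg.scale alg.one act_scale act_1)
 also have "... = c0 \<cdot>\<^sub>v u" using u(1) by (simp add: smult_zero)
 finally have t: "t = c0" using smult_inj[OF u(1,2)] u(3) by simp
 have "ker (f * e) u" using u fe0 by (simp add: ker_def)
 then obtain u' where u': "ker (e * f) u'" using ker_swap[OF ef(2,1)] by blast
 have "act z u' = (1 - s) \<cdot>\<^sub>v 0\<^sub>v d + (s * c0) \<cdot>\<^sub>v u'"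
 unfolding ez' using u' feX by (simp add: ker_def act_add alg.scale alg.one act_scale act_1)
 also have "... = (s * t) \<cdot>\<^sub>v u'" using u' by (simp add: t smult_zero ker_def)
 finally show ?thesis using u' by (auto simp: ker_def)
 qed
 qed
 thus ?thesis unfolding z_def .
qed

lemma scalar_one_dim:
 assumes "!!x. x : X ==> EX t. x \<approx> t *. 1"
 shows "d = 1"
proof (rule ccontr)
 assume "d ~= 1"
 hence d2: "d > 1" using d0 by simp
 let ?e = "unit_vec d 0 :: complex vec"
 let ?W = "{c \<cdot>\<^sub>v ?e | c. True}"
 have "linear_subspace d ?W"
 proof -
 have "0\<^sub>v d = 0 \<cdot>\<^sub>v ?e" by (simp add: smult_zero)
 moreover have "c \<cdot>\<^sub>v ?e + c' \<cdot>\<^sub>v ?e = (c + c') \<cdot>\<^sub>v ?e" for c c' by (simp add: add_smult_distrib_vec)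
 moreover have "c \<cdot>\<^sub>v (c' \<cdot>\<^sub>v ?e) = (c * c') \<cdot>\<^sub>v ?e" for c c' by (simp add: smult_smult_assoc)
 ultimately show ?thesis unfolding linear_subspace_def by fastforce
 qed
 moreover have "act x u : ?W" if xu: "x : X" "u : ?W" for x u
 proof -
 obtain c where c: "u = c \<cdot>\<^sub>v ?e" using xu(2) by blast
 obtain t where "x \<approx> t *. 1" using assms[OF xu(1)] by blast
 hence "act x u = t \<cdot>\<^sub>v u" by (simp add: c eqv_def act_scale alg.one act_1)
 also have "... = (t * c) \<cdot>\<^sub>v ?e" by (simp add: c smult_smult_assoc)
 finally show ?thesis by blast
 qed
 ultimately have W: "?W = {0\<^sub>v d} \<or> ?W = D" by (rule irr)
 have e: "?e : ?W" by (intro CollectI exI[of _ 1]) (auto intro: eq_vecI)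
 have "?e ~= 0\<^sub>v d" using d0 by (metis index_unit_vec(2) index_zero_vec(1) neq0_conv zero_neq_one)
 hence "?W = D" using W e by blast
 moreover have "unit_vec d 1 : D" by simp
 ultimately obtain c where "unit_vec d 1 = c \<cdot>\<^sub>v ?e" by blast
 hence "unit_vec d 1 $ 1 = (c \<cdot>\<^sub>v ?e) $ 1" by simp
 thus False using d2 by simp
qed

text \<open>The relations force the commutator at \<open>b\<close> to vanish, so the two vectors at \<open>b\<close> are invertible. Each other vector commutes with one of them up to a scalar of infinite order, so it is singular; once the diagonal relation has become a commutation relation by induction, Schur's lemma makes it zero.\<close>
lemma one_dimensional:
 fixes E F :: "nat list => 'r" and I :: "nat list set" and T :: "'r set" and b :: "nat list"
 assumes X: "X = E ` I \<union> F ` I \<union> T" and b: "b : I" and q: "q ~= 0" "!!m. m > 0 ==> q ^ m ~= (1::complex)" and c0: "c0 ~= 0"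
 and EE: "!!x y. x : I ==> y : I ==> EX c. E x * E y = c *. (E y * E x)"
 and FF: "!!x y. x : I ==> y : I ==> EX c. F x * F y = c *. (F y * F x)"
 and EF: "!!x y. x : I ==> y : I ==> x ~= y ==> EX c. E x * F y = c *. (F y * E x)"
 and FE: "!!x y. x : I ==> y : I ==> x ~= y ==> EX c. F y * E x = c *. (E x * F y)"
 and base: "E b * F b = (q * q) *. (F b * E b) + c0 *. 1"
 and bE: "!!y. y : I ==> y ~= b ==> E y * E b = inverse q *. (E b * E y)"
 and bF: "!!y. y : I ==> y ~= b ==> F y * F b = q *. (F b * F y)"
 and bEF: "!!y. y : I ==> y ~= b ==> (E b * F b - F b * E b) * E y = E y * (E b * F b - F b * E b)"
 and bFE: "!!y. y : I ==> y ~= b ==> (E b * F b - F b * E b) * F y = F y * (E b * F b - F b * E b)"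
 and step: "!!y. y : I ==> y ~= b ==> EX x:I. length x < length y &
 E y * F y = (q * q) *. (F y * E y) + (- q) *. (E x * F x - F x * E x)"
 and TE: "!!t x. t : T ==> x : I ==> EX c. E x * t = c *. (t * E x)"
 and TF: "!!t x. t : T ==> x : I ==> EX c. F x * t = c *. (t * F x)"
 and Tb: "!!t. t : T ==> E b * t = t * E b" "!!t. t : T ==> F b * t = t * F b"
 and TT: "!!t t'. t : T ==> t' : T ==> t * t' = t' * t"
 shows "d = 1"
proof -
 have EX: "E x : alg X" and FX: "F x : alg X" if "x : I" for x using that X by (auto intro: alg.base)
 have TX: "t : alg X" if "t : T" for t using that X by (auto intro: alg.base)
 have X_cases: "(EX y:I. x = E y) \<or> (EX y:I. x = F y) \<or> x : T" if "x : X" for x using that X by blast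
 define e f z where "e = E b" and "f = F b" and "z = e * f - f * e"
 have e: "e : alg X" and f: "f : alg X" using EX FX b by (simp_all add: e_def f_def)
 have z: "z : alg X" unfolding z_def by (intro alg_diff alg.mult e f)
 have rel: "e * f = (q * q) *. (f * e) + c0 *. 1" using base by (simp add: e_def f_def)
 have fe: "z = (q * q - 1) *. (f * e) + c0 *. 1"
 unfolding z_def rel by (simp add: calg.scale_left_diff_distrib sc1)
 have efe: "e * f * e = (q * q) *. (f * e * e) + c0 *. e" "f * e * f = (q * q) *. (f * f * e) + c0 *. f"
 using arg_cong[OF rel, of "%x. x * e"] arg_cong[OF rel, of "%x. f * x"]
 by (simp_all add: distrib_right distrib_left scl scr mult.assoc)
 have 1: "z * e = (q * q - 1) *. (f * e * e) + c0 *. e" "f * z = (q * q - 1) *. (f * f * e) + c0 *. f"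
 unfolding fe by (simp_all add: distrib_right distrib_left scl scr mult.assoc)
 have 2: "e * z = (q * q - 1) *. (e * f * e) + c0 *. e" "z * f = (q * q - 1) *. (f * e * f) + c0 *. f"
 unfolding fe by (simp_all add: distrib_right distrib_left scl scr mult.assoc)
 have zf: "z * f = (q * q) *. (f * z)" by (rule rescaled_shift[OF 1(2) 2(2)[unfolded efe]])
 have "e * z = (q * q) *. (z * e)" by (rule rescaled_shift[OF 1(1) 2(1)[unfolded efe]])
 hence "inverse (q * q) *. (e * z) = (inverse (q * q) * (q * q)) *. (z * e)" by (simp only: scc)
 moreover have "inverse (q * q) * (q * q) = 1" using q(1) by (simp add: field_simps)
 ultimately have ze: "z * e = inverse (q * q) *. (e * z)" by (simp only: sc1)
 obtain u where "ker z u" using weyl_pair_commutator[OF e f q rel] unfolding z_def by blast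
 hence z0: "z \<approx> 0"
 proof (rule schur[OF z, rotated])
 fix x assume "x : X"
 from X_cases[OF this] have "EX c. z * x = c *. (x * z)"
 proof (elim disjE bexE)
 fix y assume y: "y : I" "x = E y"
 show ?thesis
 proof (cases "y = b")
 case True
 thus ?thesis using ze y by (auto simp: e_def)
 next
 case False
 thus ?thesis using bEF[OF y(1)] y by (intro exI[of _ 1]) (simp add: z_def e_def f_def sc1)
 qed
 next
 fix y assume y: "y : I" "x = F y"
 show ?thesis
 proof (cases "y = b")
 case True
 thus ?thesis using zf y by (auto simp: f_def)
 next
 case False
 thus ?thesis using bFE[OF y(1)] y by (intro exI[of _ 1]) (simp add: z_def e_def f_def sc1)
 qed
 next
 assume t: "x : T"
 have "e * (f * x) = x * (e * f)" "f * (e * x) = x * (f * e)"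
 using Tb[OF t] unfolding e_def f_def by (metis mult.assoc)+
 thus ?thesis by (intro exI[of _ 1]) (simp add: z_def sc1 left_diff_distrib right_diff_distrib mult.assoc)
 qed
 thus "EX c. z * x \<approx> c *. (x * z)" using eqv_refl by metis
 qed
 have ef_comm: "e * f \<approx> f * e"
 proof -
 have "z + f * e \<approx> 0 + f * e" by (rule eqv_add[OF z0 eqv_refl]) (intro z alg_zero alg.mult e f)+
 thus ?thesis by (simp add: z_def)
 qed
 have q21: "q * q - 1 ~= 0" using q(2)[of 2] by (simp add: power2_eq_square)
 have "(- c0) *. 1 \<approx> (q * q - 1) *. (f * e)"
 proof -
 have "z + (- c0) *. 1 \<approx> 0 + (- c0) *. 1" by (rule eqv_add[OF z0 eqv_refl]) (intro z alg_zero alg.scale alg.one)+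
 thus ?thesis by (auto simp: fe calg.scale_minus_left intro: eqv_sym)
 qed
 hence fe_c: "act (f * e) w = (- c0 / (q * q - 1)) \<cdot>\<^sub>v w" if "w : D" for w
 proof -
 have "(- c0) \<cdot>\<^sub>v w = act ((- c0) *. 1) w" by (simp only: act_scale[OF alg.one that] act_1[OF that])
 also have "... = act ((q * q - 1) *. (f * e)) w"
 using \<open>(- c0) *. 1 \<approx> (q * q - 1) *. (f * e)\<close> that unfolding eqv_def by (rule bspec)
 also have "... = (q * q - 1) \<cdot>\<^sub>v act (f * e) w" by (rule act_scale[OF alg.mult[OF f e] that])
 finally have "(1 / (q * q - 1)) \<cdot>\<^sub>v ((- c0) \<cdot>\<^sub>v w) = (1 / (q * q - 1)) \<cdot>\<^sub>v ((q * q - 1) \<cdot>\<^sub>v act (f * e) w)" by simp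
 thus ?thesis using q21 by (simp add: smult_smult_assoc)
 qed
 have inj: "\<not> ker e w" "\<not> ker f w" for w
 proof -
 have "- c0 / (q * q - 1) ~= 0" using q21 c0 by simp
 hence *: "act (f * e) w ~= 0\<^sub>v d" if "w : D" "w ~= 0\<^sub>v d" using fe_c[OF that(1)] smult_eq_0[OF that(1)] that by metis
 show "\<not> ker e w" using * e f by (auto simp: ker_def act_mult act_v0)
 have "act (f * e) w = act e (act f w)" if "w : D" using ef_comm that e f by (simp add: eqv_def act_mult)
 thus "\<not> ker f w" using * e f by (auto simp: ker_def act_v0)
 qed
 have iq: "inverse q ~= 0" "inverse q ^ m ~= 1" if "m > 0" for m using q that by (simp_all add: power_inverse)
 have vanish: "y ~= b \<longrightarrow> E y \<approx> 0 & F y \<approx> 0" if "y : I" for y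
 using that
 proof (induction "length y" arbitrary: y rule: less_induct)
 case less
 show ?case
 proof
 assume yb: "y ~= b"
 obtain x where x: "x : I" "length x < length y" "E y * F y = (q * q) *. (F y * E y) + (- q) *. (E x * F x - F x * E x)"
 using step[OF less.prems yb] by blast
 note y = less.prems
 have "E x * F x - F x * E x \<approx> 0"
 proof (cases "x = b")
 case True
 thus ?thesis using z0 by (simp add: z_def e_def f_def)
 next
 case False
 hence "E x \<approx> 0" "F x \<approx> 0" using less.hyps[OF x(2) x(1)] by blast+
 hence "act (E x) w = 0\<^sub>v d" "act (F x) w = 0\<^sub>v d" if "w : D" for w using that by (simp_all add: eqv_def act_0)
 hence "E x * F x \<approx> F x * E x" using EX[OF x(1)] FX[OF x(1)] by (simp add: eqv_def act_mult act_v0)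
 hence "E x * F x + - (F x * E x) \<approx> F x * E x + - (F x * E x)"
 by (rule eqv_add[OF _ eqv_refl]) (intro alg.mult alg_uminus EX FX x)+
 thus ?thesis by simp
 qed
 hence "(q * q) *. (F y * E y) + (- q) *. (E x * F x - F x * E x) \<approx> (q * q) *. (F y * E y) + (- q) *. 0"
 by (intro eqv_add eqv_refl eqv_scale alg.scale alg.mult alg_diff alg_zero EX FX x y)
 hence EFy: "E y * F y \<approx> (q * q) *. (F y * E y)" by (simp add: x(3))
 hence "inverse (q * q) *. (E y * F y) \<approx> inverse (q * q) *. ((q * q) *. (F y * E y))"
 by (intro eqv_scale alg.scale alg.mult EX FX y)
 moreover have "inverse (q * q) * (q * q) = 1" using q(1) by (simp add: field_simps)
 ultimately have FEy: "F y * E y \<approx> inverse (q * q) *. (E y * F y)"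
 unfolding scc by (simp only: sc1) (rule eqv_sym)
 obtain u where u: "ker (E y) u"
 using ker_shift[OF e EX[OF y] inj(1) iq(1) iq(2)] bE[OF y yb] unfolding e_def by blast
 obtain u' where u': "ker (F y) u'"
 using ker_shift[OF f FX[OF y] inj(2) q] bF[OF y yb] unfolding f_def by blast
 have "E y \<approx> 0"
 proof (rule schur[OF EX[OF y] _ u])
 fix x assume "x : X"
 from X_cases[OF this] show "EX c. E y * x \<approx> c *. (x * E y)"
 proof (elim disjE bexE)
 fix y' assume y': "y' : I" "x = F y'"
 show ?thesis
 proof (cases "y' = y")
 case True
 thus ?thesis using EFy y' by auto
 next
 case False
 thus ?thesis using EF[OF y y'(1)] y' eqv_refl by metis
 qed
 qed (use EE[OF y] TE[OF _ y] eqv_refl in metis)+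
 qed
 moreover have "F y \<approx> 0"
 proof (rule schur[OF FX[OF y] _ u'])
 fix x assume "x : X"
 from X_cases[OF this] show "EX c. F y * x \<approx> c *. (x * F y)"
 proof (elim disjE bexE)
 fix y' assume y': "y' : I" "x = E y'"
 show ?thesis
 proof (cases "y' = y")
 case True
 thus ?thesis using FEy y' by auto
 next
 case False
 thus ?thesis using FE[OF y'(1) y] y' eqv_refl by metis
 qed
 qed (use FF[OF y] TF[OF _ y] eqv_refl in metis)+
 qed
 ultimately show "E y \<approx> 0 & F y \<approx> 0" by blast
 qed
 qed
 have triv: "x \<approx> 0 \<or> x = e \<or> x = f \<or> x : T" if "x : X" for x
 using X_cases[OF that] vanish unfolding e_def f_def by blast
 have null: "x * y \<approx> y * x" if "x \<approx> 0" "x : alg X" "y : alg X" for x y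
 proof -
 have "x * y \<approx> 0 * y" "y * x \<approx> y * 0" by (intro eqv_mult that eqv_refl alg_zero)+
 thus ?thesis by (auto intro: eqv_trans eqv_sym)
 qed
 have comm: "x * y \<approx> y * x" if "x : X" "y : X" for x y
 proof (cases "x \<approx> 0 \<or> y \<approx> 0")
 case True
 thus ?thesis using null that alg.base eqv_sym by blast
 next
 case False
 hence "x = e \<or> x = f \<or> x : T" "y = e \<or> y = f \<or> y : T" using triv that by blast+
 thus ?thesis
 using ef_comm eqv_sym[OF ef_comm] eqv_refl Tb TT by (elim disjE) (simp_all add: e_def f_def)
 qed
 show ?thesis
 proof (rule scalar_one_dim)
 fix x assume "x : X"
 thus "EX t. x \<approx> t *. 1" using central_scalar[OF alg.base comm] by blast
 qed
qed

end

lemma alg_scale_image: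
 assumes "c ~= 0" shows "alg ((%x. c *. h x) ` S) = alg (h ` S)"
proof
 show "alg ((%x. c *. h x) ` S) <= alg (h ` S)" by (rule alg_mono) (auto intro: alg.scale alg.base)
 have "h x : alg ((%x. c *. h x) ` S)" if "x : S" for x
 proof -
 have "inverse c *. (c *. h x) : alg ((%x. c *. h x) ` S)" using that by (intro alg.scale alg.base imageI)
 thus ?thesis using assms by (simp add: scc sc1)
 qed
 thus "alg (h ` S) <= alg ((%x. c *. h x) ` S)" by (intro alg_mono) blast
qed

section \<open>The two shifted coideal subalgebras\<close>

lemma path_far: "path n (xs @ z # zs) ==> a : set xs ==> c : set zs ==> cartan a c = 0"
proof (induction xs)
 case (Cons b xs)
 hence p: "path n (b # (xs @ z # zs))" by simp
 hence "ALL c:set (tl (xs @ z # zs)). cartan b c = 0" "path n (xs @ z # zs)" by (simp_all add: path_Cons_iff)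
 moreover have "c : set (tl (xs @ z # zs))" using Cons.prems by (cases xs) auto
 ultimately show ?case using Cons by auto
qed simp

lemma rsum_orthogonal:
 "set xs <= {1..n} ==> set zs <= {1..n} ==> (!!a c. a : set xs ==> c : set zs ==> cartan a c = 0) ==>
 root_form n (rsum xs) (rsum zs) = 0"
 by (induction zs) (simp_all add: root_form_add_right rsum_form_zero)

lemma rsum_form_append:
 assumes p: "path n (xs @ zs)" and ne: "xs ~= []" "zs ~= []"
 shows "root_form n (rsum xs) (rsum zs) = -1"
proof -
 obtain z zs' where zs: "zs = z # zs'" using ne by (cases zs) auto
 have s: "set xs <= {1..n}" "set zs' <= {1..n}" using path_set[OF p] by (auto simp: zs)
 have "root_form n (rsum xs) (rsum zs') = 0"
 by (rule rsum_orthogonal[OF s]) (rule path_far[OF p[unfolded zs]])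
 moreover have "path n (xs @ [z])" using path_append1[of n "xs @ [z]" zs'] p by (simp add: zs)
 ultimately show ?thesis using rsum_form_snoc[OF _ ne(1)] by (simp add: zs root_form_add_right)
qed

lemma rsum_form_self: "path n xs ==> xs ~= [] ==> root_form n (rsum xs) (rsum xs) = 2"
proof (induction xs)
 case (Cons a xs)
 have a: "a : {1..n}" using path_set[OF Cons.prems(1)] by auto
 show ?case
 proof (cases "xs = []")
 case True
 thus ?thesis using root_form_simple[OF a a] by (simp add: cartan_def)
 next
 case False
 have "root_form n (rsum xs) (simple_root a) = -1" by (rule rsum_form_Cons[OF Cons.prems(1) False])
 thus ?thesis
 unfolding rsum_simps root_form_add_left root_form_add_right
 using Cons.IH[OF path_Cons[OF Cons.prems(1) False] False] root_form_simple[OF a a]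
 root_form_sym[of n "simple_root a" "rsum xs"]
 by (simp add: cartan_def)
 qed
qed simp

lemma rsum_form_prefix: "path n (xs @ zs) ==> xs ~= [] ==> zs ~= [] ==> root_form n (rsum xs) (rsum (xs @ zs)) = 1"
 using rsum_form_append[of n xs zs] rsum_form_self[of n xs] path_append1[of n xs zs] by (simp add: root_form_add_right)

lemma rsum_form_opposite:
 assumes p: "path n (a # us)" "path n (a # vs)" "us ~= []" "vs ~= []"
 and c: "!!b c. b : set us ==> c : set vs ==> cartan b c = 0"
 shows "root_form n (rsum (a # us)) (rsum (a # vs)) = 0"
proof -
 have a: "a : {1..n}" and s: "set us <= {1..n}" "set vs <= {1..n}" using path_set[OF p(1)] path_set[OF p(2)] by auto
 show ?thesis
 using rsum_form_Cons[OF p(1,3)] rsum_form_Cons[OF p(2,4)] rsum_orthogonal[OF s c] root_form_simple[OF a a]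
 root_form_sym[of n "simple_root a" "rsum vs"]
 by (simp add: root_form_add_left root_form_add_right cartan_def)
qed

context qgroup begin

lemma Gr_relation:
 assumes "eroot xs * eroot zs = c *. (eroot zs * eroot xs)" and xs: "set xs <= {1..n}" and zs: "set zs <= {1..n}"
 shows "Gr xs * Gr zs = c *. (Gr zs * Gr xs)"
proof -
 let ?t = "q powi (- root_form n (rsum xs) (rsum zs))"
 have tw: "Kf (- rsum xs) * eroot zs = ?t *. (eroot zs * Kf (- rsum xs))" "Kf (- rsum zs) * eroot xs = ?t *. (eroot xs * Kf (- rsum zs))"
 using Kf_wt[OF wt_eroot[OF zs], of "- rsum xs"] Kf_wt[OF wt_eroot[OF xs], of "- rsum zs"] root_form_sym[of n "rsum zs" "rsum xs"]
 by (simp_all add: root_form_uminus_left tw_def)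
 have "Gr xs * Gr zs = eroot xs * (Kf (- rsum xs) * eroot zs) * Kf (- rsum zs)" by (simp add: Gr_def mult.assoc)
 also have "... = ?t *. ((eroot xs * eroot zs) * (Kf (- rsum xs) * Kf (- rsum zs)))"
 by (simp add: tw scl scr mult.assoc)
 also have "... = c *. (eroot zs * (?t *. (eroot xs * Kf (- rsum zs))) * Kf (- rsum xs))"
 unfolding assms(1) Kf_comm[of "- rsum xs"] by (simp add: scl scr mult.assoc scc mult.commute)
 also have "... = c *. (Gr zs * Gr xs)" unfolding tw(2)[symmetric] by (simp add: Gr_def mult.assoc)
 finally show ?thesis .
qed

end

context uq begin

lemma lift_roots:
 assumes f: "qgroup n f q" and xs: "set xs <= {1..n}"
 shows "lift f (G.eroot xs) = qgroup.eroot f q xs" "lift f (G.froot xs) = qgroup.froot f q xs" "lift f (G.Gr xs) = qgroup.Gr n f q xs"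
 "lift f (G.ebar lam xs) = qgroup.ebar n f q lam xs"
 "xs ~= [] ==> lift f (G.fbar kap xs) = qgroup.fbar f q kap xs"
proof -
 have tl: "set (tl xs) <= {1..n}" using xs by (cases xs) auto
 have e: "lift f (G.eroot ys) = qgroup.eroot f q ys" "lift f (G.froot ys) = qgroup.froot f q ys" if "set ys <= {1..n}" for ys
 using lift_eroot[OF f that] by (simp_all add: qgroup.eroot_def[OF f] qgroup.froot_def[OF f])
 note ops = lift_add[OF f] lift_mult[OF f] lift_scale[OF f] lift_K[OF f] A.V_add A.V_mult A.V_scale K_V eroot_V froot_V g_V lift_g[OF f]
 show "lift f (G.eroot xs) = qgroup.eroot f q xs" "lift f (G.froot xs) = qgroup.froot f q xs" by (rule e[OF xs])+
 show "lift f (G.Gr xs) = qgroup.Gr n f q xs"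
 unfolding G.Gr_def qgroup.Gr_def[OF f] using xs by (simp add: ops e)
 show "lift f (G.ebar lam xs) = qgroup.ebar n f q lam xs"
 unfolding G.ebar_def qgroup.ebar_def[OF f] using xs tl by (cases "tl xs = []") (simp_all add: ops e)
 show "lift f (G.fbar kap xs) = qgroup.fbar f q kap xs" if "xs ~= []"
 proof -
 have "hd xs : {1..n}" using that xs hd_in_set by blast
 hence "LKinv (hd xs) : letters n" by simp
 thus ?thesis
 unfolding G.fbar_def qgroup.fbar_def[OF f] using xs tl by (cases "tl xs = []") (simp_all add: ops e)
 qed
qed

lemma bar_V:
 assumes "set xs <= {1..n}"
 shows "G.Gr xs : A.V" "G.ebar lam xs : A.V" "xs ~= [] ==> G.fbar kap xs : A.V"
proof -
 have tl: "set (tl xs) <= {1..n}" using assms by (cases xs) auto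
 note ops = A.V_add A.V_mult A.V_scale K_V eroot_V froot_V g_V
 show "G.Gr xs : A.V" "G.ebar lam xs : A.V" unfolding G.Gr_def G.ebar_def using assms tl by (auto intro!: ops)
 assume "xs ~= []"
 hence "hd xs : {1..n}" using assms hd_in_set by blast
 hence "LKinv (hd xs) : letters n" by simp
 thus "G.fbar kap xs : A.V" unfolding G.fbar_def using assms tl by (auto intro!: ops)
qed

text \<open>Shape of the coproduct of a family of vectors attached to paths: the left factors are the vectors of the initial pieces.\<close>
definition cop_form where
 "cop_form R xs K R' S \<longleftrightarrow> K : A.V & R' : A.V & (ALL r:{1..<length xs}. S r : A.V) &
 cop (R xs) = lift f1 (R xs) * lift f2 K + lift f1 1 * lift f2 R' +
 (\<Sum>r\<in>{1..<length xs}. lift f1 (R (take r xs)) * lift f2 (S r))"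

lemma cop_form_tspan:
 assumes "cop_form R xs K R' S" "1 : Bs" "xs ~= []" and R: "!!r. 1 <= r ==> r <= length xs ==> R (take r xs) : Bs"
 shows "cop (R xs) : tspan Bs"
proof -
 have "1 <= length xs" using assms(3) by (cases xs) auto
 hence "R xs : Bs" using R[of "length xs"] by simp
 thus ?thesis using assms(1,2) R unfolding cop_form_def by (auto intro!: tspan_add tspan_sum tspan_base)
qed

lemma cop_root_forms:
 assumes p: "path n xs" and ne: "xs ~= []"
 shows "cop_form G.froot xs (G.Kf (- rsum xs)) (G.froot xs) (%r. (inverse q - q) *. (G.froot (drop r xs) * G.Kf (- rsum (take r xs))))"
 "cop_form G.Gr xs (G.Kf (- rsum xs)) (G.Gr xs) (%r. (1 - inverse q * inverse q) *. (G.eroot (drop r xs) * G.Kf (- rsum xs)))"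
 "cop_form (G.ebar lam) xs (G.Kf (- rsum xs)) (G.Gr xs) (%r. (1 - inverse q * inverse q) *. (G.eroot (drop r xs) * G.Kf (- rsum xs)))"
 "cop_form (G.fbar kap) xs (G.Kf (- rsum xs)) (G.froot xs) (%r. (inverse q - q) *. (G.froot (drop r xs) * G.Kf (- rsum (take r xs))))"
proof -
 have xs: "set xs <= {1..n}" by (rule path_set[OF p])
 have td: "set (take r xs) <= {1..n}" "set (drop r xs) <= {1..n}" for r
 using xs set_take_subset[of r xs] set_drop_subset[of r xs] by blast+
 have tne: "take r xs ~= []" if "r : {1..<length xs}" for r using that ne by auto
 note ops = lift_mult[OF qgroup_f2] lift_scale[OF qgroup_f2] lift_K[OF qgroup_f2] lift_1[OF qgroup_f1]
 A.V_mult A.V_scale K_V eroot_V froot_V bar_V xs td ne tne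
 lift_roots[OF P.h.qgroup_axioms] lift_roots[OF qgroup_f1] lift_roots[OF qgroup_f2] calg.scale_sum_right scr
 show "cop_form G.froot xs (G.Kf (- rsum xs)) (G.froot xs) (%r. (inverse q - q) *. (G.froot (drop r xs) * G.Kf (- rsum (take r xs))))"
 unfolding cop_form_def using P.coprod_froot[OF p] by (simp add: ops del: One_nat_def)
 show "cop_form G.Gr xs (G.Kf (- rsum xs)) (G.Gr xs) (%r. (1 - inverse q * inverse q) *. (G.eroot (drop r xs) * G.Kf (- rsum xs)))"
 unfolding cop_form_def using P.coprod_Gr[OF p] by (simp add: ops del: One_nat_def)
 show "cop_form (G.ebar lam) xs (G.Kf (- rsum xs)) (G.Gr xs) (%r. (1 - inverse q * inverse q) *. (G.eroot (drop r xs) * G.Kf (- rsum xs)))"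
 unfolding cop_form_def using P.coprod_ebar[OF p, of lam] by (simp add: ops del: One_nat_def)
 show "cop_form (G.fbar kap) xs (G.Kf (- rsum xs)) (G.froot xs) (%r. (inverse q - q) *. (G.froot (drop r xs) * G.Kf (- rsum (take r xs))))"
 unfolding cop_form_def using P.coprod_fbar[OF p, of kap] by (simp add: ops del: One_nat_def)
qed

lemma lift_PP_eroot: "path n xs ==> xs ~= [] ==> lift (PP q g) (G.eroot xs) = inverse q *. G.Gr xs"
proof (induction xs)
 case (Cons a xs)
 note f = G.qgroup_PP
 have s: "set (a # xs) <= {1..n}" by (rule path_set[OF Cons.prems(1)])
 hence a: "a : {1..n}" and la: "LE a : letters n" and xs: "set xs <= {1..n}" by auto
 show ?case
 proof (cases "xs = []")
 case True
 thus ?thesis using a la by (simp add: lift_g[OF f] G.Gr_def G.Kf_simple)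
 next
 case False
 have X: "lift (PP q g) (g (LE a)) = inverse q *. (g (LE a) * G.Kf (- simple_root a))"
 using a la by (simp add: lift_g[OF f] G.Kf_simple)
 have form: "root_form n (rsum xs) (simple_root a) = -1" by (rule rsum_form_Cons[OF Cons.prems(1) False])
 have tw: "G.Kf (- simple_root a) * G.eroot xs = q *. (G.eroot xs * G.Kf (- simple_root a))"
 "G.Kf (- rsum xs) * g (LE a) = q *. (g (LE a) * G.Kf (- rsum xs))"
 using G.Kf_wt[OF G.wt_eroot[OF xs], of "- simple_root a"] G.Kf_wt[OF G.wt_E[OF a], of "- rsum xs"] form
 root_form_sym[of n "simple_root a" "rsum xs"]
 by (simp_all add: root_form_uminus_left tw_def)
 have tw3: "G.Kf (- simple_root a) * (G.eroot xs * t) = q *. (G.eroot xs * (G.Kf (- simple_root a) * t))"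
 "G.Kf (- rsum xs) * (g (LE a) * t) = q *. (g (LE a) * (G.Kf (- rsum xs) * t))" for t
 using arg_cong[OF tw(1), of "%x. x * t"] arg_cong[OF tw(2), of "%x. x * t"] by (simp_all add: mult.assoc scl)
 have K: "G.Kf (- rsum (a # xs)) = G.Kf (- simple_root a) * G.Kf (- rsum xs)"
 using G.Kf_add[of "- simple_root a" "- rsum xs"] by (simp only: rsum_simps(2) minus_add_distrib)
 have "lift (PP q g) (G.eroot (a # xs)) = qc (inverse q) (inverse q *. (g (LE a) * G.Kf (- simple_root a))) (inverse q *. G.Gr xs)"
 using lift_qc[OF f g_V[OF la] eroot_V[OF xs]] Cons.IH[OF path_Cons[OF Cons.prems(1) False] False] X
 by (simp add: G.eroot_Cons[OF False])
 also have "... = inverse q *. G.Gr (a # xs)"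
 proof -
 have 1: "(inverse q *. (g (LE a) * G.Kf (- simple_root a))) * (inverse q *. G.Gr xs)
 = inverse q *. (g (LE a) * (G.eroot xs * (G.Kf (- simple_root a) * G.Kf (- rsum xs))))"
 using q0 by (simp add: G.Gr_def mult.assoc tw3 scl scr scc)
 have 2: "(inverse q *. G.Gr xs) * (inverse q *. (g (LE a) * G.Kf (- simple_root a)))
 = inverse q *. (G.eroot xs * (g (LE a) * (G.Kf (- simple_root a) * G.Kf (- rsum xs))))"
 using q0 G.Kf_comm[of "- rsum xs" "- simple_root a"]
 by (simp add: G.Gr_def mult.assoc tw3 scl scr scc)
 show ?thesis
 unfolding qc_def 1 2
 unfolding G.Gr_def K G.eroot_Cons[OF False] qc_def
 by (simp add: calg.scale_right_diff_distrib left_diff_distrib scl mult.assoc scc)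
 qed
 finally show ?thesis .
 qed
qed simp

end

context shift begin

text \<open>Among the cuts only that after the first vertex survives, because the character vanishes on the vectors of all longer paths.\<close>
lemma sh_form:
 assumes cf: "cop_form R xs K R' S" and ne: "xs ~= []"
 and R: "!!r. 1 <= r ==> r <= length xs ==> R (take r xs) : alg X"
 and one: "ph (R (take 1 xs)) = lam" and zero: "!!r. 2 <= r ==> r <= length xs ==> ph (R (take r xs)) = 0"
 shows "sh (R xs) = R' + (if tl xs = [] then lam *. K else lam *. S 1)"
proof -
 have len: "1 <= length xs" using ne by (cases xs) auto
 hence Rx: "R xs : alg X" using R[of "length xs"] by simp
 have V: "K : A.V" "R' : A.V" "!!r. r : {1..<length xs} ==> S r : A.V" using cf by (auto simp: cop_form_def)
 have RV: "R (take r xs) : alg X" if "r : {1..<length xs}" for r using that R by auto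
 have B: "lift f1 (R xs) * lift f2 K : B.V" "lift f1 1 * lift f2 R' : B.V"
 "!!r. r : {1..<length xs} ==> lift f1 (R (take r xs)) * lift f2 (S r) : B.V"
 using V alg_XV[OF Rx] alg_XV[OF RV] A.V_1 by (auto intro!: B.V_mult lift_V)
 note sum = Th_sum[of "{1..<length xs}" "%r. lift f1 (R (take r xs)) * lift f2 (S r)", OF B(3)]
 have "sh (R xs) = Th (lift f1 (R xs) * lift f2 K + lift f1 1 * lift f2 R' + (\<Sum>r\<in>{1..<length xs}. lift f1 (R (take r xs)) * lift f2 (S r)))"
 unfolding sh_def using cf by (simp add: cop_form_def)
 also have "... = Th (lift f1 (R xs) * lift f2 K) + Th (lift f1 1 * lift f2 R') + (\<Sum>r\<in>{1..<length xs}. Th (lift f1 (R (take r xs)) * lift f2 (S r)))"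
 using B(1,2) sum by (simp add: Th_add B.V_add)
 also have "... = ph (R xs) *. K + R' + (\<Sum>r\<in>{1..<length xs}. ph (R (take r xs)) *. S r)"
 using V Rx RV by (simp add: Th_tens alg.one ph_1 sc1)
 also have "... = R' + (if tl xs = [] then lam *. K else lam *. S 1)"
 proof (cases "tl xs = []")
 case True
 hence "length xs = 1" using ne by (cases xs) auto
 thus ?thesis using one True by simp
 next
 case False
 hence l2: "2 <= length xs" using ne by (cases xs; cases "tl xs") auto
 hence "{1..<length xs} = insert 1 {2..<length xs}" by auto
 hence "(\<Sum>r\<in>{1..<length xs}. ph (R (take r xs)) *. S r) = lam *. S 1 + (\<Sum>r\<in>{2..<length xs}. ph (R (take r xs)) *. S r)"
 using one by simp
 also have "(\<Sum>r\<in>{2..<length xs}. ph (R (take r xs)) *. S r) = 0" by (rule sum.neutral) (use zero in auto)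
 finally show ?thesis using zero[of "length xs"] l2 False by simp
 qed
 finally show ?thesis .
qed

end

context uq_vee begin

lemma arms_path: "xs : arms ==> path n xs" "xs : arms ==> xs ~= []" "xs : arms ==> set xs <= {1..n}"
 using arms_hd by blast+

lemma val_roots:
 "A.val ` rootF n q w ` inversions n w = G.froot ` arms" "A.val ` rootE n q w ` inversions n w = G.eroot ` arms"
 "rootF n q w ` inversions n w <= carrier A.U" "rootE n q w ` inversions n w <= carrier A.U"
proof -
 show "A.val ` rootF n q w ` inversions n w = G.froot ` arms" "A.val ` rootE n q w ` inversions n w = G.eroot ` arms"
 unfolding inversions_ch arms_def image_image by (intro image_cong refl; use rootF_val rootE_val in simp)+
 show "rootF n q w ` inversions n w <= carrier A.U" "rootE n q w ` inversions n w <= carrier A.U"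
 unfolding inversions_ch using rootF_val rootE_val by auto
qed

lemma Uminus_val: "Uminus_op n q w <= carrier A.U" "A.val ` Uminus_op n q w = alg (G.froot ` arms)"
 using A.val_gen_subalg[OF val_roots(3)] by (simp_all add: Uminus_op_def Uq_alt val_roots)

lemma psi_Uplus_val: "psi_Uplus n q w <= carrier A.U" "A.val ` psi_Uplus n q w = alg (G.Gr ` arms)"
proof -
 note g = A.val_gen_subalg[OF val_roots(4)]
 have e: "psi_Uplus n q w = psi n q ` gen_subalg A.U (rootE n q w ` inversions n w)" by (simp add: psi_Uplus_def Uq_alt)
 show "psi_Uplus n q w <= carrier A.U" unfolding e using psi_val g(1) by blast
 have V: "G.eroot ` arms <= A.V" using eroot_V arms_path(3) by blast
 have aV: "v : alg (G.eroot ` arms) ==> v : A.V" for v using A.alg_V[OF V] by blast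
 have "A.val ` psi_Uplus n q w = (%Y. lift (PP q g) (A.val Y)) ` gen_subalg A.U (rootE n q w ` inversions n w)"
 unfolding e image_image using psi_val g(1) by (intro image_cong refl) blast
 also have "... = lift (PP q g) ` alg (G.eroot ` arms)"
 using g(2) unfolding val_roots(2)[symmetric] by (simp add: image_image[symmetric])
 also have "... = alg (lift (PP q g) ` G.eroot ` arms)"
 by (rule hom_image_alg) (simp_all add: aV lift_add[OF G.qgroup_PP] lift_mult[OF G.qgroup_PP] lift_scale[OF G.qgroup_PP] lift_1[OF G.qgroup_PP])
 also have "lift (PP q g) ` G.eroot ` arms = (%xs. inverse q *. G.Gr xs) ` arms"
 unfolding image_image by (intro image_cong refl lift_PP_eroot arms_path)
 also have "alg ... = alg (G.Gr ` arms)" by (rule alg_scale_image) (use q0 in simp)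
 finally show "A.val ` psi_Uplus n q w = alg (G.Gr ` arms)" .
qed

end

locale vee_characters = uq_vee n q i l k for n q i l k +
 fixes \<phi>p \<phi>m :: "free set => complex"
 assumes char_p: "character A.U (psi_Uplus n q w) \<phi>p" and char_m: "character A.U (Uminus_op n q w) \<phi>m"
 and supp_p: "supp_plus n q w \<phi>p = {simple_root i}" and supp_m: "supp_minus n q w \<phi>m = {simple_root i}"
 and char_prod: "\<phi>p (UqE n q i \<otimes>\<^bsub>A.U\<^esub> UqK n q (- simple_root i)) * \<phi>m (UqF n q i) = q\<^sup>2 / ((q - inverse q) * (1 - q\<^sup>2))"

sublocale vee_characters < m: shift n q "Uminus_op n q w" "G.froot ` arms" \<phi>m
proof unfold_locales
 show "G.froot ` arms <= A.V" using froot_V arms_path(3) by blast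
 show "cop x : tspan (alg (G.froot ` arms))" if x: "x : G.froot ` arms" for x
 proof -
 obtain xs where xs: "xs : arms" "x = G.froot xs" using x by blast
 show ?thesis unfolding xs(2)
 by (rule cop_form_tspan[OF cop_root_forms(1)[OF arms_path(1,2)[OF xs(1)]] alg.one arms_path(2)[OF xs(1)]])
 (intro alg.base imageI arms_take xs)
 qed
qed (use Uminus_val char_m in auto)

sublocale vee_characters < p: shift n q "psi_Uplus n q w" "G.Gr ` arms" \<phi>p
proof unfold_locales
 show "G.Gr ` arms <= A.V" using bar_V(1) arms_path(3) by blast
 show "cop x : tspan (alg (G.Gr ` arms))" if x: "x : G.Gr ` arms" for x
 proof -
 obtain xs where xs: "xs : arms" "x = G.Gr xs" using x by blast
 show ?thesis unfolding xs(2)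
 by (rule cop_form_tspan[OF cop_root_forms(2)[OF arms_path(1,2)[OF xs(1)]] alg.one arms_path(2)[OF xs(1)]])
 (intro alg.base imageI arms_take xs)
 qed
qed (use psi_Uplus_val char_p in auto)

context vee_characters begin

definition lam where "lam = \<phi>p (UqE n q i \<otimes>\<^bsub>A.U\<^esub> UqK n q (- simple_root i))"
definition kap where "kap = \<phi>m (UqF n q i)"

lemma lam_kap: "lam * kap * (1 - q * q) = q * q / (q - inverse q)"
proof -
 have "1 - q\<^sup>2 ~= 0" using nroot[of 2] by simp
 thus ?thesis using char_prod by (simp add: lam_def kap_def power2_eq_square)
qed

lemma rsum_i: "j <= l + k ==> rsum (ch j) = simple_root i \<longleftrightarrow> j = 0"
 using ch_inj[of j 0] ch_0 by auto

lemma tl_ch: "j <= l + k ==> tl (ch j) = [] \<longleftrightarrow> j = 0"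
proof -
 assume j: "j <= l + k"
 have "length (tl (ch j)) = length (ch j) - 1" by simp
 thus ?thesis using chain_length[OF j] by (auto simp flip: length_0_conv split: if_splits)
qed

lemma ph_m: "xs : arms ==> m.ph (G.froot xs) = (if tl xs = [] then kap else 0)"
proof -
 assume "xs : arms"
 then obtain j where j: "j <= l + k" "xs = ch j" by (auto simp: arms_def)
 show ?thesis
 proof (cases "j = 0")
 case True
 have "m.ph (A.val (UqF n q i)) = kap" unfolding m.ph_def kap_def
 by (subst A.unval_val) (use UqF_val[of i] i in auto)
 thus ?thesis using True j(2) UqF_val[of i] i by (simp add: ch_0)
 next
 case False
 have "rsum (ch j) : inversions n w" using j by (simp add: inversions_ch)
 hence "\<phi>m (rootF n q w (rsum (ch j))) = 0" using supp_m rsum_i[OF j(1)] False by (auto simp: supp_minus_def)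
 thus ?thesis using rootF_val[OF j(1)] tl_ch[OF j(1)] False j(2) by (simp add: m.ph_def A.unval_val flip: rootF_val[OF j(1), THEN conjunct2])
 qed
qed

lemma ph_p: "xs : arms ==> p.ph (G.Gr xs) = (if tl xs = [] then lam else 0)"
proof -
 assume xs: "xs : arms"
 then obtain j where j: "j <= l + k" "xs = ch j" by (auto simp: arms_def)
 interpret R: ring A.U by (rule A.ring_U)
 show ?thesis
 proof (cases "j = 0")
 case True
 have "UqE n q i \<otimes>\<^bsub>A.U\<^esub> UqK n q (- simple_root i) : carrier A.U" using UqE_val[of i] i UqK_val by simp
 moreover have "A.val (UqE n q i \<otimes>\<^bsub>A.U\<^esub> UqK n q (- simple_root i)) = G.Gr [i]"
 using UqE_val[of i] i UqK_val[of "- simple_root i"] by (simp add: A.val_mult G.Gr_def)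
 ultimately have "p.ph (G.Gr [i]) = lam" unfolding p.ph_def lam_def using A.unval_val by metis
 thus ?thesis using True j(2) by (simp add: ch_0)
 next
 case False
 let ?Y = "psi n q (rootE n q w (rsum (ch j)))"
 have "rsum (ch j) : inversions n w" using j by (simp add: inversions_ch)
 hence 0: "\<phi>p ?Y = 0" using supp_p rsum_i[OF j(1)] False by (auto simp: supp_plus_def)
 have Y: "?Y : carrier A.U" "A.val ?Y = inverse q *. G.Gr xs"
 using psi_val rootE_val[OF j(1)] lift_PP_eroot[of "ch j"] arms_path(1,2)[OF xs] by (simp_all add: j(2))
 have "p.ph (A.val ?Y) = 0" using 0 Y(1) by (simp add: p.ph_def A.unval_val)
 moreover have "G.Gr xs : alg (G.Gr ` arms)" using xs by (intro alg.base imageI)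
 ultimately have "inverse q * p.ph (G.Gr xs) = 0" unfolding Y(2) by (simp only: p.ph_scale)
 thus ?thesis using q0 tl_ch[OF j(1)] False j(2) by simp
 qed
qed

lemma take_tl: "2 <= r ==> r <= length xs ==> tl (take r xs) ~= []" "tl (take 1 xs) = []"
proof -
 assume "2 <= r" "r <= length xs"
 hence "length (tl (take r xs)) = r - 1" "r - 1 ~= 0" by simp_all
 thus "tl (take r xs) ~= []" by (metis list.size(3))
qed (cases xs, simp_all)

lemma sh_m: "xs : arms ==> m.sh (G.froot xs) = G.fbar kap xs"
proof -
 assume xs: "xs : arms"
 note p = arms_path[OF xs]
 have len: "1 <= length xs" using p(2) by (cases xs) auto
 have hd: "hd xs : {1..n}" using p(2,3) hd_in_set by blast
 have "m.sh (G.froot xs) = G.froot xs + (if tl xs = [] then kap *. G.Kf (- rsum xs) else kap *. (inverse q - q) *. (G.froot (drop 1 xs) * G.Kf (- rsum (take 1 xs))))"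
 proof (rule m.sh_form[OF cop_root_forms(1)[OF p(1,2)] p(2)])
 show "G.froot (take r xs) : alg (G.froot ` arms)" if "1 <= r" "r <= length xs" for r
 using arms_take[OF xs that] by (intro alg.base imageI)
 show "m.ph (G.froot (take 1 xs)) = kap" using ph_m[OF arms_take[OF xs le_refl len]] by (simp only: take_tl(2) if_True simp_thms)
 show "m.ph (G.froot (take r xs)) = 0" if "2 <= r" "r <= length xs" for r
 using ph_m[OF arms_take[OF xs _ that(2)]] take_tl(1)[OF that] that by simp
 qed
 also have "... = G.fbar kap xs"
 using p(2) hd by (cases xs) (simp_all add: G.fbar_def G.Kf_simple scc mult.commute)
 finally show ?thesis .
qed

lemma sh_p: "xs : arms ==> p.sh (G.Gr xs) = G.ebar lam xs"
proof -
 assume xs: "xs : arms"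
 note p = arms_path[OF xs]
 have len: "1 <= length xs" using p(2) by (cases xs) auto
 have "p.sh (G.Gr xs) = G.Gr xs + (if tl xs = [] then lam *. G.Kf (- rsum xs) else lam *. (1 - inverse q * inverse q) *. (G.eroot (drop 1 xs) * G.Kf (- rsum xs)))"
 proof (rule p.sh_form[OF cop_root_forms(2)[OF p(1,2)] p(2)])
 show "G.Gr (take r xs) : alg (G.Gr ` arms)" if "1 <= r" "r <= length xs" for r
 using arms_take[OF xs that] by (intro alg.base imageI)
 show "p.ph (G.Gr (take 1 xs)) = lam" using ph_p[OF arms_take[OF xs le_refl len]] by (simp only: take_tl(2) if_True simp_thms)
 show "p.ph (G.Gr (take r xs)) = 0" if "2 <= r" "r <= length xs" for r
 using ph_p[OF arms_take[OF xs _ that(2)]] take_tl(1)[OF that] that by simp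
 qed
 also have "... = G.ebar lam xs"
 by (simp add: G.ebar_def G.Gr_def scc mult.commute drop_Suc)
 finally show ?thesis .
qed

lemma barF_val: "j <= l + k ==> barF n q w \<phi>m (rsum (ch j)) : carrier A.U & A.val (barF n q w \<phi>m (rsum (ch j))) = G.fbar kap (ch j)"
proof -
 assume j: "j <= l + k"
 hence a: "ch j : arms" by (simp add: arms_def)
 note r = rootF_val[OF j]
 have "A.val (rootF n q w (rsum (ch j))) : alg (G.froot ` arms)" using r a by (auto intro: alg.base)
 thus ?thesis unfolding barF_def using m.apply_left_cop[OF conjunct1[OF r]] r sh_m[OF a] by simp
qed

lemma barE_val: "j <= l + k ==> barE n q w \<phi>p (rsum (ch j)) : carrier A.U & A.val (barE n q w \<phi>p (rsum (ch j))) = G.ebar lam (ch j)"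
proof -
 assume j: "j <= l + k"
 hence a: "ch j : arms" by (simp add: arms_def)
 interpret R: ring A.U by (rule A.ring_U)
 let ?Y = "rootE n q w (rsum (ch j)) \<otimes>\<^bsub>A.U\<^esub> UqK n q (- rsum (ch j))"
 have Y: "?Y : carrier A.U" "A.val ?Y = G.Gr (ch j)"
 using rootE_val[OF j] UqK_val[of "- rsum (ch j)"] by (simp_all add: A.val_mult G.Gr_def)
 have "A.val ?Y : alg (G.Gr ` arms)" unfolding Y(2) using a by (auto intro: alg.base)
 thus ?thesis unfolding barE_def Uq_alt using p.apply_left_cop[OF Y(1)] Y(2) sh_p[OF a] by simp
qed

lemma shift_relations:
 assumes "xs : arms" "zs : arms"
 shows "G.eroot xs * G.eroot zs = c *. (G.eroot zs * G.eroot xs) ==> G.ebar lam xs * G.ebar lam zs = c *. (G.ebar lam zs * G.ebar lam xs)"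
 "G.froot xs * G.froot zs = c *. (G.froot zs * G.froot xs) ==> G.fbar kap xs * G.fbar kap zs = c *. (G.fbar kap zs * G.fbar kap xs)"
proof -
 assume "G.froot xs * G.froot zs = c *. (G.froot zs * G.froot xs)"
 hence "m.sh (G.froot xs * G.froot zs) = m.sh (c *. (G.froot zs * G.froot xs))" by simp
 thus "G.fbar kap xs * G.fbar kap zs = c *. (G.fbar kap zs * G.fbar kap xs)"
 using assms by (simp add: m.sh_mult m.sh_scale alg.mult alg.base sh_m)
next
 assume "G.eroot xs * G.eroot zs = c *. (G.eroot zs * G.eroot xs)"
 hence "G.Gr xs * G.Gr zs = c *. (G.Gr zs * G.Gr xs)" by (rule G.Gr_relation) (use assms arms_path in auto)
 hence "p.sh (G.Gr xs * G.Gr zs) = p.sh (c *. (G.Gr zs * G.Gr xs))" by simp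
 thus "G.ebar lam xs * G.ebar lam zs = c *. (G.ebar lam zs * G.ebar lam xs)"
 using assms by (simp add: p.sh_mult p.sh_scale alg.mult alg.base sh_p)
qed

abbreviation "e j \<equiv> G.ebar lam (ch j)"
abbreviation "f j \<equiv> G.fbar kap (ch j)"

text \<open>For \<open>E\<close> the relation holds in the order of the positions, for \<open>F\<close> in the opposite order; the mixed relations hold in both.\<close>
lemma bar_relations:
 assumes j: "j <= l + k" "j' <= l + k" "j < j'"
 defines "c \<equiv> q powi root_form n (rsum (ch j)) (rsum (ch j'))"
 shows "e j * e j' = c *. (e j' * e j)" "f j' * f j = c *. (f j * f j')"
 "e j * f j' = c *. (f j' * e j)" "e j' * f j = c *. (f j * e j')"
proof -
 have a: "ch j : arms" "ch j' : arms" using j by (auto simp: arms_def)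
 note p = arms_path[OF a(1)] arms_path[OF a(2)]
 have "e j * e j' = c *. (e j' * e j) & f j' * f j = c *. (f j * f j') &
 e j * f j' = c *. (f j' * e j) & e j' * f j = c *. (f j * e j')"
 using j
 proof (rule arms_cases)
 fix zs assume zs: "ch j' = ch j @ zs" "zs ~= []"
 have pz: "path n (ch j @ zs)" using p(4) by (simp add: zs)
 have c: "c = q" using rsum_form_prefix[OF pz p(2) zs(2)] by (simp add: c_def zs(1))
 have "G.eroot (ch j) * G.eroot (ch j') = q *. (G.eroot (ch j') * G.eroot (ch j))"
 unfolding zs(1) by (rule eroot_prefix[OF G.qgroup_axioms pz p(2) zs(2)])
 moreover have "G.froot (ch j') * G.froot (ch j) = q *. (G.froot (ch j) * G.froot (ch j'))"
 unfolding zs(1) G.froot_prefix[OF pz p(2) zs(2)] using q0 by (simp add: scc sc1)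
 ultimately show ?thesis
 using shift_relations(1)[OF a] shift_relations(2)[OF a(2,1)] G.bar_prefix[OF lam_kap pz p(2) zs(2)] by (simp add: c flip: zs(1))
 next
 fix us vs assume uv: "ch j = i # us" "ch j' = i # vs" "us ~= []" "vs ~= []" "!!b c. b : set us ==> c : set vs ==> cartan b c = 0"
 note pu = p(1)[unfolded uv(1)] and pv = p(4)[unfolded uv(2)]
 have uv': "cartan b c = 0" if "b : set vs" "c : set us" for b c using uv(5)[OF that(2,1)] by (simp add: cartan_sym)
 have c: "c = 1" using rsum_form_opposite[OF pu pv uv(3,4,5)] by (simp only: c_def uv power_int_0_right)
 have "G.eroot (ch j) * G.eroot (ch j') = 1 *. (G.eroot (ch j') * G.eroot (ch j))"
 "G.froot (ch j') * G.froot (ch j) = 1 *. (G.froot (ch j) * G.froot (ch j'))"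
 unfolding uv(1,2) sc1 by (rule G.eroot_opposite[OF pu pv uv(3,4,5)], assumption+, rule G.froot_opposite[OF pv pu uv(4,3) uv'])
 moreover have "e j * f j' = f j' * e j" "e j' * f j = f j * e j'"
 unfolding uv(1,2) by (rule G.bar_opposite[OF lam_kap pu pv uv(3,4,5)], assumption+, rule G.bar_opposite[OF lam_kap pv pu uv(4,3) uv'])
 ultimately show ?thesis
 using shift_relations(1)[OF a, of 1] shift_relations(2)[OF a(2,1), of 1] by (simp add: c sc1)
 qed
 thus "e j * e j' = c *. (e j' * e j)" "f j' * f j = c *. (f j * f j')"
 "e j * f j' = c *. (f j' * e j)" "e j' * f j = c *. (f j * e j')" by blast+
qed

lemma bar_i: "e 0 * f 0 = (q * q) *. (f 0 * e 0) + (q * q / (q - inverse q)) *. 1"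
 using G.bar_base[of i lam kap] lam_kap i by (simp add: ch_0 algebra_simps)

lemma bar_diagonal:
 assumes j: "j <= l + k" "j ~= 0"
 obtains j' m where "j' <= l + k" "ch j = ch j' @ [m]" "length (ch j') < length (ch j)"
 "e j * f j = (q * q) *. (f j * e j) + (- q) *. (e j' * f j' - f j' * e j')"
proof -
 have a: "ch j : arms" using j by (auto simp: arms_def)
 note p = arms_path[OF a]
 have tl: "tl (ch j) ~= []" using tl_ch[OF j(1)] j(2) by simp
 hence len: "2 <= length (ch j)" using p(2) by (cases "ch j"; cases "tl (ch j)") auto
 have b: "ch j = butlast (ch j) @ [last (ch j)]" using p(2) by simp
 have "butlast (ch j) : arms" using arms_take[OF a, of "length (ch j) - 1"] len by (simp add: butlast_conv_take)
 then obtain j' m where j': "j' <= l + k" "ch j = ch j' @ [m]" using b by (auto simp: arms_def)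
 have ne: "ch j' ~= []" using j'(1) arms_path(2) by (auto simp: arms_def)
 have pm: "path n (ch j' @ [m])" using p(1) by (simp only: j'(2))
 note m = G.bar_main[OF lam_kap pm ne]
 have "length (ch j') < length (ch j)" by (subst j'(2)) simp
 moreover have "e j * f j - (q * q) *. (f j * e j) = (- q) *. (e j' * f j' - f j' * e j')"
 using m by (simp only: j'(2))
 hence "e j * f j = (q * q) *. (f j * e j) + (- q) *. (e j' * f j' - f j' * e j')" by (simp only: diff_eq_eq add.commute)
 ultimately show thesis using that[OF j'(1,2)] by blast
qed

end

section \<open>The product subalgebra\<close>

lemma product_span_sum:
 fixes B C :: "'a::calg set"
 assumes B: "calg.subspace B" and C: "calg.subspace C" and v: "v : calg.span {x * y | x y. x : B & y : C}"
 shows "EX Q. finite Q & Q <= B \<times> C & v = (\<Sum>p\<in>Q. fst p * snd p)"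
 using v
proof (induction rule: calg.span_induct_alt)
 case base
 thus ?case by (intro exI[of _ "{}"]) auto
next
 case (step c z w)
 then obtain x y Q where x: "x : B" "y : C" "z = x * y" and Q: "finite Q" "Q <= B \<times> C" "w = (\<Sum>p\<in>Q. fst p * snd p)" by blast
 have cx: "c *. x : B" by (rule calg.subspace_scale[OF B x(1)])
 obtain R where "finite R" "R <= B \<times> C" "(\<Sum>p\<in>R. fst p * snd p) = (\<Sum>p\<in>{(c *. x, y)}. fst p * snd p) + (\<Sum>p\<in>Q. fst p * snd p)"
 proof (rule psum_add[of B C "%p. fst p * snd p" "{(c *. x, y)}" Q])
 fix t b u assume "(t::complex) ~= 0"
 thus "fst (t *. b, inverse t *. u) * snd (t *. b, inverse t *. u) = fst (b, u) * snd (b, u)"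
 by (simp add: scl scr scc sc1)
 qed (use B C calg.subspace_scale cx x Q in auto)
 thus ?case using x Q(3) by (intro exI[of _ R]) (simp add: scl)
qed

lemma mult_span_left:
 fixes x :: "'a::calg"
 assumes "!!s. s : S ==> x * s : calg.span T" "v : calg.span S"
 shows "x * v : calg.span T"
 by (rule span_mult[of "{x}" S T]) (use assms in \<open>auto intro: calg.span_base\<close>)

lemma mult_span_right:
 fixes x :: "'a::calg"
 assumes "!!s. s : S ==> s * x : calg.span T" "v : calg.span S"
 shows "v * x : calg.span T"
 by (rule span_mult[of S "{x}" T]) (use assms in \<open>auto intro: calg.span_base\<close>)

lemma commutator_commutes:
 fixes a b x :: "'a::calg"
 assumes c: "c ~= 0" and ax: "a * x = c *. (x * a)" and xb: "x * b = c *. (b * x)"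
 shows "(a * b - b * a) * x = x * (a * b - b * a)"
proof -
 note False = c
 have xa: "x * a = inverse c *. (a * x)" using ax False by (simp add: scc sc1)
 have "x * (a * b) = inverse c *. (a * (x * b))" using xa by (simp add: scl flip: mult.assoc)
 also have "... = a * (b * x)" unfolding xb using False by (simp add: scr scc sc1)
 finally have 1: "x * (a * b) = a * (b * x)" .
 have "x * (b * a) = c *. (b * (x * a))" using xb by (simp add: scl flip: mult.assoc)
 also have "... = b * (a * x)" unfolding xa using False by (simp add: scr scc sc1)
 finally have 2: "x * (b * a) = b * (a * x)" .
 show ?thesis by (simp add: left_diff_distrib right_diff_distrib mult.assoc 1 2)
qed

lemma smult_mat_vec: "A : carrier_mat d d ==> v : carrier_vec d ==> (c \<cdot>\<^sub>m A) *\<^sub>v v = c \<cdot>\<^sub>v (A *\<^sub>v (v :: complex vec))"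
 by (intro eq_vecI) (auto simp: scalar_prod_def sum_distrib_left mult.assoc)

context uq begin

lemma unval_pairs:
 assumes BC: "B <= carrier A.U" "C <= carrier A.U" and Q: "finite Q" "Q <= A.val ` B \<times> A.val ` C"
 shows "EX P. finite P & P <= B \<times> C & (\<Sum>p\<in>P. A.val (fst p) * A.val (snd p)) = (\<Sum>p\<in>Q. fst p * snd p)"
proof -
 define u where "u p = (A.unval (fst p), A.unval (snd p))" for p
 have u: "fst (u p) : B & snd (u p) : C & A.val (fst (u p)) = fst p & A.val (snd (u p)) = snd p" if "p : Q" for p
 proof -
 obtain X Y where "X : B" "Y : C" "p = (A.val X, A.val Y)" using Q(2) \<open>p : Q\<close> by blast
 thus ?thesis using BC A.unval_val[of X] A.unval_val[of Y] by (auto simp: u_def)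
 qed
 have "inj_on u Q"
 proof (rule inj_onI)
 fix p p' assume "p : Q" "p' : Q" "u p = u p'"
 thus "p = p'" using u[of p] u[of p'] by (metis prod.collapse)
 qed
 hence "(\<Sum>p\<in>u ` Q. A.val (fst p) * A.val (snd p)) = (\<Sum>p\<in>Q. fst p * snd p)"
 using u by (subst sum.reindex) (auto intro: sum.cong)
 moreover have "u ` Q <= B \<times> C"
 by (rule image_subsetI) (use u in \<open>simp add: mem_Times_iff\<close>)
 ultimately show ?thesis using Q(1) by (intro exI[of _ "u ` Q"]) simp
qed

lemma prod_span_val:
 assumes B: "B <= carrier A.U" "calg.subspace (A.val ` B)" and C: "C <= carrier A.U" "calg.subspace (A.val ` C)"
 shows "prod_span A.U B C <= carrier A.U"
 "A.val ` prod_span A.U B C = calg.span {x * y | x y. x : A.val ` B & y : A.val ` C}" (is "_ = calg.span ?S")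
proof -
 interpret R: ring A.U by (rule A.ring_U)
 have fs: "(\<Oplus>\<^bsub>A.U\<^esub>p\<in>P. fst p \<otimes>\<^bsub>A.U\<^esub> snd p) : carrier A.U &
 A.val (\<Oplus>\<^bsub>A.U\<^esub>p\<in>P. fst p \<otimes>\<^bsub>A.U\<^esub> snd p) = (\<Sum>p\<in>P. A.val (fst p) * A.val (snd p))" if "finite P" "P <= B \<times> C" for P
 proof -
 have m: "fst p : carrier A.U" "snd p : carrier A.U" if "p : P" for p
 using subsetD[OF \<open>P <= B \<times> C\<close> that] B(1) C(1) by (auto simp: mem_Times_iff)
 have "(\<Sum>p\<in>P. A.val (fst p \<otimes>\<^bsub>A.U\<^esub> snd p)) = (\<Sum>p\<in>P. A.val (fst p) * A.val (snd p))"
 using m by (intro sum.cong refl A.val_mult) auto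
 thus ?thesis using A.val_finsum[of P "%p. fst p \<otimes>\<^bsub>A.U\<^esub> snd p"] m \<open>finite P\<close> by simp
 qed
 thus "prod_span A.U B C <= carrier A.U" by (auto simp: prod_span_def)
 show "A.val ` prod_span A.U B C = calg.span ?S"
 proof (intro equalityI subsetI)
 fix v assume "v : A.val ` prod_span A.U B C"
 then obtain P where P: "finite P" "P <= B \<times> C" "v = A.val (\<Oplus>\<^bsub>A.U\<^esub>p\<in>P. fst p \<otimes>\<^bsub>A.U\<^esub> snd p)"
 by (auto simp: prod_span_def)
 have "A.val (fst p) * A.val (snd p) : calg.span ?S" if "p : P" for p
 using subsetD[OF P(2) that] by (intro calg.span_base) (auto simp: mem_Times_iff)
 thus "v : calg.span ?S" unfolding P(3) conjunct2[OF fs[OF P(1,2)]] by (rule calg.span_sum)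
 next
 fix v assume "v : calg.span ?S"
 from product_span_sum[OF B(2) C(2) this]
 obtain Q where Q: "finite Q" "Q <= A.val ` B \<times> A.val ` C" "v = (\<Sum>p\<in>Q. fst p * snd p)" by blast
 from unval_pairs[OF B(1) C(1) Q(1,2)]
 obtain P where P: "finite P" "P <= B \<times> C" "(\<Sum>p\<in>P. A.val (fst p) * A.val (snd p)) = v" unfolding Q(3) by blast
 have "v = A.val (\<Oplus>\<^bsub>A.U\<^esub>p\<in>P. fst p \<otimes>\<^bsub>A.U\<^esub> snd p)" using fs[OF P(1,2)] P(3) by simp
 moreover have "(\<Oplus>\<^bsub>A.U\<^esub>p\<in>P. fst p \<otimes>\<^bsub>A.U\<^esub> snd p) : prod_span A.U B C" using P(1,2) unfolding prod_span_def by blast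
 ultimately show "v : A.val ` prod_span A.U B C" by simp
 qed
qed

lemma torus_alg_val: "torus_alg n q L <= carrier A.U" "A.val ` torus_alg n q L = calg.span (G.Kf ` L)"
proof -
 have fs: "(\<Oplus>\<^bsub>A.U\<^esub>\<mu>\<in>M. c \<mu> \<odot>\<^bsub>A.U\<^esub> UqK n q \<mu>) : carrier A.U &
 A.val (\<Oplus>\<^bsub>A.U\<^esub>\<mu>\<in>M. c \<mu> \<odot>\<^bsub>A.U\<^esub> UqK n q \<mu>) = (\<Sum>\<mu>\<in>M. c \<mu> *. G.Kf \<mu>)" if "finite M" for c M
 using A.val_finsum[of M "%\<mu>. c \<mu> \<odot>\<^bsub>A.U\<^esub> UqK n q \<mu>"] UqK_val that by (simp add: A.val_smult A.smult_closed)
 thus "torus_alg n q L <= carrier A.U" by (auto simp: torus_alg_def Uq_alt)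
 show "A.val ` torus_alg n q L = calg.span (G.Kf ` L)"
 proof (intro equalityI subsetI)
 fix v assume "v : A.val ` torus_alg n q L"
 then obtain c M where M: "finite M" "M <= L" "v = A.val (\<Oplus>\<^bsub>A.U\<^esub>\<mu>\<in>M. c \<mu> \<odot>\<^bsub>A.U\<^esub> UqK n q \<mu>)"
 by (auto simp: torus_alg_def Uq_alt)
 show "v : calg.span (G.Kf ` L)" unfolding M(3) conjunct2[OF fs[OF M(1)]]
 using M(2) by (intro calg.span_sum calg.span_scale calg.span_base) auto
 next
 fix v assume "v : calg.span (G.Kf ` L)"
 then obtain t r where t: "finite t" "t <= G.Kf ` L" "v = (\<Sum>a\<in>t. r a *. a)" unfolding calg.span_explicit by blast
 then obtain M where M: "M <= L" "inj_on G.Kf M" "t = G.Kf ` M" by (auto simp: subset_image_inj)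
 have "finite M" using t(1) M finite_imageD by blast
 moreover have "v = (\<Sum>\<mu>\<in>M. r (G.Kf \<mu>) *. G.Kf \<mu>)" unfolding t(3) M(3) by (simp add: sum.reindex[OF M(2)])
 ultimately have "v = A.val (\<Oplus>\<^bsub>A.U\<^esub>\<mu>\<in>M. r (G.Kf \<mu>) \<odot>\<^bsub>A.U\<^esub> UqK n q \<mu>)" using fs[of M "%\<mu>. r (G.Kf \<mu>)"] by simp
 moreover have "(\<Oplus>\<^bsub>A.U\<^esub>\<mu>\<in>M. r (G.Kf \<mu>) \<odot>\<^bsub>A.U\<^esub> UqK n q \<mu>) : torus_alg n q L"
 using \<open>finite M\<close> M(1) unfolding torus_alg_def Uq_alt
 by (intro CollectI exI[of _ "%\<mu>. r (G.Kf \<mu>)"] exI[of _ M] conjI refl)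
 ultimately show "v : A.val ` torus_alg n q L" by (rule image_eqI)
 qed
qed

end

context vee_characters begin

definition "L = {\<mu> : root_lattice n. root_form n \<mu> (simple_root i) = 0}"
definition "FA = alg (G.fbar kap ` arms)"
definition "EA = alg (G.ebar lam ` arms)"
definition "KA = calg.span (G.Kf ` L)"
definition "X = G.ebar lam ` arms \<union> G.fbar kap ` arms \<union> G.Kf ` L"

lemma L_ops: "0 : L" "\<mu> : L ==> \<nu> : L ==> \<mu> + \<nu> : L"
 by (auto simp: L_def root_lattice_def root_form_add_left)

text \<open>The torus elements used are orthogonal to \<open>\<alpha>\<^sub>i\<close>, so the two terms of a shifted vector, which differ in weight by \<open>\<alpha>\<^sub>i\<close>, are scaled alike.\<close>
lemma K_bar:
 assumes \<nu>: "\<nu> : L" and xs: "xs : arms"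
 shows "tw (G.Kf \<nu>) (q powi root_form n \<nu> (rsum xs)) (G.ebar lam xs)" "tw (G.Kf \<nu>) (q powi (- root_form n \<nu> (rsum xs))) (G.fbar kap xs)"
proof -
 note p = arms_path[OF xs]
 obtain ys where ys: "xs = i # ys" using arms_hd[OF xs] by (cases xs) auto
 have s: "set ys <= {1..n}" "i : {1..n}" using p(3) ys by auto
 have \<nu>0: "root_form n \<nu> (simple_root i) = 0" using \<nu> by (simp add: L_def)
 have f: "root_form n \<nu> (rsum ys) = root_form n \<nu> (rsum xs)"
 unfolding ys rsum_simps root_form_add_right \<nu>0 by simp
 have K0: "tw (G.Kf \<nu>) 1 (G.Kf \<mu>)" for \<mu> using G.Kf_comm[of \<nu> \<mu>] by (simp add: tw_def sc1)
 have mult1: "tw u c x ==> tw u 1 y ==> tw u c (x * y)" for u x y :: "letter list lend" and c using tw_mult_right[of u c x 1 y] by simp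
 have E: "tw (G.Kf \<nu>) (q powi root_form n \<nu> (rsum xs)) (G.eroot xs)" "tw (G.Kf \<nu>) (q powi root_form n \<nu> (rsum xs)) (G.eroot ys)"
 using G.Kf_wt[OF G.wt_eroot[OF p(3)], of \<nu>] G.Kf_wt[OF G.wt_eroot[OF s(1)], of \<nu>] f by simp_all
 have F: "tw (G.Kf \<nu>) (q powi (- root_form n \<nu> (rsum xs))) (G.froot xs)" "tw (G.Kf \<nu>) (q powi (- root_form n \<nu> (rsum xs))) (G.froot ys)"
 using G.Kf_wt[OF G.wt_froot[OF p(3)], of \<nu>] G.Kf_wt[OF G.wt_froot[OF s(1)], of \<nu>] f by (simp_all only: root_form_uminus_right)
 have z: "root_form n \<nu> (rsum xs) = 0" if "ys = []" using f that by simp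
 have hd: "g (LKinv (hd xs)) = G.Kf (- simple_root i)" using G.Kf_simple(2)[OF s(2)] ys by simp
 show "tw (G.Kf \<nu>) (q powi root_form n \<nu> (rsum xs)) (G.ebar lam xs)"
 proof (cases "ys = []")
 case True
 thus ?thesis using E(1) K0 z[OF True] by (auto simp: G.ebar_def ys intro!: tw_add_right tw_scale_right mult1)
 next
 case False
 thus ?thesis unfolding G.ebar_def using E K0 by (auto simp: ys intro!: tw_add_right tw_scale_right mult1)
 qed
 show "tw (G.Kf \<nu>) (q powi (- root_form n \<nu> (rsum xs))) (G.fbar kap xs)"
 proof (cases "ys = []")
 case True
 thus ?thesis unfolding G.fbar_def hd using F(1) K0 z[OF True] by (auto simp: ys intro!: tw_add_right tw_scale_right mult1)
 next
 case False
 thus ?thesis unfolding G.fbar_def hd using F K0 by (auto simp: ys intro!: tw_add_right tw_scale_right mult1)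
 qed
qed

definition "E1 = insert 1 (G.ebar lam ` arms)"
definition "FE = calg.span {a * x | a x. a : FA & x : E1}"

lemma FE_base: "a : FA ==> x : E1 ==> a * x : FE" unfolding FE_def by (rule calg.span_base) blast

lemma FE_left: "a : FA ==> v : FE ==> a * v : FE"
 unfolding FE_def
proof (rule mult_span_left)
 fix s assume a: "a : FA" and "s : {a * x | a x. a : FA & x : E1}"
 then obtain b x where b: "b : FA" "x : E1" "s = b * x" by blast
 have "a * b : FA" using a b(1) unfolding FA_def by (rule alg.mult)
 thus "a * s : calg.span {a * x | a x. a : FA & x : E1}" using FE_base[of "a * b" x] b by (simp add: FE_def mult.assoc)
qed

text \<open>The diagonal relations replace a pair of vectors by a pair of shorter ones, so induction on the length brings every product into the order \<open>F\<close> before \<open>E\<close>.\<close>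
lemma e_f: "j <= l + k ==> j' <= l + k ==> e j * f j' : FE"
proof -
 have fe: "f j' * e j : FE" if "j <= l + k" "j' <= l + k" for j j'
 using that by (intro FE_base) (auto simp: FA_def E1_def arms_def intro!: alg.base)
 have ops: "c *. v : FE" "v + u : FE" "v - u : FE" if "v : FE" "u : FE" for c v u
 using that unfolding FE_def by (auto intro: calg.span_scale calg.span_add calg.span_diff)
 have "1 * 1 : FE" by (rule FE_base) (auto simp: FA_def E1_def alg.one)
 hence one: "1 : FE" by simp
 have diag: "e j * f j : FE" if "j <= l + k" for j
 using that
 proof (induction "length (ch j)" arbitrary: j rule: less_induct)
 case less
 show ?case
 proof (cases "j = 0")
 case True
 have "(q * q) *. (f 0 * e 0) + (q * q / (q - inverse q)) *. 1 : FE" by ((intro ops(2) ops(1)[OF _ one] fe one); simp)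
 thus ?thesis unfolding True bar_i .
 next
 case False
 obtain j' m where j': "j' <= l + k" "length (ch j') < length (ch j)"
 "e j * f j = (q * q) *. (f j * e j) + (- q) *. (e j' * f j' - f j' * e j')"
 by (rule bar_diagonal[OF less.prems False])
 show ?thesis unfolding j'(3)
 by (intro ops(2) ops(3) ops(1)[OF _ one] fe j'(1) less.prems less.hyps[OF j'(2,1)])
 qed
 qed
 assume j: "j <= l + k" "j' <= l + k"
 consider "j < j'" | "j = j'" | "j' < j" by linarith
 thus ?thesis
 proof cases
 case 1
 thus ?thesis using bar_relations(3)[OF j 1] ops(1)[OF fe[OF j] one] by simp
 next
 case 2
 thus ?thesis using diag j by simp
 next
 case 3
 thus ?thesis using bar_relations(4)[OF j(2,1) 3] ops(1)[OF fe[OF j] one] by simp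
 qed
qed

lemma E1_FA: "a : FA ==> x : E1 ==> x * a : FE"
proof -
 assume "a : FA"
 hence "ALL x:E1. x * a : FE"
 unfolding FA_def
 proof induction
 case (base a)
 have "1 * a : FE" using FE_base[of a 1] base by (simp add: FA_def E1_def alg.base)
 moreover have "x * a : FE" if "x : G.ebar lam ` arms" for x using e_f that base by (auto simp: arms_def)
 ultimately show ?case unfolding E1_def by blast
 next
 case one
 thus ?case using FE_base[of 1] by (simp add: FA_def alg.one)
 next
 case (add a b)
 thus ?case by (auto simp: distrib_left FE_def intro: calg.span_add)
 next
 case (mult a b)
 show ?case
 proof
 fix x assume "x : E1"
 hence "x * a : FE" using mult.IH by blast
 hence "x * a * b : FE"
 unfolding FE_def
 proof (rule mult_span_right[rotated])
 fix s assume "s : {a * x | a x. a : FA & x : E1}"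
 then obtain a' x' where s: "a' : FA" "x' : E1" "s = a' * x'" by blast
 have "a' * (x' * b) : FE" using FE_left[OF s(1)] mult.IH(2) s(2) by blast
 thus "s * b : calg.span {a * x | a x. a : FA & x : E1}" by (simp add: s(3) mult.assoc FE_def)
 qed
 thus "x * (a * b) : FE" by (simp add: mult.assoc)
 qed
 next
 case (scale a c)
 thus ?case by (auto simp: scr FE_def intro: calg.span_scale)
 qed
 thus "x : E1 ==> x * a : FE" by blast
qed

lemma E1_K: "x : E1 ==> \<nu> : L ==> EX c. x * G.Kf \<nu> = c *. (G.Kf \<nu> * x)"
proof -
 assume x: "x : E1" and \<nu>: "\<nu> : L"
 show ?thesis
 proof (cases "x = 1")
 case True
 thus ?thesis by (intro exI[of _ 1]) (simp add: sc1)
 next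
 case False
 then obtain xs where xs: "xs : arms" "x = G.ebar lam xs" using x by (auto simp: E1_def)
 show ?thesis using twD[OF tw_flip[OF K_bar(1)[OF \<nu> xs(1)]]] q0 xs(2) by auto
 qed
qed

lemma K_FA: "a : FA ==> \<nu> : L ==> EX a':FA. G.Kf \<nu> * a = a' * G.Kf \<nu>"
 unfolding FA_def
proof (induction rule: alg.induct)
 case (base a)
 then obtain xs where xs: "xs : arms" "a = G.fbar kap xs" by blast
 show ?case
 using twD[OF K_bar(2)[OF base.prems xs(1)]] xs
 by (intro bexI[of _ "(q powi (- root_form n \<nu> (rsum xs))) *. a"]) (simp add: scl, intro alg.scale alg.base[OF base.hyps])
next
 case one
 thus ?case by (intro bexI[of _ 1]) (auto intro: alg.one)
next
 case (add a b)
 then obtain a' b' where "a' : alg (G.fbar kap ` arms)" "b' : alg (G.fbar kap ` arms)" "G.Kf \<nu> * a = a' * G.Kf \<nu>" "G.Kf \<nu> * b = b' * G.Kf \<nu>" by blast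
 thus ?case by (intro bexI[of _ "a' + b'"]) (auto simp: distrib_left distrib_right intro: alg.add)
next
 case (mult a b)
 then obtain a' b' where ab: "a' : alg (G.fbar kap ` arms)" "b' : alg (G.fbar kap ` arms)" "G.Kf \<nu> * a = a' * G.Kf \<nu>" "G.Kf \<nu> * b = b' * G.Kf \<nu>" by blast
 have "G.Kf \<nu> * (a * b) = a' * (G.Kf \<nu> * b)" using ab(3) by (simp flip: mult.assoc)
 also have "... = a' * b' * G.Kf \<nu>" by (simp add: ab(4) mult.assoc)
 finally show ?case using ab by (intro bexI[of _ "a' * b'"]) (auto intro: alg.mult)
next
 case (scale a c)
 then obtain a' where "a' : alg (G.fbar kap ` arms)" "G.Kf \<nu> * a = a' * G.Kf \<nu>" by blast
 thus ?case by (intro bexI[of _ "c *. a'"]) (auto simp: scl scr intro: alg.scale)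
qed

definition "FK = calg.span {a * b | a b. a : FA & b : KA}"
definition "CV = calg.span {s * y | s y. s : FK & y : EA}"

lemma FK_base: "a : FA ==> b : KA ==> a * b : FK" unfolding FK_def by (rule calg.span_base) blast
lemma CV_base: "s : FK ==> y : EA ==> s * y : CV" unfolding CV_def by (rule calg.span_base) blast

lemma FK_left:
 assumes "!!a b. a : FA ==> b : KA ==> x * (a * b) : FK" and "s : FK"
 shows "x * s : FK"
 using assms(2) unfolding FK_def by (rule mult_span_left[rotated]) (use assms(1) in \<open>auto simp: FK_def\<close>)

lemma FK_gens:
 assumes "s : FK" "x : G.fbar kap ` arms \<union> G.Kf ` L"
 shows "x * s : FK"
proof (rule FK_left[OF _ assms(1)])
 fix a b assume ab: "a : FA" "b : KA"
 show "x * (a * b) : FK"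
 using assms(2)
 proof
 assume "x : G.fbar kap ` arms"
 hence "x * a : FA" unfolding FA_def by (rule alg.mult[OF alg.base ab(1)[unfolded FA_def]])
 thus ?thesis using FK_base[of "x * a" b] ab by (simp add: mult.assoc)
 next
 assume "x : G.Kf ` L"
 then obtain \<nu> where \<nu>: "\<nu> : L" "x = G.Kf \<nu>" by blast
 obtain a' where a': "a' : FA" "x * a = a' * x" using K_FA[OF ab(1) \<nu>(1)] \<nu>(2) by blast
 have "x * b : KA"
 using ab(2) unfolding KA_def
 by (rule mult_span_left[rotated]) (use \<nu> L_ops(2) in \<open>auto simp: G.Kf_add[symmetric] intro!: calg.span_base\<close>)
 moreover have "x * (a * b) = a' * (x * b)" using a'(2) by (simp flip: mult.assoc)
 ultimately show ?thesis using FK_base[OF a'(1)] by simp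
 qed
qed

lemma E1_FK:
 assumes "x : E1" "s : FK"
 shows "x * s : calg.span {s * y | s y. s : FK & y : E1}" (is "_ : calg.span ?T")
proof (rule mult_span_left[OF _ assms(2)[unfolded FK_def]])
 fix s assume "s : {a * b | a b. a : FA & b : KA}"
 then obtain a b where ab: "a : FA" "b : KA" "s = a * b" by blast
 note xa = E1_FA[OF ab(1) assms(1), unfolded FE_def]
 have "x * a * b : calg.span ?T"
 proof (rule mult_span_right[OF _ xa])
 fix t assume "t : {a * x | a x. a : FA & x : E1}"
 then obtain a' x' where t: "a' : FA" "x' : E1" "t = a' * x'" by blast
 show "t * b : calg.span ?T"
 proof (rule mult_span_left[OF _ ab(2)[unfolded KA_def]])
 fix u assume "u : G.Kf ` L"
 then obtain \<nu> where \<nu>: "\<nu> : L" "u = G.Kf \<nu>" by blast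
 obtain c where c: "x' * u = c *. (u * x')" using E1_K[OF t(2) \<nu>(1)] \<nu>(2) by blast
 have "u : KA" unfolding KA_def using \<nu> by (intro calg.span_base) blast
 hence "(a' * u) * x' : calg.span ?T" using FK_base[OF t(1)] t(2) by (intro calg.span_base) blast
 moreover have "t * u = c *. ((a' * u) * x')" by (simp add: t(3) mult.assoc c scr)
 ultimately show "t * u : calg.span ?T" by (simp add: calg.span_scale)
 qed
 qed
 thus "x * s : calg.span ?T" unfolding ab(3) by (simp only: mult.assoc)
qed

lemma CV_gens:
 assumes "x : X" "v : CV"
 shows "x * v : CV"
 using assms(2) unfolding CV_def
proof (rule mult_span_left[rotated])
 fix z assume "z : {s * y | s y. s : FK & y : EA}"
 then obtain s y where s: "s : FK" "y : EA" "z = s * y" by blast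
 have "x * s * y : CV"
 proof (cases "x : G.fbar kap ` arms \<union> G.Kf ` L")
 case True
 thus ?thesis using CV_base[OF FK_gens[OF s(1) True] s(2)] by simp
 next
 case False
 hence "x : E1" using assms(1) by (auto simp: X_def E1_def)
 from E1_FK[OF this s(1)] show ?thesis unfolding CV_def
 proof (rule mult_span_right[rotated])
 fix t assume "t : {s * y | s y. s : FK & y : E1}"
 then obtain s' x' where t: "s' : FK" "x' : E1" "t = s' * x'" by blast
 have "x' * y : EA" using t(2) s(2) unfolding EA_def E1_def by (auto intro: alg.mult alg.base)
 thus "t * y : calg.span {s * y | s y. s : FK & y : EA}"
 using CV_base[OF t(1)] by (simp add: t(3) mult.assoc CV_def)
 qed
 qed
 thus "x * z : calg.span {s * y | s y. s : FK & y : EA}" by (simp add: s(3) mult.assoc CV_def)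
qed

text \<open>The inclusion from right to left is stability of the span under left multiplication by generators.\<close>
lemma CV_alg: "CV = alg X"
proof
 have KA: "KA <= alg X" unfolding KA_def by (rule calg.span_minimal[OF _ alg_subspace]) (auto simp: X_def intro!: alg.base)
 have FA: "FA <= alg X" and EA: "EA <= alg X" unfolding FA_def EA_def by (rule alg_mono; auto simp: X_def intro!: alg.base)+
 have "FK <= alg X" unfolding FK_def by (rule calg.span_minimal[OF _ alg_subspace]) (use KA FA in \<open>auto intro: alg.mult\<close>)
 thus "CV <= alg X" unfolding CV_def by (intro calg.span_minimal[OF _ alg_subspace]) (use EA in \<open>auto intro: alg.mult\<close>)
 have "1 : KA" unfolding KA_def using L_ops(1) by (intro calg.span_base image_eqI[of _ _ 0]) simp_all
 hence "1 * 1 : FK" by (intro FK_base) (simp_all add: FA_def alg.one)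
 hence "1 * 1 : CV" by (intro CV_base) (simp_all add: EA_def alg.one)
 have "v : alg X ==> ALL u:CV. v * u : CV" for v
 proof (induction rule: alg.induct)
 case (mult v w)
 thus ?case by (simp add: mult.assoc)
 next
 case (base x)
 thus ?case using CV_gens by blast
 qed (auto simp: distrib_right scl CV_def intro: calg.span_add calg.span_scale)
 thus "alg X <= CV" using \<open>1 * 1 : CV\<close> by fastforce
qed

definition "CU = prod_span A.U (prod_span A.U (char_shift n q (Uminus_op n q w) \<phi>m) (torus_alg n q L)) (char_shift n q (psi_Uplus n q w) \<phi>p)"

lemma shift_images: "m.sh ` G.froot ` arms = G.fbar kap ` arms" "p.sh ` G.Gr ` arms = G.ebar lam ` arms"
 unfolding image_image by (rule image_cong[OF refl], erule sh_m, rule image_cong[OF refl], erule sh_p)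

lemma CU_val: "CU <= carrier A.U" "A.val ` CU = alg X"
proof -
 note F = m.char_shift_val[unfolded shift_images, folded FA_def]
 note E = p.char_shift_val[unfolded shift_images, folded EA_def]
 note T = torus_alg_val[of L, folded KA_def]
 have sub: "calg.subspace FA" "calg.subspace EA" "calg.subspace KA" unfolding FA_def EA_def KA_def by (rule alg_subspace calg.subspace_span)+
 note 1 = prod_span_val[OF F(1) _ T(1), unfolded F(2) T(2), OF sub(1,3), folded FK_def]
 have "calg.subspace FK" unfolding FK_def by (rule calg.subspace_span)
 note 2 = prod_span_val[OF 1(1) _ E(1), unfolded 1(2) E(2), OF this sub(2), folded CV_def]
 show "CU <= carrier A.U" "A.val ` CU = alg X" using 2 by (simp_all add: CU_def CV_alg)
qed

lemma X_V: "X <= A.V"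
 unfolding X_def using arms_path bar_V K_V by blast

lemma coideal: "right_coideal_subalg n q CU"
proof -
 have sub: "calg.subspace (A.val ` CU)" unfolding CU_val(2) by (rule alg_subspace)
 have cX: "cop x : tspan (alg X)" if x: "x : X" for x
 proof -
 consider xs where "xs : arms" "x = G.ebar lam xs" | xs where "xs : arms" "x = G.fbar kap xs" | \<nu> where "\<nu> : L" "x = G.Kf \<nu>"
 using x by (auto simp: X_def)
 thus ?thesis
 proof cases
 case 1
 show ?thesis unfolding 1(2)
 by (rule cop_form_tspan[OF cop_root_forms(3)[OF arms_path(1,2)[OF 1(1)]] alg.one arms_path(2)[OF 1(1)]])
 (rule alg.base, unfold X_def, intro UnI1 imageI arms_take 1(1))
 next
 case 2
 show ?thesis unfolding 2(2)
 by (rule cop_form_tspan[OF cop_root_forms(4)[OF arms_path(1,2)[OF 2(1)]] alg.one arms_path(2)[OF 2(1)]])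
 (rule alg.base, unfold X_def, rule UnI1, intro UnI2 imageI arms_take 2(1))
 next
 case 3
 have "cop x = lift f1 (G.Kf \<nu>) * lift f2 (G.Kf \<nu>)"
 unfolding 3(2) by (simp add: lift_K[OF P.h.qgroup_axioms] lift_K[OF qgroup_f1] lift_K[OF qgroup_f2] P.kword_DD)
 moreover have "G.Kf \<nu> : alg X" using 3(1) by (intro alg.base) (auto simp: X_def)
 ultimately show ?thesis using tspan_base[OF _ K_V] by simp
 qed
 qed
 have "coproduct n q c : tens_span n q CU (carrier (Uq n q))" if c: "c : CU" for c
 proof -
 have cU: "c : carrier A.U" using CU_val(1) c by blast
 note cv = coproduct_val[OF cU]
 have "A.val c : alg X" using CU_val(2) c by blast
 hence "B.val (coproduct n q c) : tspan (A.val ` CU)" unfolding conjunct2[OF cv] CU_val(2)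
 by (intro cop_alg[OF X_V cX])
 then obtain Q where "finite Q" "Q <= CU \<times> carrier A.U" "coproduct n q c = (\<Oplus>\<^bsub>B.U\<^esub>p\<in>Q. tens n q (fst p) (snd p))"
 by (rule tens_pairs[OF CU_val(1) sub conjunct1[OF cv]])
 thus ?thesis unfolding tens_span_def Uq2_alt Uq_alt by blast
 qed
 moreover have "subalg A.U CU" unfolding A.subalg_iff[OF CU_val(1)] CU_val(2) by (auto intro: alg.intros)
 ultimately show ?thesis by (simp add: right_coideal_subalg_def Uq_alt)
qed

lemma arms_relations:
 assumes "xs : arms" "ys : arms"
 shows "EX c. G.ebar lam xs * G.ebar lam ys = c *. (G.ebar lam ys * G.ebar lam xs)"
 "EX c. G.fbar kap xs * G.fbar kap ys = c *. (G.fbar kap ys * G.fbar kap xs)"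
 "xs ~= ys ==> EX c. c ~= 0 & G.ebar lam xs * G.fbar kap ys = c *. (G.fbar kap ys * G.ebar lam xs)"
proof -
 obtain j j' where j: "j <= l + k" "xs = ch j" "j' <= l + k" "ys = ch j'" using assms by (auto simp: arms_def)
 have inv: "EX c. u = c *. v" if "v = c *. u" "c ~= 0" for u v :: "letter list lend" and c
 using that by (intro exI[of _ "inverse c"]) (simp add: scc sc1)
 have nz: "q powi t ~= 0" for t using q0 by simp
 consider "j < j'" | "j = j'" | "j' < j" by linarith
 hence "(EX c. e j * e j' = c *. (e j' * e j)) & (EX c. f j * f j' = c *. (f j' * f j)) &
 (j ~= j' \<longrightarrow> (EX c. c ~= 0 & e j * f j' = c *. (f j' * e j)))"
 proof cases
 case 1
 note r = bar_relations[OF j(1,3) 1]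
 show ?thesis using r(1,3) inv[OF r(2) nz] nz by blast
 next
 case 2
 thus ?thesis using sc1 by metis
 next
 case 3
 note r = bar_relations[OF j(3,1) 3]
 show ?thesis using r(2,4) inv[OF r(1) nz] nz by blast
 qed
 thus "EX c. G.ebar lam xs * G.ebar lam ys = c *. (G.ebar lam ys * G.ebar lam xs)"
 "EX c. G.fbar kap xs * G.fbar kap ys = c *. (G.fbar kap ys * G.fbar kap xs)"
 "xs ~= ys ==> EX c. c ~= 0 & G.ebar lam xs * G.fbar kap ys = c *. (G.fbar kap ys * G.ebar lam xs)"
 unfolding j(2,4) by auto
qed

lemma relations_i:
 assumes "y : arms" "y ~= [i]"
 shows "G.ebar lam [i] * G.ebar lam y = q *. (G.ebar lam y * G.ebar lam [i])" "G.fbar kap y * G.fbar kap [i] = q *. (G.fbar kap [i] * G.fbar kap y)"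
 "G.ebar lam [i] * G.fbar kap y = q *. (G.fbar kap y * G.ebar lam [i])" "G.ebar lam y * G.fbar kap [i] = q *. (G.fbar kap [i] * G.ebar lam y)"
proof -
 obtain j where j: "j <= l + k" "y = ch j" using assms by (auto simp: arms_def)
 have j0: "0 < j" using assms(2) j(2) ch_0 by (cases j) auto
 have y: "y = [i] @ tl y" "tl y ~= []" using arms_hd[OF assms(1)] assms(2) by (cases y; auto)+
 have "path n ([i] @ tl y)" using arms_path(1)[OF assms(1)] by (simp only: y(1)[symmetric])
 hence "root_form n (rsum [i]) (rsum ([i] @ tl y)) = 1" using y(2) by (intro rsum_form_prefix) simp_all
 hence "q powi root_form n (rsum (ch 0)) (rsum (ch j)) = q" by (simp only: ch_0 y(1)[symmetric] j(2)[symmetric] power_int_1_right)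
 thus "G.ebar lam [i] * G.ebar lam y = q *. (G.ebar lam y * G.ebar lam [i])" "G.fbar kap y * G.fbar kap [i] = q *. (G.fbar kap [i] * G.fbar kap y)"
 "G.ebar lam [i] * G.fbar kap y = q *. (G.fbar kap y * G.ebar lam [i])" "G.ebar lam y * G.fbar kap [i] = q *. (G.fbar kap [i] * G.ebar lam y)"
 using bar_relations[OF le0 j(1) j0] by (simp_all only: ch_0 j(2))
qed

lemma basic: "basic_alg A.U CU"
 unfolding basic_alg_def
proof (intro allI impI)
 fix d \<rho> assume "irreducible_rep A.U CU d \<rho>"
 hence hom: "\<rho> : Ring.ring_hom (A.U\<lparr>carrier := CU\<rparr>) (ring_mat TYPE(complex) d ())"
 and sm: "!!c Y. Y : CU ==> \<rho> (c \<odot>\<^bsub>A.U\<^esub> Y) = c \<cdot>\<^sub>m \<rho> Y" and d: "d ~= 0"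
 and irr: "!!W. linear_subspace d W ==> (!!Y v. Y : CU ==> v : W ==> \<rho> Y *\<^sub>v v : W) ==> W = {0\<^sub>v d} \<or> W = carrier_vec d"
 unfolding irreducible_rep_def representation_def by blast+
 have h: "\<rho> Y : carrier_mat d d" "\<rho> (Y \<otimes>\<^bsub>A.U\<^esub> Z) = \<rho> Y * \<rho> Z" "\<rho> (Y \<oplus>\<^bsub>A.U\<^esub> Z) = \<rho> Y + \<rho> Z" "\<rho> \<one>\<^bsub>A.U\<^esub> = 1\<^sub>m d"
 if "Y : CU" "Z : CU" for Y Z
 using hom that unfolding Ring.ring_hom_def by (auto simp: ring_mat_def)
 define act where "act v u = \<rho> (A.unval v) *\<^sub>v u" for v u
 have XV: "v : A.V" if "v : alg X" for v using A.alg_V[OF X_V] that by blast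
 have un: "A.unval v : CU" if "v : alg X" for v
 proof -
 obtain Y where Y: "Y : CU" "v = A.val Y" using \<open>v : alg X\<close> CU_val(2) by blast
 thus ?thesis using A.unval_val[of Y] CU_val(1) by auto
 qed
 have aadd: "act (v + w) u = act v u + act w u" if "v : alg X" "w : alg X" "u : carrier_vec d" for v w u
 unfolding act_def m.unval_ops(1)[OF XV[OF that(1)] XV[OF that(2)]] h(3)[OF un[OF that(1)] un[OF that(2)]]
 by (rule add_mult_distrib_mat_vec[OF h(1) h(1)]) (use un that in auto)
 have amult: "act (v * w) u = act v (act w u)" if "v : alg X" "w : alg X" "u : carrier_vec d" for v w u
 unfolding act_def m.unval_ops(2)[OF XV[OF that(1)] XV[OF that(2)]] h(2)[OF un[OF that(1)] un[OF that(2)]]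
 by (rule assoc_mult_mat_vec[OF h(1) h(1)]) (use un that in auto)
 have ascale: "act (c *. v) u = c \<cdot>\<^sub>v act v u" if "v : alg X" "u : carrier_vec d" for c v u
 unfolding act_def m.unval_ops(3)[OF XV[OF that(1)] XV[OF that(1)]] sm[OF un[OF that(1)]]
 by (rule smult_mat_vec[OF h(1)]) (use un that in auto)
 have aone: "act 1 u = u" if "u : carrier_vec d" for u
 unfolding act_def m.unval_ops(4)[OF A.V_1 A.V_1] h(4)[OF un[OF alg.one] un[OF alg.one]] using that by simp
 interpret I: irreducible_action X d act
 proof
 show "d ~= 0" by (rule d)
 show "EX A. A : carrier_mat d d & (ALL u:carrier_vec d. act v u = A *\<^sub>v u)" if "v : alg X" for v
 using h(1)[OF un[OF that] un[OF that]] unfolding act_def by blast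
 show "act (v + w) u = act v u + act w u" if "v : alg X" "w : alg X" "u : carrier_vec d" for v w u by (rule aadd[OF that])
 show "act (v * w) u = act v (act w u)" if "v : alg X" "w : alg X" "u : carrier_vec d" for v w u by (rule amult[OF that])
 show "act (c *. v) u = c \<cdot>\<^sub>v act v u" if "v : alg X" "u : carrier_vec d" for c v u by (rule ascale[OF that])
 show "act 1 u = u" if "u : carrier_vec d" for u by (rule aone[OF that])
 fix W assume W: "linear_subspace d W" "!!x u. x : X ==> u : W ==> act x u : W"
 have "\<rho> Y *\<^sub>v v : W" if Y: "Y : CU" and v: "v : W" for Y v
 proof -
 have WD: "u : carrier_vec d" if "u : W" for u using W(1) that by (auto simp: linear_subspace_def)
 have "x : alg X ==> ALL u:W. act x u : W" for x
 proof (induction rule: alg.induct)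
 case (add x y)
 thus ?case using W(1) by (simp add: aadd WD linear_subspace_def)
 next
 case (mult x y)
 thus ?case by (simp add: amult WD)
 next
 case (scale x c)
 thus ?case using W(1) by (simp add: ascale WD linear_subspace_def)
 next
 case one
 show ?case by (simp add: aone WD)
 qed (use W(2) in blast)
 moreover have "A.val Y : alg X" using Y CU_val(2) by blast
 ultimately have "act (A.val Y) v : W" using v by blast
 thus ?thesis unfolding act_def using A.unval_val[of Y] CU_val(1) Y by auto
 qed
 thus "W = {0\<^sub>v d} \<or> W = carrier_vec d" by (rule irr[OF W(1)])
 qed
 have sc: "EX c. v = c *. u" if "u = c *. v" "c ~= 0" for u v :: "letter list lend" and c
 using that by (intro exI[of _ "inverse c"]) (simp add: scc sc1)
 have q1: "q - inverse q ~= 0"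
 proof
 assume "q - inverse q = 0"
 hence "q ^ 2 = 1" using q0 by (simp add: power2_eq_square field_simps)
 thus False using nroot[of 2] by simp
 qed
 have diag: "EX x:arms. length x < length y & G.ebar lam y * G.fbar kap y = (q * q) *. (G.fbar kap y * G.ebar lam y) +
 (- q) *. (G.ebar lam x * G.fbar kap x - G.fbar kap x * G.ebar lam x)" if y: "y : arms" "y ~= [i]" for y
 proof -
 obtain j where j: "j <= l + k" "y = ch j" using y by (auto simp: arms_def)
 have "j ~= 0" using y(2) j(2) ch_0 by (cases j) auto
 obtain j' m where j': "j' <= l + k" "length (ch j') < length (ch j)"
 "e j * f j = (q * q) *. (f j * e j) + (- q) *. (e j' * f j' - f j' * e j')"
 by (rule bar_diagonal[OF j(1) \<open>j ~= 0\<close>])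
 thus ?thesis unfolding j(2) by (intro bexI[of _ "ch j'"]) (auto simp: arms_def)
 qed
 have tw_T: "EX c. x * t = c *. (t * x)" if "tw t c x" "c ~= 0" for t x :: "letter list lend" and c
 using twD[OF tw_flip[OF that]] by blast
 have ci: "tw (G.Kf \<nu>) 1 (G.ebar lam [i])" "tw (G.Kf \<nu>) 1 (G.fbar kap [i])" if "\<nu> : L" for \<nu>
 using K_bar[OF that single_chain] that by (simp_all add: L_def)
 show "d = 1"
 proof (rule I.one_dimensional[where E = "G.ebar lam" and F = "G.fbar kap" and I = arms and T = "G.Kf ` L" and b = "[i]"
 and ?c0.0 = "q * q / (q - inverse q)", OF X_def single_chain q0 nroot])
 show "G.ebar lam [i] * G.fbar kap [i] = (q * q) *. (G.fbar kap [i] * G.ebar lam [i]) + (q * q / (q - inverse q)) *. 1"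
 using bar_i by (simp only: ch_0)
 show "G.ebar lam y * G.ebar lam [i] = inverse q *. (G.ebar lam [i] * G.ebar lam y)" if "y : arms" "y ~= [i]" for y
 unfolding relations_i(1)[OF that] using q0 by (simp add: scc sc1)
 show "G.fbar kap y * G.fbar kap [i] = q *. (G.fbar kap [i] * G.fbar kap y)" if "y : arms" "y ~= [i]" for y
 by (rule relations_i(2)[OF that])
 show "(G.ebar lam [i] * G.fbar kap [i] - G.fbar kap [i] * G.ebar lam [i]) * G.ebar lam y =
 G.ebar lam y * (G.ebar lam [i] * G.fbar kap [i] - G.fbar kap [i] * G.ebar lam [i])" if "y : arms" "y ~= [i]" for y
 by (rule commutator_commutes[OF q0 relations_i(1)[OF that] relations_i(4)[OF that]])
 show "(G.ebar lam [i] * G.fbar kap [i] - G.fbar kap [i] * G.ebar lam [i]) * G.fbar kap y =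
 G.fbar kap y * (G.ebar lam [i] * G.fbar kap [i] - G.fbar kap [i] * G.ebar lam [i])" if "y : arms" "y ~= [i]" for y
 by (rule commutator_commutes[OF q0 relations_i(3)[OF that] relations_i(2)[OF that]])
 show "EX c. G.fbar kap y * G.ebar lam x = c *. (G.ebar lam x * G.fbar kap y)" if xy: "x : arms" "y : arms" "x ~= y" for x y
 proof -
 obtain c where "c ~= 0" "G.ebar lam x * G.fbar kap y = c *. (G.fbar kap y * G.ebar lam x)" using arms_relations(3)[OF xy] by blast
 thus ?thesis using sc by blast
 qed
 show "EX c. G.ebar lam x * t = c *. (t * G.ebar lam x)" if "t : G.Kf ` L" "x : arms" for t x
 using that(1) tw_T[OF K_bar(1)[OF _ that(2)]] q0 by auto
 show "EX c. G.fbar kap x * t = c *. (t * G.fbar kap x)" if "t : G.Kf ` L" "x : arms" for t x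
 using that(1) tw_T[OF K_bar(2)[OF _ that(2)]] q0 by auto
 show "G.ebar lam [i] * t = t * G.ebar lam [i]" "G.fbar kap [i] * t = t * G.fbar kap [i]" if "t : G.Kf ` L" for t
 using that ci by (auto simp: tw_def sc1)
 show "t * t' = t' * t" if "t : G.Kf ` L" "t' : G.Kf ` L" for t t' using that G.Kf_comm by auto
 show "q * q / (q - inverse q) ~= 0" using q0 q1 by simp
 show "EX c. G.ebar lam x * G.ebar lam y = c *. (G.ebar lam y * G.ebar lam x)" if "x : arms" "y : arms" for x y
 by (rule arms_relations(1)[OF that])
 show "EX c. G.fbar kap x * G.fbar kap y = c *. (G.fbar kap y * G.fbar kap x)" if "x : arms" "y : arms" for x y
 by (rule arms_relations(2)[OF that])
 show "EX c. G.ebar lam x * G.fbar kap y = c *. (G.fbar kap y * G.ebar lam x)" if "x : arms" "y : arms" "x ~= y" for x y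
 using arms_relations(3)[OF that] by blast
 qed (assumption, rule diag)
qed

end

section \<open>The relations in the quantum group\<close>

lemma root_sum_rsum_step:
 assumes "rsum (xs @ [m]) = \<mu>" shows "rsum xs = \<mu> - simple_root m"
 unfolding assms[symmetric] by simp

lemma height_rsum: "set xs <= {1..n} ==> (\<Sum>a\<in>{1..n}. rsum xs a) = int (length xs)"
proof (induction xs)
 case (Cons b xs)
 have "(\<Sum>a\<in>{1..n}. simple_root b a) = 1" using Cons.prems by (simp add: simple_root_def)
 thus ?case using Cons by (simp add: sum.distrib)
qed simp

context vee_characters begin

lemma qcomm_eqI:
 assumes "Y : carrier A.U" "Z : carrier A.U" "R : carrier A.U" "A.val Y * A.val Z = c *. (A.val Z * A.val Y) + A.val R"
 shows "qcomm A.U Y Z c = R"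
proof -
 have "A.val (qcomm A.U Y Z c) = A.val R" using A.val_qcomm[OF assms(1,2), of c] assms(4) by (simp add: qc_def)
 thus ?thesis using A.val_inj A.val_qcomm[OF assms(1,2)] assms(3) by blast
qed

lemma qcomm_zeroI:
 assumes "Y : carrier A.U" "Z : carrier A.U" "A.val Y * A.val Z = c *. (A.val Z * A.val Y)"
 shows "qcomm A.U Y Z c = \<zero>\<^bsub>A.U\<^esub>"
proof -
 interpret R: ring A.U by (rule A.ring_U)
 show ?thesis by (rule qcomm_eqI) (use assms in \<open>simp_all add: A.val_zero\<close>)
qed

lemma last_ch: "1 <= r ==> r <= l ==> ch r = xs @ [m] ==> m = i + r"
 "1 <= s ==> s <= k ==> ch (l + s) = xs @ [m] ==> m = i - s"
proof -
 assume "r <= l" "ch r = xs @ [m]"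
 hence "last [i..<Suc (i + r)] = m" by (simp add: chain_def del: upt_Suc)
 thus "m = i + r" by simp
next
 assume "1 <= s" "ch (l + s) = xs @ [m]"
 hence "rev [i - s..<Suc i] = xs @ [m]" by (simp add: chain_def del: upt_Suc)
 hence "[i - s..<Suc i] = m # rev xs" by (simp add: rev_eq_Cons_iff[symmetric] rev_swap del: upt_Suc)
 hence "hd [i - s..<Suc i] = m" by simp
 thus "m = i - s" by (simp add: hd_upt del: upt_Suc)
qed

text \<open>The normalisation changes the factor \<open>-q\<close> into its square because the height of the shorter root is smaller by one.\<close>
lemma diagonal_relation:
 assumes j: "j <= l + k" "j ~= 0" and m: "!!xs m'. ch j = xs @ [m'] ==> m' = m"
 defines "\<mu> \<equiv> rsum (ch j)"
 shows "qcomm A.U (barE n q w \<phi>p \<mu>) (barF n q w \<phi>m \<mu>) (q powi root_form n \<mu> \<mu>) =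
 (- q) \<odot>\<^bsub>A.U\<^esub> qcomm A.U (barE n q w \<phi>p (\<mu> - simple_root m)) (barF n q w \<phi>m (\<mu> - simple_root m)) 1"
 "qcomm A.U (barE n q w \<phi>p \<mu>) (barF_norm n q w \<phi>m \<mu>) (q powi root_form n \<mu> \<mu>) =
 q\<^sup>2 \<odot>\<^bsub>A.U\<^esub> qcomm A.U (barE n q w \<phi>p (\<mu> - simple_root m)) (barF_norm n q w \<phi>m (\<mu> - simple_root m)) 1"
proof -
 obtain j' m' where j': "j' <= l + k" "ch j = ch j' @ [m']" "length (ch j') < length (ch j)"
 "e j * f j = (q * q) *. (f j * e j) + (- q) *. (e j' * f j' - f j' * e j')"
 by (rule bar_diagonal[OF j])
 have \<mu>': "\<mu> - simple_root m = rsum (ch j')"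
 using root_sum_rsum_step[of "ch j'" m' \<mu>] m[OF j'(2)] by (simp only: \<mu>_def j'(2))
 have a: "ch j : arms" "ch j' : arms" using j(1) j'(1) by (simp_all add: arms_def)
 have c: "q powi root_form n \<mu> \<mu> = q * q"
 unfolding \<mu>_def rsum_form_self[OF arms_path(1,2)[OF a(1)]] by (simp add: power2_eq_square)
 note E = barE_val[OF j(1)] barE_val[OF j'(1)] and F = barF_val[OF j(1)] barF_val[OF j'(1)]
 note E1 = E[THEN conjunct1] and E2 = E[THEN conjunct2] and F1 = F[THEN conjunct1] and F2 = F[THEN conjunct2]
 note qc' = A.val_qcomm[OF E1(2) F1(2), of 1]
 show "qcomm A.U (barE n q w \<phi>p \<mu>) (barF n q w \<phi>m \<mu>) (q powi root_form n \<mu> \<mu>) =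
 (- q) \<odot>\<^bsub>A.U\<^esub> qcomm A.U (barE n q w \<phi>p (\<mu> - simple_root m)) (barF n q w \<phi>m (\<mu> - simple_root m)) 1"
 unfolding c \<mu>' unfolding \<mu>_def
 proof (rule qcomm_eqI[OF E1(1) F1(1) A.smult_closed[OF conjunct1[OF qc']]])
 show "A.val (barE n q w \<phi>p (rsum (ch j))) * A.val (barF n q w \<phi>m (rsum (ch j))) =
 (q * q) *. (A.val (barF n q w \<phi>m (rsum (ch j))) * A.val (barE n q w \<phi>p (rsum (ch j)))) +
 A.val ((- q) \<odot>\<^bsub>A.U\<^esub> qcomm A.U (barE n q w \<phi>p (rsum (ch j'))) (barF n q w \<phi>m (rsum (ch j'))) 1)"
 unfolding A.val_smult[OF conjunct1[OF qc']] conjunct2[OF qc'] E2 F2 qc_def sc1 by (rule j'(4))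
 qed
 have ht: "nat ((\<Sum>a\<in>{1..n}. rsum (ch t) a) - 1) = length (ch t) - 1" if "ch t : arms" for t
 using height_rsum[OF arms_path(3)[OF that]] by simp
 have len: "length (ch j) - 1 = Suc (length (ch j') - 1)"
 using arms_path(2)[OF a(2)] unfolding j'(2) by (cases "ch j'") auto
 define t where "t = (- q) ^ (length (ch j') - 1)"
 have N: "barF_norm n q w \<phi>m (rsum (ch j)) = (- q * t) \<odot>\<^bsub>A.U\<^esub> barF n q w \<phi>m (rsum (ch j))"
 "barF_norm n q w \<phi>m (rsum (ch j')) = t \<odot>\<^bsub>A.U\<^esub> barF n q w \<phi>m (rsum (ch j'))"
 unfolding barF_norm_def ht[OF a(1)] ht[OF a(2)] len t_def Uq_alt by simp_all
 note N1 = A.smult_closed[OF F1(1), of "- q * t"] A.smult_closed[OF F1(2), of t]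
 note qn = A.val_qcomm[OF E1(2) N1(2), of 1]
 show "qcomm A.U (barE n q w \<phi>p \<mu>) (barF_norm n q w \<phi>m \<mu>) (q powi root_form n \<mu> \<mu>) =
 q\<^sup>2 \<odot>\<^bsub>A.U\<^esub> qcomm A.U (barE n q w \<phi>p (\<mu> - simple_root m)) (barF_norm n q w \<phi>m (\<mu> - simple_root m)) 1"
 unfolding c \<mu>' unfolding \<mu>_def N
 proof (rule qcomm_eqI[OF E1(1) N1(1) A.smult_closed[OF conjunct1[OF qn]]])
 have "e j * ((- q * t) *. f j) = (- q * t) *. ((q * q) *. (f j * e j) + (- q) *. (e j' * f j' - f j' * e j'))"
 unfolding scr j'(4) ..
 also have "... = (q * q) *. (((- q * t) *. f j) * e j) + q\<^sup>2 *. (e j' * (t *. f j') - (t *. f j') * e j')"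
 by (simp add: scl scr scc sc_add_r calg.scale_right_diff_distrib
 power2_eq_square mult_ac calg.scale_minus_left)
 finally show "A.val (barE n q w \<phi>p (rsum (ch j))) * A.val ((- q * t) \<odot>\<^bsub>A.U\<^esub> barF n q w \<phi>m (rsum (ch j))) =
 (q * q) *. (A.val ((- q * t) \<odot>\<^bsub>A.U\<^esub> barF n q w \<phi>m (rsum (ch j))) * A.val (barE n q w \<phi>p (rsum (ch j)))) +
 A.val (q\<^sup>2 \<odot>\<^bsub>A.U\<^esub> qcomm A.U (barE n q w \<phi>p (rsum (ch j'))) (t \<odot>\<^bsub>A.U\<^esub> barF n q w \<phi>m (rsum (ch j'))) 1)"
 unfolding A.val_smult[OF conjunct1[OF qn]] conjunct2[OF qn] A.val_smult[OF F1(1)] A.val_smult[OF F1(2)] E2 F2 qc_def sc1 .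
 qed
qed

lemma commutation_relations:
 assumes j: "j <= l + k" "j' <= l + k"
 defines "\<mu> \<equiv> rsum (ch j)" and "\<nu> \<equiv> rsum (ch j')"
 shows "j < j' ==> qcomm A.U (barE n q w \<phi>p \<mu>) (barE n q w \<phi>p \<nu>) (q powi root_form n \<mu> \<nu>) = \<zero>\<^bsub>A.U\<^esub>"
 "j' < j ==> qcomm A.U (barF n q w \<phi>m \<mu>) (barF n q w \<phi>m \<nu>) (q powi root_form n \<mu> \<nu>) = \<zero>\<^bsub>A.U\<^esub>"
 "j ~= j' ==> qcomm A.U (barE n q w \<phi>p \<mu>) (barF n q w \<phi>m \<nu>) (q powi root_form n \<mu> \<nu>) = \<zero>\<^bsub>A.U\<^esub>"
proof -
 note E = barE_val[OF j(1)] barE_val[OF j(2)] and F = barF_val[OF j(1)] barF_val[OF j(2)]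
 note E1 = E[THEN conjunct1] and E2 = E[THEN conjunct2] and F1 = F[THEN conjunct1] and F2 = F[THEN conjunct2]
 have sym: "root_form n \<mu> \<nu> = root_form n \<nu> \<mu>" by (rule root_form_sym)
 show "qcomm A.U (barE n q w \<phi>p \<mu>) (barE n q w \<phi>p \<nu>) (q powi root_form n \<mu> \<nu>) = \<zero>\<^bsub>A.U\<^esub>" if "j < j'"
 unfolding \<mu>_def \<nu>_def by (rule qcomm_zeroI[OF E1(1,2)], unfold E2, rule bar_relations(1)[OF j that])
 show "qcomm A.U (barF n q w \<phi>m \<mu>) (barF n q w \<phi>m \<nu>) (q powi root_form n \<mu> \<nu>) = \<zero>\<^bsub>A.U\<^esub>" if "j' < j"
 unfolding sym unfolding \<mu>_def \<nu>_def by (rule qcomm_zeroI[OF F1(1,2)], unfold F2, rule bar_relations(2)[OF j(2,1) that])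
 show "qcomm A.U (barE n q w \<phi>p \<mu>) (barF n q w \<phi>m \<nu>) (q powi root_form n \<mu> \<nu>) = \<zero>\<^bsub>A.U\<^esub>" if ne: "j ~= j'"
 proof (cases "j < j'")
 case True
 show ?thesis unfolding \<mu>_def \<nu>_def by (rule qcomm_zeroI[OF E1(1) F1(2)], unfold E2 F2, rule bar_relations(3)[OF j True])
 next
 case False
 hence "j' < j" using ne by simp
 thus ?thesis unfolding sym unfolding \<mu>_def \<nu>_def
 by (intro qcomm_zeroI[OF E1(1) F1(2)], unfold E2 F2, intro bar_relations(4)[OF j(2,1)])
 qed
qed

end

theorem lemma4p7:
  fixes q :: complex and n i l k :: nat and \<phi>p \<phi>m :: "free set \<Rightarrow> complex"
  defines "U \<equiv> Uq n q"
    and "w \<equiv> vee i l k"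
    and "L \<equiv> {\<mu> \<in> root_lattice n. root_form n \<mu> (simple_root i) = 0}"
  defines "\<Phi> \<equiv> inversions n w"
    and "Ebar \<equiv> barE n q w \<phi>p"
    and "Fbar \<equiv> barF n q w \<phi>m"
    and "Fnorm \<equiv> barF_norm n q w \<phi>m"
    and "C \<equiv> prod_span U (prod_span U (char_shift n q (Uminus_op n q w) \<phi>m) (torus_alg n q L))
                (char_shift n q (psi_Uplus n q w) \<phi>p)"
  assumes "q \<noteq> 0" and "\<And>m. m > 0 \<Longrightarrow> q ^ m \<noteq> 1"
    and "1 \<le> i" "i \<le> n" "l \<le> n - i" "k \<le> i - 1"
    and "character U (psi_Uplus n q w) \<phi>p"
    and "character U (Uminus_op n q w) \<phi>m"
    and "supp_plus n q w \<phi>p = {simple_root i}"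
    and "supp_minus n q w \<phi>m = {simple_root i}"
    and "\<phi>p (UqE n q i \<otimes>\<^bsub>U\<^esub> UqK n q (- simple_root i)) * \<phi>m (UqF n q i) =
           q\<^sup>2 / ((q - inverse q) * (1 - q\<^sup>2))"
  shows "(\<Phi> = {root_sum i (i + r) | r. r \<le> l} \<union> {root_sum (i - s) i | s. s \<le> k}) \<and>
     (right_coideal_subalg n q C) \<and>
     (basic_alg U C) \<and>
     (qcomm U (Ebar (simple_root i)) (Fbar (simple_root i))
           (q powi root_form n (simple_root i) (simple_root i)) =
         (q\<^sup>2 / (q - inverse q)) \<odot>\<^bsub>U\<^esub> \<one>\<^bsub>U\<^esub>) \<and>
     (\<forall>\<mu>\<in>\<Phi>. \<forall>\<nu>\<in>\<Phi>. root_index n w \<mu> < root_index n w \<nu> \<longrightarrow>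
           qcomm U (Ebar \<mu>) (Ebar \<nu>) (q powi root_form n \<mu> \<nu>) = \<zero>\<^bsub>U\<^esub>) \<and>
     (\<forall>\<mu>\<in>\<Phi>. \<forall>\<nu>\<in>\<Phi>. root_index n w \<nu> < root_index n w \<mu> \<longrightarrow>
           qcomm U (Fbar \<mu>) (Fbar \<nu>) (q powi root_form n \<mu> \<nu>) = \<zero>\<^bsub>U\<^esub>) \<and>
     (\<forall>\<mu>\<in>\<Phi>. \<forall>\<nu>\<in>\<Phi>. \<mu> \<noteq> \<nu> \<longrightarrow>
           qcomm U (Ebar \<mu>) (Fbar \<nu>) (q powi root_form n \<mu> \<nu>) = \<zero>\<^bsub>U\<^esub>) \<and>
     (\<forall>\<mu>\<in>\<Phi>. \<forall>\<mu>'.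
           (\<exists>r\<in>{1..l}. \<mu> = root_sum i (i + r) \<and> \<mu>' = \<mu> - simple_root (i + r)) \<or>
           (\<exists>s\<in>{1..k}. \<mu> = root_sum (i - s) i \<and> \<mu>' = \<mu> - simple_root (i - s)) \<longrightarrow>
           qcomm U (Ebar \<mu>) (Fbar \<mu>) (q powi root_form n \<mu> \<mu>) =
             (- q) \<odot>\<^bsub>U\<^esub> qcomm U (Ebar \<mu>') (Fbar \<mu>') 1 \<and>
           qcomm U (Ebar \<mu>) (Fnorm \<mu>) (q powi root_form n \<mu> \<mu>) =
             q\<^sup>2 \<odot>\<^bsub>U\<^esub> qcomm U (Ebar \<mu>') (Fnorm \<mu>') 1)"
proof -
 interpret Q: uq n q by (rule uq.intro) (use assms in auto)
 have U: "U = Q.A.U" by (simp add: U_def Q.Uq_alt)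
 interpret V: vee_characters n q i l k \<phi>p \<phi>m
 proof (intro vee_characters.intro uq_vee.intro vee_data.intro Q.uq_axioms vee_characters_axioms.intro)
 show "1 <= i" "i <= n" "l <= n - i" "k <= i - 1" by fact+
 show "character Q.A.U (psi_Uplus n q (vee i l k)) \<phi>p" "character Q.A.U (Uminus_op n q (vee i l k)) \<phi>m"
 "supp_plus n q (vee i l k) \<phi>p = {simple_root i}" "supp_minus n q (vee i l k) \<phi>m = {simple_root i}"
 "\<phi>p (UqE n q i \<otimes>\<^bsub>Q.A.U\<^esub> UqK n q (- simple_root i)) * \<phi>m (UqF n q i) = q\<^sup>2 / ((q - inverse q) * (1 - q\<^sup>2))"
 using assms(15-19) unfolding U w_def by simp_all
 qed
 note wv = w_def
 have \<Phi>: "\<Phi> = (%j. rsum (V.ch j)) ` {..l + k}" unfolding \<Phi>_def w_def by (rule V.inversions_ch)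
 have index: "root_index n w (rsum (V.ch j)) = j" if "j <= l + k" for j unfolding w_def by (rule V.root_index_ch[OF that])
 have C: "C = V.CU" unfolding C_def V.CU_def U w_def L_def V.L_def ..
 note defs = Ebar_def Fbar_def Fnorm_def U w_def
 have 1: "\<Phi> = {root_sum i (i + r) | r. r <= l} \<union> {root_sum (i - s) i | s. s <= k}"
 unfolding \<Phi>_def w_def by (rule inversions_vee) fact+
 have 2: "right_coideal_subalg n q C" unfolding C by (rule V.coideal)
 have 3: "basic_alg U C" unfolding C U by (rule V.basic)
 have i0: "simple_root i = rsum (V.ch 0)" by (simp add: V.ch_0)
 have 4: "qcomm U (Ebar (simple_root i)) (Fbar (simple_root i)) (q powi root_form n (simple_root i) (simple_root i)) =
 (q\<^sup>2 / (q - inverse q)) \<odot>\<^bsub>U\<^esub> \<one>\<^bsub>U\<^esub>"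
 proof -
 interpret R: ring Q.A.U by (rule Q.A.ring_U)
 note E = V.barE_val[OF le0] and F = V.barF_val[OF le0]
 have c: "q powi root_form n (simple_root i) (simple_root i) = q * q"
 using root_form_simple[of i n i] V.i by (simp add: cartan_def power2_eq_square)
 show ?thesis
 unfolding c defs unfolding i0
 by (rule V.qcomm_eqI[OF conjunct1[OF E] conjunct1[OF F] Q.A.smult_closed[OF R.one_closed]])
 (use V.bar_i in \<open>simp only: conjunct2[OF E] conjunct2[OF F] Q.A.val_smult[OF R.one_closed] Q.A.val_one power2_eq_square\<close>)
 qed
 have 5: "ALL \<mu>:\<Phi>. ALL \<nu>:\<Phi>. root_index n w \<mu> < root_index n w \<nu> \<longrightarrow>
 qcomm U (Ebar \<mu>) (Ebar \<nu>) (q powi root_form n \<mu> \<nu>) = \<zero>\<^bsub>U\<^esub>"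
 unfolding \<Phi> using V.commutation_relations(1) by (auto simp: index defs[symmetric])
 have 6: "ALL \<mu>:\<Phi>. ALL \<nu>:\<Phi>. root_index n w \<nu> < root_index n w \<mu> \<longrightarrow>
 qcomm U (Fbar \<mu>) (Fbar \<nu>) (q powi root_form n \<mu> \<nu>) = \<zero>\<^bsub>U\<^esub>"
 unfolding \<Phi> using V.commutation_relations(2) by (auto simp: index defs[symmetric])
 have 7: "ALL \<mu>:\<Phi>. ALL \<nu>:\<Phi>. \<mu> ~= \<nu> \<longrightarrow>
 qcomm U (Ebar \<mu>) (Fbar \<nu>) (q powi root_form n \<mu> \<nu>) = \<zero>\<^bsub>U\<^esub>"
 proof (intro ballI impI)
 fix \<mu> \<nu> assume "\<mu> : \<Phi>" "\<nu> : \<Phi>" "\<mu> ~= \<nu>"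
 then obtain j j' where j: "j <= l + k" "j' <= l + k" "j ~= j'" "\<mu> = rsum (V.ch j)" "\<nu> = rsum (V.ch j')" unfolding \<Phi> by auto
 show "qcomm U (Ebar \<mu>) (Fbar \<nu>) (q powi root_form n \<mu> \<nu>) = \<zero>\<^bsub>U\<^esub>"
 unfolding j(4,5) defs by (rule V.commutation_relations(3)[OF j(1-3)])
 qed
 have 8: "qcomm U (Ebar \<mu>) (Fbar \<mu>) (q powi root_form n \<mu> \<mu>) = (- q) \<odot>\<^bsub>U\<^esub> qcomm U (Ebar \<mu>') (Fbar \<mu>') 1 &
 qcomm U (Ebar \<mu>) (Fnorm \<mu>) (q powi root_form n \<mu> \<mu>) = q\<^sup>2 \<odot>\<^bsub>U\<^esub> qcomm U (Ebar \<mu>') (Fnorm \<mu>') 1"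
 if \<mu>: "(EX r:{1..l}. \<mu> = root_sum i (i + r) & \<mu>' = \<mu> - simple_root (i + r)) \<or>
 (EX s:{1..k}. \<mu> = root_sum (i - s) i & \<mu>' = \<mu> - simple_root (i - s))" for \<mu> \<mu>'
 proof -
 from \<mu> obtain j m where j: "j <= l + k" "j ~= 0" "\<mu> = rsum (V.ch j)" "\<mu>' = \<mu> - simple_root m"
 "!!xs m'. V.ch j = xs @ [m'] ==> m' = m"
 proof (elim disjE bexE conjE)
 fix r assume r: "r : {1..l}" "\<mu> = root_sum i (i + r)" "\<mu>' = \<mu> - simple_root (i + r)"
 show thesis
 by (rule that[of r "i + r"]) (use r V.rsum_ch[of r] V.last_ch(1)[of r] in auto)
 next
 fix s assume s: "s : {1..k}" "\<mu> = root_sum (i - s) i" "\<mu>' = \<mu> - simple_root (i - s)"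
 show thesis
 by (rule that[of "l + s" "i - s"]) (use s V.rsum_ch[of "l + s"] V.last_ch(2)[of s] in auto)
 qed
 show ?thesis unfolding j(4) unfolding j(3) defs
 by (rule conjI, rule V.diagonal_relation(1)[OF j(1,2)], erule j(5), rule V.diagonal_relation(2)[OF j(1,2)], erule j(5))
 qed
 show ?thesis by (intro conjI; (rule 1 2 3 4 5 6 7 | (intro ballI allI impI; rule 8; assumption)))
qed

end
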